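(* Let $a<b$ be real numbers, let $r\in[a,b]$ be real with $r\neq a$ and $r\neq b$, and let $\delta_r$ be a Dirac-like (at $r$) measurable function on $[a,b]_{\mathcal{R}}$ of class $C^1$. For $f\in C^0([a,b])$, let $p_n^f$ be the best uniform approximation of $f$ on $[a,b]$ by real polynomials of degree at most $n$, let $P_n(x)=\int_a^x p_n^f(t)\,dt$, and let $\overline{P}_n$ be the canonical extension of $P_n$ to $[a,b]_{\mathcal{R}}$. Then for every $f\in C^0([a,b])$, $$\lim_{n\to\infty}{}^\circ\!\left(\int_{[a,b]_{\mathcal{R}}}\delta_r'\cdot\overline{P}_n\right)=\lim_{n\to\infty}\left(\int_{[a,b]_{\mathcal{R}}}\delta_r'\cdot\overline{P}_n\right)[0]=-f(r).$$
   Context: A set $F\subset\mathbb{Q}$ is left-finite if $\{x\in F: x\le q\}$ is finite for every $q\in\mathbb{Q}$. The Levi-Civita field $\mathcal{R}$ is the set of functions $x:\mathbb{Q}\to\mathbb{R}$ (values written $x[q]$) whose support $\{q: x[q]\neq 0\}$ is left-finite, with pointwise sum and product $(x\cdot y)[q]=\sum_{q_1+q_2=q}x[q_1]y[q_2]$. For $x\ne 0$, $\lambda(x)=\min\operatorname{supp}(x)$, and $\lambda(0)=\infty$. For $x\neq y$, $x<y$ iff $(x-y)[\lambda(x-y)]<0$. This makes $\mathcal{R}$ an ordered field containing $\mathbb{R}$. $M_o=\{\varepsilon\in\mathcal{R}:0<\lambda(\varepsilon)<\infty\}$ is the set of nonzero infinitesimals. The standard part ${}^\circ x$ is $x[0]$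 if $\lambda(x)\ge 0$, and $+\infty$ (resp. $-\infty$) if $\lambda(x)<0$ and $x>0$ (resp. $x<0$). $[a,b]_{\mathcal{R}}=\{x\in\mathcal{R}:a\le x\le b\}$. Continuity, derivatives and class $C^1$ for functions on $\mathcal{R}$ are with respect to the order topology. A sequence strongly converges to $l$ if for every $\varepsilon\in\mathcal{R}$, $\varepsilon>0$, eventually $|a_n-l|<\varepsilon$. It weakly converges to $l\in\mathcal{R}$ if for every real $\varepsilon>0$, eventually $\max_{q\in\mathbb{Q},q\le\varepsilon^{-1}}|(a_n-l)[q]|<\varepsilon$. For $a\le b$ in $\mathcal{R}$, $I(a,b)$ denotes any of the four intervals of $\mathcal{R}$ with endpoints $a,b$ (degenerate intervals allowed), with length $l(I(a,b))=b-a$. A set $A\subseteq\mathcal{R}$ is measurable iff for every $\varepsilon\in\mathcal{R}$, $\varepsilon>0$, there are two sequences of mutually disjoint intervals $\{I_n\}$, $\{J_n\}$ such that $\bigcup_n I_n\subseteq A\subseteq\bigcup_n J_n$, $\sum_n l(I_n)$ and $\sum_n l(J_n)$ strongly converge, and $\sum_n l(J_n)-\sum_n l(I_n)\le\varepsilon$. The measure $m(A)\in\mathcal{R}$ is the (existing) supremum of such inner sums, equal to the infimum of such outer sums. A function $f$ is simple on an interval $I$ if there are $x_0,a_k\in\mathcal{R}$ such that for every $x\in I$ the partial sums $\sum_{k\le K}a_k(x-x_0)^k$ weakly converge to $f(x)$. For $A$ measurable, $f:A\to\mathcal{R}$ is measurable ($f\in\mathcal{M}(A)$) iff for every $\varepsilon\in\mathcal{R}$,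 $\varepsilon>0$, there is a sequence of mutually disjoint intervals $\{I_n\}$ with $\bigcup_n I_n\subseteq A$, $\sum_n l(I_n)$ strongly convergent, $m(A)-\sum_n l(I_n)<\varepsilon$, and $f$ simple on each $I_n$. If $f$ is simple on $I(a,b)$ with (termwise) antiderivative $F$, $\int_{I(a,b)}f=\lim_{x\to b}F(x)-\lim_{x\to a}F(x)$. For $f\in\mathcal{M}(A)$, $\int_A f$ is the limit of $\sum_n\int_{I_n}f$ (strong sum) over sequences of mutually disjoint intervals $\{I_n\}$ with $\bigcup_n I_n\subseteq A$ and $f$ simple on each $I_n$, as $\sum_n l(I_n)\to m(A)$; it is $\pm\infty$ if the partial sums diverge (eventually exceed every element of $\mathcal R$, resp. for the negatives), and undefined if the limit does not exist. $\mathcal{L}^1(A)$ is the set of $f\in\mathcal{M}(A)$ such that $\int_A|f|$ is defined and finite, with $\|f\|_1=\int_A|f|$. Dirac-like: $\delta_r\in\mathcal{L}^1(A)$ is Dirac-like at $r\in A$ iff $\delta_r(x)\ge 0$ for all $x\in A$; there is $h\in M_o$, $h>0$, with $\{x:\delta_r(x)\neq0\}\subseteq[r-h,r+h]_{\mathcal{R}}\subseteq A$; and $\|\delta_r\|_1=1$. The canonical extension of a real polynomial to $[a,b]_{\mathcal{R}}$ is the same polynomial evaluated on $[a,b]_{\mathcal{R}}$. The polynomial $p_n^f$ is the unique real polynomial of degree at most $n$ minimizing the sup-norm distance to $f$ on $[a,b]$. *)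

theory Defs
  imports "HOL-Analysis.Analysis" "HOL-Library.Lub_Glb" "HOL-Computational_Algebra.Polynomial"
begin

section \<open>The Levi-Civita field\<close>

definition left_finite :: "rat set \<Rightarrow> bool" where
  "left_finite F \<longleftrightarrow> (\<forall>q. finite {x \<in> F. x \<le> q})"

typedef levi_civita = "{x :: rat \<Rightarrow> real. left_finite {q. x q \<noteq> 0}}"
  morphisms lc_coeff Abs_levi_civita
  by (rule exI[of _ "\<lambda>_. 0"]) (simp add: left_finite_def)

setup_lifting type_definition_levi_civita

lemma lc_eqI: "(\<And>q. lc_coeff x q = lc_coeff y q) \<Longrightarrow> x = y"
  by (metis lc_coeff_inject ext)

definition lc_supp :: "levi_civita \<Rightarrow> rat set" where
  "lc_supp x = {q. lc_coeff x q \<noteq> 0}"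

lemma left_finite_subset: "left_finite B \<Longrightarrow> A \<subseteq> B \<Longrightarrow> left_finite A"
  unfolding left_finite_def
  by (metis (no_types, lifting) Collect_mono finite_subset subsetD)

lemma left_finite_Un: "left_finite A \<Longrightarrow> left_finite B \<Longrightarrow> left_finite (A \<union> B)"
proof -
  assume "left_finite A" "left_finite B"
  moreover have "{x \<in> A \<union> B. x \<le> q} = {x \<in> A. x \<le> q} \<union> {x \<in> B. x \<le> q}" for q by auto
  ultimately show ?thesis unfolding left_finite_def by simp
qed

lemma left_finite_supp: "left_finite (lc_supp x)"
  using lc_coeff[of x] by (simp add: lc_supp_def)

lemma finite_lc_supp_le: "finite {q \<in> lc_supp x. q \<le> B}"
  using left_finite_supp[of x] by (simp add: left_finite_def)

lemma left_finite_bdd: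
  assumes "left_finite F" shows "\<exists>m. \<forall>q\<in>F. m \<le> q"
proof (cases "{x \<in> F. x \<le> 0} = {}")
  case True
  then have "\<forall>q\<in>F. 0 \<le> q" by (metis (mono_tags, lifting) empty_Collect_eq linear)
  then show ?thesis by blast
next
  case False
  have f: "finite {x \<in> F. x \<le> 0}" using assms by (auto simp: left_finite_def)
  have "Min {x \<in> F. x \<le> 0} \<le> q" if "q \<in> F" for q
  proof (cases "q \<le> 0")
    case True then show ?thesis using f that by (intro Min_le) auto
  next
    case False': False
    have "Min {x \<in> F. x \<le> 0} \<in> {x \<in> F. x \<le> 0}" using f False by (rule Min_in)
    then show ?thesis using False' by auto
  qed
  then show ?thesis by blast
qed

lemma lc_supp_bdd: "\<exists>m. \<forall>q\<in>lc_supp x. m \<le> q"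
  using left_finite_bdd left_finite_supp by blast

lemma finite_conv:
  assumes "left_finite F" "left_finite G"
  shows "finite {(p, r). p \<in> F \<and> r \<in> G \<and> p + r \<le> (B::rat)}"
proof -
  obtain m n where m: "\<forall>q\<in>F. m \<le> q" and n: "\<forall>q\<in>G. n \<le> q"
    using left_finite_bdd assms by metis
  have "{(p, r). p \<in> F \<and> r \<in> G \<and> p + r \<le> B}
      \<subseteq> {p \<in> F. p \<le> B - n} \<times> {r \<in> G. r \<le> B - m}"
    using m n by force
  moreover have "finite ({p \<in> F. p \<le> B - n} \<times> {r \<in> G. r \<le> B - m})"
    using assms by (auto simp: left_finite_def)
  ultimately show ?thesis by (rule finite_subset)
qed

lemma left_finite_conv:
  assumes "left_finite F" "left_finite G"
  shows "left_finite {p + r | p r. p \<in> F \<and> r \<in> G}"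
  unfolding left_finite_def
proof
  fix B :: rat
  have "{x \<in> {p + r | p r. p \<in> F \<and> r \<in> G}. x \<le> B}
      \<subseteq> (\<lambda>(p, r). p + r) ` {(p, r). p \<in> F \<and> r \<in> G \<and> p + r \<le> B}" by force
  then show "finite {x \<in> {p + r | p r. p \<in> F \<and> r \<in> G}. x \<le> B}"
    using finite_conv[OF assms, of B] by (meson finite_imageI finite_subset)
qed

instantiation levi_civita :: comm_ring_1
begin

lift_definition zero_levi_civita :: levi_civita is "\<lambda>_. 0"
  by (simp add: left_finite_def)

lift_definition one_levi_civita :: levi_civita is "\<lambda>q. if q = 0 then 1 else 0"
  by (simp add: left_finite_def)

lift_definition plus_levi_civita :: "levi_civita \<Rightarrow> levi_civita \<Rightarrow> levi_civita"
  is "\<lambda>x y q. x q + y q"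
  by (rule left_finite_subset[OF left_finite_Un], assumption, assumption) auto

lift_definition uminus_levi_civita :: "levi_civita \<Rightarrow> levi_civita" is "\<lambda>x q. - x q"
  by simp

lift_definition minus_levi_civita :: "levi_civita \<Rightarrow> levi_civita \<Rightarrow> levi_civita"
  is "\<lambda>x y q. x q - y q"
  by (rule left_finite_subset[OF left_finite_Un], assumption, assumption) auto

text \<open>The sum over all \<open>q\<^sub>1 + q\<^sub>2 = q\<close> is restricted to the supports, where it is finite.\<close>

lift_definition times_levi_civita :: "levi_civita \<Rightarrow> levi_civita \<Rightarrow> levi_civita"
  is "\<lambda>x y q. \<Sum>(q\<^sub>1, q\<^sub>2)\<in>{(q\<^sub>1, q\<^sub>2). x q\<^sub>1 \<noteq> 0 \<and> y q\<^sub>2 \<noteq> 0 \<and> q\<^sub>1 + q\<^sub>2 = q}. x q\<^sub>1 * y q\<^sub>2"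
proof -
  fix x y :: "rat \<Rightarrow> real"
  assume "left_finite {q. x q \<noteq> 0}" "left_finite {q. y q \<noteq> 0}"
  from left_finite_conv[OF this]
  show "left_finite {q. (\<Sum>(q\<^sub>1, q\<^sub>2)\<in>{(q\<^sub>1, q\<^sub>2). x q\<^sub>1 \<noteq> 0 \<and> y q\<^sub>2 \<noteq> 0 \<and> q\<^sub>1 + q\<^sub>2 = q}.
      x q\<^sub>1 * y q\<^sub>2) \<noteq> 0}"
  proof (rule left_finite_subset, safe)
    fix q assume "(\<Sum>(q\<^sub>1, q\<^sub>2)\<in>{(q\<^sub>1, q\<^sub>2). x q\<^sub>1 \<noteq> 0 \<and> y q\<^sub>2 \<noteq> 0 \<and> q\<^sub>1 + q\<^sub>2 = q}. x q\<^sub>1 * y q\<^sub>2) \<noteq> 0"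
    then have "{(q\<^sub>1, q\<^sub>2). x q\<^sub>1 \<noteq> 0 \<and> y q\<^sub>2 \<noteq> 0 \<and> q\<^sub>1 + q\<^sub>2 = q} \<noteq> {}" by (metis sum.empty)
    then show "\<exists>p r. q = p + r \<and> p \<in> {q. x q \<noteq> 0} \<and> r \<in> {q. y q \<noteq> 0}" by auto
  qed
qed

lemma lc_coeff_times_finite:
  assumes X: "finite X" "\<And>p. p \<in> lc_supp x \<Longrightarrow> p \<le> q - n \<Longrightarrow> p \<in> X"
    and Y: "finite Y" "\<And>p. p \<in> lc_supp y \<Longrightarrow> p \<le> q - m \<Longrightarrow> p \<in> Y"
    and m: "\<And>p. p \<in> lc_supp x \<Longrightarrow> m \<le> p" and n: "\<And>p. p \<in> lc_supp y \<Longrightarrow> n \<le> p"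
  shows "lc_coeff (x * y) q
    = (\<Sum>r\<in>X. \<Sum>s\<in>Y. if r + s = q then lc_coeff x r * lc_coeff y s else 0)"
proof -
  let ?S = "{(r, s). lc_coeff x r \<noteq> 0 \<and> lc_coeff y s \<noteq> 0 \<and> r + s = q}"
  have "lc_coeff (x * y) q = (\<Sum>(r, s)\<in>?S. lc_coeff x r * lc_coeff y s)"
    by transfer simp
  also have "\<dots> = (\<Sum>(r, s)\<in>?S. if r + s = q then lc_coeff x r * lc_coeff y s else 0)"
    by (rule sum.cong) auto
  also have "\<dots> = (\<Sum>(r, s)\<in>X \<times> Y. if r + s = q then lc_coeff x r * lc_coeff y s else 0)"
  proof (rule sum.mono_neutral_left)
    show "finite (X \<times> Y)" using X Y by simp
    show "?S \<subseteq> X \<times> Y"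
    proof safe
      fix r s assume h: "lc_coeff x r \<noteq> 0" "lc_coeff y s \<noteq> 0" "q = r + s"
      have "m \<le> r" "n \<le> s" using h m n by (auto simp: lc_supp_def)
      then show "r \<in> X" "s \<in> Y" using h X(2) Y(2) by (auto simp: lc_supp_def)
    qed
  qed (auto split: if_splits)
  finally show ?thesis by (simp add: sum.cartesian_product)
qed

lemma lc_times_commute: "x * y = y * (x :: levi_civita)"
proof (rule lc_eqI)
  fix q
  let ?S = "\<lambda>x y. {(r, s). lc_coeff x r \<noteq> 0 \<and> lc_coeff y s \<noteq> 0 \<and> r + s = q}"
  have c: "lc_coeff (x * y) q = (\<Sum>(r, s)\<in>?S x y. lc_coeff x r * lc_coeff y s)" for x y
    by transfer simp
  have "(\<Sum>(r, s)\<in>?S x y. lc_coeff x r * lc_coeff y s)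
      = (\<Sum>(r, s)\<in>?S y x. lc_coeff y r * lc_coeff x s)"
    by (rule sum.reindex_bij_witness[of _ prod.swap prod.swap]) (auto simp: add.commute)
  then show "lc_coeff (x * y) q = lc_coeff (y * x) q" by (simp add: c)
qed

lemma lc_supp_times_ge:
  assumes "p \<in> lc_supp (x * y)"
  obtains r s where "r \<in> lc_supp x" "s \<in> lc_supp y" "p = r + s"
proof -
  have "lc_coeff (x * y) p \<noteq> 0" using assms by (simp add: lc_supp_def)
  moreover have "lc_coeff (x * y) p
      = (\<Sum>(r, s)\<in>{(r, s). lc_coeff x r \<noteq> 0 \<and> lc_coeff y s \<noteq> 0 \<and> r + s = p}. lc_coeff x r * lc_coeff y s)"
    by transfer simp
  ultimately have "{(r, s). lc_coeff x r \<noteq> 0 \<and> lc_coeff y s \<noteq> 0 \<and> r + s = p} \<noteq> {}"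
    by (metis sum.empty)
  then show ?thesis using that by (auto simp: lc_supp_def)
qed

lemma lc_times_assoc_coeff:
  fixes x y z :: levi_civita and q :: rat
  assumes B: "\<And>p. p \<in> lc_supp x \<Longrightarrow> B \<le> p" "\<And>p. p \<in> lc_supp y \<Longrightarrow> B \<le> p"
      "\<And>p. p \<in> lc_supp z \<Longrightarrow> B \<le> p" and B0: "B \<le> 0"
  defines "X \<equiv> \<lambda>w. {p \<in> lc_supp w. p \<le> q - 2 * B}"
  shows "lc_coeff ((x * y) * z) q = (\<Sum>r\<in>X x. \<Sum>s\<in>X y. \<Sum>t\<in>X z.
      if r + s + t = q then lc_coeff x r * lc_coeff y s * lc_coeff z t else 0)"
proof -
  have fX: "finite (X w)" for w unfolding X_def by (rule finite_lc_supp_le)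
  define U where "U = (\<lambda>(r, s). r + s) ` (X x \<times> X y)"
  have fU: "finite U" unfolding U_def using fX by auto
  have inU: "p \<in> U" if pp: "p \<in> lc_supp (x * y)" "p \<le> q - B" for p
  proof -
    obtain r s where rs: "r \<in> lc_supp x" "s \<in> lc_supp y" "p = r + s"
      by (rule lc_supp_times_ge[OF pp(1)]) blast
    have "B \<le> r" "B \<le> s" using rs B by auto
    then have "r \<in> X x" "s \<in> X y" using rs pp(2) unfolding X_def by auto
    then show ?thesis unfolding U_def using rs by auto
  qed
  have low: "2 * B \<le> p" if pp: "p \<in> lc_supp (x * y)" for p
  proof -
    obtain r s where rs: "r \<in> lc_supp x" "s \<in> lc_supp y" "p = r + s"
      by (rule lc_supp_times_ge[OF pp(1)]) blast
    have "B \<le> r" "B \<le> s" using rs B by auto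
    then show ?thesis using rs by auto
  qed
  have xy: "lc_coeff (x * y) u
      = (\<Sum>r\<in>X x. \<Sum>s\<in>X y. if r + s = u then lc_coeff x r * lc_coeff y s else 0)"
    if "u \<le> q - B" for u
    by (rule lc_coeff_times_finite[where m = B and n = B])
      (use that B B0 fX in \<open>auto simp: X_def\<close>)
  have "lc_coeff ((x * y) * z) q
      = (\<Sum>u\<in>U. \<Sum>t\<in>X z. if u + t = q then lc_coeff (x * y) u * lc_coeff z t else 0)"
    by (rule lc_coeff_times_finite[where m = "2 * B" and n = B])
      (use fU fX inU low B in \<open>auto simp: X_def\<close>)
  also have "\<dots> = (\<Sum>u\<in>U. \<Sum>t\<in>X z. \<Sum>r\<in>X x. \<Sum>s\<in>X y.
      if r + s = u then if u + t = q then lc_coeff x r * lc_coeff y s * lc_coeff z t else 0 else 0)"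
  proof (rule sum.cong[OF refl], rule sum.cong[OF refl])
    fix u t assume "t \<in> X z"
    then have "B \<le> t" using B by (auto simp: X_def)
    show "(if u + t = q then lc_coeff (x * y) u * lc_coeff z t else 0) = (\<Sum>r\<in>X x. \<Sum>s\<in>X y.
      if r + s = u then if u + t = q then lc_coeff x r * lc_coeff y s * lc_coeff z t else 0 else 0)"
    proof (cases "u + t = q")
      case True
      then have "u \<le> q - B" using \<open>B \<le> t\<close> by auto
      have "lc_coeff (x * y) u * lc_coeff z t = (\<Sum>r\<in>X x. \<Sum>s\<in>X y.
          (if r + s = u then lc_coeff x r * lc_coeff y s else 0) * lc_coeff z t)"
        unfolding xy[OF \<open>u \<le> q - B\<close>] sum_distrib_right ..
      also have "\<dots> = (\<Sum>r\<in>X x. \<Sum>s\<in>X y.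
        if r + s = u then if u + t = q then lc_coeff x r * lc_coeff y s * lc_coeff z t else 0 else 0)"
        using True by (intro sum.cong refl) auto
      finally show ?thesis using True by simp
    next
      case False
      have "(\<Sum>r\<in>X x. \<Sum>s\<in>X y.
        if r + s = u then if u + t = q then lc_coeff x r * lc_coeff y s * lc_coeff z t else 0 else 0) = 0"
        using False by (intro sum.neutral ballI) auto
      then show ?thesis using False by simp
    qed
  qed
  also have "\<dots> = (\<Sum>t\<in>X z. \<Sum>u\<in>U. \<Sum>r\<in>X x. \<Sum>s\<in>X y.
      if r + s = u then if u + t = q then lc_coeff x r * lc_coeff y s * lc_coeff z t else 0 else 0)"
    by (rule sum.swap)
  also have "\<dots> = (\<Sum>t\<in>X z. \<Sum>r\<in>X x. \<Sum>u\<in>U. \<Sum>s\<in>X y.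
      if r + s = u then if u + t = q then lc_coeff x r * lc_coeff y s * lc_coeff z t else 0 else 0)"
    by (rule sum.cong[OF refl]) (rule sum.swap)
  also have "\<dots> = (\<Sum>t\<in>X z. \<Sum>r\<in>X x. \<Sum>s\<in>X y. \<Sum>u\<in>U.
      if r + s = u then if u + t = q then lc_coeff x r * lc_coeff y s * lc_coeff z t else 0 else 0)"
    by (rule sum.cong[OF refl], rule sum.cong[OF refl]) (rule sum.swap)
  also have "\<dots> = (\<Sum>t\<in>X z. \<Sum>r\<in>X x. \<Sum>s\<in>X y.
      if r + s + t = q then lc_coeff x r * lc_coeff y s * lc_coeff z t else 0)"
  proof (intro sum.cong refl)
    fix t r s assume "r \<in> X x" "s \<in> X y"
    then have "r + s \<in> U" unfolding U_def by auto
    then show "(\<Sum>u\<in>U. if r + s = u then if u + t = q then lc_coeff x r * lc_coeff y s * lc_coeff z t else 0 else 0)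
        = (if r + s + t = q then lc_coeff x r * lc_coeff y s * lc_coeff z t else 0)"
      using fU by (subst sum.delta') auto
  qed
  also have "\<dots> = (\<Sum>r\<in>X x. \<Sum>t\<in>X z. \<Sum>s\<in>X y.
      if r + s + t = q then lc_coeff x r * lc_coeff y s * lc_coeff z t else 0)"
    by (rule sum.swap)
  also have "\<dots> = (\<Sum>r\<in>X x. \<Sum>s\<in>X y. \<Sum>t\<in>X z.
      if r + s + t = q then lc_coeff x r * lc_coeff y s * lc_coeff z t else 0)"
    by (rule sum.cong[OF refl]) (rule sum.swap)
  finally show ?thesis .
qed

lemma lc_times_assoc: "(x * y) * z = x * (y * (z :: levi_civita))"
proof (rule lc_eqI)
  fix q
  obtain b1 b2 b3 where b: "\<forall>p\<in>lc_supp x. b1 \<le> p" "\<forall>p\<in>lc_supp y. b2 \<le> p" "\<forall>p\<in>lc_supp z. b3 \<le> p"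
    using lc_supp_bdd by metis
  define B where "B = min (min b1 b2) (min b3 0)"
  have Bx: "\<And>p. p \<in> lc_supp x \<Longrightarrow> B \<le> p" and By: "\<And>p. p \<in> lc_supp y \<Longrightarrow> B \<le> p"
    and Bz: "\<And>p. p \<in> lc_supp z \<Longrightarrow> B \<le> p" and B0: "B \<le> 0"
    using b unfolding B_def by force+
  define X where "X w = {p \<in> lc_supp w. p \<le> q - 2 * B}" for w
  have "lc_coeff (x * (y * z)) q = lc_coeff ((y * z) * x) q" by (simp add: lc_times_commute)
  also have "\<dots> = (\<Sum>r\<in>X y. \<Sum>s\<in>X z. \<Sum>t\<in>X x.
      if r + s + t = q then lc_coeff y r * lc_coeff z s * lc_coeff x t else 0)"
    unfolding X_def by (rule lc_times_assoc_coeff[OF By Bz Bx B0])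
  also have "\<dots> = (\<Sum>r\<in>X y. \<Sum>t\<in>X x. \<Sum>s\<in>X z.
      if r + s + t = q then lc_coeff y r * lc_coeff z s * lc_coeff x t else 0)"
    by (rule sum.cong[OF refl]) (rule sum.swap)
  also have "\<dots> = (\<Sum>t\<in>X x. \<Sum>r\<in>X y. \<Sum>s\<in>X z.
      if r + s + t = q then lc_coeff y r * lc_coeff z s * lc_coeff x t else 0)"
    by (rule sum.swap)
  also have "\<dots> = (\<Sum>t\<in>X x. \<Sum>r\<in>X y. \<Sum>s\<in>X z.
      if t + r + s = q then lc_coeff x t * lc_coeff y r * lc_coeff z s else 0)"
    by (intro sum.cong refl) (auto simp: algebra_simps)
  also have "\<dots> = lc_coeff ((x * y) * z) q"
    unfolding X_def by (rule lc_times_assoc_coeff[OF Bx By Bz B0, symmetric])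
  finally show "lc_coeff ((x * y) * z) q = lc_coeff (x * (y * z)) q" ..
qed

lemma lc_coeff_zero: "lc_coeff 0 q = 0" by transfer simp
lemma lc_coeff_one: "lc_coeff 1 q = (if q = 0 then 1 else 0)" by transfer simp
lemma lc_coeff_add: "lc_coeff (x + y) q = lc_coeff x q + lc_coeff y q" by transfer simp
lemma lc_coeff_diff: "lc_coeff (x - y) q = lc_coeff x q - lc_coeff y q" by transfer simp
lemma lc_coeff_uminus: "lc_coeff (- x) q = - lc_coeff x q" by transfer simp

instance
proof
  fix x y z :: levi_civita
  show "x + y + z = x + (y + z)" "x + y = y + x" "0 + x = x" "- x + x = 0" "x - y = x + - y"
    by (rule lc_eqI; simp add: lc_coeff_zero lc_coeff_add lc_coeff_diff lc_coeff_uminus)+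
  show "x * y * z = x * (y * z)" by (rule lc_times_assoc)
  show "x * y = y * x" by (rule lc_times_commute)
  show "1 * x = x"
  proof (rule lc_eqI)
    fix q
    obtain b where b: "\<forall>p\<in>lc_supp x. b \<le> p" using lc_supp_bdd by metis
    have "lc_coeff (1 * x) q = (\<Sum>r\<in>{0}. \<Sum>s\<in>insert q {p \<in> lc_supp x. p \<le> q - 0}.
        if r + s = q then lc_coeff 1 r * lc_coeff x s else 0)"
      by (rule lc_coeff_times_finite[where m = 0 and n = b])
        (use b finite_lc_supp_le[of x q] in \<open>auto simp: lc_supp_def lc_coeff_one split: if_splits\<close>)
    also have "\<dots> = lc_coeff x q"
      using finite_lc_supp_le[of x q] by (simp add: lc_coeff_one sum.delta)
    finally show "lc_coeff (1 * x) q = lc_coeff x q" .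
  qed
  show "(x + y) * z = x * z + y * z"
  proof (rule lc_eqI)
    fix q
    obtain b1 b2 b3 where b: "\<forall>p\<in>lc_supp x. b1 \<le> p" "\<forall>p\<in>lc_supp y. b2 \<le> p" "\<forall>p\<in>lc_supp z. b3 \<le> p"
      using lc_supp_bdd by metis
    define B where "B = min b1 b2"
    define X where "X = {p \<in> lc_supp x. p \<le> q - b3} \<union> {p \<in> lc_supp y. p \<le> q - b3}"
    define Z where "Z = {p \<in> lc_supp z. p \<le> q - B}"
    have f: "finite X" "finite Z" unfolding X_def Z_def using finite_lc_supp_le by auto
    have e: "lc_coeff (w * z) q
        = (\<Sum>r\<in>X. \<Sum>s\<in>Z. if r + s = q then lc_coeff w r * lc_coeff z s else 0)"
      if "\<And>p. p \<in> lc_supp w \<Longrightarrow> p \<in> lc_supp x \<or> p \<in> lc_supp y" for w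
    proof (rule lc_coeff_times_finite[where m = B and n = b3])
      show "p \<in> X" if "p \<in> lc_supp w" "p \<le> q - b3" for p
        using that \<open>\<And>p. p \<in> lc_supp w \<Longrightarrow> p \<in> lc_supp x \<or> p \<in> lc_supp y\<close> unfolding X_def by blast
      show "B \<le> p" if "p \<in> lc_supp w" for p
        using \<open>\<And>p. p \<in> lc_supp w \<Longrightarrow> p \<in> lc_supp x \<or> p \<in> lc_supp y\<close>[OF that] b
        unfolding B_def by fastforce
    qed (use f b in \<open>auto simp: Z_def\<close>)
    have "lc_coeff ((x + y) * z) q = (\<Sum>r\<in>X. \<Sum>s\<in>Z.
        (if r + s = q then lc_coeff x r * lc_coeff z s else 0)
        + (if r + s = q then lc_coeff y r * lc_coeff z s else 0))"
    proof (subst e)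
      show "\<And>p. p \<in> lc_supp (x + y) \<Longrightarrow> p \<in> lc_supp x \<or> p \<in> lc_supp y"
        by (auto simp: lc_supp_def lc_coeff_add)
    qed (intro sum.cong refl, auto simp: lc_coeff_add distrib_right)
    also have "\<dots> = lc_coeff (x * z) q + lc_coeff (y * z) q"
      by (subst (1 2) e) (auto simp: sum.distrib)
    finally show "lc_coeff ((x + y) * z) q = lc_coeff (x * z + y * z) q" by (simp add: lc_coeff_add)
  qed
  show "(0::levi_civita) \<noteq> 1"
    by (metis lc_coeff_zero lc_coeff_one zero_neq_one)
qed

end

definition lc_lead :: "levi_civita \<Rightarrow> rat" where
  "lc_lead x = (LEAST q. lc_coeff x q \<noteq> 0)"

definition lc_lambda :: "levi_civita \<Rightarrow> ereal" where
  "lc_lambda x = (if x = 0 then \<infinity> else ereal (real_of_rat (lc_lead x)))"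

lemma lc_lead_eqI:
  assumes "lc_coeff x q \<noteq> 0" "\<And>p. p < q \<Longrightarrow> lc_coeff x p = 0" shows "lc_lead x = q"
  unfolding lc_lead_def using assms by (intro Least_equality) (auto intro: leI)

lemma lc_lead:
  assumes "x \<noteq> 0"
  shows "lc_coeff x (lc_lead x) \<noteq> 0" and "p < lc_lead x \<Longrightarrow> lc_coeff x p = 0"
proof -
  obtain r where r: "lc_coeff x r \<noteq> 0" using assms by (metis lc_eqI lc_coeff_zero)
  define F where "F = {q \<in> lc_supp x. q \<le> r}"
  have rF: "r \<in> F" using r by (simp add: F_def lc_supp_def)
  have F: "finite F" unfolding F_def by (rule finite_lc_supp_le)
  have m: "Min F \<in> F" using F rF by (intro Min_in) auto
  have 0: "lc_coeff x p = 0" if "p < Min F" for p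
  proof (rule ccontr)
    assume "lc_coeff x p \<noteq> 0"
    moreover have "p \<le> r" using that Min_le[OF F rF] by linarith
    ultimately have "p \<in> F" by (simp add: F_def lc_supp_def)
    then show False using Min_le[OF F] that by force
  qed
  have nz: "lc_coeff x (Min F) \<noteq> 0" using m by (simp add: F_def lc_supp_def)
  have e: "lc_lead x = Min F" using nz 0 by (rule lc_lead_eqI)
  show "lc_coeff x (lc_lead x) \<noteq> 0" using nz unfolding e .
  show "p < lc_lead x \<Longrightarrow> lc_coeff x p = 0" unfolding e by (rule 0)
qed

lemma lc_coeff_times_lead:
  assumes "\<And>p. p < a \<Longrightarrow> lc_coeff x p = 0" "\<And>p. p < b \<Longrightarrow> lc_coeff y p = 0"
  shows "lc_coeff (x * y) (a + b) = lc_coeff x a * lc_coeff y b"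
    and "p < a + b \<Longrightarrow> lc_coeff (x * y) p = 0"
proof -
  have a: "\<And>p. p \<in> lc_supp x \<Longrightarrow> a \<le> p" and b: "\<And>p. p \<in> lc_supp y \<Longrightarrow> b \<le> p"
    using assms by (auto simp: lc_supp_def intro: leI)
  have "lc_coeff (x * y) (a + b)
      = (\<Sum>r\<in>{a}. \<Sum>s\<in>{b}. if r + s = a + b then lc_coeff x r * lc_coeff y s else 0)"
    by (rule lc_coeff_times_finite[where m = a and n = b]) (use a b in force)+
  then show "lc_coeff (x * y) (a + b) = lc_coeff x a * lc_coeff y b" by simp
  show "lc_coeff (x * y) p = 0" if "p < a + b"
  proof (rule ccontr)
    assume "lc_coeff (x * y) p \<noteq> 0"
    then obtain r s where "r \<in> lc_supp x" "s \<in> lc_supp y" "p = r + s"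
      using lc_supp_times_ge[of p x y] by (auto simp: lc_supp_def)
    then show False using a b that by force
  qed
qed

definition lc_pos :: "levi_civita \<Rightarrow> bool" where
  "lc_pos x \<longleftrightarrow> (\<exists>q. lc_coeff x q > 0 \<and> (\<forall>p<q. lc_coeff x p = 0))"

lemma lc_pos_iff: "lc_pos x \<longleftrightarrow> x \<noteq> 0 \<and> lc_coeff x (lc_lead x) > 0"
proof
  assume "lc_pos x"
  then obtain q where q: "lc_coeff x q > 0" "\<And>p. p < q \<Longrightarrow> lc_coeff x p = 0"
    by (auto simp: lc_pos_def)
  then have "lc_lead x = q" by (intro lc_lead_eqI) auto
  then show "x \<noteq> 0 \<and> lc_coeff x (lc_lead x) > 0" using q by (auto simp: lc_coeff_zero)
next
  assume "x \<noteq> 0 \<and> lc_coeff x (lc_lead x) > 0"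
  then show "lc_pos x" unfolding lc_pos_def
    using lc_lead(2)[of x] by (intro exI[of _ "lc_lead x"]) simp
qed

lemma lc_lead_uminus: "lc_lead (- x) = lc_lead x"
  by (simp add: lc_lead_def lc_coeff_uminus)

lemma lc_pos_cases: "x = 0 \<or> lc_pos x \<or> lc_pos (- x)"
  using lc_lead(1)[of x] by (auto simp: lc_pos_iff lc_lead_uminus lc_coeff_uminus)

lemma lc_pos_not_uminus: "lc_pos x \<Longrightarrow> \<not> lc_pos (- x)"
  by (auto simp: lc_pos_iff lc_lead_uminus lc_coeff_uminus)

lemma lc_pos_add: assumes "lc_pos x" "lc_pos y" shows "lc_pos (x + y)"
proof -
  obtain a b where a: "lc_coeff x a > 0" "\<forall>p<a. lc_coeff x p = 0"
    and b: "lc_coeff y b > 0" "\<forall>p<b. lc_coeff y p = 0"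
    using assms by (auto simp: lc_pos_def)
  have "lc_coeff (x + y) (min a b) > 0 \<and> (\<forall>p<min a b. lc_coeff (x + y) p = 0)"
    using a b by (cases a b rule: linorder_cases) (auto simp: lc_coeff_add min_def)
  then show ?thesis unfolding lc_pos_def by blast
qed

lemma lc_pos_mult: assumes "lc_pos x" "lc_pos y" shows "lc_pos (x * y)"
proof -
  obtain a b where a: "lc_coeff x a > 0" "\<forall>p<a. lc_coeff x p = 0"
    and b: "lc_coeff y b > 0" "\<forall>p<b. lc_coeff y p = 0"
    using assms by (auto simp: lc_pos_def)
  then show ?thesis unfolding lc_pos_def
    using lc_coeff_times_lead[of a x b y] by (intro exI[of _ "a + b"]) auto
qed

lift_definition lc_monom :: "real \<Rightarrow> rat \<Rightarrow> levi_civita" is "\<lambda>c q p. if p = q then c else 0"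
  by (simp add: left_finite_def)

lemma lc_coeff_monom: "lc_coeff (lc_monom c q) p = (if p = q then c else 0)"
  by transfer simp

lemma lc_coeff_monom_times: "lc_coeff (lc_monom c k * x) q = c * lc_coeff x (q - k)"
proof -
  obtain b where b: "\<forall>p\<in>lc_supp x. b \<le> p" using lc_supp_bdd by metis
  let ?Y = "insert (q - k) {p \<in> lc_supp x. p \<le> q - k}"
  have "lc_coeff (lc_monom c k * x) q = (\<Sum>r\<in>{k}. \<Sum>s\<in>?Y.
      if r + s = q then lc_coeff (lc_monom c k) r * lc_coeff x s else 0)"
    by (rule lc_coeff_times_finite[where m = k and n = b])
      (use b finite_lc_supp_le[of x "q - k"] in
        \<open>auto simp: lc_supp_def lc_coeff_monom split: if_splits\<close>)
  also have "\<dots> = (\<Sum>s\<in>?Y. if s = q - k then c * lc_coeff x (q - k) else 0)"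
    by (auto simp: lc_coeff_monom intro!: sum.cong)
  also have "\<dots> = c * lc_coeff x (q - k)"
    using finite_lc_supp_le[of x "q - k"] by (subst sum.delta) auto
  finally show ?thesis .
qed

lemma lc_coeff_sum: "lc_coeff (\<Sum>i\<in>I. f i) q = (\<Sum>i\<in>I. lc_coeff (f i) q)"
  by (induction I rule: infinite_finite_induct) (auto simp: lc_coeff_zero lc_coeff_add)

lemma lc_coeff_power_eq_0:
  assumes "\<And>p. p < h \<Longrightarrow> lc_coeff e p = 0" "q < of_nat n * h"
  shows "lc_coeff (e ^ n) q = 0"
  using assms(2)
proof (induction n arbitrary: q)
  case 0 then show ?case by (simp add: lc_coeff_one)
next
  case (Suc n)
  show ?case unfolding power_Suc
    by (rule lc_coeff_times_lead(2)[where a = h and b = "of_nat n * h"])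
      (use assms(1) Suc in \<open>auto simp: algebra_simps\<close>)
qed

lemma lc_geometric:
  assumes h: "h > 0" "\<And>p. p < h \<Longrightarrow> lc_coeff e p = 0"
  shows "\<exists>s. (1 - e) * s = 1"
proof -
  define N where "N q = nat \<lceil>q / h\<rceil>" for q :: rat
  define S where "S q = (\<Sum>n\<le>N q. lc_coeff (e ^ n) q)" for q
  have Nq: "q < of_nat (Suc (N q)) * h" for q
  proof -
    have "q / h \<le> of_int \<lceil>q / h\<rceil>" by (rule le_of_int_ceiling)
    also have "\<dots> < of_nat (Suc (N q))" unfolding N_def by simp
    finally show ?thesis using h(1) by (simp add: divide_less_eq)
  qed
  have Nmono: "N p \<le> N q" if "p \<le> q" for p q
    unfolding N_def using that h(1) by (intro nat_mono ceiling_mono divide_right_mono) auto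
  have zero: "lc_coeff (e ^ n) q = 0" if "N q < n" for n q
  proof (rule lc_coeff_power_eq_0[OF h(2)])
    have "of_nat (Suc (N q)) * h \<le> of_nat n * h" using that h(1) by (intro mult_right_mono) auto
    then show "q < of_nat n * h" using Nq[of q] by linarith
  qed
  have SN: "S p = lc_coeff (\<Sum>n\<le>N q. e ^ n) p" if "p \<le> q" for p q
    unfolding S_def lc_coeff_sum using Nmono[OF that] zero by (intro sum.mono_neutral_left) auto
  have "left_finite {q. S q \<noteq> 0}" unfolding left_finite_def
  proof
    fix Q
    have "{x \<in> {q. S q \<noteq> 0}. x \<le> Q} \<subseteq> {p \<in> lc_supp (\<Sum>n\<le>N Q. e ^ n). p \<le> Q}"
      using SN by (auto simp: lc_supp_def)
    then show "finite {x \<in> {q. S q \<noteq> 0}. x \<le> Q}" using finite_lc_supp_le finite_subset by blast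
  qed
  then have S: "lc_coeff (Abs_levi_civita S) = S" by (simp add: Abs_levi_civita_inverse)
  let ?S = "Abs_levi_civita S"
  have "(1 - e) * ?S = 1"
  proof (rule lc_eqI)
    fix q
    let ?P = "\<Sum>n\<le>N q. e ^ n"
    have "lc_coeff ((1 - e) * (?S - ?P)) q = 0"
    proof (rule ccontr)
      assume "lc_coeff ((1 - e) * (?S - ?P)) q \<noteq> 0"
      then obtain r s where rs: "r \<in> lc_supp (1 - e)" "s \<in> lc_supp (?S - ?P)" "q = r + s"
        using lc_supp_times_ge[of q "1 - e" "?S - ?P"] by (auto simp: lc_supp_def)
      have "0 \<le> r"
      proof (rule ccontr)
        assume "\<not> 0 \<le> r"
        then have "lc_coeff (1 - e) r = 0" using h by (auto simp: lc_coeff_diff lc_coeff_one)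
        then show False using rs by (simp add: lc_supp_def)
      qed
      then have "s \<le> q" using rs by simp
      then show False using rs(2) SN[of s q] by (simp add: lc_supp_def lc_coeff_diff S)
    qed
    moreover have "(1 - e) * ?S = (1 - e) * ?P + (1 - e) * (?S - ?P)" by (simp add: algebra_simps)
    moreover have "(1 - e) * ?P = 1 - e ^ Suc (N q)" by (rule sum_gp_basic)
    moreover have "lc_coeff (e ^ Suc (N q)) q = 0" by (rule zero) simp
    ultimately show "lc_coeff ((1 - e) * ?S) q = lc_coeff 1 q"
      by (simp add: lc_coeff_add lc_coeff_diff del: power_Suc)
  qed
  then show ?thesis by blast
qed

lemma lc_ex_inverse:
  fixes x :: levi_civita
  assumes "x \<noteq> 0" shows "\<exists>y. x * y = 1"
proof -
  let ?l = "lc_lead x"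
  define m where "m = lc_monom (1 / lc_coeff x ?l) (- ?l)"
  define e where "e = 1 - m * x"
  have e0: "lc_coeff e p = 0" if "p \<le> 0" for p
  proof (cases "p = 0")
    case True then show ?thesis using lc_lead(1)[OF assms]
      by (simp add: e_def m_def lc_coeff_diff lc_coeff_one lc_coeff_monom_times)
  next
    case False
    then show ?thesis using lc_lead(2)[OF assms, of "p + ?l"] that
      by (simp add: e_def m_def lc_coeff_diff lc_coeff_one lc_coeff_monom_times)
  qed
  have "\<exists>h>0. \<forall>p<h. lc_coeff e p = 0"
  proof (cases "e = 0")
    case True then show ?thesis by (intro exI[of _ 1]) (simp add: lc_coeff_zero)
  next
    case False
    then have "lc_lead e > 0" using lc_lead(1)[OF False] e0 by (meson not_le)
    then show ?thesis using lc_lead(2)[OF False] by blast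
  qed
  then obtain s where "(1 - e) * s = 1" using lc_geometric by blast
  then have "x * (m * s) = 1" by (simp add: e_def algebra_simps)
  then show ?thesis by blast
qed

instantiation levi_civita :: linordered_field
begin

definition less_levi_civita :: "levi_civita \<Rightarrow> levi_civita \<Rightarrow> bool" where
  "x < y \<longleftrightarrow> x \<noteq> y \<and> lc_coeff (x - y) (lc_lead (x - y)) < 0"

definition less_eq_levi_civita :: "levi_civita \<Rightarrow> levi_civita \<Rightarrow> bool" where
  "x \<le> y \<longleftrightarrow> x < y \<or> x = (y :: levi_civita)"

definition abs_levi_civita :: "levi_civita \<Rightarrow> levi_civita" where
  "\<bar>x\<bar> = (if x < 0 then - x else x :: levi_civita)"

definition sgn_levi_civita :: "levi_civita \<Rightarrow> levi_civita" where
  "sgn x = (if x = 0 then 0 else if 0 < x then 1 else - 1 :: levi_civita)"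

definition inverse_levi_civita :: "levi_civita \<Rightarrow> levi_civita" where
  "inverse x = (if x = 0 then 0 else THE y. x * y = (1 :: levi_civita))"

definition divide_levi_civita :: "levi_civita \<Rightarrow> levi_civita \<Rightarrow> levi_civita" where
  "x div y = x * inverse (y :: levi_civita)"

lemma lc_less_iff_pos: "x < y \<longleftrightarrow> lc_pos (y - x)"
proof -
  have "y - x = - (x - y)" by simp
  then have "lc_pos (y - x) \<longleftrightarrow> x - y \<noteq> 0 \<and> lc_coeff (x - y) (lc_lead (x - y)) < 0"
    unfolding lc_pos_iff by (metis lc_lead_uminus lc_coeff_uminus neg_0_less_iff_less neg_equal_0_iff_equal)
  then show ?thesis by (simp add: less_levi_civita_def)
qed

lemma lc_inverse_right: assumes "x \<noteq> 0" shows "x * inverse x = (1 :: levi_civita)"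
proof -
  obtain y where y: "x * y = 1" using lc_ex_inverse[OF assms] by blast
  have "z = y" if "x * z = 1" for z
  proof -
    have "z = (x * y) * z" using y by simp
    also have "\<dots> = y * (x * z)" by (simp add: ac_simps)
    finally show ?thesis using that by simp
  qed
  then have "(THE y. x * y = 1) = y" using y by (intro the_equality)
  then show ?thesis using y assms by (simp add: inverse_levi_civita_def)
qed

instance
proof
  fix x y z :: levi_civita
  have npos0: "\<not> lc_pos 0" by (simp add: lc_pos_iff)
  show "(x < y) = (x \<le> y \<and> \<not> y \<le> x)"
    using lc_pos_not_uminus[of "y - x"] npos0 by (auto simp: less_eq_levi_civita_def lc_less_iff_pos)
  show "x \<le> x" by (simp add: less_eq_levi_civita_def)
  show "x \<le> z" if "x \<le> y" "y \<le> z"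
    using that lc_pos_add[of "y - x" "z - y"] by (auto simp: less_eq_levi_civita_def lc_less_iff_pos)
  show "x = y" if "x \<le> y" "y \<le> x"
    using that lc_pos_not_uminus[of "y - x"] by (auto simp: less_eq_levi_civita_def lc_less_iff_pos)
  show "x \<le> y \<or> y \<le> x"
    using lc_pos_cases[of "y - x"] by (auto simp: less_eq_levi_civita_def lc_less_iff_pos)
  show "z + x \<le> z + y" if "x \<le> y"
    using that by (auto simp: less_eq_levi_civita_def lc_less_iff_pos)
  show "z * x < z * y" if "x < y" "0 < z"
    using that lc_pos_mult[of z "y - x"] by (auto simp: lc_less_iff_pos algebra_simps)
  show "\<bar>x\<bar> = (if x < 0 then - x else x)" by (rule abs_levi_civita_def)
  show "sgn x = (if x = 0 then 0 else if 0 < x then 1 else - 1)" by (rule sgn_levi_civita_def)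
  show "inverse x * x = 1" if "x \<noteq> 0" using lc_inverse_right[OF that] by (simp add: mult.commute)
  show "x div y = x * inverse y" by (rule divide_levi_civita_def)
  show "inverse (0 :: levi_civita) = 0" by (simp add: inverse_levi_civita_def)
qed

end

instantiation levi_civita :: real_field
begin

lift_definition scaleR_levi_civita :: "real \<Rightarrow> levi_civita \<Rightarrow> levi_civita" is "\<lambda>c x q. c * x q"
  by (rule left_finite_subset) auto

lemma lc_scaleR_eq: "c *\<^sub>R x = lc_monom c 0 * x"
  by (rule lc_eqI) (simp add: lc_coeff_monom_times scaleR_levi_civita.rep_eq)

instance
proof
  fix a b :: real and x y :: levi_civita
  show "a *\<^sub>R (x + y) = a *\<^sub>R x + a *\<^sub>R y" "(a + b) *\<^sub>R x = a *\<^sub>R x + b *\<^sub>R x"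
    "a *\<^sub>R b *\<^sub>R x = (a * b) *\<^sub>R x" "1 *\<^sub>R x = x"
    by (rule lc_eqI; simp add: scaleR_levi_civita.rep_eq lc_coeff_add algebra_simps)+
  show "a *\<^sub>R x * y = a *\<^sub>R (x * y)" "x * a *\<^sub>R y = a *\<^sub>R (x * y)"
    by (simp_all add: lc_scaleR_eq ac_simps)
qed

end

lemma lc_coeff_of_real: "lc_coeff (of_real c) q = (if q = 0 then c else 0)"
  by (simp add: of_real_def scaleR_levi_civita.rep_eq lc_coeff_one)

instantiation levi_civita :: linorder_topology
begin

definition open_levi_civita :: "levi_civita set \<Rightarrow> bool" where
  "open_levi_civita = generate_topology (range (\<lambda>a. {..<a}) \<union> range (\<lambda>a. {a<..}))"

instance by standard (rule open_levi_civita_def)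

end

definition lc_infinitesimals :: "levi_civita set" where
  "lc_infinitesimals = {e. 0 < lc_lambda e \<and> lc_lambda e < \<infinity>}"

definition lc_standard_part :: "levi_civita \<Rightarrow> ereal" where
  "lc_standard_part x =
    (if lc_lambda x \<ge> 0 then ereal (lc_coeff x 0) else if x > 0 then \<infinity> else - \<infinity>)"


section \<open>Convergence, continuity and derivatives\<close>

definition strongly_converges :: "(nat \<Rightarrow> levi_civita) \<Rightarrow> levi_civita \<Rightarrow> bool" where
  "strongly_converges X l \<longleftrightarrow> (\<forall>\<epsilon>>0. \<forall>\<^sub>F n in sequentially. \<bar>X n - l\<bar> < \<epsilon>)"

definition weakly_converges :: "(nat \<Rightarrow> levi_civita) \<Rightarrow> levi_civita \<Rightarrow> bool" where
  "weakly_converges X l \<longleftrightarrow> (\<forall>\<epsilon>::real. \<epsilon> > 0 \<longrightarrow>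
    (\<forall>\<^sub>F n in sequentially. Max {\<bar>lc_coeff (X n - l) q\<bar> | q. real_of_rat q \<le> inverse \<epsilon>} < \<epsilon>))"

definition strong_sums :: "(nat \<Rightarrow> levi_civita) \<Rightarrow> levi_civita \<Rightarrow> bool" where
  "strong_sums f s \<longleftrightarrow> strongly_converges (\<lambda>N. \<Sum>n<N. f n) s"

lemma strongly_converges_iff_LIMSEQ: "strongly_converges X l \<longleftrightarrow> X \<longlonglongrightarrow> l"
proof
  assume X: "strongly_converges X l"
  show "X \<longlonglongrightarrow> l"
  proof (rule order_tendstoI)
    fix a assume "a < l"
    then have "\<forall>\<^sub>F n in sequentially. \<bar>X n - l\<bar> < l - a" using X by (simp add: strongly_converges_def)
    then show "\<forall>\<^sub>F n in sequentially. a < X n" by eventually_elim linarith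
  next
    fix a assume "l < a"
    then have "\<forall>\<^sub>F n in sequentially. \<bar>X n - l\<bar> < a - l" using X by (simp add: strongly_converges_def)
    then show "\<forall>\<^sub>F n in sequentially. X n < a" by eventually_elim linarith
  qed
next
  assume X: "X \<longlonglongrightarrow> l"
  show "strongly_converges X l" unfolding strongly_converges_def
  proof (intro allI impI)
    fix \<epsilon> :: levi_civita assume "\<epsilon> > 0"
    then have "\<forall>\<^sub>F n in sequentially. l - \<epsilon> < X n" "\<forall>\<^sub>F n in sequentially. X n < l + \<epsilon>"
      using X by (auto intro: order_tendstoD)
    then show "\<forall>\<^sub>F n in sequentially. \<bar>X n - l\<bar> < \<epsilon>" by eventually_elim linarith
  qed
qed

text \<open>The maximum in \<^const>\<open>weakly_converges\<close> is over a finite set, by left-finiteness.\<close>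

lemma finite_lc_coeff_values: "finite {\<bar>lc_coeff x q\<bar> | q. real_of_rat q \<le> B}"
proof -
  obtain n :: nat where n: "B \<le> of_nat n" using real_arch_simple by blast
  have "{\<bar>lc_coeff x q\<bar> | q. real_of_rat q \<le> B}
      \<subseteq> insert 0 ((\<lambda>q. \<bar>lc_coeff x q\<bar>) ` {q \<in> lc_supp x. q \<le> of_nat n})"
  proof safe
    fix q assume q: "real_of_rat q \<le> B"
      and nin: "\<bar>lc_coeff x q\<bar> \<notin> (\<lambda>q. \<bar>lc_coeff x q\<bar>) ` {q \<in> lc_supp x. q \<le> of_nat n}"
    have "real_of_rat q \<le> real_of_rat (of_nat n)" using q n by simp
    then have "q \<le> of_nat n" by (simp only: of_rat_less_eq)
    then show "\<bar>lc_coeff x q\<bar> = 0" using nin by (auto simp: lc_supp_def)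
  qed
  then show ?thesis using finite_lc_supp_le finite_subset by blast
qed

lemma weakly_converges_iff:
  "weakly_converges X l \<longleftrightarrow> (\<forall>\<epsilon>>0. \<forall>\<^sub>F n in sequentially.
    \<forall>q. real_of_rat q \<le> inverse \<epsilon> \<longrightarrow> \<bar>lc_coeff (X n - l) q\<bar> < \<epsilon>)"
proof -
  have "Max {\<bar>lc_coeff x q\<bar> | q. real_of_rat q \<le> inverse \<epsilon>} < \<epsilon>
      \<longleftrightarrow> (\<forall>q. real_of_rat q \<le> inverse \<epsilon> \<longrightarrow> \<bar>lc_coeff x q\<bar> < \<epsilon>)" if "\<epsilon> > 0" for x and \<epsilon> :: real
  proof -
    have "{\<bar>lc_coeff x q\<bar> | q. real_of_rat q \<le> inverse \<epsilon>} \<noteq> {}"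
      using that by (auto intro!: exI[of _ "0 :: rat"])
    then show ?thesis using finite_lc_coeff_values[of x "inverse \<epsilon>"] by (subst Max_less_iff) auto
  qed
  then show ?thesis by (simp add: weakly_converges_def)
qed

text \<open>Limits of functions and \<^const>\<open>continuous_on\<close> refer to the order topology; on an interval
  they are one-sided at the endpoints.\<close>

definition lc_differentiable_on :: "levi_civita set \<Rightarrow> (levi_civita \<Rightarrow> levi_civita) \<Rightarrow> bool" where
  "lc_differentiable_on A f \<longleftrightarrow>
    (\<forall>x\<in>A. \<exists>D. ((\<lambda>y. (f y - f x) / (y - x)) \<longlongrightarrow> D) (at x within A))"

definition lc_deriv :: "levi_civita set \<Rightarrow> (levi_civita \<Rightarrow> levi_civita) \<Rightarrow> levi_civita \<Rightarrow> levi_civita" where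
  "lc_deriv A f x = Lim (at x within A) (\<lambda>y. (f y - f x) / (y - x))"

definition lc_C1_on :: "levi_civita set \<Rightarrow> (levi_civita \<Rightarrow> levi_civita) \<Rightarrow> bool" where
  "lc_C1_on A f \<longleftrightarrow> lc_differentiable_on A f \<and> continuous_on A (lc_deriv A f)"


section \<open>Measure and integral\<close>

definition lc_interval :: "levi_civita \<Rightarrow> levi_civita \<Rightarrow> levi_civita set \<Rightarrow> bool" where
  "lc_interval u v I \<longleftrightarrow> u \<le> v \<and> (I = {u..v} \<or> I = {u<..<v} \<or> I = {u..<v} \<or> I = {u<..v})"

text \<open>A sequence of intervals carries its endpoints along, since they determine the length.
  As \<open>{c<..<c} = {}\<close> is an interval, finite families of intervals are included.\<close>

definition disjoint_intervals ::
    "(nat \<Rightarrow> levi_civita) \<Rightarrow> (nat \<Rightarrow> levi_civita) \<Rightarrow> (nat \<Rightarrow> levi_civita set) \<Rightarrow> bool" where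
  "disjoint_intervals u v I \<longleftrightarrow> (\<forall>n. lc_interval (u n) (v n) (I n)) \<and> disjoint_family I"

definition lc_inner_sums :: "levi_civita set \<Rightarrow> levi_civita set" where
  "lc_inner_sums A = {s. \<exists>u v I. disjoint_intervals u v I \<and> (\<Union>n. I n) \<subseteq> A
    \<and> strong_sums (\<lambda>n. v n - u n) s}"

definition lc_outer_sums :: "levi_civita set \<Rightarrow> levi_civita set" where
  "lc_outer_sums A = {s. \<exists>u v J. disjoint_intervals u v J \<and> A \<subseteq> (\<Union>n. J n)
    \<and> strong_sums (\<lambda>n. v n - u n) s}"

definition lc_measurable :: "levi_civita set \<Rightarrow> bool" where
  "lc_measurable A \<longleftrightarrow> (\<forall>\<epsilon>>0. \<exists>s\<in>lc_inner_sums A. \<exists>t\<in>lc_outer_sums A. t - s \<le> \<epsilon>)"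

definition lc_measure :: "levi_civita set \<Rightarrow> levi_civita" where
  "lc_measure A = (THE m. isLub UNIV (lc_inner_sums A) m)"

definition lc_power_series_on ::
    "levi_civita set \<Rightarrow> (nat \<Rightarrow> levi_civita) \<Rightarrow> levi_civita \<Rightarrow> (levi_civita \<Rightarrow> levi_civita) \<Rightarrow> bool" where
  "lc_power_series_on I a x\<^sub>0 f \<longleftrightarrow>
    (\<forall>x\<in>I. weakly_converges (\<lambda>K. \<Sum>k\<le>K. a k * (x - x\<^sub>0) ^ k) (f x))"

definition lc_simple_on :: "levi_civita set \<Rightarrow> (levi_civita \<Rightarrow> levi_civita) \<Rightarrow> bool" where
  "lc_simple_on I f \<longleftrightarrow> (\<exists>x\<^sub>0 a. lc_power_series_on I a x\<^sub>0 f)"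

definition lc_measurable_on :: "levi_civita set \<Rightarrow> (levi_civita \<Rightarrow> levi_civita) \<Rightarrow> bool" where
  "lc_measurable_on A f \<longleftrightarrow> lc_measurable A \<and>
    (\<forall>\<epsilon>>0. \<exists>u v I s. disjoint_intervals u v I \<and> (\<Union>n. I n) \<subseteq> A
      \<and> strong_sums (\<lambda>n. v n - u n) s \<and> lc_measure A - s < \<epsilon> \<and> (\<forall>n. lc_simple_on (I n) f))"

text \<open>In \<open>F\<close> the constant of integration at \<open>x\<^sub>0\<close> is 0; it cancels in \<open>M - L\<close>.
  The degenerate case is separate because \<open>at u within I\<close> is then the trivial filter.\<close>

definition lc_has_simple_integral ::
    "(levi_civita \<Rightarrow> levi_civita) \<Rightarrow> levi_civita \<Rightarrow> levi_civita \<Rightarrow> levi_civita set \<Rightarrow> levi_civita \<Rightarrow> bool" where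
  "lc_has_simple_integral f u v I j \<longleftrightarrow>
    (if u = v then j = 0
     else \<exists>x\<^sub>0 a F L M. lc_power_series_on I a x\<^sub>0 f
       \<and> lc_power_series_on I (\<lambda>k. if k = 0 then 0 else a (k - 1) / of_nat k) x\<^sub>0 F
       \<and> (F \<longlongrightarrow> L) (at u within I) \<and> (F \<longlongrightarrow> M) (at v within I) \<and> j = M - L)"

text \<open>Finite integrals only: the values \<open>\<plusminus>\<infinity>\<close> of a divergent integral are not represented.\<close>

definition lc_has_integral ::
    "levi_civita set \<Rightarrow> (levi_civita \<Rightarrow> levi_civita) \<Rightarrow> levi_civita \<Rightarrow> bool" where
  "lc_has_integral A f J \<longleftrightarrow> lc_measurable_on A f \<and>
    (\<forall>\<epsilon>>0. \<exists>\<eta>>0. \<forall>u v I s. disjoint_intervals u v I \<and> (\<Union>n. I n) \<subseteq> A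
      \<and> (\<forall>n. lc_simple_on (I n) f) \<and> strong_sums (\<lambda>n. v n - u n) s \<and> lc_measure A - s < \<eta>
      \<longrightarrow> (\<exists>j S. (\<forall>n. lc_has_simple_integral f (u n) (v n) (I n) (j n))
             \<and> strong_sums j S \<and> \<bar>S - J\<bar> < \<epsilon>))"

definition lc_integrable :: "levi_civita set \<Rightarrow> (levi_civita \<Rightarrow> levi_civita) \<Rightarrow> bool" where
  "lc_integrable A f \<longleftrightarrow> (\<exists>J. lc_has_integral A f J)"

definition lc_integral :: "levi_civita set \<Rightarrow> (levi_civita \<Rightarrow> levi_civita) \<Rightarrow> levi_civita" where
  "lc_integral A f = (THE J. lc_has_integral A f J)"

definition lc_L1 :: "levi_civita set \<Rightarrow> (levi_civita \<Rightarrow> levi_civita) set" where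
  "lc_L1 A = {f. lc_measurable_on A f \<and> lc_integrable A (\<lambda>x. \<bar>f x\<bar>)}"

definition lc_norm1 :: "levi_civita set \<Rightarrow> (levi_civita \<Rightarrow> levi_civita) \<Rightarrow> levi_civita" where
  "lc_norm1 A f = lc_integral A (\<lambda>x. \<bar>f x\<bar>)"

definition dirac_like :: "levi_civita set \<Rightarrow> levi_civita \<Rightarrow> (levi_civita \<Rightarrow> levi_civita) \<Rightarrow> bool" where
  "dirac_like A r \<delta> \<longleftrightarrow> r \<in> A \<and> \<delta> \<in> lc_L1 A \<and> (\<forall>x\<in>A. \<delta> x \<ge> 0)
    \<and> (\<exists>h\<in>lc_infinitesimals. h > 0 \<and> {x \<in> A. \<delta> x \<noteq> 0} \<subseteq> {r - h..r + h} \<and> {r - h..r + h} \<subseteq> A)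
    \<and> lc_norm1 A \<delta> = 1"


section \<open>Real polynomials\<close>

text \<open>The minimiser is unique, so the choice made by \<^const>\<open>arg_min\<close> is forced.\<close>

definition best_approx :: "real \<Rightarrow> real \<Rightarrow> (real \<Rightarrow> real) \<Rightarrow> nat \<Rightarrow> real poly" where
  "best_approx a b f n = arg_min (\<lambda>p. SUP x\<in>{a..b}. \<bar>f x - poly p x\<bar>) (\<lambda>p. degree p \<le> n)"

text \<open>The canonical extension of a function \<open>g\<close> that agrees on \<open>{a..b}\<close> with a polynomial.\<close>

definition canonical_ext :: "real \<Rightarrow> real \<Rightarrow> (real \<Rightarrow> real) \<Rightarrow> levi_civita \<Rightarrow> levi_civita" where
  "canonical_ext a b g x = poly (map_poly of_real (THE p. \<forall>t\<in>{a..b}. poly p t = g t)) x"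

lemma canonical_ext_eq:
  assumes "a < b" "\<And>t. t \<in> {a..b} \<Longrightarrow> g t = poly p t"
  shows "canonical_ext a b g x = poly (map_poly of_real p) x"
proof -
  have "q = p" if "\<forall>t\<in>{a..b}. poly q t = g t" for q
  proof -
    have "{a..b} \<subseteq> {t. poly (q - p) t = 0}" using that assms(2) by auto
    then have "infinite {t. poly (q - p) t = 0}"
      using assms(1) infinite_Icc finite_subset by blast
    then show ?thesis using poly_roots_finite[of "q - p"] by auto
  qed
  then have "(THE p. \<forall>t\<in>{a..b}. poly p t = g t) = p"
    using assms(2) by (intro the_equality) auto
  then show ?thesis by (simp add: canonical_ext_def)
qed

end

theory Submission
  imports Defs "HOL-Complex_Analysis.Conformal_Mappings"
begin

text \<open>
  For every \<open>n\<close> the integral of \<open>\<delta>' \<cdot> P\<^sub>n\<close> is infinitely close to \<open>- p\<^sub>n(r)\<close>, where \<open>p\<^sub>n = P\<^sub>n'\<close> is the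
  best approximation of \<open>f\<close>: integrating by parts, \<open>\<integral>\<delta>' \<cdot> P\<^sub>n = - \<integral>\<delta> \<cdot> p\<^sub>n\<close>, and \<open>p\<^sub>n\<close> varies only by an
  infinitesimal on the support of \<open>\<delta>\<close>, which carries total mass 1. By the Weierstrass theorem
  \<open>p\<^sub>n(r)\<close> tends to \<open>f(r)\<close>.

  Integration by parts needs care, since a \<open>C\<^sup>1\<close> function on the field may have derivative 0
  without being constant. Measurability excludes this: for every scale, \<open>[a, b]\<close> is a finite union
  of intervals on which \<open>\<delta>\<close> is a power series and of gaps of small total length. Nested gaps shrink
  to points, so \<open>\<delta>\<close> and \<open>\<delta>'\<close> are bounded and \<open>\<delta>\<close> is Lipschitz; a bounded measurable function
  has a Lipschitz primitive, whose increment is the integral. The increments of two Lipschitz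
  functions that agree on the power series intervals differ by at most a multiple of the gap length.

  A power series that converges weakly on an interval may have coefficients without common
  left-finite support, and then its termwise primitive need not converge. It can always be
  recentered and rescaled so that the coefficients have common left-finite support and each of
  their entries decays faster than every power of the index; such series can be differentiated,
  integrated and extended to the end points of the interval.
\<close>

section \<open>Exponents, convergence and order topology of the field\<close>

section \<open>Lower bounds on the support\<close>

text \<open>The order topology is totally disconnected and has no mean value theorem. Its place is
  taken by real analysis: on a power series interval the coefficients of F(u + s (v - u)) are
  differentiable functions of a real s in [0, 1], and a common left-finite support lets the lowest
  exponent of the derivative decide the sign of an increment. Across gaps only Lipschitz bounds are
  known. Their constants may be infinitely large, but the gaps can be made shorter than any power of
  the infinitesimal unit, so no error remains. Integration by parts and the final estimate are one
  comparison of increments. Let p = P', c = p(r), and let W and V be primitives of \<delta>' P and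
  |\<delta>|. On power series intervals X = W - \<delta> P + c V has derivative \<delta> (c - p), so
  its increments are at most E times those of V. Here E is infinitesimal because p has a real
  Lipschitz constant and \<delta> vanishes outside an infinitesimal neighbourhood of r. Common
  left-finite supports are read off from a single value of the series: a real argument outside
  countably many zero sets makes every exponent of the coefficients visible in the sum.\<close>

text \<open>\<open>lc_ge m x\<close> stands for \<open>\<lambda>(x) \<ge> m\<close>.\<close>

definition lc_ge :: "rat \<Rightarrow> levi_civita \<Rightarrow> bool" where
  "lc_ge m x \<longleftrightarrow> (\<forall>p<m. lc_coeff x p = 0)"

lemma lc_geD: "lc_ge m x \<Longrightarrow> p < m \<Longrightarrow> lc_coeff x p = 0"
  by (simp add: lc_ge_def)

lemma lc_ge_suppD: "lc_ge m x \<Longrightarrow> p \<in> lc_supp x \<Longrightarrow> m \<le> p"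
  by (auto simp: lc_ge_def lc_supp_def intro: leI)

lemma lc_ge_mono: "lc_ge m x \<Longrightarrow> n \<le> m \<Longrightarrow> lc_ge n x"
  by (auto simp: lc_ge_def)

lemma lc_ge_0 [simp]: "lc_ge m 0" by (simp add: lc_ge_def lc_coeff_zero)
lemma lc_ge_add: "lc_ge m x \<Longrightarrow> lc_ge m y \<Longrightarrow> lc_ge m (x + y)" by (simp add: lc_ge_def lc_coeff_add)
lemma lc_ge_diff: "lc_ge m x \<Longrightarrow> lc_ge m y \<Longrightarrow> lc_ge m (x - y)" by (simp add: lc_ge_def lc_coeff_diff)
lemma lc_ge_uminus [simp]: "lc_ge m (- x) = lc_ge m x" by (simp add: lc_ge_def lc_coeff_uminus)
lemma lc_ge_abs [simp]: "lc_ge m \<bar>x\<bar> = lc_ge m x" by (simp add: abs_levi_civita_def)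
lemma lc_ge_sum: "(\<And>i. i \<in> I \<Longrightarrow> lc_ge m (f i)) \<Longrightarrow> lc_ge m (sum f I)"
  by (simp add: lc_ge_def lc_coeff_sum)
lemma lc_ge_mult: "lc_ge m x \<Longrightarrow> lc_ge n y \<Longrightarrow> lc_ge (m + n) (x * y)"
  unfolding lc_ge_def using lc_coeff_times_lead(2)[of m x n y] by blast
lemma lc_ge_of_real: "lc_ge 0 (of_real c)" by (simp add: lc_ge_def lc_coeff_of_real)
lemma lc_ge_1: "lc_ge 0 1" by (simp add: lc_ge_def lc_coeff_one)
lemma lc_ge_power: "lc_ge m x \<Longrightarrow> lc_ge (of_nat n * m) (x ^ n)"
  unfolding lc_ge_def using lc_coeff_power_eq_0[of m x] by blast
lemma lc_ge_0_power: "lc_ge 0 x \<Longrightarrow> lc_ge 0 (x ^ n)"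
  using lc_ge_power[of 0 x n] by simp
lemma lc_ge_monom: "q \<le> k \<Longrightarrow> lc_ge q (lc_monom c k)" by (simp add: lc_ge_def lc_coeff_monom)
lemma lc_ge_of_nat: "lc_ge 0 (of_nat n)" using lc_ge_of_real[of "of_nat n"] by simp
lemma lc_ge_ex: "\<exists>m. lc_ge m x"
proof -
  obtain m where "\<forall>q\<in>lc_supp x. m \<le> q" using lc_supp_bdd by blast
  then have "lc_ge m x" by (force simp: lc_ge_def lc_supp_def)
  then show ?thesis ..
qed

lemma lc_ge_lead: "lc_ge (lc_lead x) x"
  by (cases "x = 0") (auto simp: lc_ge_def lc_lead(2) lc_coeff_zero)

lemma lc_coeff_scaleR: "lc_coeff (c *\<^sub>R x) q = c * lc_coeff x q"
  by transfer simp

lemma lc_coeff_of_real_times: "lc_coeff (of_real c * x) q = c * lc_coeff x q"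
  by (metis lc_coeff_scaleR scaleR_conv_of_real)

lemma lc_coeff_of_nat_times: "lc_coeff (of_nat n * x) q = of_nat n * lc_coeff x q"
  using lc_coeff_of_real_times[of "of_nat n" x q] by simp

lemma lc_gt_0_iff: "0 < x \<longleftrightarrow> (\<exists>q. lc_coeff x q > 0 \<and> lc_ge q x)"
  using lc_less_iff_pos[of 0 x] by (simp add: lc_pos_def lc_ge_def)

lemma lc_nonneg_coeff: assumes "0 \<le> x" "lc_ge m x" shows "0 \<le> lc_coeff x m"
proof (cases "x = 0")
  case False
  then obtain q where q: "lc_coeff x q > 0" "lc_ge q x" using assms lc_gt_0_iff[of x] by auto
  show ?thesis
  proof (cases m q rule: linorder_cases)
    case greater then show ?thesis using q assms(2) by (auto simp: lc_ge_def)
  qed (use q in \<open>auto simp: lc_ge_def\<close>)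
qed (simp add: lc_coeff_zero)

text \<open>The order is decided at the lowest exponent. The witness \<open>q\<close> shows that the
  leading exponent of \<open>x\<close> is at most \<open>q < m\<close>, hence below every exponent
  of \<open>y\<close>.\<close>

lemma lc_abs_less:
  assumes "lc_ge m y" "0 < x" "lc_coeff x q \<noteq> 0" "q < m"
  shows "\<bar>y\<bar> < x"
proof -
  obtain p where p: "lc_coeff x p > 0" "lc_ge p x" using assms lc_gt_0_iff[of x] by auto
  have pq: "p \<le> q" using p(2) assms(3) by (auto simp: lc_ge_def intro: leI)
  have "lc_ge p (x - y)" "lc_coeff (x - y) p > 0" "lc_ge p (x + y)" "lc_coeff (x + y) p > 0"
    using p pq assms by (auto simp: lc_ge_def lc_coeff_diff lc_coeff_add)
  then have "0 < x - y" "0 < x + y" by (auto simp: lc_gt_0_iff)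
  then show ?thesis by (simp add: abs_less_iff)
qed

text \<open>The \<open>q\<close>-th power of the infinitesimal unit. These elements decrease to 0 as
  \<open>q\<close> grows (\<open>lc_d_small\<close>), so the integer powers form a countable scale
  that serves every \<epsilon>.\<close>

abbreviation lc_d :: "rat \<Rightarrow> levi_civita" where "lc_d \<equiv> lc_monom 1"

lemma lc_d_pos: "0 < lc_d q"
  unfolding lc_gt_0_iff by (rule exI[of _ q]) (simp add: lc_coeff_monom lc_ge_monom)

lemma lc_ge_abs_less_d: "lc_ge m x \<Longrightarrow> q < m \<Longrightarrow> \<bar>x\<bar> < lc_d q"
  by (rule lc_abs_less[OF _ lc_d_pos]) (simp_all add: lc_coeff_monom)

lemma lc_abs_le_ge:
  assumes "\<bar>x\<bar> \<le> y" "lc_ge m y" shows "lc_ge m x"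
proof (rule ccontr)
  assume "\<not> lc_ge m x"
  then obtain q where q: "q < m" "lc_coeff x q \<noteq> 0" by (auto simp: lc_ge_def)
  then have "x \<noteq> 0" by (auto simp: lc_coeff_zero)
  have "lc_coeff \<bar>x\<bar> q \<noteq> 0" using q by (simp add: abs_levi_civita_def lc_coeff_uminus)
  then have "\<bar>y\<bar> < \<bar>x\<bar>" using lc_abs_less[OF assms(2), of "\<bar>x\<bar>" q] q \<open>x \<noteq> 0\<close> by simp
  then show False using assms(1) by (meson abs_ge_self leD order.trans)
qed

lemma lc_abs_le_d: "\<bar>x\<bar> \<le> lc_d q \<Longrightarrow> lc_ge q x"
  by (rule lc_abs_le_ge) (auto simp: lc_ge_monom)

lemma lc_d_small:
  assumes "0 < e" obtains q where "\<And>p. q \<le> p \<Longrightarrow> lc_d p < e"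
proof -
  obtain q where q: "lc_coeff e q > 0" using assms lc_gt_0_iff[of e] by auto
  have "lc_d p < e" if "q + 1 \<le> p" for p
    using lc_abs_less[of p "lc_d p" e q] q that assms lc_ge_monom[of p p 1] lc_d_pos[of p] by auto
  then show ?thesis using that by blast
qed

lemma lc_d_nat_small:
  assumes "0 < e" obtains n :: nat where "\<And>p. of_nat n \<le> p \<Longrightarrow> lc_d p < e"
proof -
  obtain q where q: "\<And>p. q \<le> p \<Longrightarrow> lc_d p < e" using lc_d_small[OF assms] by blast
  obtain n :: nat where "q \<le> of_nat n" using real_arch_simple by blast
  then show ?thesis using q that order.trans by blast
qed

text \<open>The index set \<open>S\<close> depends on the left factor and on the bound
  \<open>m\<close> alone. For a sequence of right factors with a common lower bound the product is
  therefore a fixed finite linear combination of coefficients, and limits, derivatives and estimates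
  pass through it.\<close>

lemma lc_coeff_times_left:
  assumes S: "finite S" "\<And>s. s \<in> lc_supp x \<Longrightarrow> s \<le> q - m \<Longrightarrow> s \<in> S" and m: "lc_ge m y"
  shows "lc_coeff (x * y) q = (\<Sum>s\<in>S. lc_coeff x s * lc_coeff y (q - s))"
proof -
  obtain n where n: "\<And>p. p \<in> lc_supp x \<Longrightarrow> n \<le> p" using lc_supp_bdd by metis
  let ?Y = "(\<lambda>s. q - s) ` S \<union> {p \<in> lc_supp y. p \<le> q - n}"
  have "lc_coeff (x * y) q
      = (\<Sum>r\<in>S. \<Sum>s\<in>?Y. if r + s = q then lc_coeff x r * lc_coeff y s else 0)"
    by (rule lc_coeff_times_finite[where m = n and n = m])
      (use S n m finite_lc_supp_le[of y "q - n"] in \<open>auto intro: lc_ge_suppD\<close>)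
  also have "\<dots> = (\<Sum>s\<in>S. lc_coeff x s * lc_coeff y (q - s))"
  proof (rule sum.cong[OF refl])
    fix r assume r: "r \<in> S"
    have "(\<Sum>s\<in>?Y. if r + s = q then lc_coeff x r * lc_coeff y s else 0)
        = (\<Sum>s\<in>?Y. if s = q - r then lc_coeff x r * lc_coeff y (q - r) else 0)"
      by (rule sum.cong) (auto simp: algebra_simps)
    also have "\<dots> = lc_coeff x r * lc_coeff y (q - r)"
      using r S(1) finite_lc_supp_le[of y "q - n"] by (subst sum.delta) auto
    finally show "(\<Sum>s\<in>?Y. if r + s = q then lc_coeff x r * lc_coeff y s else 0)
      = lc_coeff x r * lc_coeff y (q - r)" .
  qed
  finally show ?thesis .
qed

lemma lc_supp_mult: "lc_supp x \<subseteq> A \<Longrightarrow> lc_supp y \<subseteq> B \<Longrightarrow>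
    lc_supp (x * y) \<subseteq> {p + r | p r. p \<in> A \<and> r \<in> B}"
  by (auto elim!: lc_supp_times_ge)

section \<open>Weak convergence\<close>

text \<open>Weak convergence asks in addition for uniformity over all exponents up to a bound. For
  sequences with a common left-finite support the two notions agree (\<open>weak_imp_cw\<close>,
  \<open>weakI\<close>), so power series can be treated one coefficient at a time.\<close>

definition cw_conv :: "(nat \<Rightarrow> levi_civita) \<Rightarrow> levi_civita \<Rightarrow> bool" where
  "cw_conv X l \<longleftrightarrow> (\<forall>q. (\<lambda>n. lc_coeff (X n) q) \<longlonglongrightarrow> lc_coeff l q)"

definition lc_regular :: "(nat \<Rightarrow> levi_civita) \<Rightarrow> bool" where
  "lc_regular X \<longleftrightarrow> (\<exists>E. left_finite E \<and> (\<forall>n. lc_supp (X n) \<subseteq> E))"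

lemma cw_convD: "cw_conv X l \<Longrightarrow> (\<lambda>n. lc_coeff (X n) q) \<longlonglongrightarrow> lc_coeff l q"
  by (simp add: cw_conv_def)

lemma cw_conv_unique: "cw_conv X l \<Longrightarrow> cw_conv X l' \<Longrightarrow> l = l'"
  unfolding cw_conv_def by (intro lc_eqI) (metis LIMSEQ_unique)

lemma weak_imp_cw: assumes "weakly_converges X l" shows "cw_conv X l"
  unfolding cw_conv_def
proof
  fix q
  show "(\<lambda>n. lc_coeff (X n) q) \<longlonglongrightarrow> lc_coeff l q"
  proof (rule tendstoI)
    fix e :: real assume e: "0 < e"
    \<comment> \<open>The second argument makes \<open>inverse e'\<close> at least \<open>q\<close>,
      so that \<open>q\<close> lies in the range controlled by weak convergence; the maximum with 1
      keeps the inverse positive.\<close>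
    define e' where "e' = min e (inverse (max 1 (real_of_rat q)))"
    have e': "0 < e'" "e' \<le> e" using e by (auto simp: e'_def)
    have "e' \<le> inverse (max 1 (real_of_rat q))" by (simp add: e'_def)
    then have "max 1 (real_of_rat q) \<le> inverse e'"
      using e'(1) by (metis inverse_inverse_eq le_imp_inverse_le)
    then have "real_of_rat q \<le> inverse e'" by simp
    moreover have "\<forall>\<^sub>F n in sequentially. \<forall>q. real_of_rat q \<le> inverse e' \<longrightarrow> \<bar>lc_coeff (X n - l) q\<bar> < e'"
      using assms e' unfolding weakly_converges_iff by blast
    ultimately have "\<forall>\<^sub>F n in sequentially. \<bar>lc_coeff (X n - l) q\<bar> < e'"
      by (auto elim: eventually_mono)
    then show "\<forall>\<^sub>F n in sequentially. dist (lc_coeff (X n) q) (lc_coeff l q) < e"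
      by eventually_elim (use e' in \<open>auto simp: lc_coeff_diff dist_real_def\<close>)
  qed
qed

lemma cw_conv_supp:
  assumes "cw_conv X l" "\<And>n. lc_supp (X n) \<subseteq> E" shows "lc_supp l \<subseteq> E"
proof
  fix q assume "q \<in> lc_supp l"
  show "q \<in> E"
  proof (rule ccontr)
    assume "q \<notin> E"
    then have "\<And>n. lc_coeff (X n) q = 0" using assms(2) by (auto simp: lc_supp_def)
    then have "lc_coeff l q = 0" using cw_convD[OF assms(1), of q] by (simp add: LIMSEQ_const_iff)
    then show False using \<open>q \<in> lc_supp l\<close> by (simp add: lc_supp_def)
  qed
qed

lemma cw_conv_ge:
  assumes "cw_conv X l" "\<And>n. lc_ge m (X n)" shows "lc_ge m l"
proof -
  have "lc_supp l \<subseteq> {m..}" by (rule cw_conv_supp[OF assms(1)]) (use assms(2) lc_ge_suppD in auto)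
  then show ?thesis by (force simp: lc_ge_def lc_supp_def)
qed

text \<open>Only finitely many exponents of the common support lie below a given bound, so pointwise
  convergence is uniform on them; at all other exponents both the sequence and the limit
  vanish.\<close>

lemma weakI:
  assumes "lc_regular X" "cw_conv X l" shows "weakly_converges X l"
  unfolding weakly_converges_iff
proof (intro allI impI)
  fix e :: real assume e: "0 < e"
  obtain E where E: "left_finite E" "\<And>n. lc_supp (X n) \<subseteq> E"
    using assms(1) by (auto simp: lc_regular_def)
  have El: "lc_supp l \<subseteq> E" by (rule cw_conv_supp[OF assms(2) E(2)])
  obtain N :: nat where N: "inverse e \<le> of_nat N" using real_arch_simple by blast
  define F where "F = {q \<in> E. q \<le> of_nat N}"
  have F: "finite F" using E(1) by (simp add: F_def left_finite_def)
  have "\<forall>\<^sub>F n in sequentially. \<forall>q\<in>F. \<bar>lc_coeff (X n - l) q\<bar> < e"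
  proof (rule eventually_ball_finite[OF F], rule ballI)
    fix q
    have "\<forall>\<^sub>F n in sequentially. dist (lc_coeff (X n) q) (lc_coeff l q) < e"
      using cw_convD[OF assms(2)] e by (rule tendstoD)
    then show "\<forall>\<^sub>F n in sequentially. \<bar>lc_coeff (X n - l) q\<bar> < e"
      by (simp add: lc_coeff_diff dist_real_def)
  qed
  then show "\<forall>\<^sub>F n in sequentially. \<forall>q. real_of_rat q \<le> inverse e \<longrightarrow> \<bar>lc_coeff (X n - l) q\<bar> < e"
  proof eventually_elim
    case (elim n)
    show ?case
    proof (intro allI impI)
      fix q assume "real_of_rat q \<le> inverse e"
      then have "real_of_rat q \<le> real_of_rat (of_nat N)" using N by simp
      then have q: "q \<le> of_nat N" by (simp only: of_rat_less_eq)
      show "\<bar>lc_coeff (X n - l) q\<bar> < e"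
      proof (cases "q \<in> E")
        case True then show ?thesis using elim q by (simp add: F_def)
      next
        case False
        then have "lc_coeff (X n) q = 0" "lc_coeff l q = 0" using E(2)[of n] El by (auto simp: lc_supp_def)
        then show ?thesis using e by (simp add: lc_coeff_diff)
      qed
    qed
  qed
qed

lemma cw_conv_add: "cw_conv X l \<Longrightarrow> cw_conv Y k \<Longrightarrow> cw_conv (\<lambda>n. X n + Y n) (l + k)"
  by (auto simp: cw_conv_def lc_coeff_add intro!: tendsto_add)

lemma cw_conv_diff: "cw_conv X l \<Longrightarrow> cw_conv Y k \<Longrightarrow> cw_conv (\<lambda>n. X n - Y n) (l - k)"
  by (auto simp: cw_conv_def lc_coeff_diff intro!: tendsto_diff)

lemma cw_conv_mult:
  assumes "cw_conv X l" "\<And>n. lc_ge m (X n)" shows "cw_conv (\<lambda>n. c * X n) (c * l)"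
  unfolding cw_conv_def
proof
  fix q
  let ?S = "{s \<in> lc_supp c. s \<le> q - m}"
  have "lc_coeff (c * y) q = (\<Sum>s\<in>?S. lc_coeff c s * lc_coeff y (q - s))" if "lc_ge m y" for y
    by (rule lc_coeff_times_left[OF finite_lc_supp_le _ that]) auto
  then show "(\<lambda>n. lc_coeff (c * X n) q) \<longlonglongrightarrow> lc_coeff (c * l) q"
    using assms cw_conv_ge[OF assms] by (auto intro!: tendsto_intros simp: cw_convD)
qed

lemma lc_regular_ge: assumes "lc_regular X" obtains m where "\<And>n. lc_ge m (X n)"
proof -
  obtain E where E: "left_finite E" "\<And>n. lc_supp (X n) \<subseteq> E"
    using assms by (auto simp: lc_regular_def)
  obtain m where "\<forall>q\<in>E. m \<le> q" using left_finite_bdd E by blast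
  then have "lc_ge m (X n)" for n using E(2)[of n] by (force simp: lc_ge_def lc_supp_def)
  then show ?thesis using that by blast
qed

section \<open>The order topology\<close>

lemma lc_eventually_at:
  fixes x :: levi_civita
  shows "eventually P (at x within A) \<longleftrightarrow> (\<exists>d>0. \<forall>y\<in>A. y \<noteq> x \<and> \<bar>y - x\<bar> < d \<longrightarrow> P y)"
proof
  assume "eventually P (at x within A)"
  then obtain S where S: "open S" "x \<in> S" "\<And>y. y \<in> S \<Longrightarrow> y \<noteq> x \<Longrightarrow> y \<in> A \<Longrightarrow> P y"
    unfolding eventually_at_topological by auto
  obtain b where b: "b > x" "{x..<b} \<subseteq> S" using open_right[OF S(1,2), of "x + 1"] by auto
  obtain a where a: "a < x" "{a<..x} \<subseteq> S" using open_left[OF S(1,2), of "x - 1"] by auto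
  have "y \<in> S" if "\<bar>y - x\<bar> < min (b - x) (x - a)" for y
  proof (cases "y \<le> x")
    case True then have "y \<in> {a<..x}" using that by auto
    then show ?thesis using a by blast
  next
    case False then have "y \<in> {x..<b}" using that by auto
    then show ?thesis using b by blast
  qed
  then show "\<exists>d>0. \<forall>y\<in>A. y \<noteq> x \<and> \<bar>y - x\<bar> < d \<longrightarrow> P y"
    using S a b by (intro exI[of _ "min (b - x) (x - a)"]) auto
next
  assume "\<exists>d>0. \<forall>y\<in>A. y \<noteq> x \<and> \<bar>y - x\<bar> < d \<longrightarrow> P y"
  then obtain d where d: "d > 0" "\<And>y. y \<in> A \<Longrightarrow> y \<noteq> x \<Longrightarrow> \<bar>y - x\<bar> < d \<Longrightarrow> P y" by blast
  show "eventually P (at x within A)" unfolding eventually_at_topological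
    by (rule exI[of _ "{x - d<..<x + d}"]) (use d in \<open>auto simp: abs_less_iff algebra_simps\<close>)
qed

lemma lc_tendsto_iff:
  fixes f :: "'a \<Rightarrow> levi_civita"
  shows "(f \<longlongrightarrow> L) F \<longleftrightarrow> (\<forall>e>0. \<forall>\<^sub>F y in F. \<bar>f y - L\<bar> < e)"
proof
  assume f: "(f \<longlongrightarrow> L) F"
  show "\<forall>e>0. \<forall>\<^sub>F y in F. \<bar>f y - L\<bar> < e"
  proof (intro allI impI)
    fix e :: levi_civita assume "e > 0"
    then have "\<forall>\<^sub>F n in F. L - e < f n" "\<forall>\<^sub>F n in F. f n < L + e"
      using f by (auto intro: order_tendstoD)
    then show "\<forall>\<^sub>F n in F. \<bar>f n - L\<bar> < e" by eventually_elim linarith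
  qed
next
  assume f: "\<forall>e>0. \<forall>\<^sub>F y in F. \<bar>f y - L\<bar> < e"
  show "(f \<longlongrightarrow> L) F"
  proof (rule order_tendstoI)
    fix a assume "a < L"
    then have "\<forall>\<^sub>F n in F. \<bar>f n - L\<bar> < L - a" using f by simp
    then show "\<forall>\<^sub>F n in F. a < f n" by eventually_elim linarith
  next
    fix a assume "L < a"
    then have "\<forall>\<^sub>F n in F. \<bar>f n - L\<bar> < a - L" using f by simp
    then show "\<forall>\<^sub>F n in F. f n < a" by eventually_elim linarith
  qed
qed

lemma lc_tendsto_at_iff:
  fixes x :: levi_civita and f :: "levi_civita \<Rightarrow> levi_civita"
  shows "(f \<longlongrightarrow> L) (at x within A)
    \<longleftrightarrow> (\<forall>e>0. \<exists>d>0. \<forall>y\<in>A. y \<noteq> x \<and> \<bar>y - x\<bar> < d \<longrightarrow> \<bar>f y - L\<bar> < e)"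
  unfolding lc_tendsto_iff lc_eventually_at ..

text \<open>Two elements closer than \<open>lc_d q\<close> have the same coefficients below
  \<open>q\<close>. The coefficients of a Cauchy sequence are thus eventually constant, and the
  limit is put together from the eventual values.\<close>

lemma lc_Cauchy:
  fixes X :: "nat \<Rightarrow> levi_civita"
  assumes "\<And>e. e > 0 \<Longrightarrow> \<exists>N. \<forall>m\<ge>N. \<forall>n\<ge>N. \<bar>X m - X n\<bar> < e"
  shows "\<exists>l. strongly_converges X l"
proof -
  have "\<exists>N. \<forall>m\<ge>N. \<forall>n\<ge>N. lc_ge q (X m - X n)" for q
    using assms[OF lc_d_pos[of q]] lc_abs_le_d less_imp_le by metis
  then obtain N where N: "\<And>q m n. m \<ge> N q \<Longrightarrow> n \<ge> N q \<Longrightarrow> lc_ge q (X m - X n)" by metis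
  \<comment> \<open>The shift by 1 is needed because \<open>lc_ge r\<close> fixes only the
    coefficients at exponents strictly below \<open>r\<close>.\<close>
  define L where "L q = lc_coeff (X (N (q + 1))) q" for q
  have L: "L q = lc_coeff (X n) q" if "q < r" "n \<ge> N r" for q r n
  proof -
    let ?m = "max n (N (q + 1))"
    have "lc_ge (q + 1) (X (N (q + 1)) - X ?m)" "lc_ge r (X n - X ?m)" using N that by auto
    then show ?thesis using that by (auto simp: L_def lc_ge_def lc_coeff_diff)
  qed
  have "left_finite {q. L q \<noteq> 0}" unfolding left_finite_def
  proof
    fix Q
    have "{x \<in> {q. L q \<noteq> 0}. x \<le> Q} \<subseteq> {q \<in> lc_supp (X (N (Q + 1))). q \<le> Q}"
      using L[of _ "Q + 1" "N (Q + 1)"] by (auto simp: lc_supp_def)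
    then show "finite {x \<in> {q. L q \<noteq> 0}. x \<le> Q}" using finite_lc_supp_le finite_subset by blast
  qed
  then have c: "lc_coeff (Abs_levi_civita L) = L" by (simp add: Abs_levi_civita_inverse)
  have "strongly_converges X (Abs_levi_civita L)" unfolding strongly_converges_def
  proof (intro allI impI)
    fix e :: levi_civita assume "e > 0"
    then obtain q where q: "lc_d q < e" using lc_d_small by blast
    have "\<bar>X n - Abs_levi_civita L\<bar> < e" if "n \<ge> N (q + 1)" for n
    proof -
      have "lc_ge (q + 1) (X n - Abs_levi_civita L)"
        unfolding lc_ge_def using L[OF _ that] by (simp add: lc_coeff_diff c)
      then have "\<bar>X n - Abs_levi_civita L\<bar> < lc_d q" by (rule lc_ge_abs_less_d) simp
      then show ?thesis using q by simp
    qed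
    then show "\<forall>\<^sub>F n in sequentially. \<bar>X n - Abs_levi_civita L\<bar> < e"
      using eventually_sequentially by blast
  qed
  then show ?thesis by blast
qed

section \<open>Calculus of power series with rapidly decaying coefficients\<close>

section \<open>Rapidly decaying power series\<close>

text \<open>The disc contains points infinitely close to \<open>1\<close> on either side. This is why rapid decay is
  required of the coefficients, and not only absolute summability.\<close>

definition lc_disc :: "levi_civita \<Rightarrow> bool" where
  "lc_disc t \<longleftrightarrow> lc_ge 0 t \<and> \<bar>lc_coeff t 0\<bar> \<le> 1"

definition lc_rapid :: "(nat \<Rightarrow> levi_civita) \<Rightarrow> bool" where
  "lc_rapid e \<longleftrightarrow> lc_regular e \<and> (\<forall>q j. \<exists>C. \<forall>k. \<bar>lc_coeff (e k) q\<bar> * real (Suc k) ^ j \<le> C)"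

lemma lc_discD: "lc_disc t \<Longrightarrow> lc_ge 0 t" "lc_disc t \<Longrightarrow> \<bar>lc_coeff t 0\<bar> \<le> 1"
  by (auto simp: lc_disc_def)

lemma lc_disc_between:
  assumes "lc_disc t1" "lc_disc t2" "t1 \<le> t" "t \<le> t2" shows "lc_disc t"
proof -
  have "\<bar>t\<bar> \<le> \<bar>t1\<bar> + \<bar>t2\<bar>" using assms(3,4) by linarith
  moreover have "lc_ge 0 (\<bar>t1\<bar> + \<bar>t2\<bar>)" using assms(1,2) by (intro lc_ge_add) (auto dest: lc_discD)
  ultimately have g: "lc_ge 0 t" by (rule lc_abs_le_ge)
  have "0 \<le> lc_coeff (t - t1) 0" "0 \<le> lc_coeff (t2 - t) 0"
    using assms g by (auto intro!: lc_nonneg_coeff lc_ge_diff dest: lc_discD)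
  then show ?thesis using g assms(1,2) by (auto simp: lc_disc_def lc_coeff_diff)
qed

lemma lc_ge_pos_ex:
  assumes "lc_ge 0 x" "lc_coeff x 0 = 0" obtains m where "0 < m" "lc_ge m x"
proof (cases "x = 0")
  case True then show ?thesis using that[of 1] by simp
next
  case False
  have "0 < lc_lead x" using lc_lead(1)[OF False] assms
    by (metis lc_geD linorder_cases)
  then show ?thesis using that lc_ge_lead by blast
qed

lemma lc_binomial:
  "lc_coeff ((of_real c + h) ^ k) s
    = (\<Sum>i\<le>k. real (k choose i) * c ^ (k - i) * lc_coeff (h ^ i) s)"
proof -
  have "(of_real c + h) ^ k = (\<Sum>i\<le>k. of_real (real (k choose i) * c ^ (k - i)) * h ^ i)"
    by (subst add.commute) (simp add: binomial_ring ac_simps)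
  then show ?thesis by (simp only: lc_coeff_sum lc_coeff_of_real_times)
qed

lemma lc_power_vanish:
  assumes "0 < m" obtains N :: nat where "\<And>i x. N < i \<Longrightarrow> lc_ge m x \<Longrightarrow> lc_coeff (x ^ i) s = 0"
proof -
  obtain N :: nat where N: "s / m \<le> of_nat N" using real_arch_simple by blast
  have "lc_coeff (x ^ i) s = 0" if "N < i" "lc_ge m x" for i x
  proof -
    have "s \<le> of_nat N * m" using N assms by (simp add: divide_le_eq)
    also have "\<dots> < of_nat i * m" using that assms by simp
    finally show ?thesis using lc_ge_power[OF that(2), of i] lc_geD by blast
  qed
  then show ?thesis using that by blast
qed

lemma lc_powers_left_finite:
  assumes "0 < m" "lc_ge m x" shows "left_finite (\<Union>i. lc_supp (x ^ i))"
  unfolding left_finite_def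
proof
  fix B
  obtain N :: nat where N: "B / m < of_nat N" using reals_Archimedean2 by blast
  have "{q \<in> (\<Union>i. lc_supp (x ^ i)). q \<le> B} \<subseteq> (\<Union>i\<le>N. {q \<in> lc_supp (x ^ i). q \<le> B})"
  proof safe
    fix q i assume q: "q \<in> lc_supp (x ^ i)" "q \<le> B"
    have "of_nat i * m \<le> q" using lc_ge_suppD[OF lc_ge_power[OF assms(2)] q(1)] .
    also note q(2)
    also have "B < of_nat N * m" using N assms(1) by (simp add: divide_less_eq)
    finally have "i < N" using assms(1) by simp
    then show "q \<in> (\<Union>i\<le>N. {q \<in> lc_supp (x ^ i). q \<le> B})" using q by auto
  qed
  then show "finite {q \<in> (\<Union>i. lc_supp (x ^ i)). q \<le> B}"
    by (rule finite_subset) (auto intro: finite_lc_supp_le)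
qed

text \<open>Write b = c + h with a real |c| \<le> 1 and h infinitesimal or 0. At a fixed exponent
  only the powers h^i with i \<le> N contribute to the binomial expansion of b^k, with factors at
  most (k + 1)^N. So the growth in k is polynomial even if |c| = 1, and rapid decay compensates for
  it.\<close>

lemma lc_disc_growth:
  assumes "lc_disc b"
  obtains M where "left_finite M" "\<And>k. lc_supp (b ^ k) \<subseteq> M"
    "\<And>s. \<exists>C N. \<forall>k. \<bar>lc_coeff (b ^ k) s\<bar> \<le> C * real (Suc k) ^ N"
proof -
  define c where "c = lc_coeff b 0"
  define h where "h = b - of_real c"
  have b: "b = of_real c + h" by (simp add: h_def)
  have "lc_ge 0 h" "lc_coeff h 0 = 0"
    using assms by (auto simp: h_def c_def lc_coeff_diff lc_coeff_of_real lc_ge_of_real intro!: lc_ge_diff dest: lc_discD)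
  then obtain m where m: "0 < m" "lc_ge m h" by (rule lc_ge_pos_ex)
  have c: "\<bar>c\<bar> \<le> 1" using assms by (simp add: c_def lc_disc_def)
  show ?thesis
  proof (rule that)
    show "left_finite (\<Union>i. lc_supp (h ^ i))" by (rule lc_powers_left_finite[OF m])
    show "lc_supp (b ^ k) \<subseteq> (\<Union>i. lc_supp (h ^ i))" for k
    proof
      fix s assume "s \<in> lc_supp (b ^ k)"
      then have "(\<Sum>i\<le>k. real (k choose i) * c ^ (k - i) * lc_coeff (h ^ i) s) \<noteq> 0"
        unfolding lc_supp_def b lc_binomial by simp
      then obtain i where "lc_coeff (h ^ i) s \<noteq> 0" by (metis (no_types, lifting) mult_zero_right sum.neutral)
      then show "s \<in> (\<Union>i. lc_supp (h ^ i))" by (auto simp: lc_supp_def)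
    qed
    show "\<exists>C N. \<forall>k. \<bar>lc_coeff (b ^ k) s\<bar> \<le> C * real (Suc k) ^ N" for s
    proof -
      obtain N :: nat where N: "\<And>i. N < i \<Longrightarrow> lc_coeff (h ^ i) s = 0"
        using lc_power_vanish[OF m(1)] m(2) by metis
      have "\<bar>lc_coeff (b ^ k) s\<bar> \<le> (\<Sum>i\<le>N. \<bar>lc_coeff (h ^ i) s\<bar>) * real (Suc k) ^ N" for k
      proof -
        have "\<bar>lc_coeff (b ^ k) s\<bar> \<le> (\<Sum>i\<le>k. \<bar>real (k choose i) * c ^ (k - i) * lc_coeff (h ^ i) s\<bar>)"
          unfolding b lc_binomial by (rule sum_abs)
        also have "\<dots> \<le> (\<Sum>i\<le>k. if i \<le> N then real (Suc k) ^ N * \<bar>lc_coeff (h ^ i) s\<bar> else 0)"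
        proof (rule sum_mono)
          fix i assume i: "i \<in> {..k}"
          show "\<bar>real (k choose i) * c ^ (k - i) * lc_coeff (h ^ i) s\<bar>
            \<le> (if i \<le> N then real (Suc k) ^ N * \<bar>lc_coeff (h ^ i) s\<bar> else 0)"
          proof (cases "i \<le> N")
            case True
            have "k choose i \<le> k ^ i" using i by (intro binomial_le_pow) simp
            also have "\<dots> \<le> Suc k ^ i" by (rule power_mono) auto
            also have "\<dots> \<le> Suc k ^ N" using True by (intro power_increasing) auto
            finally have "real (k choose i) \<le> real (Suc k) ^ N"
              by (metis of_nat_le_iff of_nat_power)
            moreover have "\<bar>c\<bar> ^ (k - i) \<le> 1" using c by (simp add: power_le_one)
            ultimately have "real (k choose i) * \<bar>c\<bar> ^ (k - i) \<le> real (Suc k) ^ N * 1"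
              by (intro mult_mono) auto
            then show ?thesis using True by (simp add: abs_mult power_abs mult_right_mono)
          next
            case False then show ?thesis using N by simp
          qed
        qed
        also have "\<dots> \<le> (\<Sum>i\<le>N. real (Suc k) ^ N * \<bar>lc_coeff (h ^ i) s\<bar>)"
          by (subst sum.inter_filter[symmetric]) (auto intro!: sum_mono2)
        finally show ?thesis by (simp add: sum_distrib_left sum_distrib_right mult.commute)
      qed
      then show ?thesis by blast
    qed
  qed
qed

lemma lc_coeff_mult_mono:
  assumes "\<And>p. \<bar>lc_coeff x p\<bar> \<le> lc_coeff X p" "\<And>p. \<bar>lc_coeff y p\<bar> \<le> lc_coeff Y p"
  shows "\<bar>lc_coeff (x * y) q\<bar> \<le> lc_coeff (X * Y) q"
proof -
  obtain m where m: "lc_ge m Y" using lc_ge_ex by blast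
  have my: "lc_ge m y" unfolding lc_ge_def
  proof (intro allI impI)
    fix p assume "p < m"
    then show "lc_coeff y p = 0" using assms(2)[of p] m by (simp add: lc_ge_def)
  qed
  let ?S = "{s \<in> lc_supp X. s \<le> q - m}"
  have sub: "lc_supp x \<subseteq> lc_supp X"
  proof
    fix p assume "p \<in> lc_supp x" then show "p \<in> lc_supp X"
      using assms(1)[of p] by (auto simp: lc_supp_def)
  qed
  have 1: "lc_coeff (x * y) q = (\<Sum>s\<in>?S. lc_coeff x s * lc_coeff y (q - s))"
    by (rule lc_coeff_times_left[OF finite_lc_supp_le _ my]) (use sub in auto)
  have 2: "lc_coeff (X * Y) q = (\<Sum>s\<in>?S. lc_coeff X s * lc_coeff Y (q - s))"
    by (rule lc_coeff_times_left[OF finite_lc_supp_le _ m]) auto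
  have nn: "0 \<le> lc_coeff X s" for s using assms(1)[of s] by linarith
  show ?thesis unfolding 1 2
    by (rule order.trans[OF sum_abs])
      (auto intro!: sum_mono mult_mono simp: abs_mult assms nn)
qed

lemma lc_coeff_power_mono:
  assumes "\<And>p. \<bar>lc_coeff x p\<bar> \<le> lc_coeff X p"
  shows "\<bar>lc_coeff (x ^ k) q\<bar> \<le> lc_coeff (X ^ k) q"
proof (induction k arbitrary: q)
  case 0 then show ?case by (simp add: lc_coeff_one)
next
  case (Suc k) show ?case unfolding power_Suc by (rule lc_coeff_mult_mono[OF assms Suc])
qed

text \<open>All bounds are uniform in \<open>t\<close> below the majorant \<open>b\<close>. One
  majorant serves a whole segment and yields the summable bound, independent of the point, that the
  Weierstrass test in \<open>lc_phi_line\<close> requires.\<close>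

lemma lc_rapid_bound:
  assumes e: "lc_rapid e" and b: "lc_disc b"
  obtains E where "left_finite E"
    "\<And>t k. (\<And>p. \<bar>lc_coeff t p\<bar> \<le> lc_coeff b p) \<Longrightarrow> lc_supp (e k * t ^ k) \<subseteq> E"
    "\<And>q. \<exists>C. \<forall>t k. (\<forall>p. \<bar>lc_coeff t p\<bar> \<le> lc_coeff b p)
       \<longrightarrow> \<bar>lc_coeff (e k * t ^ k) q\<bar> \<le> C / real (Suc k) ^ 2"
proof -
  obtain M where M: "left_finite M" "\<And>k. lc_supp (b ^ k) \<subseteq> M"
    "\<And>s. \<exists>C N. \<forall>k. \<bar>lc_coeff (b ^ k) s\<bar> \<le> C * real (Suc k) ^ N"
    using lc_disc_growth[OF b] by blast
  obtain F where F: "left_finite F" "\<And>k. lc_supp (e k) \<subseteq> F"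
    using e by (auto simp: lc_rapid_def lc_regular_def)
  obtain m where "\<And>k. lc_ge m (e k)" using lc_regular_ge e unfolding lc_rapid_def by metis
  note m = this
  have tM: "lc_supp (t ^ k) \<subseteq> M" if "\<And>p. \<bar>lc_coeff t p\<bar> \<le> lc_coeff b p" for t k
  proof
    fix p assume "p \<in> lc_supp (t ^ k)"
    then have "p \<in> lc_supp (b ^ k)" using lc_coeff_power_mono[OF that, of k p] by (auto simp: lc_supp_def)
    then show "p \<in> M" using M(2) by blast
  qed
  show ?thesis
  proof (rule that)
    show "left_finite {p + r | p r. p \<in> F \<and> r \<in> M}" by (rule left_finite_conv[OF F(1) M(1)])
    show "lc_supp (e k * t ^ k) \<subseteq> {p + r | p r. p \<in> F \<and> r \<in> M}"
      if "\<And>p. \<bar>lc_coeff t p\<bar> \<le> lc_coeff b p" for t k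
      by (rule lc_supp_mult[OF F(2) tM[OF that]])
    show "\<exists>C. \<forall>t k. (\<forall>p. \<bar>lc_coeff t p\<bar> \<le> lc_coeff b p)
       \<longrightarrow> \<bar>lc_coeff (e k * t ^ k) q\<bar> \<le> C / real (Suc k) ^ 2" for q
    proof -
      define S where "S = {s \<in> M. s \<le> q - m}"
      have S: "finite S" using M(1) by (simp add: S_def left_finite_def)
      obtain C N where CN: "\<And>s k. \<bar>lc_coeff (b ^ k) s\<bar> \<le> C s * real (Suc k) ^ N s" using M(3) by metis
      \<comment> \<open>The power \<open>N s\<close> absorbs the growth of the powers of
        \<open>b\<close>; the remaining 2 makes the bound summable.\<close>
      have "\<exists>D. \<forall>k. \<bar>lc_coeff (e k) (q - s)\<bar> * real (Suc k) ^ (N s + 2) \<le> D" for s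
        using e unfolding lc_rapid_def by blast
      then obtain D where D: "\<And>s k. \<bar>lc_coeff (e k) (q - s)\<bar> * real (Suc k) ^ (N s + 2) \<le> D s" by metis
      have C0: "0 \<le> C s" for s using CN[of 0 s] by simp
      have "\<bar>lc_coeff (e k * t ^ k) q\<bar> \<le> (\<Sum>s\<in>S. C s * D s) / real (Suc k) ^ 2"
        if t: "\<forall>p. \<bar>lc_coeff t p\<bar> \<le> lc_coeff b p" for t k
      proof -
        have "lc_coeff (e k * t ^ k) q = lc_coeff (t ^ k * e k) q" by (simp add: mult.commute)
        also have "\<dots> = (\<Sum>s\<in>S. lc_coeff (t ^ k) s * lc_coeff (e k) (q - s))"
          by (rule lc_coeff_times_left[OF S _ m]) (use tM t in \<open>auto simp: S_def\<close>)
        finally have "\<bar>lc_coeff (e k * t ^ k) q\<bar> \<le> (\<Sum>s\<in>S. \<bar>lc_coeff (t ^ k) s * lc_coeff (e k) (q - s)\<bar>)"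
          by (simp add: sum_abs)
        also have "\<dots> \<le> (\<Sum>s\<in>S. C s * D s / real (Suc k) ^ 2)"
        proof (rule sum_mono)
          fix s
          have "\<bar>lc_coeff (t ^ k) s\<bar> \<le> lc_coeff (b ^ k) s" using lc_coeff_power_mono t by blast
          also have "\<dots> \<le> C s * real (Suc k) ^ N s" using CN[of k s] by linarith
          finally have "\<bar>lc_coeff (t ^ k) s\<bar> * \<bar>lc_coeff (e k) (q - s)\<bar>
              \<le> C s * real (Suc k) ^ N s * \<bar>lc_coeff (e k) (q - s)\<bar>" by (rule mult_right_mono) simp
          also have "\<dots> = C s * (\<bar>lc_coeff (e k) (q - s)\<bar> * real (Suc k) ^ (N s + 2)) / real (Suc k) ^ 2"
            by (simp add: power_add power2_eq_square del: of_nat_Suc)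
          also have "\<dots> \<le> C s * D s / real (Suc k) ^ 2"
            by (intro divide_right_mono mult_left_mono D C0) simp
          finally show "\<bar>lc_coeff (t ^ k) s * lc_coeff (e k) (q - s)\<bar> \<le> C s * D s / real (Suc k) ^ 2"
            by (simp add: abs_mult)
        qed
        finally show ?thesis by (simp add: sum_divide_distrib)
      qed
      then show ?thesis by blast
    qed
  qed
qed

lift_definition lc_majorant :: "levi_civita \<Rightarrow> levi_civita" is "\<lambda>x q. \<bar>x q\<bar>" by simp

lemma lc_coeff_majorant: "lc_coeff (lc_majorant x) q = \<bar>lc_coeff x q\<bar>" by transfer simp

lemma lc_ge_majorant [simp]: "lc_ge m (lc_majorant x) = lc_ge m x"
  by (simp add: lc_ge_def lc_coeff_majorant)

text \<open>The sum is taken separately at each exponent. Where it diverges, or the result has no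
  left-finite support, the value is arbitrary; it is meaningful for rapid \<open>e\<close> and
  \<open>t\<close> in the disc (lemma \<open>lc_phi\<close>).\<close>

definition lc_phi :: "(nat \<Rightarrow> levi_civita) \<Rightarrow> levi_civita \<Rightarrow> levi_civita" where
  "lc_phi e t = Abs_levi_civita (\<lambda>q. \<Sum>k. lc_coeff (e k * t ^ k) q)"

lemma summable_inverse_Suc_square: "summable (\<lambda>k. C / real (Suc k) ^ 2)"
proof -
  have "summable (\<lambda>k. inverse (real (Suc k) ^ 2))"
    using inverse_power_summable[of 2, where ?'a = real] by (subst summable_Suc_iff) simp
  then show ?thesis unfolding divide_inverse by (rule summable_mult)
qed

lemma lc_phi:
  assumes e: "lc_rapid e" and t: "lc_disc t"
  shows "(\<lambda>k. lc_coeff (e k * t ^ k) q) sums lc_coeff (lc_phi e t) q"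
    and "lc_regular (\<lambda>n. \<Sum>k\<le>n. e k * t ^ k)"
    and "cw_conv (\<lambda>n. \<Sum>k\<le>n. e k * t ^ k) (lc_phi e t)"
proof -
  have b: "lc_disc (lc_majorant t)" using t by (auto simp: lc_disc_def lc_coeff_majorant)
  obtain E where E: "left_finite E"
    "\<And>x k. (\<And>p. \<bar>lc_coeff x p\<bar> \<le> lc_coeff (lc_majorant t) p) \<Longrightarrow> lc_supp (e k * x ^ k) \<subseteq> E"
    "\<And>q. \<exists>C. \<forall>x k. (\<forall>p. \<bar>lc_coeff x p\<bar> \<le> lc_coeff (lc_majorant t) p)
       \<longrightarrow> \<bar>lc_coeff (e k * x ^ k) q\<bar> \<le> C / real (Suc k) ^ 2"
    using lc_rapid_bound[OF e b] by metis
  have E2: "lc_supp (e k * t ^ k) \<subseteq> E" for k using E(2) by (simp add: lc_coeff_majorant)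
  have sm: "summable (\<lambda>k. lc_coeff (e k * t ^ k) q)" for q
  proof -
    obtain C where "\<And>k. \<bar>lc_coeff (e k * t ^ k) q\<bar> \<le> C / real (Suc k) ^ 2"
      using E(3)[of q] by (auto simp: lc_coeff_majorant)
    then show ?thesis
      by (intro summable_comparison_test[OF _ summable_inverse_Suc_square[of C]]) auto
  qed
  have "left_finite {q. (\<Sum>k. lc_coeff (e k * t ^ k) q) \<noteq> 0}"
  proof (rule left_finite_subset[OF E(1)], safe, rule ccontr)
    fix q assume "(\<Sum>k. lc_coeff (e k * t ^ k) q) \<noteq> 0" "q \<notin> E"
    moreover from \<open>q \<notin> E\<close> have "lc_coeff (e k * t ^ k) q = 0" for k using E2 by (auto simp: lc_supp_def)
    ultimately show False by simp
  qed
  then have "lc_coeff (lc_phi e t) q = (\<Sum>k. lc_coeff (e k * t ^ k) q)" for q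
    by (simp add: lc_phi_def Abs_levi_civita_inverse)
  then show s: "(\<lambda>k. lc_coeff (e k * t ^ k) q) sums lc_coeff (lc_phi e t) q" for q
    using sm summable_sums by metis
  then show "cw_conv (\<lambda>n. \<Sum>k\<le>n. e k * t ^ k) (lc_phi e t)"
    by (simp add: cw_conv_def lc_coeff_sum sums_def_le)
  show "lc_regular (\<lambda>n. \<Sum>k\<le>n. e k * t ^ k)" unfolding lc_regular_def
  proof (intro exI[of _ E] conjI E(1) allI subsetI)
    fix n q assume "q \<in> lc_supp (\<Sum>k\<le>n. e k * t ^ k)"
    then have "(\<Sum>k\<le>n. lc_coeff (e k * t ^ k) q) \<noteq> 0" by (simp add: lc_supp_def lc_coeff_sum)
    then obtain k where "lc_coeff (e k * t ^ k) q \<noteq> 0" by (meson sum.neutral)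
    then show "q \<in> E" using E2 by (auto simp: lc_supp_def)
  qed
qed

lemma lc_phi_weak:
  "lc_rapid e \<Longrightarrow> lc_disc t \<Longrightarrow> weakly_converges (\<lambda>n. \<Sum>k\<le>n. e k * t ^ k) (lc_phi e t)"
  by (intro weakI lc_phi)

lemma lc_phi_eqI:
  assumes "lc_rapid e" "lc_disc t" "cw_conv (\<lambda>n. \<Sum>k\<le>n. e k * t ^ k) l" shows "lc_phi e t = l"
  using cw_conv_unique lc_phi(3) assms by blast

lemma lc_phi_ge:
  assumes "lc_rapid e" "lc_disc t" "\<And>k. lc_ge m (e k)" shows "lc_ge m (lc_phi e t)"
proof (rule cw_conv_ge[OF lc_phi(3)[OF assms(1,2)]])
  fix n
  show "lc_ge m (\<Sum>k\<le>n. e k * t ^ k)"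
    using lc_ge_mult[OF assms(3) lc_ge_0_power[OF lc_discD(1)[OF assms(2)]]] by (intro lc_ge_sum) simp
qed

lemma lc_rapid_ge: assumes "lc_rapid e" obtains m where "\<And>k. lc_ge m (e k)"
  using lc_regular_ge assms unfolding lc_rapid_def by metis

section \<open>Closure properties\<close>

lemma lc_rapid_add:
  assumes "lc_rapid e" "lc_rapid e'" shows "lc_rapid (\<lambda>k. e k + e' k)"
  unfolding lc_rapid_def
proof (intro conjI allI)
  obtain E E' where E: "left_finite E" "\<And>k. lc_supp (e k) \<subseteq> E" "left_finite E'" "\<And>k. lc_supp (e' k) \<subseteq> E'"
    using assms by (auto simp: lc_rapid_def lc_regular_def)
  have "lc_supp (e k + e' k) \<subseteq> E \<union> E'" for k
  proof
    fix p assume "p \<in> lc_supp (e k + e' k)"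
    then have "p \<in> lc_supp (e k) \<or> p \<in> lc_supp (e' k)" by (auto simp: lc_supp_def lc_coeff_add)
    then show "p \<in> E \<union> E'" using E by blast
  qed
  then show "lc_regular (\<lambda>k. e k + e' k)" unfolding lc_regular_def
    using left_finite_Un[OF E(1,3)] by blast
  fix q j
  obtain C C' where C: "\<And>k. \<bar>lc_coeff (e k) q\<bar> * real (Suc k) ^ j \<le> C"
    "\<And>k. \<bar>lc_coeff (e' k) q\<bar> * real (Suc k) ^ j \<le> C'" using assms unfolding lc_rapid_def by metis
  have "\<bar>lc_coeff (e k + e' k) q\<bar> * real (Suc k) ^ j \<le> C + C'" for k
  proof -
    have "\<bar>lc_coeff (e k + e' k) q\<bar> * real (Suc k) ^ j
        \<le> (\<bar>lc_coeff (e k) q\<bar> + \<bar>lc_coeff (e' k) q\<bar>) * real (Suc k) ^ j"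
      by (intro mult_right_mono) (auto simp: lc_coeff_add)
    then show ?thesis using C[of k] by (simp add: distrib_right)
  qed
  then show "\<exists>C. \<forall>k. \<bar>lc_coeff (e k + e' k) q\<bar> * real (Suc k) ^ j \<le> C" by blast
qed

lemma lc_rapid_cmult:
  assumes "lc_rapid e" shows "lc_rapid (\<lambda>k. c * e k)"
  unfolding lc_rapid_def
proof (intro conjI allI)
  obtain E where E: "left_finite E" "\<And>k. lc_supp (e k) \<subseteq> E"
    using assms by (auto simp: lc_rapid_def lc_regular_def)
  show "lc_regular (\<lambda>k. c * e k)" unfolding lc_regular_def
    using left_finite_conv[OF left_finite_supp E(1)] lc_supp_mult[OF subset_refl E(2)] by blast
  obtain m where "\<And>k. lc_ge m (e k)" using lc_rapid_ge[OF assms] by blast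
  note m = this
  fix q j
  define S where "S = {s \<in> lc_supp c. s \<le> q - m}"
  have "\<exists>C. \<forall>k. \<bar>lc_coeff (e k) (q - s)\<bar> * real (Suc k) ^ j \<le> C" for s
    using assms unfolding lc_rapid_def by blast
  then obtain C where C: "\<And>s k. \<bar>lc_coeff (e k) (q - s)\<bar> * real (Suc k) ^ j \<le> C s" by metis
  have "\<bar>lc_coeff (c * e k) q\<bar> * real (Suc k) ^ j \<le> (\<Sum>s\<in>S. \<bar>lc_coeff c s\<bar> * C s)" for k
  proof -
    have "lc_coeff (c * e k) q = (\<Sum>s\<in>S. lc_coeff c s * lc_coeff (e k) (q - s))"
      by (rule lc_coeff_times_left[OF _ _ m]) (auto simp: S_def finite_lc_supp_le)
    then have "\<bar>lc_coeff (c * e k) q\<bar> * real (Suc k) ^ j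
        \<le> (\<Sum>s\<in>S. \<bar>lc_coeff c s * lc_coeff (e k) (q - s)\<bar>) * real (Suc k) ^ j"
      by (simp add: mult_right_mono sum_abs)
    also have "\<dots> \<le> (\<Sum>s\<in>S. \<bar>lc_coeff c s\<bar> * C s)"
      unfolding sum_distrib_right abs_mult mult.assoc by (intro sum_mono mult_left_mono C) simp
    finally show ?thesis .
  qed
  then show "\<exists>C. \<forall>k. \<bar>lc_coeff (c * e k) q\<bar> * real (Suc k) ^ j \<le> C" by blast
qed

lemma lc_rapid_comp_Suc:
  assumes "lc_rapid e" shows "lc_rapid (\<lambda>k. of_nat (Suc k) * e (Suc k))"
  unfolding lc_rapid_def
proof (intro conjI allI)
  obtain E where E: "left_finite E" "\<And>k. lc_supp (e k) \<subseteq> E"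
    using assms by (auto simp: lc_rapid_def lc_regular_def)
  have "lc_supp (of_nat (Suc k) * e (Suc k)) \<subseteq> E" for k
    using E(2)[of "Suc k"] by (auto simp: lc_supp_def lc_coeff_of_nat_times simp del: of_nat_Suc)
  then show "lc_regular (\<lambda>k. of_nat (Suc k) * e (Suc k))" unfolding lc_regular_def using E(1) by blast
  fix q j
  obtain C where C: "\<And>k. \<bar>lc_coeff (e k) q\<bar> * real (Suc k) ^ Suc j \<le> C"
    using assms unfolding lc_rapid_def by metis
  have "\<bar>lc_coeff (of_nat (Suc k) * e (Suc k)) q\<bar> * real (Suc k) ^ j \<le> C" for k
  proof -
    have "\<bar>lc_coeff (of_nat (Suc k) * e (Suc k)) q\<bar> * real (Suc k) ^ j
       = \<bar>lc_coeff (e (Suc k)) q\<bar> * real (Suc k) ^ Suc j"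
      by (simp add: lc_coeff_of_nat_times abs_mult del: of_nat_Suc)
    also have "\<dots> \<le> \<bar>lc_coeff (e (Suc k)) q\<bar> * real (Suc (Suc k)) ^ Suc j"
      by (intro mult_left_mono power_mono) auto
    also have "\<dots> \<le> C" by (rule C)
    finally show ?thesis .
  qed
  then show "\<exists>C. \<forall>k. \<bar>lc_coeff (of_nat (Suc k) * e (Suc k)) q\<bar> * real (Suc k) ^ j \<le> C" by blast
qed

text \<open>Weights 1 give the coefficients of t times the series, weights 1 / k those of its
  termwise primitive.\<close>

lemma lc_rapid_shift:
  assumes "lc_rapid e" and w: "\<And>k. \<bar>w k\<bar> \<le> 1"
  shows "lc_rapid (\<lambda>k. if k = 0 then 0 else of_real (w k) * e (k - 1))"
  unfolding lc_rapid_def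
proof (intro conjI allI)
  let ?e = "\<lambda>k. if k = 0 then 0 else of_real (w k) * e (k - 1)"
  obtain E where E: "left_finite E" "\<And>k. lc_supp (e k) \<subseteq> E"
    using assms by (auto simp: lc_rapid_def lc_regular_def)
  have "lc_supp (?e k) \<subseteq> E" for k
    using E(2)[of "k - 1"] by (auto simp: lc_supp_def lc_coeff_of_real_times lc_coeff_zero split: if_splits)
  then show "lc_regular ?e" unfolding lc_regular_def using E(1) by blast
  fix q j
  obtain C where C: "\<And>k. \<bar>lc_coeff (e k) q\<bar> * real (Suc k) ^ j \<le> C"
    using assms unfolding lc_rapid_def by metis
  \<comment> \<open>The index moves from i to k = i + 1, and k + 1 \<le> 2 (i + 1) costs the factor
    2^j.\<close>
  have "\<bar>lc_coeff (?e k) q\<bar> * real (Suc k) ^ j \<le> 2 ^ j * C" for k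
  proof (cases k)
    case 0 then show ?thesis using C[of 0] by (auto simp: lc_coeff_zero)
  next
    case (Suc i)
    have "\<bar>lc_coeff (?e k) q\<bar> * real (Suc k) ^ j = \<bar>w k\<bar> * \<bar>lc_coeff (e i) q\<bar> * real (Suc k) ^ j"
      by (simp add: Suc lc_coeff_of_real_times abs_mult)
    also have "\<dots> \<le> 1 * \<bar>lc_coeff (e i) q\<bar> * (2 * real (Suc i)) ^ j"
      by (intro mult_mono power_mono w) (auto simp: Suc)
    also have "\<dots> = 2 ^ j * (\<bar>lc_coeff (e i) q\<bar> * real (Suc i) ^ j)"
      by (simp add: power_mult_distrib del: of_nat_Suc)
    also have "\<dots> \<le> 2 ^ j * C" by (intro mult_left_mono C) auto
    finally show ?thesis .
  qed
  then show "\<exists>C. \<forall>k. \<bar>lc_coeff (?e k) q\<bar> * real (Suc k) ^ j \<le> C" by blast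
qed

lemma lc_phi_add:
  assumes "lc_rapid e" "lc_rapid e'" "lc_disc t"
  shows "lc_phi (\<lambda>k. e k + e' k) t = lc_phi e t + lc_phi e' t"
  using cw_conv_add[OF lc_phi(3)[OF assms(1,3)] lc_phi(3)[OF assms(2,3)]]
  by (intro lc_phi_eqI lc_rapid_add assms) (simp add: distrib_right sum.distrib)

lemma lc_phi_cmult:
  assumes "lc_rapid e" "lc_disc t" shows "lc_phi (\<lambda>k. c * e k) t = c * lc_phi e t"
proof -
  obtain m where m: "\<And>n. lc_ge m (\<Sum>k\<le>n. e k * t ^ k)" using lc_regular_ge[OF lc_phi(2)[OF assms]] by blast
  show ?thesis
    using cw_conv_mult[OF lc_phi(3)[OF assms] m, of c]
    by (intro lc_phi_eqI lc_rapid_cmult assms) (simp add: sum_distrib_left mult.assoc)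
qed

lemma cw_conv_Suc: "cw_conv (\<lambda>n. X (Suc n)) l \<longleftrightarrow> cw_conv X l"
proof -
  have "((\<lambda>n. lc_coeff (X (Suc n)) q) \<longlonglongrightarrow> c) \<longleftrightarrow> ((\<lambda>n. lc_coeff (X n) q) \<longlonglongrightarrow> c)" for q c
    by (rule filterlim_sequentially_Suc)
  then show ?thesis by (simp add: cw_conv_def)
qed

lemma lc_phi_shift:
  assumes "lc_rapid e" "lc_disc t"
  shows "lc_phi (\<lambda>k. if k = 0 then 0 else e (k - 1)) t = t * lc_phi e t"
proof -
  obtain m where m: "\<And>n. lc_ge m (\<Sum>k\<le>n. e k * t ^ k)" using lc_regular_ge[OF lc_phi(2)[OF assms]] by blast
  have eq: "(\<Sum>k\<le>Suc n. (if k = 0 then 0 else e (k - 1)) * t ^ k) = t * (\<Sum>k\<le>n. e k * t ^ k)" for n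
    by (subst sum.atMost_Suc_shift) (simp add: sum_distrib_left ac_simps)
  have "cw_conv (\<lambda>n. \<Sum>k\<le>Suc n. (if k = 0 then 0 else e (k - 1)) * t ^ k) (t * lc_phi e t)"
    unfolding eq by (rule cw_conv_mult[OF lc_phi(3)[OF assms] m])
  then have "cw_conv (\<lambda>n. \<Sum>k\<le>n. (if k = 0 then 0 else e (k - 1)) * t ^ k) (t * lc_phi e t)"
    by (subst (asm) cw_conv_Suc[where X = "\<lambda>n. \<Sum>k\<le>n. (if k = 0 then 0 else e (k - 1)) * t ^ k"])
  then show ?thesis
    using lc_rapid_shift[OF assms(1), of "\<lambda>_. 1"] by (intro lc_phi_eqI assms) (simp_all cong: if_cong)
qed

lemma lc_rapid_const: "lc_rapid (\<lambda>k. if k = 0 then c else 0)"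
  unfolding lc_rapid_def
proof (intro conjI allI)
  show "lc_regular (\<lambda>k. if k = 0 then c else 0)"
    unfolding lc_regular_def by (rule exI[of _ "lc_supp c"]) (use left_finite_supp[of c] in \<open>auto simp: lc_supp_def lc_coeff_zero\<close>)
  show "\<exists>C. \<forall>k. \<bar>lc_coeff (if k = 0 then c else 0) q\<bar> * real (Suc k) ^ j \<le> C" for q j
    by (rule exI[of _ "\<bar>lc_coeff c q\<bar>"]) (auto simp: lc_coeff_zero)
qed

lemma lc_phi_const: "lc_disc t \<Longrightarrow> lc_phi (\<lambda>k. if k = 0 then c else 0) t = c"
  by (rule lc_phi_eqI[OF lc_rapid_const]) (simp_all add: if_distrib[of "\<lambda>x. x * _"] sum.delta cw_conv_def cong: if_cong)

section \<open>Differentiation\<close>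

abbreviation lc_dcoeffs :: "(nat \<Rightarrow> levi_civita) \<Rightarrow> nat \<Rightarrow> levi_civita" where
  "lc_dcoeffs e \<equiv> \<lambda>k. of_nat (Suc k) * e (Suc k)"

text \<open>Sums, products and integer multiples of elements without negative exponents have none
  either. The factor left after h^2 is therefore bounded below in exponent uniformly in
  \<open>k\<close>, however large the binomial coefficients become.\<close>

lemma lc_power_expansion:
  assumes "lc_ge 0 t" "lc_ge 0 h"
  shows "\<exists>r. lc_ge 0 r \<and> (t + h) ^ k - t ^ k - of_nat k * t ^ (k - 1) * h = h ^ 2 * r"
proof (induction k)
  case 0 then show ?case by (intro exI[of _ 0]) simp
next
  case (Suc k)
  then obtain r where r: "lc_ge 0 r" "(t + h) ^ k - t ^ k - of_nat k * t ^ (k - 1) * h = h ^ 2 * r" by blast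
  have p: "(t + h) ^ k = t ^ k + of_nat k * t ^ (k - 1) * h + h ^ 2 * r" using r(2) by (simp add: algebra_simps)
  have tk: "of_nat k * t ^ k = of_nat k * t * t ^ (k - 1)" by (cases k) auto
  have "(t + h) ^ Suc k - t ^ Suc k - of_nat (Suc k) * t ^ (Suc k - 1) * h
      = h ^ 2 * ((t + h) * r + of_nat k * t ^ (k - 1))"
  proof -
    have "(t + h) * (W + K * w * h + h ^ 2 * r) - t * W - (1 + K) * W * h = h ^ 2 * ((t + h) * r + K * w)"
      if "K * W = K * t * w" for W w K using that by algebra
    from this[OF tk] show ?thesis by (simp add: p)
  qed
  moreover have "lc_ge 0 ((t + h) * r + of_nat k * t ^ (k - 1))"
    using lc_ge_mult[OF lc_ge_add[OF assms] r(1)] lc_ge_mult[OF lc_ge_of_nat lc_ge_0_power[OF assms(1)]]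
    by (intro lc_ge_add) simp_all
  ultimately show ?case by blast
qed

text \<open>Each term of the remainder has exponents at least m + 2 \<lambda>(h), a bound that
  survives the limit. The constant K = \<open>lc_d (m - 1)\<close> sits one exponent lower, so that
  K h^2 dominates every element with this bound.\<close>

lemma lc_phi_deriv:
  assumes e: "lc_rapid e"
  obtains K where "0 < K" "\<And>t h. lc_disc t \<Longrightarrow> lc_disc (t + h) \<Longrightarrow>
    \<bar>lc_phi e (t + h) - lc_phi e t - h * lc_phi (lc_dcoeffs e) t\<bar> \<le> K * h ^ 2"
proof -
  obtain m where m: "\<And>k. lc_ge m (e k)" using lc_rapid_ge[OF e] by blast
  have de: "lc_rapid (lc_dcoeffs e)" by (rule lc_rapid_comp_Suc[OF e])
  show ?thesis
  proof (rule that[of "lc_d (m - 1)"])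
    fix t h assume t: "lc_disc t" and th: "lc_disc (t + h)"
    let ?D = "lc_phi e (t + h) - lc_phi e t - h * lc_phi (lc_dcoeffs e) t"
    have h0: "lc_ge 0 h" using lc_ge_diff[OF lc_discD(1)[OF th] lc_discD(1)[OF t]] by simp
    show "\<bar>?D\<bar> \<le> lc_d (m - 1) * h ^ 2"
    proof (cases "h = 0")
      case False
      obtain m' where m': "\<And>n. lc_ge m' (\<Sum>k\<le>n. lc_dcoeffs e k * t ^ k)"
        using lc_regular_ge[OF lc_phi(2)[OF de t]] by blast
      have s: "cw_conv (\<lambda>n. \<Sum>k\<le>Suc n. e k * x ^ k) (lc_phi e x)" if "lc_disc x" for x
        using lc_phi(3)[OF e that] by (subst cw_conv_Suc[where X = "\<lambda>n. \<Sum>k\<le>n. e k * x ^ k"])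
      have c: "cw_conv (\<lambda>n. (\<Sum>k\<le>Suc n. e k * (t + h) ^ k) - (\<Sum>k\<le>Suc n. e k * t ^ k)
          - h * (\<Sum>k\<le>n. lc_dcoeffs e k * t ^ k)) ?D"
        by (intro cw_conv_diff s t th cw_conv_mult[OF lc_phi(3)[OF de t] m'])
      have "lc_ge (m + 2 * lc_lead h) ?D"
      proof (rule cw_conv_ge[OF c])
        fix n
        have eq: "(\<Sum>k\<le>Suc n. e k * (t + h) ^ k) - (\<Sum>k\<le>Suc n. e k * t ^ k)
          - h * (\<Sum>k\<le>n. lc_dcoeffs e k * t ^ k)
          = (\<Sum>k\<le>n. e (Suc k) * ((t + h) ^ Suc k - t ^ Suc k - of_nat (Suc k) * t ^ (Suc k - 1) * h))"
          unfolding sum.atMost_Suc_shift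
          by (simp add: sum_distrib_left sum_subtractf algebra_simps sum.distrib del: of_nat_Suc)
        show "lc_ge (m + 2 * lc_lead h) ((\<Sum>k\<le>Suc n. e k * (t + h) ^ k) - (\<Sum>k\<le>Suc n. e k * t ^ k)
          - h * (\<Sum>k\<le>n. lc_dcoeffs e k * t ^ k))"
          unfolding eq
        proof (rule lc_ge_sum)
          fix k
          obtain r where r: "lc_ge 0 r"
            "(t + h) ^ Suc k - t ^ Suc k - of_nat (Suc k) * t ^ (Suc k - 1) * h = h ^ 2 * r"
            using lc_power_expansion[OF lc_discD(1)[OF t] h0] by blast
          have "lc_ge (m + (of_nat 2 * lc_lead h + 0)) (e (Suc k) * (h ^ 2 * r))"
            by (intro lc_ge_mult m lc_ge_power lc_ge_lead r(1))
          then show "lc_ge (m + 2 * lc_lead h)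
            (e (Suc k) * ((t + h) ^ Suc k - t ^ Suc k - of_nat (Suc k) * t ^ (Suc k - 1) * h))"
            unfolding r(2) by simp
        qed
      qed
      moreover have "0 < lc_d (m - 1) * h ^ 2" using False lc_d_pos by simp
      moreover have "lc_coeff (lc_d (m - 1) * h ^ 2) (m - 1 + 2 * lc_lead h) \<noteq> 0"
      proof -
        have "lc_coeff (h * h) (lc_lead h + lc_lead h) = lc_coeff h (lc_lead h) * lc_coeff h (lc_lead h)"
          by (rule lc_coeff_times_lead(1)) (use lc_ge_lead lc_geD in blast)+
        then show ?thesis using lc_lead(1)[OF False] by (simp add: lc_coeff_monom_times power2_eq_square)
      qed
      ultimately show ?thesis using lc_abs_less less_imp_le by fastforce
    qed simp
  qed (rule lc_d_pos)
qed

text \<open>Every coefficient is differentiated with respect to a real parameter. Along a segment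
  this opens the way to the mean value theorem and termwise differentiation of real
  analysis.\<close>

definition cw_deriv :: "(real \<Rightarrow> levi_civita) \<Rightarrow> levi_civita \<Rightarrow> real \<Rightarrow> real set \<Rightarrow> bool" where
  "cw_deriv g D s S \<longleftrightarrow> (\<forall>q. ((\<lambda>s. lc_coeff (g s) q) has_real_derivative lc_coeff D q) (at s within S))"

lemma cw_deriv_mult:
  assumes "cw_deriv g D s S" "\<And>x. lc_ge m (g x)" "lc_ge m D"
  shows "cw_deriv (\<lambda>x. c * g x) (c * D) s S"
  unfolding cw_deriv_def
proof
  fix q
  let ?S = "{s \<in> lc_supp c. s \<le> q - m}"
  have eq: "lc_coeff (c * y) q = (\<Sum>s\<in>?S. lc_coeff c s * lc_coeff y (q - s))" if "lc_ge m y" for y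
    by (rule lc_coeff_times_left[OF finite_lc_supp_le _ that]) auto
  show "((\<lambda>x. lc_coeff (c * g x) q) has_real_derivative lc_coeff (c * D) q) (at s within S)"
    unfolding eq[OF assms(2)] eq[OF assms(3)]
    using assms(1) by (intro DERIV_sum DERIV_cmult) (auto simp: cw_deriv_def)
qed

lemma cw_deriv_power:
  assumes "lc_ge 0 t" "lc_ge 0 k"
  shows "cw_deriv (\<lambda>x. (t + of_real x * k) ^ n) (of_nat n * k * (t + of_real s * k) ^ (n - 1)) s S"
proof (induction n)
  case 0 then show ?case by (simp add: cw_deriv_def lc_coeff_zero)
next
  case (Suc n)
  let ?p = "\<lambda>x. (t + of_real x * k) ^ n"
  let ?D = "of_nat n * k * (t + of_real s * k) ^ (n - 1)"
  have p: "lc_ge 0 ((t + of_real x * k) ^ i)" for x i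
    using lc_ge_mult[OF lc_ge_of_real assms(2)] by (intro lc_ge_0_power lc_ge_add assms) simp
  have D: "lc_ge 0 ?D"
    using lc_ge_mult[OF lc_ge_mult[OF lc_ge_of_nat assms(2)] p] by simp
  have 1: "cw_deriv (\<lambda>x. t * ?p x) (t * ?D) s S" "cw_deriv (\<lambda>x. k * ?p x) (k * ?D) s S"
    by (rule cw_deriv_mult[OF Suc p D])+
  have "cw_deriv (\<lambda>x. t * ?p x + of_real x * (k * ?p x)) (t * ?D + (of_real s * (k * ?D) + k * ?p s)) s S"
    using 1 unfolding cw_deriv_def lc_coeff_add lc_coeff_of_real_times
    by (auto intro!: derivative_eq_intros)
  moreover have "t * ?D + (of_real s * (k * ?D) + k * ?p s)
      = of_nat (Suc n) * k * (t + of_real s * k) ^ (Suc n - 1)"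
    by (cases n) (auto simp: algebra_simps)
  ultimately show ?case by (simp add: algebra_simps)
qed

lemma lc_line_majorant:
  assumes t: "lc_disc t" "lc_disc (t + k)"
  obtains b where "lc_disc b" "\<And>x p. x \<in> {0..1} \<Longrightarrow> \<bar>lc_coeff (t + of_real x * k) p\<bar> \<le> lc_coeff b p"
    "\<And>x. x \<in> {0..1} \<Longrightarrow> lc_disc (t + of_real x * k)"
proof -
  have t0: "lc_ge 0 t" using t by (simp add: lc_discD)
  have k0: "lc_ge 0 k" using lc_ge_diff[OF lc_discD(1)[OF t(2)] t0] by simp
  \<comment> \<open>The last summand sets the coefficient at exponent 0 to exactly 1. By convexity
    the real parts along the segment stay within modulus 1, whereas the sum of the two majorants
    could exceed 1 and leave the disc.\<close>
  define b where "b = lc_majorant t + lc_majorant k + of_real (1 - \<bar>lc_coeff t 0\<bar> - \<bar>lc_coeff k 0\<bar>)"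
  have b0: "lc_coeff b p = (if p = 0 then 1 else \<bar>lc_coeff t p\<bar> + \<bar>lc_coeff k p\<bar>)" for p
    by (simp add: b_def lc_coeff_add lc_coeff_majorant lc_coeff_of_real lc_coeff_diff lc_coeff_one)
  define L where "L x = t + of_real x * k" for x
  have b: "lc_disc b" using t0 k0 by (auto simp: lc_disc_def b0 lc_ge_def)
  have Lb: "\<bar>lc_coeff (L x) p\<bar> \<le> lc_coeff b p" if "x \<in> {0..1}" for x p
  proof (cases "p = 0")
    case True
    have "\<bar>lc_coeff t 0\<bar> \<le> 1" "\<bar>lc_coeff t 0 + lc_coeff k 0\<bar> \<le> 1"
      using t by (auto simp: lc_disc_def lc_coeff_add)
    moreover have "lc_coeff (L x) 0 = (1 - x) * lc_coeff t 0 + x * (lc_coeff t 0 + lc_coeff k 0)"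
      by (simp only: L_def lc_coeff_add lc_coeff_of_real_times) (simp add: algebra_simps)
    ultimately have "\<bar>lc_coeff (L x) 0\<bar> \<le> 1"
      using that convex_bound_le[of "\<bar>lc_coeff t 0\<bar>" 1 "\<bar>lc_coeff t 0 + lc_coeff k 0\<bar>" "1 - x" x]
      by (auto simp: abs_mult intro!: order.trans[OF abs_triangle_ineq])
    then show ?thesis using True by (simp add: b0)
  next
    case False
    have "\<bar>x * lc_coeff k p\<bar> \<le> \<bar>lc_coeff k p\<bar>" using that by (simp add: abs_mult mult_left_le_one_le)
    then show ?thesis using False by (simp add: b0 L_def lc_coeff_add lc_coeff_of_real_times)
  qed
  have Ld: "lc_disc (L x)" if "x \<in> {0..1}" for x
    using Lb[OF that, of 0] lc_ge_add[OF t0, of "of_real x * k"] lc_ge_mult[OF lc_ge_of_real k0, of x]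
    by (simp add: lc_disc_def L_def b0)
  show ?thesis using that[OF b Lb[unfolded L_def] Ld[unfolded L_def]] by blast
qed

text \<open>Termwise differentiation at a fixed exponent: the terms are polynomials in the real
  parameter, and the derived series has a summable bound that is uniform on [0, 1].\<close>

lemma lc_phi_line:
  assumes e: "lc_rapid e" and t: "lc_disc t" "lc_disc (t + k)" and s: "s \<in> {0..1}"
  shows "cw_deriv (\<lambda>x. lc_phi e (t + of_real x * k)) (k * lc_phi (lc_dcoeffs e) (t + of_real s * k)) s {0..1}"
  unfolding cw_deriv_def
proof
  fix q
  have t0: "lc_ge 0 t" using t by (simp add: lc_discD)
  have k0: "lc_ge 0 k" using lc_ge_diff[OF lc_discD(1)[OF t(2)] t0] by simp
  define L where "L x = t + of_real x * k" for x
  obtain b where b: "lc_disc b" and Lb: "\<And>x p. x \<in> {0..1} \<Longrightarrow> \<bar>lc_coeff (L x) p\<bar> \<le> lc_coeff b p"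
    and Ld: "\<And>x. x \<in> {0..1} \<Longrightarrow> lc_disc (L x)"
    unfolding L_def by (rule lc_line_majorant[OF t]) blast
  define e' where "e' = (\<lambda>i. k * lc_dcoeffs e i)"
  have e': "lc_rapid e'" unfolding e'_def by (intro lc_rapid_cmult lc_rapid_comp_Suc e)
  define f where "f i x = lc_coeff (e i * L x ^ i) q" for i x
  define f' where "f' i x = lc_coeff (e i * (of_nat i * k * L x ^ (i - 1))) q" for i x
  have f'S: "f' (Suc i) x = lc_coeff (e' i * L x ^ i) q" for i x
    by (simp add: f'_def e'_def ac_simps)
  have f'0: "f' 0 x = 0" for x by (simp add: f'_def lc_coeff_zero)
  obtain C where C: "\<And>x i. x \<in> {0..1} \<Longrightarrow> \<bar>lc_coeff (e' i * L x ^ i) q\<bar> \<le> C / real (Suc i) ^ 2"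
    using lc_rapid_bound[OF e' b] Lb by metis
  \<comment> \<open>Index 0 is separate because the derivative of the constant term is 0; the later
    terms are those of the derived series, moved by one.\<close>
  define M where "M i = (case i of 0 \<Rightarrow> 0 | Suc j \<Rightarrow> C / real (Suc j) ^ 2)" for i
  have M: "summable M"
    using summable_inverse_Suc_square[of C] by (subst summable_Suc_iff[symmetric]) (simp add: M_def)
  have fM: "norm (f' i x) \<le> M i" if "x \<in> {0..1}" for i x
    using C[OF that] by (cases i) (auto simp: f'0 f'S M_def)
  have f's: "(\<Sum>i. f' i x) = lc_coeff (k * lc_phi (lc_dcoeffs e) (L x)) q" if "x \<in> {0..1}" for x
  proof -
    have "(\<lambda>i. f' (Suc i) x) sums lc_coeff (lc_phi e' (L x)) q"
      unfolding f'S by (rule lc_phi(1)[OF e' Ld[OF that]])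
    then have "(\<lambda>i. f' i x) sums lc_coeff (lc_phi e' (L x)) q" using f'0 sums_Suc_iff[of "\<lambda>i. f' i x"] by simp
    then have "(\<Sum>i. f' i x) = lc_coeff (lc_phi e' (L x)) q" by (rule sums_unique[symmetric])
    moreover have "lc_phi e' (L x) = k * lc_phi (lc_dcoeffs e) (L x)"
      unfolding e'_def by (intro lc_phi_cmult lc_rapid_comp_Suc e Ld that)
    ultimately show ?thesis by simp
  qed
  have ul: "uniform_limit {0..1} (\<lambda>n x. \<Sum>i<n. f' i x) (\<lambda>x. lc_coeff (k * lc_phi (lc_dcoeffs e) (L x)) q) sequentially"
    using Weierstrass_m_test[of "{0..1}" f' M, OF fM M] f's
    by (auto elim!: uniform_limit_cong'[THEN iffD1, rotated 2])
  have fd: "(f i has_field_derivative f' i x) (at x within {0..1})" for i x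
  proof -
    have pw: "lc_ge 0 (L y ^ j)" for y j
      using lc_ge_mult[OF lc_ge_of_real k0, of y] by (simp add: L_def lc_ge_0_power lc_ge_add t0)
    have "lc_ge 0 (of_nat i * k * L x ^ (i - 1))"
      using lc_ge_mult[OF lc_ge_mult[OF lc_ge_of_nat k0] pw] by simp
    then have "cw_deriv (\<lambda>x. e i * L x ^ i) (e i * (of_nat i * k * L x ^ (i - 1))) x {0..1}"
      using pw unfolding L_def by (intro cw_deriv_mult[OF cw_deriv_power[OF t0 k0], where m = 0])
    then show ?thesis by (simp add: cw_deriv_def f_def[abs_def] f'_def)
  qed
  have sm: "summable (\<lambda>i. f i 0)"
    using lc_phi(1)[OF e Ld[of 0]] by (simp add: f_def sums_iff)
  have "\<exists>g. \<forall>x\<in>{0..1}. (\<lambda>i. f i x) sums g x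
      \<and> (g has_field_derivative lc_coeff (k * lc_phi (lc_dcoeffs e) (L x)) q) (at x within {0..1})"
    by (rule has_field_derivative_series[OF _ fd ul _ sm]) auto
  then obtain g where g: "\<And>x. x \<in> {0..1} \<Longrightarrow> (\<lambda>i. f i x) sums g x"
    "\<And>x. x \<in> {0..1} \<Longrightarrow> (g has_field_derivative lc_coeff (k * lc_phi (lc_dcoeffs e) (L x)) q) (at x within {0..1})"
    by blast
  have "g x = lc_coeff (lc_phi e (L x)) q" if "x \<in> {0..1}" for x
    using g(1)[OF that] lc_phi(1)[OF e Ld[OF that], of q] unfolding f_def by (rule sums_unique2)
  then show "((\<lambda>x. lc_coeff (lc_phi e (t + of_real x * k)) q) has_real_derivative
      lc_coeff (k * lc_phi (lc_dcoeffs e) (t + of_real s * k)) q) (at s within {0..1})"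
    using has_field_derivative_transform_within[OF g(2)[OF s], of 1] s by (simp add: L_def)
qed

text \<open>One support for the whole segment is what allows a least exponent over all its points to
  be chosen in \<open>lc_prim_mono\<close>.\<close>

lemma lc_phi_line_supp:
  assumes e: "lc_rapid e" and t: "lc_disc t" "lc_disc (t + k)"
  shows "\<exists>E. left_finite E \<and> (\<forall>s\<in>{0..1}. lc_supp (lc_phi e (t + of_real s * k)) \<subseteq> E)"
proof -
  obtain b where b: "lc_disc b" and Lb: "\<And>x p. x \<in> {0..1} \<Longrightarrow> \<bar>lc_coeff (t + of_real x * k) p\<bar> \<le> lc_coeff b p"
    and Ld: "\<And>x. x \<in> {0..1} \<Longrightarrow> lc_disc (t + of_real x * k)"
    by (rule lc_line_majorant[OF t]) blast
  obtain E where E: "left_finite E"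
    "\<And>t k. (\<And>p. \<bar>lc_coeff t p\<bar> \<le> lc_coeff b p) \<Longrightarrow> lc_supp (e k * t ^ k) \<subseteq> E"
    using lc_rapid_bound[OF e b] by metis
  have "lc_supp (lc_phi e (t + of_real s * k)) \<subseteq> E" if s: "s \<in> {0..1}" for s
  proof (rule cw_conv_supp[OF lc_phi(3)[OF e Ld[OF s]]], rule subsetI)
    fix n q assume "q \<in> lc_supp (\<Sum>i\<le>n. e i * (t + of_real s * k) ^ i)"
    then have "(\<Sum>i\<le>n. lc_coeff (e i * (t + of_real s * k) ^ i) q) \<noteq> 0" by (simp add: lc_supp_def lc_coeff_sum)
    then obtain i where "lc_coeff (e i * (t + of_real s * k) ^ i) q \<noteq> 0" by (meson sum.neutral)
    then show "q \<in> E" using E(2)[OF Lb[OF s], of i] by (auto simp: lc_supp_def)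
  qed
  then show ?thesis using E(1) by blast
qed

section \<open>Normal form of weakly convergent power series\<close>

section \<open>Real power series and polynomials\<close>

text \<open>As a complex power series on the unit disc, the sum is holomorphic and not identically
  0, so its zeros are countable. There are only countably many exponents, hence one real number can
  avoid the zeros belonging to all of them.\<close>

lemma powser_countable_zeros:
  fixes c :: "nat \<Rightarrow> real"
  assumes sm: "\<And>r. \<bar>r\<bar> < 1 \<Longrightarrow> summable (\<lambda>k. c k * r ^ k)" and nz: "c k \<noteq> 0"
  shows "countable {r. \<bar>r\<bar> < 1 \<and> (\<Sum>k. c k * r ^ k) = 0}"
proof -
  let ?a = "\<lambda>k. complex_of_real (c k)"
  define g where "g z = (\<Sum>k. ?a k * z ^ k)" for z
  have s: "(\<lambda>k. ?a k * z ^ k) sums g z" if z: "norm z < 1" for z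
  proof -
    obtain r where r: "norm z < r" "r < 1" using dense[OF z] by blast
    have "0 < r" using r(1) norm_ge_zero[of z] by linarith
    have "summable (\<lambda>k. complex_of_real (c k * r ^ k))"
      unfolding summable_complex_of_real using sm[of r] r \<open>0 < r\<close> by simp
    then have "summable (\<lambda>k. ?a k * complex_of_real r ^ k)" by simp
    then have "summable (\<lambda>k. ?a k * z ^ k)"
      by (rule powser_inside) (use r \<open>0 < r\<close> in auto)
    then show ?thesis unfolding g_def by (rule summable_sums)
  qed
  have hol: "g holomorphic_on ball 0 1"
    using power_series_holomorphic[of 0 1 ?a g] s by simp
  have gr: "g (of_real r) = of_real (\<Sum>k. c k * r ^ k)" if "\<bar>r\<bar> < 1" for r
  proof -
    have "(\<lambda>k. complex_of_real (c k * r ^ k)) sums of_real (\<Sum>k. c k * r ^ k)"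
      using summable_sums[OF sm[OF that]] by (simp only: sums_of_real_iff)
    moreover have "(\<lambda>k. ?a k * of_real r ^ k) sums g (of_real r)" using s that by simp
    ultimately show ?thesis using sums_unique2 by fastforce
  qed
  have g0: "g 0 = ?a 0" unfolding g_def by (rule powser_zero)
  have "countable {z \<in> ball 0 1. g z = 0}"
  proof (cases "g constant_on ball 0 1")
    case False
    \<comment> \<open>The exhaustion by closed discs shows that the open disc is an F-sigma set,
      which the theorem on countable zeros asks for.\<close>
    have "ball (0::complex) 1 = (\<Union>n. cball 0 (1 - inverse (real (Suc n))))"
    proof safe
      fix z :: complex assume "z \<in> ball 0 1"
      then obtain n where "inverse (real (Suc n)) < 1 - norm z" using reals_Archimedean[of "1 - norm z"] by auto
      then have "norm z \<le> 1 - inverse (real (Suc n))" by linarith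
      then show "z \<in> (\<Union>n. cball 0 (1 - inverse (real (Suc n))))" by auto
    next
      fix z :: complex and n assume "z \<in> cball 0 (1 - inverse (real (Suc n)))"
      then have "norm z \<le> 1 - inverse (real (Suc n))" by simp
      moreover have "0 < inverse (real (Suc n))" by simp
      ultimately have "norm z < 1" by linarith
      then show "z \<in> ball 0 1" by simp
    qed
    then have "fsigma (ball (0::complex) 1)" by (simp only: fsigma.intros closed_cball)
    then show ?thesis using holomorphic_countable_zeros[OF hol _ _ _ False] by simp
  next
    case True
    \<comment> \<open>If the constant were 0, the nonzero coefficient would make 0 an isolated
      zero.\<close>
    have "g 0 \<noteq> 0"
    proof
      assume z: "g 0 = 0"
      then have "c 0 = 0" using g0 by simp
      then have "k > 0" using nz by (cases k) auto
      have sm': "\<And>x. norm (x - 0) < 1 \<Longrightarrow> (\<lambda>n. ?a n * (x - 0) ^ n) sums g x" using s by simp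
      obtain e where e: "0 < e" "\<And>z. z \<in> cball 0 e - {0} \<Longrightarrow> g z \<noteq> 0"
        by (rule powser_0_nonzero[OF zero_less_one sm' z, of k]) (use nz \<open>k > 0\<close> in auto)
      define z where "z = complex_of_real (min e (1/2))"
      have "g z \<noteq> 0" using e by (intro e(2)) (auto simp: z_def)
      moreover have "z \<in> ball 0 1" using e(1) by (auto simp: z_def)
      ultimately show False using True z by (auto simp: constant_on_def)
    qed
    then have "{z \<in> ball 0 1. g z = 0} = {}" using True by (auto simp: constant_on_def)
    then show ?thesis by (simp only: countable_empty)
  qed
  then have "countable (Re ` {z \<in> ball 0 1. g z = 0})" by (rule countable_image)
  moreover have "{r. \<bar>r\<bar> < 1 \<and> (\<Sum>k. c k * r ^ k) = 0} \<subseteq> Re ` {z \<in> ball 0 1. g z = 0}"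
  proof safe
    fix r :: real assume r: "\<bar>r\<bar> < 1" "(\<Sum>k. c k * r ^ k) = 0"
    then have "complex_of_real r \<in> {z \<in> ball 0 1. g z = 0}" using gr[OF r(1)] by simp
    then show "r \<in> Re ` {z \<in> ball 0 1. g z = 0}" by (metis Re_complex_of_real image_eqI)
  qed
  ultimately show ?thesis by (rule countable_subset[rotated])
qed

text \<open>Lagrange interpolation: the coefficients of a polynomial of degree at most n are fixed
  linear combinations of its values at n + 1 points. Convergence of the values thus passes to the
  coefficients.\<close>

lemma lagrange_weights:
  fixes x :: "nat \<Rightarrow> real"
  assumes "inj_on x {..n}"
  obtains w where "\<And>p i. degree p \<le> n \<Longrightarrow> coeff p i = (\<Sum>j\<le>n. w i j * poly p (x j))"
proof -
  define L where "L j = (\<Prod>l\<in>{..n} - {j}. smult (1 / (x j - x l)) [:- x l, 1:])" for j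
  have L: "poly (L j) (x i) = (if i = j then 1 else 0)" if "i \<le> n" "j \<le> n" for i j
  proof (cases "i = j")
    case True
    have "poly (L j) (x j) = (\<Prod>l\<in>{..n} - {j}. 1)" unfolding L_def poly_prod
    proof (rule prod.cong[OF refl])
      fix l assume "l \<in> {..n} - {j}"
      then have "x j \<noteq> x l" using inj_onD[OF assms, of j l] that by auto
      then show "poly (smult (1 / (x j - x l)) [:- x l, 1:]) (x j) = 1" by (simp add: divide_simps)
    qed
    then show ?thesis using True by simp
  next
    case False then show ?thesis using that by (auto simp: L_def poly_prod intro!: prod_zero bexI[of _ i])
  qed
  have dL: "degree (L j) \<le> n" if "j \<le> n" for j
  proof -
    have "degree (L j) \<le> (\<Sum>l\<in>{..n} - {j}. degree (smult (1 / (x j - x l)) [:- x l, 1:]))"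
      unfolding L_def by (rule order.trans[OF degree_prod_sum_le]) (simp_all only: o_def finite_Diff finite_atMost order.refl)
    also have "\<dots> \<le> (\<Sum>l\<in>{..n} - {j}. 1)" by (rule sum_mono) simp
    finally show ?thesis using that by simp
  qed
  have "coeff p i = (\<Sum>j\<le>n. coeff (L j) i * poly p (x j))" if "degree p \<le> n" for p i
  proof -
    have "p = (\<Sum>j\<le>n. smult (poly p (x j)) (L j))"
    proof (rule poly_eqI_degree[where A = "x ` {..n}"])
      show "poly p y = poly (\<Sum>j\<le>n. smult (poly p (x j)) (L j)) y" if "y \<in> x ` {..n}" for y
      proof -
        from that obtain i where i: "i \<le> n" "y = x i" by auto
        have "poly (\<Sum>j\<le>n. smult (poly p (x j)) (L j)) y = (\<Sum>j\<le>n. if i = j then poly p (x j) else 0)"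
          unfolding poly_sum by (rule sum.cong) (use i L in auto)
        then show ?thesis using i by simp
      qed
      have "card (x ` {..n}) = Suc n" using card_image[OF assms] by simp
      moreover have "degree (\<Sum>j\<le>n. smult (poly p (x j)) (L j)) \<le> n"
        by (rule degree_sum_le) (use dL in \<open>auto intro: order.trans[OF degree_smult_le]\<close>)
      ultimately show "card (x ` {..n}) > degree p"
        "card (x ` {..n}) > degree (\<Sum>j\<le>n. smult (poly p (x j)) (L j))" using that by auto
    qed
    then have "coeff p i = coeff (\<Sum>j\<le>n. smult (poly p (x j)) (L j)) i" by simp
    then show ?thesis by (simp add: coeff_sum mult.commute)
  qed
  then show ?thesis by (rule that)
qed

lemma convergent_poly_coeffs:
  fixes c :: "nat \<Rightarrow> nat \<Rightarrow> real"
  assumes "\<And>r. 0 < r \<Longrightarrow> r < 1 \<Longrightarrow> convergent (\<lambda>K. \<Sum>i\<le>n. c K i * r ^ i)" and "i \<le> n"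
  shows "convergent (\<lambda>K. c K i)"
proof -
  \<comment> \<open>The nodes are distinct and lie in (0, 1), where convergence is assumed.\<close>
  define x where "x j = 1 / real (j + 2)" for j :: nat
  have "inj_on x {..n}" by (auto simp: inj_on_def x_def)
  then obtain w where w: "\<And>p i. degree p \<le> n \<Longrightarrow> coeff p i = (\<Sum>j\<le>n. w i j * poly p (x j))"
    using lagrange_weights by blast
  have "c K i = (\<Sum>j\<le>n. w i j * (\<Sum>l\<le>n. c K l * x j ^ l))" for K
  proof -
    let ?p = "\<Sum>l\<le>n. monom (c K l) l"
    have "degree ?p \<le> n" by (rule degree_sum_le) (auto intro: order.trans[OF degree_monom_le])
    from w[OF this, of i] show ?thesis
      using assms(2) by (simp add: coeff_sum poly_sum poly_monom sum.delta)
  qed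
  moreover have "convergent (\<lambda>K. \<Sum>j\<le>n. w i j * (\<Sum>l\<le>n. c K l * x j ^ l))"
    by (intro convergent_sum convergent_mult convergent_const assms(1)) (auto simp: x_def)
  ultimately show ?thesis by simp
qed

lemma countable_poly_zeros:
  fixes c :: "nat \<Rightarrow> real"
  assumes "i \<le> n" "c i \<noteq> 0" shows "countable {r. (\<Sum>i\<le>n. c i * r ^ i) = 0}"
proof -
  let ?p = "\<Sum>l\<le>n. monom (c l) l"
  have "coeff ?p i = c i" using assms(1) by (simp add: coeff_sum sum.delta)
  then have "?p \<noteq> 0" using assms(2) by (metis coeff_0)
  then have "finite {r. poly ?p r = 0}" by (rule poly_roots_finite)
  then show ?thesis by (simp add: poly_sum poly_monom countable_finite)
qed

text \<open>The bound \<open>(k / j) ^ j \<le> k choose j\<close> turns binomial growth into powers: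
  for large k the binomial coefficient dominates (k + 1)^j up to a constant.\<close>

lemma binomial_decay_imp_rapid:
  fixes c :: "nat \<Rightarrow> real"
  assumes "(\<lambda>k. real (k choose j) * c k) \<longlonglongrightarrow> 0"
  shows "\<exists>C. \<forall>k. \<bar>c k\<bar> * real (Suc k) ^ j \<le> C"
proof -
  have "Bseq (\<lambda>k. real (k choose j) * c k)" using assms convergentI convergent_imp_Bseq by blast
  then have B: "Bseq (\<lambda>k. (2 * real j) ^ j * (real (k choose j) * c k))"
    by (rule Bseq_mult[OF Bfun_const])
  have "\<forall>\<^sub>F k in sequentially. norm (\<bar>c k\<bar> * real (Suc k) ^ j)
      \<le> norm ((2 * real j) ^ j * (real (k choose j) * c k))"
    \<comment> \<open>\<open>j \<le> k\<close> is needed for the binomial bound and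
      \<open>1 \<le> k\<close> for k + 1 \<le> 2 k.\<close>
    using eventually_ge_at_top[of "max 1 j"]
  proof eventually_elim
    case (elim k)
    have "real (Suc k) ^ j \<le> (2 * real k) ^ j" using elim by (intro power_mono) auto
    also have "\<dots> = (2 * real j) ^ j * (real k / real j) ^ j"
      by (cases "j = 0") (auto simp: power_mult_distrib power_divide)
    also have "\<dots> \<le> (2 * real j) ^ j * real (k choose j)"
      using elim binomial_ge_n_over_k_pow_k[of j k, where ?'a = real] by (intro mult_left_mono) auto
    finally have "\<bar>c k\<bar> * real (Suc k) ^ j \<le> \<bar>c k\<bar> * ((2 * real j) ^ j * real (k choose j))"
      by (rule mult_left_mono) simp
    then show ?case by (simp add: abs_mult mult.commute mult.left_commute power_abs)
  qed
  then have "Bseq (\<lambda>k. \<bar>c k\<bar> * real (Suc k) ^ j)" using B by (rule Bseq_eventually_mono)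
  then obtain C where "\<And>k. norm (\<bar>c k\<bar> * real (Suc k) ^ j) \<le> C" by (auto simp: Bseq_def)
  then show ?thesis by (metis abs_le_D1 real_norm_def)
qed

lemma ex_avoid_countable:
  fixes a b :: real
  assumes "a < b" "countable N" obtains x where "a < x" "x < b" "x \<notin> N"
proof -
  have "\<not> {a<..<b} \<subseteq> N"
    using assms uncountable_open_interval[of a b] countable_subset by blast
  then obtain x where "x \<in> {a<..<b}" "x \<notin> N" by blast
  then show ?thesis using that[of x] by auto
qed

section \<open>Centers close to the interval\<close>

lemma lc_less_coeff0:
  assumes "lc_ge 0 x" "lc_ge 0 y" "lc_coeff x 0 < lc_coeff y 0" shows "x < y"
  using lc_gt_0_iff[of "y - x"] lc_ge_diff[OF assms(2,1)] assms(3)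
  by (auto simp: lc_coeff_diff)

lemma cw_conv_terms:
  assumes "cw_conv (\<lambda>n. \<Sum>k\<le>n. X k) l"
  shows "(\<lambda>k. lc_coeff (X k) q) \<longlonglongrightarrow> 0" "(\<lambda>k. lc_coeff (X k) q) sums lc_coeff l q"
proof -
  show s: "(\<lambda>k. lc_coeff (X k) q) sums lc_coeff l q"
    using assms by (simp add: cw_conv_def sums_def_le lc_coeff_sum)
  then show "(\<lambda>k. lc_coeff (X k) q) \<longlonglongrightarrow> 0" by (intro summable_LIMSEQ_zero sums_summable)
qed

lemma lc_coeff_power_lead:
  assumes "lc_ge m h" shows "lc_coeff (h ^ j) (of_nat j * m) = lc_coeff h m ^ j"
proof (induction j)
  case 0 then show ?case by (simp add: lc_coeff_one)
next
  case (Suc j)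
  have "lc_coeff (h * h ^ j) (m + of_nat j * m) = lc_coeff h m * lc_coeff (h ^ j) (of_nat j * m)"
    by (rule lc_coeff_times_lead(1)) (use lc_geD[OF assms] lc_geD[OF lc_ge_power[OF assms]] in blast)+
  then show ?case using Suc by (simp add: algebra_simps)
qed

lemma lc_binomial_1:
  assumes N: "\<And>i. N < i \<Longrightarrow> lc_coeff (h ^ i) s = 0"
  shows "lc_coeff ((1 + h) ^ k) s = (\<Sum>i\<le>N. real (k choose i) * lc_coeff (h ^ i) s)"
proof -
  have "lc_coeff ((1 + h) ^ k) s = (\<Sum>i\<le>k. real (k choose i) * lc_coeff (h ^ i) s)"
    using lc_binomial[of 1 h k s] by simp
  also have "\<dots> = (\<Sum>i\<le>max k N. real (k choose i) * lc_coeff (h ^ i) s)"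
    by (rule sum.mono_neutral_left) (auto simp: binomial_eq_0)
  also have "\<dots> = (\<Sum>i\<le>N. real (k choose i) * lc_coeff (h ^ i) s)"
    by (rule sum.mono_neutral_right) (auto simp: N)
  finally show ?thesis .
qed

text \<open>Consider the coefficient of \<open>e k * (1 + h) ^ k\<close> at exponent
  \<open>q + of_nat j * m\<close>, with \<open>m\<close> so small that \<open>E\<close> has no
  exponent above \<open>q\<close> up to that point. The exponents of \<open>e k\<close> below
  \<open>q\<close> contribute terms that vanish in the limit by \<open>IH\<close>. The exponent
  \<open>q\<close> contributes multiples of (k choose i) times the coefficient of \<open>e k\<close>
  for i \<le> j. Those with i < j vanish by induction on j, so the last one does too, and its factor
  is the nonzero \<open>lc_coeff h m ^ j\<close>.\<close>

lemma lc_binomial_decay_step: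
  assumes E: "left_finite E" "\<And>k. lc_supp (e k) \<subseteq> E"
    and h: "\<And>\<mu>. 0 < \<mu> \<Longrightarrow> \<exists>m h. 0 < m \<and> m < \<mu> \<and> lc_ge m h \<and> lc_coeff h m \<noteq> 0
      \<and> (\<forall>q. (\<lambda>k. lc_coeff (e k * (1 + h) ^ k) q) \<longlonglongrightarrow> 0)"
    and IH: "\<And>p j. p < q \<Longrightarrow> (\<lambda>k. real (k choose j) * lc_coeff (e k) p) \<longlonglongrightarrow> 0"
  shows "(\<lambda>k. real (k choose j) * lc_coeff (e k) q) \<longlonglongrightarrow> 0"
proof (induction j rule: less_induct)
  case (less j)
  \<comment> \<open>\<open>Min G\<close> is the next exponent of \<open>E\<close> after
    \<open>q\<close>, or \<open>q + 1\<close> if that is closer; adding \<open>q + 1\<close> keeps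
    \<open>G\<close> nonempty.\<close>
  define G where "G = insert (q + 1) {x \<in> E. q < x \<and> x \<le> q + 1}"
  have G: "finite G" "G \<noteq> {}"
    using E(1) by (auto simp: G_def left_finite_def intro: rev_finite_subset[where B = "{x \<in> E. x \<le> q + 1}"])
  have gq: "q < Min G" using G by (subst Min_gr_iff) (auto simp: G_def)
  have gap: "x \<le> q \<or> Min G \<le> x" if "x \<in> E" for x
  proof (rule disjCI)
    assume "\<not> Min G \<le> x"
    moreover have "Min G \<le> q + 1" using G by (intro Min_le) (auto simp: G_def)
    ultimately have "x \<notin> G" "x \<le> q + 1" using G by (auto intro: Min_le)
    then show "x \<le> q" using that by (auto simp: G_def)
  qed
  \<comment> \<open>Dividing by \<open>Suc j\<close> instead of \<open>j\<close> also covers j = 0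
    and leaves room for the strict inequality \<open>Q < Min G\<close>.\<close>
  define \<mu> where "\<mu> = (Min G - q) / of_nat (Suc j)"
  have "0 < \<mu>" using gq by (simp add: \<mu>_def)
  from h[OF this] obtain m h where m: "0 < m" "m < \<mu>" "lc_ge m h" "lc_coeff h m \<noteq> 0"
    and lim: "\<And>q. (\<lambda>k. lc_coeff (e k * (1 + h) ^ k) q) \<longlonglongrightarrow> 0" by blast
  define Q where "Q = q + of_nat j * m"
  have "of_nat j * m < of_nat (Suc j) * \<mu>"
    using m(1,2) by (intro mult_le_less_imp_less[THEN order.strict_trans2] order.refl mult_strict_mono) (auto)
  then have QG: "Q < Min G" by (simp add: Q_def \<mu>_def)
  define S where "S = {s \<in> E. s \<le> q}"
  have S: "finite S" using E(1) by (simp add: S_def left_finite_def)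
  have h0: "lc_ge 0 (1 + h)" using m by (intro lc_ge_add lc_ge_1) (auto intro: lc_ge_mono)
  have exp: "lc_coeff (e k * (1 + h) ^ k) Q
      = (\<Sum>s\<in>S - {q}. lc_coeff (e k) s * lc_coeff ((1 + h) ^ k) (Q - s))
        + lc_coeff (e k) q * lc_coeff ((1 + h) ^ k) (Q - q)" for k
  proof -
    have "lc_coeff (e k * (1 + h) ^ k) Q
      = (\<Sum>s\<in>insert q S. lc_coeff (e k) s * lc_coeff ((1 + h) ^ k) (Q - s))"
    proof (rule lc_coeff_times_left[where m = 0])
      show "finite (insert q S)" using S by simp
      show "s \<in> insert q S" if "s \<in> lc_supp (e k)" "s \<le> Q - 0" for s
        using gap[of s] that QG E(2) by (auto simp: S_def)
    qed (rule lc_ge_0_power[OF h0])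
    then show ?thesis using S by (simp add: sum.insert_remove add.commute)
  qed
  have 1: "(\<lambda>k. lc_coeff (e k) s * lc_coeff ((1 + h) ^ k) \<sigma>) \<longlonglongrightarrow> 0" if "s < q" for s \<sigma>
  proof -
    obtain N :: nat where N: "\<And>i. N < i \<Longrightarrow> lc_coeff (h ^ i) \<sigma> = 0"
      using lc_power_vanish[OF m(1)] m(3) by metis
    have "(\<lambda>k. \<Sum>i\<le>N. lc_coeff (h ^ i) \<sigma> * (real (k choose i) * lc_coeff (e k) s)) \<longlonglongrightarrow> (\<Sum>i\<le>N. lc_coeff (h ^ i) \<sigma> * 0)"
      by (intro tendsto_intros IH that)
    then show ?thesis by (simp add: lc_binomial_1[OF N] sum_distrib_left ac_simps)
  qed
  have 2: "(\<lambda>k. \<Sum>s\<in>S - {q}. lc_coeff (e k) s * lc_coeff ((1 + h) ^ k) (Q - s)) \<longlonglongrightarrow> 0"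
    by (rule tendsto_null_sum) (auto simp: S_def intro!: 1)
  have 3: "(\<lambda>k. lc_coeff (e k) q * lc_coeff ((1 + h) ^ k) (Q - q)) \<longlonglongrightarrow> 0"
    using tendsto_diff[OF lim[of Q] 2] by (simp add: exp)
  have van: "lc_coeff (h ^ i) (Q - q) = 0" if "j < i" for i
    by (rule lc_geD[OF lc_ge_power[OF m(3)]]) (use that m(1) in \<open>simp add: Q_def\<close>)
  have "lc_coeff (e k) q * lc_coeff ((1 + h) ^ k) (Q - q)
      = (\<Sum>i<j. lc_coeff (h ^ i) (Q - q) * (real (k choose i) * lc_coeff (e k) q))
        + lc_coeff h m ^ j * (real (k choose j) * lc_coeff (e k) q)" for k
  proof -
    have "lc_coeff (h ^ j) (Q - q) = lc_coeff h m ^ j"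
      using lc_coeff_power_lead[OF m(3), of j] by (simp add: Q_def)
    moreover have "lc_coeff ((1 + h) ^ k) (Q - q) = (\<Sum>i\<le>j. real (k choose i) * lc_coeff (h ^ i) (Q - q))"
      by (rule lc_binomial_1[OF van])
    ultimately show ?thesis unfolding lessThan_Suc_atMost[symmetric]
      by (simp add: sum_distrib_left distrib_left ac_simps)
  qed
  moreover have "(\<lambda>k. \<Sum>i<j. lc_coeff (h ^ i) (Q - q) * (real (k choose i) * lc_coeff (e k) q)) \<longlonglongrightarrow> 0"
    by (rule tendsto_null_sum) (use less in \<open>auto intro: tendsto_mult_right_zero\<close>)
  ultimately have "(\<lambda>k. lc_coeff h m ^ j * (real (k choose j) * lc_coeff (e k) q)) \<longlonglongrightarrow> 0"
    using tendsto_diff[OF 3] by fastforce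
  then have "(\<lambda>k. (1 / lc_coeff h m ^ j) * (lc_coeff h m ^ j * (real (k choose j) * lc_coeff (e k) q))) \<longlonglongrightarrow> 0"
    by (rule tendsto_mult_right_zero)
  then show ?case using m(4) by simp
qed

text \<open>The outer induction runs over exponents: those without decay lie in a left-finite set,
  so there would be a least one, which \<open>lc_binomial_decay_step\<close> rules out.\<close>

lemma lc_rapidI:
  assumes reg: "lc_regular e"
    and h: "\<And>\<mu>. 0 < \<mu> \<Longrightarrow> \<exists>m h. 0 < m \<and> m < \<mu> \<and> lc_ge m h \<and> lc_coeff h m \<noteq> 0
      \<and> (\<forall>q. (\<lambda>k. lc_coeff (e k * (1 + h) ^ k) q) \<longlonglongrightarrow> 0)"
  shows "lc_rapid e"
proof -
  obtain E where E: "left_finite E" "\<And>k. lc_supp (e k) \<subseteq> E" using reg by (auto simp: lc_regular_def)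
  have conv: "(\<lambda>k. real (k choose j) * lc_coeff (e k) q) \<longlonglongrightarrow> 0" for q j
  proof (rule ccontr)
    define bad where "bad q \<longleftrightarrow> (\<exists>j. \<not> (\<lambda>k. real (k choose j) * lc_coeff (e k) q) \<longlonglongrightarrow> 0)" for q
    assume "\<not> (\<lambda>k. real (k choose j) * lc_coeff (e k) q) \<longlonglongrightarrow> 0"
    then have bq: "bad q" by (auto simp: bad_def)
    have badE: "p \<in> E" if "bad p" for p
    proof (rule ccontr)
      assume "p \<notin> E"
      then have "lc_coeff (e k) p = 0" for k using E(2) by (auto simp: lc_supp_def)
      then show False using that by (simp add: bad_def)
    qed
    define F where "F = {p. bad p \<and> p \<le> q}"
    have F: "finite F" using E(1) badE unfolding F_def left_finite_def
      by (auto intro: rev_finite_subset[where B = "{x \<in> E. x \<le> q}"])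
    have "q \<in> F" using bq by (simp add: F_def)
    then have M: "Min F \<in> F" using F by (intro Min_in) auto
    have "\<not> bad p" if "p < Min F" for p
      using that Min_le[OF F, of p] M by (auto simp: F_def)
    then have "\<not> bad (Min F)"
      using lc_binomial_decay_step[OF E h, of "Min F"] unfolding bad_def by blast
    then show False using M by (simp add: F_def)
  qed
  show ?thesis unfolding lc_rapid_def using reg binomial_decay_imp_rapid[OF conv] by blast
qed

text \<open>Convergence is exploited at two kinds of points. At a real argument avoiding countably
  many zeros, every exponent of the coefficients occurs in the sum, which gives the common support.
  At points infinitely close to an end with real part 1 or -1, the terms still tend to 0
  coefficientwise, and \<open>lc_rapidI\<close> turns this into rapid decay.\<close>

lemma lc_rapid_near:
  assumes t: "lc_disc t1" "lc_disc t2" "lc_coeff t1 0 < lc_coeff t2 0"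
    and edge: "\<bar>lc_coeff t1 0\<bar> = 1 \<or> \<bar>lc_coeff t2 0\<bar> = 1"
    and conv: "\<And>t. t1 < t \<Longrightarrow> t < t2 \<Longrightarrow> \<exists>l. cw_conv (\<lambda>n. \<Sum>k\<le>n. e k * t ^ k) l"
  shows "lc_rapid e"
proof -
  define \<alpha> \<beta> where "\<alpha> = lc_coeff t1 0" and "\<beta> = lc_coeff t2 0"
  have ab: "\<alpha> < \<beta>" "\<bar>\<alpha>\<bar> \<le> 1" "\<bar>\<beta>\<bar> \<le> 1" "\<alpha> = -1 \<or> \<beta> = 1"
    using t edge by (auto simp: \<alpha>_def \<beta>_def lc_disc_def abs_if split: if_splits)
  have "\<exists>l. cw_conv (\<lambda>n. \<Sum>k\<le>n. e k * of_real r ^ k) l" if "\<alpha> < r" "r < \<beta>" for r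
    using that t by (intro conv lc_less_coeff0) (auto simp: lc_coeff_of_real lc_ge_of_real \<alpha>_def \<beta>_def dest: lc_discD)
  then obtain l where l: "\<And>r. \<alpha> < r \<Longrightarrow> r < \<beta> \<Longrightarrow> cw_conv (\<lambda>n. \<Sum>k\<le>n. e k * of_real r ^ k) (l r)" by metis
  have lr: "(\<lambda>k. lc_coeff (e k) q * r ^ k) sums lc_coeff (l r) q" if "\<alpha> < r" "r < \<beta>" for r q
  proof -
    have "lc_coeff (e k * of_real r ^ k) q = lc_coeff (e k) q * r ^ k" for k
      by (metis lc_coeff_of_real_times mult.commute of_real_power)
    then show ?thesis using cw_conv_terms(2)[OF l[OF that], of q] by simp
  qed
  have sm: "summable (\<lambda>k. lc_coeff (e k) q * r ^ k)" if r: "\<bar>r\<bar> < 1" for r q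
  proof -
    \<comment> \<open>The interval from \<alpha> to \<beta> reaches modulus 1 at one end, so it
      contains points of modulus above |r|; convergence there gives convergence at r.\<close>
    obtain r' where r': "\<alpha> < r'" "r' < \<beta>" "\<bar>r\<bar> < \<bar>r'\<bar>"
    proof (cases "\<beta> = 1")
      case True
      obtain x where "max \<alpha> \<bar>r\<bar> < x" "x < 1" using dense[of "max \<alpha> \<bar>r\<bar>" 1] ab r True by auto
      then show ?thesis using that[of x] True by auto
    next
      case False
      obtain x where "max (-\<beta>) \<bar>r\<bar> < x" "x < 1" using dense[of "max (-\<beta>) \<bar>r\<bar>" 1] ab r False by auto
      then show ?thesis using that[of "-x"] False ab(4) by auto
    qed
    show ?thesis using powser_inside[OF sums_summable[OF lr[OF r'(1,2), of q]], of r] r'(3) by simp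
  qed
  define E where "E = {q. \<exists>k. lc_coeff (e k) q \<noteq> 0}"
  have "left_finite E" unfolding left_finite_def
  proof
    fix B
    define Z where "Z q = {r. \<bar>r\<bar> < 1 \<and> (\<Sum>k. lc_coeff (e k) q * r ^ k) = 0}" for q
    have "countable (Z q)" if "q \<in> E" for q
      using that powser_countable_zeros[OF sm] by (auto simp: E_def Z_def)
    then have "countable (\<Union>q\<in>E. Z q)" by (intro countable_UN) auto
    then obtain r where r: "\<alpha> < r" "r < \<beta>" "r \<notin> (\<Union>q\<in>E. Z q)" using ex_avoid_countable[OF ab(1)] by metis
    have "\<bar>r\<bar> < 1" using r ab by linarith
    have "{x \<in> E. x \<le> B} \<subseteq> {q \<in> lc_supp (l r). q \<le> B}"
      using r(3) \<open>\<bar>r\<bar> < 1\<close> sums_unique[OF lr[OF r(1,2)]] by (auto simp: Z_def lc_supp_def)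
    then show "finite {x \<in> E. x \<le> B}" using finite_lc_supp_le finite_subset by blast
  qed
  then have reg: "lc_regular e" unfolding lc_regular_def by (intro exI[of _ E]) (auto simp: E_def lc_supp_def)
  \<comment> \<open>If the edge is at -1, the factors (-1)^k move it to 1.\<close>
  define c where "c = (if \<beta> = 1 then 1 else - 1 :: real)"
  define e' where "e' k = of_real (c ^ k) * e k" for k
  have coe: "\<bar>lc_coeff (e' k) q\<bar> = \<bar>lc_coeff (e k) q\<bar>" for k q
    by (simp only: e'_def lc_coeff_of_real_times) (simp add: c_def abs_mult power_abs)
  have "lc_supp (e' k) = lc_supp (e k)" for k
    using coe by (auto simp: lc_supp_def) (metis abs_zero abs_eq_0)+
  then have reg': "lc_regular e'" using reg by (simp add: lc_regular_def)
  have "lc_rapid e'"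
  proof (rule lc_rapidI[OF reg'])
    fix \<mu> :: rat assume "0 < \<mu>"
    define tt where "tt = (if \<beta> = 1 then t2 else - t1)"
    have tt: "lc_ge 0 (tt - 1)" "lc_coeff (tt - 1) 0 = 0"
      using t ab lc_discD(1)[OF t(1)] lc_discD(1)[OF t(2)]
      by (auto simp: tt_def lc_coeff_diff lc_coeff_uminus lc_coeff_one \<alpha>_def \<beta>_def intro!: lc_ge_diff lc_ge_1)
    obtain n where n: "0 < n" "lc_ge n (tt - 1)" using lc_ge_pos_ex[OF tt] by blast
    obtain m where m: "0 < m" "m < \<mu>" "m < n" using dense[of 0 "min \<mu> n"] n \<open>0 < \<mu>\<close> by auto
    \<comment> \<open>As \<open>m\<close> is below \<open>n\<close>, the term
      \<open>- lc_d m\<close> is the leading term of \<open>h\<close>. The minus sign makes the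
      resulting point \<open>x\<close> lie inside the interval.\<close>
    define h where "h = tt - 1 - lc_d m"
    have h: "lc_ge m h" unfolding h_def
      by (rule lc_ge_diff[OF lc_ge_mono[OF n(2)] lc_ge_monom]) (use m in auto)
    have hm: "lc_coeff h m = -1" using lc_geD[OF n(2) m(3)] by (simp add: h_def lc_coeff_diff lc_coeff_monom)
    define x where "x = of_real c * (1 + h)"
    have x: "x = (if \<beta> = 1 then t2 - lc_d m else t1 + lc_d m)"
      by (simp add: x_def h_def tt_def c_def)
    have dm: "lc_ge 0 (lc_d m)" "lc_coeff (lc_d m) 0 = 0" using m by (auto simp: lc_ge_monom lc_coeff_monom)
    have "t1 < x \<and> x < t2"
    proof (cases "\<beta> = 1")
      case True
      have "t1 < x" unfolding x using True t dm lc_discD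
        by (auto intro!: lc_less_coeff0 lc_ge_diff simp: lc_coeff_diff)
      then show ?thesis using True lc_d_pos[of m] by (simp add: x)
    next
      case False
      have "x < t2" unfolding x using False t dm lc_discD
        by (auto intro!: lc_less_coeff0 lc_ge_add simp: lc_coeff_add)
      then show ?thesis using False lc_d_pos[of m] by (simp add: x)
    qed
    then obtain l' where "cw_conv (\<lambda>n. \<Sum>k\<le>n. e k * x ^ k) l'" using conv by blast
    then have "(\<lambda>k. lc_coeff (e k * x ^ k) q) \<longlonglongrightarrow> 0" for q by (rule cw_conv_terms(1))
    moreover have "e k * x ^ k = e' k * (1 + h) ^ k" for k
      by (simp add: x_def e'_def power_mult_distrib)
    ultimately show "\<exists>m h. 0 < m \<and> m < \<mu> \<and> lc_ge m h \<and> lc_coeff h m \<noteq> 0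
      \<and> (\<forall>q. (\<lambda>k. lc_coeff (e' k * (1 + h) ^ k) q) \<longlonglongrightarrow> 0)"
      using m h hm by (intro exI[of _ m] exI[of _ h]) auto
  qed
  then show ?thesis using reg coe by (simp add: lc_rapid_def)
qed

section \<open>Centers far from the interval\<close>

lemma lc_add_power_ge:
  assumes "lc_ge 0 y" "lc_ge p h" "0 \<le> p"
  shows "lc_ge p ((y + h) ^ k - y ^ k)"
proof -
  obtain r where r: "lc_ge 0 r" "(y + h) ^ k - y ^ k - of_nat k * y ^ (k - 1) * h = h ^ 2 * r"
    using lc_power_expansion[OF assms(1) lc_ge_mono[OF assms(2,3)]] by blast
  have "(y + h) ^ k - y ^ k = of_nat k * y ^ (k - 1) * h + h * (h * r)"
    using r(2) by (simp add: algebra_simps power2_eq_square)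
  moreover have "lc_ge (0 + 0 + p) (of_nat k * y ^ (k - 1) * h)"
    by (intro lc_ge_mult lc_ge_of_nat lc_ge_0_power assms)
  moreover have "lc_ge (p + (0 + 0)) (h * (h * r))"
    by (intro lc_ge_mult r lc_ge_mono[OF assms(2,3)] assms(2))
  ultimately show ?thesis by (simp add: lc_ge_add)
qed

text \<open>If the supports of the coefficients were not uniformly bounded below, a point of the interval
  could be built coefficient by coefficient at which infinitely many terms of the series have
  an entry of modulus at least 1 in degree 0.\<close>

lemma lc_far_bounded:
  assumes m: "0 < m" "lc_ge m z" "z \<noteq> 0"
    and conv: "\<And>s. 0 < s \<Longrightarrow> s < 1 \<Longrightarrow> \<exists>l. cw_conv (\<lambda>K. \<Sum>k\<le>K. c k * (1 + s * z) ^ k) l"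
  shows "\<exists>N. \<forall>k. lc_ge N (c k)"
proof (rule ccontr)
  assume no: "\<not> (\<exists>N. \<forall>k. lc_ge N (c k))"
  \<comment> \<open>Each single coefficient is bounded below, so the failure of a common bound
    occurs at arbitrarily late indices.\<close>
  have "\<exists>k\<ge>n. \<not> lc_ge (- of_nat n) (c k)" for n :: nat
  proof (rule ccontr)
    assume h: "\<not> (\<exists>k\<ge>n. \<not> lc_ge (- of_nat n) (c k))"
    have "\<forall>k. \<exists>m. lc_ge m (c k)" using lc_ge_ex by blast
    then obtain M where M: "\<And>k. lc_ge (M k) (c k)" by metis
    let ?N = "Min (insert (- of_nat n) (M ` {..<n}))"
    have "lc_ge ?N (c k)" for k
    proof (cases "k < n")
      case True then show ?thesis by (intro lc_ge_mono[OF M[of k]] Min_le) auto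
    next
      case False
      then have "lc_ge (- of_nat n) (c k)" using h not_less by blast
      then show ?thesis by (rule lc_ge_mono) simp
    qed
    then show False using no by blast
  qed
  then obtain \<kappa> where \<kappa>: "\<And>n. n \<le> \<kappa> n" "\<And>n. \<not> lc_ge (- of_nat n) (c (\<kappa> n))" by metis
  define P where "P n = - lc_lead (c (\<kappa> n))" for n
  have c0: "c (\<kappa> n) \<noteq> 0" for n using \<kappa>(2)[of n] by auto
  have Pn: "of_nat n < P n" for n
  proof -
    obtain p where "p < - of_nat n" "lc_coeff (c (\<kappa> n)) p \<noteq> 0" using \<kappa>(2)[of n] by (auto simp: lc_ge_def)
    then show ?thesis using lc_lead(2)[OF c0[of n], of p] by (force simp: P_def)
  qed
  \<comment> \<open>Jumping beyond \<open>P n\<close> makes the exponents \<open>p j\<close>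
    strictly increasing, so that later corrections do not disturb the entries already
    produced.\<close>
  define step where "step n = nat \<lceil>P n\<rceil> + 1" for n
  have step: "P n < of_nat (step n)" for n
    unfolding step_def using of_nat_ceiling[of "P n"] by simp
  \<comment> \<open>\<open>N0\<close> lies above the leading exponent of \<open>z\<close>, so all
    corrections are negligible against \<open>z\<close> and the constructed point stays near the
    middle of the interval.\<close>
  obtain N0 :: nat where N0: "max (lc_lead z) 0 < of_nat N0" using reals_Archimedean2 by blast
  define \<nu> where "\<nu> j = (step ^^ j) N0" for j
  define p where "p j = P (\<nu> j)" for j
  define k where "k j = \<kappa> (\<nu> j)" for j
  have \<nu>S: "p j < of_nat (\<nu> (Suc j))" for j using step by (simp add: \<nu>_def p_def)
  have p\<nu>: "of_nat (\<nu> j) < p j" for j using Pn by (simp add: p_def)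
  have pS: "p j < p (Suc j)" for j using \<nu>S[of j] p\<nu>[of "Suc j"] by linarith
  have pmono: "i \<le> j \<Longrightarrow> p i \<le> p j" for i j using lift_Suc_mono_le[of p] pS less_imp_le by blast
  have \<nu>mono: "\<nu> j < \<nu> (Suc j)" for j
    using less_trans[OF p\<nu>[of j] \<nu>S[of j]] by simp
  have \<nu>j: "N0 + j \<le> \<nu> j" for j
  proof (induction j)
    case 0 then show ?case by (simp add: \<nu>_def)
  next
    case (Suc j) then show ?case using \<nu>mono[of j] by simp
  qed
  have p0: "0 < p j" for j using N0 \<nu>j[of j] p\<nu>[of j] by (smt (verit) less_imp_le of_nat_0_le_iff order.strict_trans1)
  have pz: "lc_lead z < p 0" using N0 p\<nu>[of 0] by (simp add: \<nu>_def)
  have pj: "of_nat j < p j" for j using \<nu>j[of j] p\<nu>[of j]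
    by (meson le_add2 of_nat_le_iff order.strict_trans1 order.trans)
  have kj: "j \<le> k j" "0 < k j" for j
    using \<kappa>(1)[of "\<nu> j"] \<nu>j[of j] N0 by (auto simp: k_def intro: Nat.gr0I)
  have ck: "lc_ge (- p j) (c (k j))" "lc_coeff (c (k j)) (- p j) \<noteq> 0" for j
    using lc_ge_lead lc_lead(1)[OF c0] by (simp_all add: p_def P_def k_def)
  \<comment> \<open>If the entry in degree 0 has modulus below 1, the correction adds exactly 2 to
    it: to first order the power changes by \<open>real (k j)\<close> times the monomial, and the
    coefficient at \<open>- p j\<close> supplies the remaining factor.\<close>
  define \<tau> where "\<tau> j Y = (if \<bar>lc_coeff (c (k j) * Y ^ k j) 0\<bar> \<ge> 1 then 0
      else 2 / (real (k j) * lc_coeff (c (k j)) (- p j)))" for j Y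
  define Y where "Y = rec_nat (1 + of_real (1/2) * z) (\<lambda>j Y. Y + lc_monom (\<tau> j Y) (p j))"
  have Y0: "Y 0 = 1 + of_real (1/2) * z" by (simp add: Y_def)
  have YS: "Y (Suc j) = Y j + lc_monom (\<tau> j (Y j)) (p j)" for j by (simp add: Y_def)
  have Yd: "lc_ge (p j) (Y (j + i) - Y j)" for j i
  proof (induction i)
    case (Suc i)
    have "lc_ge (p j) (lc_monom (\<tau> (j + i) (Y (j + i))) (p (j + i)))"
      by (intro lc_ge_monom pmono) simp
    then have "lc_ge (p j) ((Y (j + i) - Y j) + lc_monom (\<tau> (j + i) (Y (j + i))) (p (j + i)))"
      by (rule lc_ge_add[OF Suc])
    then show ?case by (simp add: YS algebra_simps)
  qed simp
  have Yd': "lc_ge (p j) (Y i - Y j)" if "j \<le> i" for i j using Yd[of j "i - j"] that by simp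
  have "\<exists>l. strongly_converges Y l"
  proof (rule lc_Cauchy)
    fix e :: levi_civita assume "0 < e"
    then obtain n :: nat where n: "\<And>p. of_nat n \<le> p \<Longrightarrow> lc_d p < e" using lc_d_nat_small by metis
    have "\<bar>Y i - Y j\<bar> < e" if "i \<ge> n" "j \<ge> n" for i j
    proof -
      have "lc_ge (p n) ((Y i - Y n) - (Y j - Y n))" by (rule lc_ge_diff[OF Yd'[OF that(1)] Yd'[OF that(2)]])
      then have "\<bar>Y i - Y j\<bar> < lc_d (of_nat n)" using lc_ge_abs_less_d[OF _ pj[of n]] by simp
      then show ?thesis using n[of "of_nat n"] by simp
    qed
    then show "\<exists>N. \<forall>m\<ge>N. \<forall>n\<ge>N. \<bar>Y m - Y n\<bar> < e" by blast
  qed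
  then obtain y where y: "strongly_converges Y y" by blast
  have yd: "lc_ge (p j) (y - Y j)" for j
  proof -
    have "\<forall>\<^sub>F n in sequentially. \<bar>Y n - y\<bar> < lc_d (p j)" using y lc_d_pos by (simp add: strongly_converges_def)
    then have "\<forall>\<^sub>F n in sequentially. n \<ge> j \<and> \<bar>Y n - y\<bar> < lc_d (p j)"
      using eventually_ge_at_top[of j] by (rule eventually_conj[rotated])
    then obtain n where n: "n \<ge> j" "\<bar>Y n - y\<bar> < lc_d (p j)"
      using eventually_happens'[OF sequentially_bot] by blast
    have "lc_ge (p j) (Y n - y)" using n(2) by (intro lc_abs_le_d) simp
    then have "lc_ge (p j) ((Y n - Y j) - (Y n - y))" by (rule lc_ge_diff[OF Yd'[OF n(1)]])
    then show ?thesis by simp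
  qed
  have z0: "lc_ge 0 z" using lc_ge_mono[OF m(2)] m(1) by simp
  have Y00: "lc_ge 0 (Y 0)" "lc_coeff (Y 0) 0 = 1"
  proof -
    show "lc_ge 0 (Y 0)"
      using lc_ge_add[OF lc_ge_1, of "of_real (1/2) * z"] lc_ge_mult[OF lc_ge_of_real z0, of "1/2"] by (simp add: Y0)
    show "lc_coeff (Y 0) 0 = 1" unfolding Y0 lc_coeff_add lc_coeff_of_real_times
      using lc_geD[OF m(2,1)] by (simp add: lc_coeff_one)
  qed
  have Yj0: "lc_ge 0 (Y j)" "lc_coeff (Y j) 0 = 1" for j
  proof -
    have "lc_ge 0 (Y j - Y 0)" using lc_ge_mono[OF Yd'[of 0 j]] p0[of 0] by simp
    from lc_ge_add[OF this Y00(1)] show "lc_ge 0 (Y j)" by simp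
    show "lc_coeff (Y j) 0 = 1" using lc_geD[OF Yd'[of 0 j] p0[of 0]] Y00(2) by (simp add: lc_coeff_diff)
  qed
  have big: "\<bar>lc_coeff (c (k j) * Y (Suc j) ^ k j) 0\<bar> \<ge> 1" for j
  proof -
    define C K t h where "C = c (k j)" and "K = k j" and "t = \<tau> j (Y j)" and "h = lc_monom t (p j)"
    have h: "lc_ge (p j) h" by (simp add: h_def lc_ge_monom)
    obtain r where r: "lc_ge 0 r" "(Y j + h) ^ K - Y j ^ K - of_nat K * Y j ^ (K - 1) * h = h ^ 2 * r"
      using lc_power_expansion[OF Yj0(1) lc_ge_mono[OF h]] p0[of j] by (meson less_imp_le)
    have "C * Y (Suc j) ^ K = C * Y j ^ K + of_nat K * (lc_monom t (p j) * (C * Y j ^ (K - 1))) + C * (h * (h * r))"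
      using r(2) by (simp add: YS h_def t_def algebra_simps power2_eq_square)
    \<comment> \<open>The second-order term starts at exponent \<open>- p j + 2 * p j\<close>, which
      is positive.\<close>
    moreover have "lc_coeff (C * (h * (h * r))) 0 = 0"
      by (rule lc_geD[OF lc_ge_mult[OF ck(1)[of j, folded C_def] lc_ge_mult[OF h lc_ge_mult[OF h r(1)]]]])
        (use p0[of j] in simp)
    moreover have "lc_coeff (C * Y j ^ (K - 1)) (- p j) = lc_coeff C (- p j)"
    proof -
      have "lc_coeff (C * Y j ^ (K - 1)) (- p j + 0) = lc_coeff C (- p j) * lc_coeff (Y j ^ (K - 1)) 0"
        by (rule lc_coeff_times_lead(1))
          (use lc_geD[OF ck(1)[of j, folded C_def]] lc_geD[OF lc_ge_0_power[OF Yj0(1)]] in blast)+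
      then show ?thesis using lc_coeff_power_lead[OF Yj0(1)[of j], of "K - 1"] Yj0(2)[of j] by simp
    qed
    ultimately have "lc_coeff (C * Y (Suc j) ^ K) 0 = lc_coeff (C * Y j ^ K) 0 + real K * t * lc_coeff C (- p j)"
      by (simp add: lc_coeff_add lc_coeff_of_nat_times lc_coeff_monom_times)
    then show ?thesis using ck(2)[of j] kj(2)[of j]
      by (auto simp: C_def K_def t_def \<tau>_def)
  qed
  have ybig: "\<bar>lc_coeff (c (k j) * y ^ k j) 0\<bar> \<ge> 1" for j
  proof -
    have "lc_ge (p (Suc j)) ((Y (Suc j) + (y - Y (Suc j))) ^ k j - Y (Suc j) ^ k j)"
      using p0[of "Suc j"] by (intro lc_add_power_ge Yj0 yd) simp
    then have "lc_ge (- p j + p (Suc j)) (c (k j) * (y ^ k j - Y (Suc j) ^ k j))"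
      by (intro lc_ge_mult ck) simp
    then have "lc_coeff (c (k j) * (y ^ k j - Y (Suc j) ^ k j)) 0 = 0"
      by (rule lc_geD) (use pS[of j] in simp)
    then show ?thesis using big[of j] by (simp add: right_diff_distrib lc_coeff_diff)
  qed
  define s where "s = (y - 1) / z"
  have ys: "y = 1 + s * z" using m(3) by (simp add: s_def)
  have "\<bar>y - Y 0\<bar> < of_real (1/2) * \<bar>z\<bar>"
  proof (rule lc_abs_less[OF yd])
    show "0 < of_real (1 / 2) * \<bar>z\<bar>" using m(3) by simp
    show "lc_coeff (of_real (1 / 2) * \<bar>z\<bar>) (lc_lead z) \<noteq> 0"
      using lc_lead(1)[OF m(3)] unfolding lc_coeff_of_real_times by (simp add: abs_levi_civita_def lc_coeff_uminus)
  qed (rule pz)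
  then have "\<bar>y - Y 0\<bar> / \<bar>z\<bar> < 1 / 2" using m(3) by (simp add: divide_simps)
  then have "\<bar>(y - Y 0) / z\<bar> < 1 / 2" by (simp only: abs_divide)
  moreover have "(y - Y 0) / z = s - 1 / 2" using m(3) by (simp add: s_def Y0 field_simps)
  ultimately have "0 < s" "s < 1" by (auto simp: abs_less_iff field_simps)
  then obtain l where "cw_conv (\<lambda>K. \<Sum>k\<le>K. c k * (1 + s * z) ^ k) l" using conv by blast
  then have "(\<lambda>i. lc_coeff (c i * y ^ i) 0) \<longlonglongrightarrow> 0" unfolding ys by (rule cw_conv_terms(1))
  then have "\<forall>\<^sub>F i in sequentially. \<bar>lc_coeff (c i * y ^ i) 0\<bar> < 1" 
    using tendstoD[of _ 0 sequentially 1] by (fastforce simp: dist_real_def)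
  then obtain n where "\<And>i. i \<ge> n \<Longrightarrow> \<bar>lc_coeff (c i * y ^ i) 0\<bar> < 1" by (auto simp: eventually_sequentially)
  then show False using ybig[of n] kj(1)[of n] by fastforce
qed

text \<open>The exponents of the \<open>c k\<close> are bounded below and \<open>z\<close> is
  infinitesimal, so at exponent \<open>q\<close> the partial sums involve only the powers of s up to
  \<open>nq q\<close>. Convergence at real s forces each recentered coefficient to converge
  (\<open>convergent_poly_coeffs\<close>), and the limits are rapid because a given exponent occurs
  in only finitely many of them. The derived series is included because termwise primitives have to
  be differentiated back.\<close>

lemma lc_far_normal:
  assumes m: "0 < m" "lc_ge m z" "z \<noteq> 0"
    and conv: "\<And>s. 0 < s \<Longrightarrow> s < 1 \<Longrightarrow> \<exists>l. cw_conv (\<lambda>K. \<Sum>k\<le>K. c k * (1 + s * z) ^ k) l"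
  obtains b N where "lc_rapid b" "\<And>k. lc_ge N (c k)"
    "\<And>s. lc_disc s \<Longrightarrow> cw_conv (\<lambda>K. \<Sum>k\<le>K. c k * (1 + s * z) ^ k) (lc_phi b s)"
    "\<And>s. lc_disc s \<Longrightarrow> cw_conv (\<lambda>K. \<Sum>k\<le>K. of_nat (Suc k) * c (Suc k) * (1 + s * z) ^ k * z)
      (lc_phi (lc_dcoeffs b) s)"
proof -
  obtain N where N: "\<And>k. lc_ge N (c k)" using lc_far_bounded[OF m conv] by blast
  define nq where "nq q = nat \<lceil>(q - N) / m\<rceil>" for q
  have nq: "q < N + of_nat i * m" if "nq q < i" for q i
  proof -
    have "(q - N) / m \<le> of_nat (nq q)" unfolding nq_def by (rule of_nat_ceiling)
    also have "\<dots> < of_nat i" using that by simp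
    finally show ?thesis using m(1) by (simp add: divide_less_eq)
  qed
  have exp: "lc_coeff (c k * w * (1 + s * z) ^ j) q
      = (\<Sum>i\<le>nq q. real (j choose i) * lc_coeff (c k * z ^ i * s ^ i * w) q)" if s: "lc_ge 0 s" "lc_ge 0 w" for s k w j q
  proof -
    have "c k * w * (1 + s * z) ^ j = (\<Sum>i\<le>j. of_nat (j choose i) * (c k * z ^ i * s ^ i * w))"
    proof -
      have "(1 + s * z) ^ j = (\<Sum>i\<le>j. of_nat (j choose i) * (s * z) ^ i)"
        using binomial_ring[of "s * z" 1 j] by (simp add: add.commute)
      then show ?thesis by (simp add: sum_distrib_left power_mult_distrib ac_simps)
    qed
    then have "lc_coeff (c k * w * (1 + s * z) ^ j) q = (\<Sum>i\<le>j. real (j choose i) * lc_coeff (c k * z ^ i * s ^ i * w) q)"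
      by (simp only: lc_coeff_sum lc_coeff_of_nat_times)
    also have "\<dots> = (\<Sum>i\<le>max j (nq q). real (j choose i) * lc_coeff (c k * z ^ i * s ^ i * w) q)"
      by (rule sum.mono_neutral_left) (auto simp: binomial_eq_0)
    also have "\<dots> = (\<Sum>i\<le>nq q. real (j choose i) * lc_coeff (c k * z ^ i * s ^ i * w) q)"
    proof (rule sum.mono_neutral_right)
      show "\<forall>i\<in>{..max j (nq q)} - {..nq q}. real (j choose i) * lc_coeff (c k * z ^ i * s ^ i * w) q = 0"
      proof
        fix i assume "i \<in> {..max j (nq q)} - {..nq q}"
        then have "q < N + of_nat i * m" by (intro nq) auto
        then have "lc_coeff (c k * z ^ i * s ^ i * w) q = 0"
          by (intro lc_geD[OF lc_ge_mult[OF lc_ge_mult[OF lc_ge_mult[OF N lc_ge_power[OF m(2)]] lc_ge_0_power[OF s(1)]] s(2)]]) simp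
        then show "real (j choose i) * lc_coeff (c k * z ^ i * s ^ i * w) q = 0" by simp
      qed
    qed auto
    finally show ?thesis .
  qed
  \<comment> \<open>\<open>B K i\<close> is the coefficient of s^i in the partial sum up to
    \<open>K\<close>, as obtained from the binomial theorem.\<close>
  define B where "B K i = (\<Sum>k\<le>K. of_nat (k choose i) * (c k * z ^ i))" for K i
  have Bge: "lc_ge (N + of_nat i * m) (B K i)" for K i
    unfolding B_def using lc_ge_mult[OF lc_ge_of_nat lc_ge_mult[OF N lc_ge_power[OF m(2)]]]
    by (intro lc_ge_sum) simp
  have Bc: "lc_coeff (\<Sum>k\<le>K. c k * (1 + s * z) ^ k) q = (\<Sum>i\<le>nq q. lc_coeff (B K i * s ^ i) q)"
    if s: "lc_ge 0 s" for s K q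
  proof -
    have "lc_coeff (\<Sum>k\<le>K. c k * (1 + s * z) ^ k) q
       = (\<Sum>k\<le>K. \<Sum>i\<le>nq q. real (k choose i) * lc_coeff (c k * z ^ i * s ^ i) q)"
      using exp[OF s lc_ge_1] by (simp add: lc_coeff_sum)
    also have "\<dots> = (\<Sum>i\<le>nq q. \<Sum>k\<le>K. real (k choose i) * lc_coeff (c k * z ^ i * s ^ i) q)" by (rule sum.swap)
    also have "\<dots> = (\<Sum>i\<le>nq q. lc_coeff (B K i * s ^ i) q)"
      unfolding B_def sum_distrib_right lc_coeff_sum mult.assoc lc_coeff_of_nat_times ..
    finally show ?thesis .
  qed
  have cor: "lc_coeff (x * of_real r ^ i) q = lc_coeff x q * r ^ i" for x q i and r :: real
    by (metis lc_coeff_of_real_times mult.commute of_real_power)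
  have Bcr: "lc_coeff (\<Sum>k\<le>K. c k * (1 + of_real r * z) ^ k) q = (\<Sum>i\<le>nq q. lc_coeff (B K i) q * r ^ i)"
    for K q and r :: real
    using Bc[OF lc_ge_of_real] by (simp add: cor)
  have "\<exists>l. cw_conv (\<lambda>K. \<Sum>k\<le>K. c k * (1 + of_real r * z) ^ k) l" if "0 < r" "r < 1" for r :: real
    using that by (intro conv lc_less_coeff0) (auto simp: lc_ge_of_real lc_ge_1 lc_coeff_of_real lc_coeff_zero lc_coeff_one)
  then obtain l where l: "\<And>r::real. 0 < r \<Longrightarrow> r < 1 \<Longrightarrow> cw_conv (\<lambda>K. \<Sum>k\<le>K. c k * (1 + of_real r * z) ^ k) (l r)" by metis
  have B0: "lc_coeff (B K i) q = 0" if "nq q < i" for K i q using lc_geD[OF Bge nq[OF that]] .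
  have "convergent (\<lambda>K. lc_coeff (B K i) q)" for i q
  proof (cases "i \<le> nq q")
    case True
    show ?thesis
    proof (rule convergent_poly_coeffs[OF _ True])
      fix r :: real assume "0 < r" "r < 1"
      from cw_convD[OF l[OF this], of q] show "convergent (\<lambda>K. \<Sum>i\<le>nq q. lc_coeff (B K i) q * r ^ i)"
        unfolding Bcr by (rule convergentI)
    qed
  next
    case False then show ?thesis by (simp add: B0 convergent_const)
  qed
  then obtain \<beta> where \<beta>: "\<And>i q. (\<lambda>K. lc_coeff (B K i) q) \<longlonglongrightarrow> \<beta> i q" unfolding convergent_def by metis
  have \<beta>0: "\<beta> i q = 0" if "nq q < i" for i q using \<beta>[of i q] B0[OF that] by (simp add: LIMSEQ_const_iff)
  \<comment> \<open>Left-finiteness again comes from one real \<open>r\<close> that avoids the zeros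
    of all the polynomials, so that every exponent in \<open>E\<close> appears in
    \<open>l r\<close>.\<close>
  define E where "E = {q. \<exists>i. \<beta> i q \<noteq> 0}"
  have E: "left_finite E" unfolding left_finite_def
  proof
    fix Q
    have cnt: "countable (\<Union>q\<in>E. {r. (\<Sum>i\<le>nq q. \<beta> i q * r ^ i) = 0})"
    proof (rule countable_UN)
      fix q assume "q \<in> E"
      then obtain i where i: "\<beta> i q \<noteq> 0" by (auto simp: E_def)
      then have "i \<le> nq q" using \<beta>0 by (meson not_le)
      then show "countable {r. (\<Sum>i\<le>nq q. \<beta> i q * r ^ i) = 0}" using i by (rule countable_poly_zeros)
    qed auto
    obtain r :: real where r: "0 < r" "r < 1" "r \<notin> (\<Union>q\<in>E. {r. (\<Sum>i\<le>nq q. \<beta> i q * r ^ i) = 0})"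
      by (rule ex_avoid_countable[OF zero_less_one cnt])
    have "lc_coeff (l r) q = (\<Sum>i\<le>nq q. \<beta> i q * r ^ i)" for q
    proof (rule LIMSEQ_unique[OF cw_convD[OF l[OF r(1,2)]]])
      show "(\<lambda>K. lc_coeff (\<Sum>k\<le>K. c k * (1 + of_real r * z) ^ k) q) \<longlonglongrightarrow> (\<Sum>i\<le>nq q. \<beta> i q * r ^ i)"
        unfolding Bcr by (intro tendsto_intros \<beta>)
    qed
    then have "{x \<in> E. x \<le> Q} \<subseteq> {q \<in> lc_supp (l r). q \<le> Q}" using r(3) by (auto simp: lc_supp_def)
    then show "finite {x \<in> E. x \<le> Q}" using finite_lc_supp_le finite_subset by blast
  qed
  define b where "b i = Abs_levi_civita (\<beta> i)" for i
  have b: "lc_coeff (b i) = \<beta> i" for i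
  proof -
    have "left_finite {q. \<beta> i q \<noteq> 0}" by (rule left_finite_subset[OF E]) (auto simp: E_def)
    then show ?thesis by (simp add: b_def Abs_levi_civita_inverse)
  qed
  have rb: "lc_rapid b" unfolding lc_rapid_def
  proof (intro conjI allI)
    show "lc_regular b" unfolding lc_regular_def
      by (rule exI[of _ E]) (use E in \<open>auto simp: E_def lc_supp_def b\<close>)
    show "\<exists>C. \<forall>k. \<bar>lc_coeff (b k) q\<bar> * real (Suc k) ^ j \<le> C" for q j
    proof (intro exI allI)
      fix k
      show "\<bar>lc_coeff (b k) q\<bar> * real (Suc k) ^ j \<le> (\<Sum>i\<le>nq q. \<bar>lc_coeff (b i) q\<bar> * real (Suc i) ^ j)"
      proof (cases "k \<le> nq q")
        case True
        then show ?thesis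
          by (intro member_le_sum[where f = "\<lambda>i. \<bar>lc_coeff (b i) q\<bar> * real (Suc i) ^ j"]) auto
      next
        case False then show ?thesis by (simp add: b \<beta>0 sum_nonneg)
      qed
    qed
  qed
  have bB: "cw_conv (\<lambda>K. B K i) (b i)" for i by (simp add: cw_conv_def b \<beta>)
  have Bs: "(\<lambda>K. lc_coeff (B K i * w) q) \<longlonglongrightarrow> lc_coeff (b i * w) q" for i w q
    using cw_convD[OF cw_conv_mult[OF bB Bge, of w]] by (simp add: mult.commute)
  have bge: "lc_ge (N + of_nat i * m) (b i)" for i by (rule cw_conv_ge[OF bB Bge])
  have fin: "lc_coeff (lc_phi e s) q = (\<Sum>i\<le>nq q. lc_coeff (e i * s ^ i) q)"
    if e: "lc_rapid e" "lc_disc s" "\<And>i. lc_ge (N + of_nat i * m) (e i)" for e s q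
  proof -
    have "lc_coeff (e i * s ^ i) q = 0" if "i \<notin> {..nq q}" for i
      by (rule lc_geD[OF lc_ge_mult[OF e(3) lc_ge_0_power[OF lc_discD(1)[OF e(2)]]]])
        (use nq[of q i] that in simp)
    then show ?thesis by (intro sums_unique2[OF lc_phi(1)[OF e(1,2)]] sums_finite) auto
  qed
  show ?thesis
  proof (rule that[OF rb N])
    fix s assume s: "lc_disc s"
    show "cw_conv (\<lambda>K. \<Sum>k\<le>K. c k * (1 + s * z) ^ k) (lc_phi b s)"
      unfolding cw_conv_def Bc[OF lc_discD(1)[OF s]] fin[OF rb s bge] by (intro allI tendsto_intros Bs)
    have dge: "lc_ge (N + of_nat i * m) (lc_dcoeffs b i)" for i
    proof -
      have "lc_ge (N + of_nat (Suc i) * m) (lc_dcoeffs b i)"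
        using lc_ge_mult[OF lc_ge_of_nat bge[of "Suc i"], of "Suc i"] by simp
      then show ?thesis by (rule lc_ge_mono) (use m(1) in \<open>simp add: algebra_simps\<close>)
    qed
    have "lc_coeff (\<Sum>k\<le>K. of_nat (Suc k) * c (Suc k) * (1 + s * z) ^ k * z) q
        = (\<Sum>i\<le>nq q. real (Suc i) * lc_coeff (B (Suc K) (Suc i) * s ^ i) q)" for K q
    proof -
      have z0: "lc_ge 0 z" using lc_ge_mono[OF m(2)] m(1) by simp
      have "lc_coeff (\<Sum>k\<le>K. of_nat (Suc k) * c (Suc k) * (1 + s * z) ^ k * z) q
        = (\<Sum>k\<le>K. real (Suc k) * lc_coeff (c (Suc k) * z * (1 + s * z) ^ k) q)"
        unfolding lc_coeff_sum lc_coeff_of_nat_times[symmetric] by (simp only: ac_simps)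
      also have "\<dots> = (\<Sum>k\<le>K. \<Sum>i\<le>nq q. real (Suc k) * (real (k choose i) * lc_coeff (c (Suc k) * z ^ i * s ^ i * z) q))"
        unfolding exp[OF lc_discD(1)[OF s] z0] sum_distrib_left ..
      also have "\<dots> = (\<Sum>i\<le>nq q. \<Sum>k\<le>K. real (Suc k) * (real (k choose i) * lc_coeff (c (Suc k) * z ^ i * s ^ i * z) q))"
        by (rule sum.swap)
      \<comment> \<open>The identity (k + 1) (k choose i) = (i + 1) (k + 1 choose i + 1) makes
        differentiation commute with recentering.\<close>
      also have "\<dots> = (\<Sum>i\<le>nq q. \<Sum>k\<le>K. real (Suc i) * (real (Suc k choose Suc i) * lc_coeff (c (Suc k) * (z ^ Suc i * s ^ i)) q))"
      proof (intro sum.cong refl)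
        fix i k
        have "real (Suc k) * real (k choose i) = real (Suc i) * real (Suc k choose Suc i)"
          by (metis Suc_times_binomial of_nat_mult)
        then have "real (Suc k) * (real (k choose i) * x) = real (Suc i) * (real (Suc k choose Suc i) * x)" for x
          by (metis mult.assoc)
        moreover have "c (Suc k) * z ^ i * s ^ i * z = c (Suc k) * (z ^ Suc i * s ^ i)" by (simp add: ac_simps)
        ultimately show "real (Suc k) * (real (k choose i) * lc_coeff (c (Suc k) * z ^ i * s ^ i * z) q)
          = real (Suc i) * (real (Suc k choose Suc i) * lc_coeff (c (Suc k) * (z ^ Suc i * s ^ i)) q)" by metis
      qed
      also have "\<dots> = (\<Sum>i\<le>nq q. real (Suc i) * lc_coeff (B (Suc K) (Suc i) * s ^ i) q)"
      proof (intro sum.cong refl)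
        fix i
        have "lc_coeff (B (Suc K) (Suc i) * s ^ i) q
           = (\<Sum>k\<le>K. real (Suc k choose Suc i) * lc_coeff (c (Suc k) * (z ^ Suc i * s ^ i)) q)"
          unfolding B_def sum.atMost_Suc_shift sum_distrib_right distrib_right lc_coeff_sum lc_coeff_add mult.assoc lc_coeff_of_nat_times
          by simp
        then show "(\<Sum>k\<le>K. real (Suc i) * (real (Suc k choose Suc i) * lc_coeff (c (Suc k) * (z ^ Suc i * s ^ i)) q))
          = real (Suc i) * lc_coeff (B (Suc K) (Suc i) * s ^ i) q" by (simp only: sum_distrib_left)
      qed
      finally show ?thesis .
    qed
    moreover have "lc_coeff (lc_phi (lc_dcoeffs b) s) q = (\<Sum>i\<le>nq q. real (Suc i) * lc_coeff (b (Suc i) * s ^ i) q)" for q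
      unfolding fin[OF lc_rapid_comp_Suc[OF rb] s dge] mult.assoc lc_coeff_of_nat_times ..
    moreover have "(\<lambda>K. lc_coeff (B (Suc K) (Suc i) * s ^ i) q) \<longlonglongrightarrow> lc_coeff (b (Suc i) * s ^ i) q" for i q
      using Bs[of "Suc i" "s ^ i" q] by (rule LIMSEQ_Suc)
    ultimately show "cw_conv (\<lambda>K. \<Sum>k\<le>K. of_nat (Suc k) * c (Suc k) * (1 + s * z) ^ k * z) (lc_phi (lc_dcoeffs b) s)"
      unfolding cw_conv_def by (auto intro!: tendsto_intros simp del: of_nat_Suc)
  qed
qed

section \<open>Normal form of a simple function\<close>

text \<open>The affine map with center \<open>y\<close> and scale \<open>\<tau>\<close> carries the
  interval into the disc. The center need not belong to [u, v].\<close>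

definition lc_frame :: "levi_civita \<Rightarrow> levi_civita \<Rightarrow> levi_civita \<Rightarrow> levi_civita \<Rightarrow> bool" where
  "lc_frame u v y \<tau> \<longleftrightarrow> u < v \<and> 0 < \<tau> \<and> lc_disc ((u - y) / \<tau>) \<and> lc_disc ((v - y) / \<tau>)"

lemma lc_frame_disc:
  assumes "lc_frame u v y \<tau>" "x \<in> {u..v}" shows "lc_disc ((x - y) / \<tau>)"
  using assms unfolding lc_frame_def
  by (auto intro!: lc_disc_between[of "(u - y) / \<tau>" "(v - y) / \<tau>"] divide_right_mono)

lemma lc_frame_subset: "lc_frame u v y \<tau> \<Longrightarrow> u \<le> x \<Longrightarrow> x < z \<Longrightarrow> z \<le> v \<Longrightarrow> lc_frame x z y \<tau>"
  using lc_frame_disc[of u v y \<tau> x] lc_frame_disc[of u v y \<tau> z] by (auto simp: lc_frame_def)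

lemma lc_interval_mem:
  assumes "lc_interval u v I" shows "I \<subseteq> {u..v}" "{u<..<v} \<subseteq> I"
  using assms by (auto simp: lc_interval_def)

lemma lc_ge_inverse:
  assumes "x \<noteq> 0" shows "lc_ge (- lc_lead x) (inverse x)"
proof -
  have nz: "inverse x \<noteq> 0" using assms by simp
  have "lc_coeff (x * inverse x) (lc_lead x + lc_lead (inverse x)) = lc_coeff x (lc_lead x) * lc_coeff (inverse x) (lc_lead (inverse x))"
    by (rule lc_coeff_times_lead(1)) (use lc_ge_lead lc_geD in blast)+
  then have "lc_coeff 1 (lc_lead x + lc_lead (inverse x)) \<noteq> 0"
    using assms lc_lead(1)[OF assms] lc_lead(1)[OF nz] by simp
  then have "lc_lead (inverse x) = - lc_lead x" by (auto simp: lc_coeff_one split: if_splits)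
  then show ?thesis using lc_ge_lead by metis
qed

text \<open>The cases compare the distance from the center to the interval with the length
  \<open>T\<close>. If the ratio \<open>w\<close> has no negative exponents, the center is kept and
  the argument rescaled; otherwise the center is infinitely far away on this scale, and the series
  is recentered at \<open>u\<close>. The last conclusion identifies the sum of the formal derivative
  of the original series; it serves to recognise a function as the derivative of its termwise
  primitive.\<close>

lemma lc_normal_form:
  assumes I: "lc_interval u v I" and uv: "u < v" and f: "lc_power_series_on I a x\<^sub>0 f"
  obtains y \<tau> e where "lc_frame u v y \<tau>" "lc_rapid e"
    "\<And>x. x \<in> I \<Longrightarrow> f x = lc_phi e ((x - y) / \<tau>)"
    "\<And>x. x \<in> I \<Longrightarrow> cw_conv (\<lambda>K. \<Sum>k\<le>K. of_nat (Suc k) * a (Suc k) * (x - x\<^sub>0) ^ k)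
      (lc_phi (lc_dcoeffs e) ((x - y) / \<tau>) / \<tau>)"
proof -
  define T where "T = v - u"
  have T: "0 < T" using uv by (simp add: T_def)
  define w where "w = (u - x\<^sub>0) / T"
  have fx: "cw_conv (\<lambda>K. \<Sum>k\<le>K. a k * (x - x\<^sub>0) ^ k) (f x)" if "x \<in> I" for x
    using f that by (auto simp: lc_power_series_on_def intro: weak_imp_cw)
  show ?thesis
  proof (cases "lc_ge 0 w")
    case True
    define w0 where "w0 = lc_coeff w 0"
    \<comment> \<open>The larger modulus of the rescaled real parts at the two ends: both ends land
      in the disc and one of them on its edge, as \<open>lc_rapid_near\<close> requires.\<close>
    define R where "R = max \<bar>w0\<bar> \<bar>w0 + 1\<bar>"
    have R: "0 < R" by (auto simp: R_def)
    define \<tau> where "\<tau> = of_real R * T"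
    have \<tau>: "0 < \<tau>"
    proof -
      have "0 < (of_real R :: levi_civita)" unfolding lc_gt_0_iff
        by (rule exI[of _ 0]) (use R in \<open>simp add: lc_coeff_of_real lc_ge_of_real\<close>)
      then show ?thesis using T by (simp add: \<tau>_def)
    qed
    have t1: "(u - x\<^sub>0) / \<tau> = of_real (1/R) * w" by (simp add: \<tau>_def w_def)
    have t2: "(v - x\<^sub>0) / \<tau> = of_real (1/R) * (w + 1)"
    proof -
      have "w + 1 = (v - x\<^sub>0) / T" using T by (simp add: w_def field_simps) (simp add: T_def)
      then show ?thesis by (simp add: \<tau>_def)
    qed
    have c1: "lc_coeff ((u - x\<^sub>0) / \<tau>) 0 = w0 / R" "lc_coeff ((v - x\<^sub>0) / \<tau>) 0 = (w0 + 1) / R"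
      unfolding t1 t2 lc_coeff_of_real_times by (simp_all add: w0_def lc_coeff_add lc_coeff_one)
    have w1: "lc_ge 0 (w + 1)" by (intro lc_ge_add True lc_ge_1)
    have d: "lc_disc ((u - x\<^sub>0) / \<tau>)" "lc_disc ((v - x\<^sub>0) / \<tau>)"
    proof -
      have "lc_ge 0 ((u - x\<^sub>0) / \<tau>)" "lc_ge 0 ((v - x\<^sub>0) / \<tau>)"
        unfolding t1 t2 using lc_ge_mult[OF lc_ge_of_real True, of "1/R"] lc_ge_mult[OF lc_ge_of_real w1, of "1/R"] by simp_all
      moreover have "\<bar>w0 / R\<bar> \<le> 1" "\<bar>(w0 + 1) / R\<bar> \<le> 1" using R by (simp_all add: abs_divide) (simp_all add: R_def)
      ultimately show "lc_disc ((u - x\<^sub>0) / \<tau>)" "lc_disc ((v - x\<^sub>0) / \<tau>)" by (simp_all add: lc_disc_def c1)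
    qed
    have fr: "lc_frame u v x\<^sub>0 \<tau>" using d \<tau> uv by (simp add: lc_frame_def)
    define e where "e k = a k * \<tau> ^ k" for k
    have ek: "e k * ((x - x\<^sub>0) / \<tau>) ^ k = a k * (x - x\<^sub>0) ^ k" for k x
      using \<tau> by (simp add: e_def power_divide)
    have rap: "lc_rapid e"
    proof (rule lc_rapid_near[OF d])
      show "lc_coeff ((u - x\<^sub>0) / \<tau>) 0 < lc_coeff ((v - x\<^sub>0) / \<tau>) 0" unfolding c1 using R by (simp add: divide_strict_right_mono)
      show "\<bar>lc_coeff ((u - x\<^sub>0) / \<tau>) 0\<bar> = 1 \<or> \<bar>lc_coeff ((v - x\<^sub>0) / \<tau>) 0\<bar> = 1"
        unfolding c1 using R by (auto simp: R_def max_def)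
      fix t assume t: "(u - x\<^sub>0) / \<tau> < t" "t < (v - x\<^sub>0) / \<tau>"
      define x where "x = x\<^sub>0 + \<tau> * t"
      have "u < x" "x < v" using t \<tau> by (simp_all add: x_def divide_less_eq less_divide_eq algebra_simps)
      then have "x \<in> I" using lc_interval_mem(2)[OF I] by auto
      moreover have "(x - x\<^sub>0) / \<tau> = t" using \<tau> by (simp add: x_def)
      ultimately show "\<exists>l. cw_conv (\<lambda>n. \<Sum>k\<le>n. e k * t ^ k) l" using fx[of x] ek[of _ x] by auto
    qed
    show ?thesis
    proof (rule that[OF fr rap])
      fix x assume x: "x \<in> I"
      then have dx: "lc_disc ((x - x\<^sub>0) / \<tau>)" using lc_frame_disc[OF fr] lc_interval_mem(1)[OF I] by blast
      show "f x = lc_phi e ((x - x\<^sub>0) / \<tau>)"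
        by (rule lc_phi_eqI[OF rap dx, symmetric]) (use fx[OF x] in \<open>simp add: ek\<close>)
      have rd: "lc_rapid (lc_dcoeffs e)" by (rule lc_rapid_comp_Suc[OF rap])
      obtain m where m: "\<And>n. lc_ge m (\<Sum>k\<le>n. lc_dcoeffs e k * ((x - x\<^sub>0) / \<tau>) ^ k)"
        using lc_regular_ge[OF lc_phi(2)[OF rd dx]] by blast
      have "(1 / \<tau>) * (\<Sum>k\<le>K. lc_dcoeffs e k * ((x - x\<^sub>0) / \<tau>) ^ k)
          = (\<Sum>k\<le>K. of_nat (Suc k) * a (Suc k) * (x - x\<^sub>0) ^ k)" for K
        unfolding sum_distrib_left using \<tau> by (intro sum.cong refl) (simp add: e_def power_divide del: of_nat_Suc)
      then show "cw_conv (\<lambda>K. \<Sum>k\<le>K. of_nat (Suc k) * a (Suc k) * (x - x\<^sub>0) ^ k)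
        (lc_phi (lc_dcoeffs e) ((x - x\<^sub>0) / \<tau>) / \<tau>)"
        using cw_conv_mult[OF lc_phi(3)[OF rd dx] m, of "1 / \<tau>"] by simp
    qed
  next
    case False
    then have w: "w \<noteq> 0" by auto
    \<comment> \<open>\<open>z\<close> is infinitesimal, and \<open>x - x\<^sub>0\<close> equals
      \<open>(u - x\<^sub>0) * (1 + s * z)\<close> with s = (x - u) / T.\<close>
    define z where "z = inverse w"
    have lw: "lc_lead w < 0" using False lc_ge_mono[OF lc_ge_lead[of w]] by (meson not_less)
    have z: "0 < - lc_lead w" "lc_ge (- lc_lead w) z" "z \<noteq> 0"
      using lw lc_ge_inverse[OF w] w by (auto simp: z_def)
    have ux: "u - x\<^sub>0 = T * w" using T by (simp add: w_def)
    define c where "c k = a k * (u - x\<^sub>0) ^ k" for k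
    have lin: "(u - x\<^sub>0) * (1 + (x - u) / T * z) = x - x\<^sub>0" for x
    proof -
      define \<sigma> where "\<sigma> = (x - u) / T"
      have "T * \<sigma> = x - u" "w * z = 1" using T w by (simp_all add: \<sigma>_def z_def)
      moreover have "T * w * (1 + \<sigma> * z) = T * w + (T * \<sigma>) * (w * z)" by (simp add: algebra_simps)
      ultimately show ?thesis unfolding \<sigma>_def[symmetric] using ux by simp
    qed
    have ck: "c k * (1 + (x - u) / T * z) ^ k = a k * (x - x\<^sub>0) ^ k" for k x
      using lin[of x] by (metis c_def mult.assoc power_mult_distrib)
    have conv: "\<exists>l. cw_conv (\<lambda>K. \<Sum>k\<le>K. c k * (1 + s * z) ^ k) l" if "0 < s" "s < 1" for s
    proof -
      define x where "x = u + s * T"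
      have s: "(x - u) / T = s" using T by (simp add: x_def)
      have "u < x" using that T by (simp add: x_def)
      moreover have "s * T < 1 * T" using that T by (intro mult_strict_right_mono)
      then have "x < v" by (simp add: x_def T_def)
      ultimately have "x \<in> I" using lc_interval_mem(2)[OF I] by auto
      from fx[OF this] show ?thesis using ck[of _ x] unfolding s by auto
    qed
    obtain b N where b: "lc_rapid b" and N: "\<And>k. lc_ge N (c k)"
      and c1: "\<And>s. lc_disc s \<Longrightarrow> cw_conv (\<lambda>K. \<Sum>k\<le>K. c k * (1 + s * z) ^ k) (lc_phi b s)"
      and c2: "\<And>s. lc_disc s \<Longrightarrow> cw_conv (\<lambda>K. \<Sum>k\<le>K. of_nat (Suc k) * c (Suc k) * (1 + s * z) ^ k * z)
      (lc_phi (lc_dcoeffs b) s)" using lc_far_normal[OF z conv] by blast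
    have "lc_disc 0" "lc_disc 1" by (auto simp: lc_disc_def lc_ge_1 lc_coeff_zero lc_coeff_one)
    then have fr: "lc_frame u v u T" using T by (simp add: lc_frame_def T_def)
    show ?thesis
    proof (rule that[OF fr b])
      fix x assume x: "x \<in> I"
      then have dx: "lc_disc ((x - u) / T)" using lc_frame_disc[OF fr] lc_interval_mem(1)[OF I] by blast
      show "f x = lc_phi b ((x - u) / T)"
        using cw_conv_unique[OF fx[OF x]] c1[OF dx] unfolding ck by blast
      have z0: "lc_ge 0 z" using lc_ge_mono[OF z(2)] z(1) by simp
      have y0: "lc_ge 0 (1 + (x - u) / T * z)"
        using lc_ge_add[OF lc_ge_1, of "(x - u) / T * z"] lc_ge_mult[OF lc_discD(1)[OF dx] z0] by simp
      have "lc_ge (0 + N + 0 + 0) (of_nat (Suc k) * c (Suc k) * (1 + (x - u) / T * z) ^ k * z)" for k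
        by (intro lc_ge_mult lc_ge_of_nat N lc_ge_0_power y0 z0)
      then have "lc_ge N (\<Sum>k\<le>K. of_nat (Suc k) * c (Suc k) * (1 + (x - u) / T * z) ^ k * z)" for K
        by (intro lc_ge_sum) (simp only: add_0_left add_0_right)
      then have "cw_conv (\<lambda>K. (1 / T) * (\<Sum>k\<le>K. of_nat (Suc k) * c (Suc k) * (1 + (x - u) / T * z) ^ k * z))
        ((1 / T) * lc_phi (lc_dcoeffs b) ((x - u) / T))" by (rule cw_conv_mult[OF c2[OF dx]])
      moreover have "(1 / T) * (\<Sum>k\<le>K. of_nat (Suc k) * c (Suc k) * (1 + (x - u) / T * z) ^ k * z)
          = (\<Sum>k\<le>K. of_nat (Suc k) * a (Suc k) * (x - x\<^sub>0) ^ k)" for K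
        unfolding sum_distrib_left
      proof (rule sum.cong[OF refl])
        fix k
        have 1: "(x - x\<^sub>0) ^ k = (u - x\<^sub>0) ^ k * (1 + (x - u) / T * z) ^ k"
          using lin[of x] by (metis power_mult_distrib)
        have "(u - x\<^sub>0) * z = T" using w by (simp add: ux z_def)
        then have 2: "(1 / T) * ((u - x\<^sub>0) * z) = 1" using T by simp
        have "1 / T * (of_nat (Suc k) * c (Suc k) * (1 + (x - u) / T * z) ^ k * z)
          = ((1 / T) * ((u - x\<^sub>0) * z)) * (of_nat (Suc k) * a (Suc k) * ((u - x\<^sub>0) ^ k * (1 + (x - u) / T * z) ^ k))"
          by (simp add: c_def ac_simps del: of_nat_Suc)
        then show "1 / T * (of_nat (Suc k) * c (Suc k) * (1 + (x - u) / T * z) ^ k * z)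
          = of_nat (Suc k) * a (Suc k) * (x - x\<^sub>0) ^ k" unfolding 2 1 by simp
      qed
      ultimately show "cw_conv (\<lambda>K. \<Sum>k\<le>K. of_nat (Suc k) * a (Suc k) * (x - x\<^sub>0) ^ k)
        (lc_phi (lc_dcoeffs b) ((x - u) / T) / T)" by simp
    qed
  qed
qed

section \<open>Derivatives and analytic primitives on the field\<close>

section \<open>Derivatives in the order topology\<close>

text \<open>The limit of the difference quotients, cleared of denominators: the inequality also
  covers y = x, so sums and products need no case distinction.\<close>

definition lc_has_deriv ::
    "(levi_civita \<Rightarrow> levi_civita) \<Rightarrow> levi_civita \<Rightarrow> levi_civita \<Rightarrow> levi_civita set \<Rightarrow> bool" where
  "lc_has_deriv f D x A \<longleftrightarrow>
    (\<forall>e>0. \<exists>d>0. \<forall>y\<in>A. \<bar>y - x\<bar> < d \<longrightarrow> \<bar>f y - f x - D * (y - x)\<bar> \<le> e * \<bar>y - x\<bar>)"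

lemma lc_has_deriv_iff_tendsto:
  "lc_has_deriv f D x A \<longleftrightarrow> ((\<lambda>y. (f y - f x) / (y - x)) \<longlongrightarrow> D) (at x within A)"
proof -
  have q: "(f y - f x) / (y - x) - D = (f y - f x - D * (y - x)) / (y - x)" if "y \<noteq> x" for y
    using that by (simp add: field_simps)
  have le: "\<bar>(f y - f x) / (y - x) - D\<bar> \<le> e \<longleftrightarrow> \<bar>f y - f x - D * (y - x)\<bar> \<le> e * \<bar>y - x\<bar>"
    if "y \<noteq> x" for y e using that by (simp add: q abs_divide divide_le_eq)
  show ?thesis
  proof
    assume h: "lc_has_deriv f D x A"
    show "((\<lambda>y. (f y - f x) / (y - x)) \<longlongrightarrow> D) (at x within A)"
      unfolding lc_tendsto_at_iff
    proof (intro allI impI)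
      fix e :: levi_civita assume e: "e > 0"
      then obtain d where d: "d > 0" "\<And>y. y \<in> A \<Longrightarrow> \<bar>y - x\<bar> < d \<Longrightarrow> \<bar>f y - f x - D * (y - x)\<bar> \<le> e / 2 * \<bar>y - x\<bar>"
        using h unfolding lc_has_deriv_def by (meson half_gt_zero)
      show "\<exists>d>0. \<forall>y\<in>A. y \<noteq> x \<and> \<bar>y - x\<bar> < d \<longrightarrow> \<bar>(f y - f x) / (y - x) - D\<bar> < e"
      proof (intro exI[of _ d] conjI ballI impI d(1))
        fix y assume y: "y \<in> A" "y \<noteq> x \<and> \<bar>y - x\<bar> < d"
        then have "\<bar>(f y - f x) / (y - x) - D\<bar> \<le> e / 2" using d(2)[of y] le[of y "e / 2"] by blast
        also have "e / 2 < e" using e by simp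
        finally show "\<bar>(f y - f x) / (y - x) - D\<bar> < e" .
      qed
    qed
  next
    assume h: "((\<lambda>y. (f y - f x) / (y - x)) \<longlongrightarrow> D) (at x within A)"
    show "lc_has_deriv f D x A" unfolding lc_has_deriv_def
    proof (intro allI impI)
      fix e :: levi_civita assume "e > 0"
      then obtain d where d: "d > 0" "\<And>y. y \<in> A \<Longrightarrow> y \<noteq> x \<Longrightarrow> \<bar>y - x\<bar> < d \<Longrightarrow> \<bar>(f y - f x) / (y - x) - D\<bar> < e"
        using h unfolding lc_tendsto_at_iff by blast
      show "\<exists>d>0. \<forall>y\<in>A. \<bar>y - x\<bar> < d \<longrightarrow> \<bar>f y - f x - D * (y - x)\<bar> \<le> e * \<bar>y - x\<bar>"
      proof (intro exI[of _ d] conjI ballI impI d(1))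
        fix y assume y: "y \<in> A" "\<bar>y - x\<bar> < d"
        show "\<bar>f y - f x - D * (y - x)\<bar> \<le> e * \<bar>y - x\<bar>"
        proof (cases "y = x")
          case False then show ?thesis using d(2)[OF y(1) False y(2)] le[OF False, of e] by simp
        qed simp
      qed
    qed
  qed
qed

lemma lc_has_deriv_subset: "lc_has_deriv f D x B \<Longrightarrow> A \<subseteq> B \<Longrightarrow> lc_has_deriv f D x A"
  unfolding lc_has_deriv_def by (meson subsetD)

lemma lc_has_deriv_cong:
  assumes "lc_has_deriv f D x A" "x \<in> A" "\<And>y. y \<in> A \<Longrightarrow> f y = g y" shows "lc_has_deriv g D x A"
  using assms unfolding lc_has_deriv_def by (metis (no_types, lifting))

lemma lc_interval_limit_point:
  assumes "lc_interval u v I" "u < v" "x \<in> {u..v}" shows "at x within I \<noteq> bot"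
proof -
  have "\<exists>y\<in>I. y \<noteq> x \<and> \<bar>y - x\<bar> < d" if d: "d > 0" for d
  proof (cases "x < v")
    case True
    obtain y where "x < y" "y < min v (x + d)" using dense[of x "min v (x + d)"] True d by auto
    then show ?thesis using assms lc_interval_mem(2)[OF assms(1)] by (intro bexI[of _ y]) auto
  next
    case False
    obtain y where "max u (x - d) < y" "y < x" using dense[of "max u (x - d)" x] False assms d by auto
    then show ?thesis using assms lc_interval_mem(2)[OF assms(1)] by (intro bexI[of _ y]) auto
  qed
  then have "\<not> eventually (\<lambda>y. False) (at x within I)" unfolding lc_eventually_at by blast
  then show ?thesis by auto
qed

lemma lc_has_deriv_unique:
  assumes "lc_has_deriv f D x I" "lc_has_deriv f D' x I" "lc_interval u v I" "u < v" "x \<in> I"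
  shows "D = D'"
proof -
  have "at x within I \<noteq> bot" using lc_interval_limit_point[OF assms(3,4)] lc_interval_mem(1)[OF assms(3)] assms(5) by blast
  then show ?thesis using assms(1,2) unfolding lc_has_deriv_iff_tendsto by (rule tendsto_unique)
qed

lemma lc_has_deriv_lipschitz:
  assumes "lc_has_deriv f D x A"
  shows "\<exists>d>0. \<forall>y\<in>A. \<bar>y - x\<bar> < d \<longrightarrow> \<bar>f y - f x\<bar> \<le> (\<bar>D\<bar> + 1) * \<bar>y - x\<bar>"
proof -
  obtain d where d: "d > 0" "\<And>y. y \<in> A \<Longrightarrow> \<bar>y - x\<bar> < d \<Longrightarrow> \<bar>f y - f x - D * (y - x)\<bar> \<le> 1 * \<bar>y - x\<bar>"
    using assms unfolding lc_has_deriv_def by (meson zero_less_one)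
  have "\<bar>f y - f x\<bar> \<le> (\<bar>D\<bar> + 1) * \<bar>y - x\<bar>" if "y \<in> A" "\<bar>y - x\<bar> < d" for y
  proof -
    have "\<bar>f y - f x\<bar> \<le> \<bar>f y - f x - D * (y - x)\<bar> + \<bar>D * (y - x)\<bar>" by linarith
    also have "\<dots> \<le> \<bar>y - x\<bar> + \<bar>D\<bar> * \<bar>y - x\<bar>" unfolding abs_mult using d(2)[OF that] by simp
    finally show ?thesis by (simp add: distrib_right)
  qed
  then show ?thesis using d(1) by blast
qed

lemma lc_has_deriv_continuous:
  assumes "lc_has_deriv f D x A" "e > 0"
  shows "\<exists>d>0. \<forall>y\<in>A. \<bar>y - x\<bar> < d \<longrightarrow> \<bar>f y - f x\<bar> < e"
proof -
  obtain d where d: "d > 0" "\<And>y. y \<in> A \<Longrightarrow> \<bar>y - x\<bar> < d \<Longrightarrow> \<bar>f y - f x\<bar> \<le> (\<bar>D\<bar> + 1) * \<bar>y - x\<bar>"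
    using lc_has_deriv_lipschitz[OF assms(1)] by blast
  have D: "0 < \<bar>D\<bar> + 1" by (simp add: add_nonneg_pos)
  have "\<bar>f y - f x\<bar> < e" if "y \<in> A" "\<bar>y - x\<bar> < min d (e / (\<bar>D\<bar> + 1))" for y
  proof -
    have "(\<bar>D\<bar> + 1) * \<bar>y - x\<bar> < e" using that(2) D by (simp add: less_divide_eq mult.commute)
    then show ?thesis using d(2)[OF that(1)] that(2) by simp
  qed
  then show ?thesis using d(1) assms(2) D by (intro exI[of _ "min d (e / (\<bar>D\<bar> + 1))"]) auto
qed

lemma lc_has_deriv_tendsto: "lc_has_deriv f D x A \<Longrightarrow> (f \<longlongrightarrow> f x) (at x within A)"
  unfolding lc_tendsto_at_iff using lc_has_deriv_continuous by blast

lemma lc_has_deriv_add: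
  assumes "lc_has_deriv f D x A" "lc_has_deriv g D' x A"
  shows "lc_has_deriv (\<lambda>x. f x + g x) (D + D') x A"
  unfolding lc_has_deriv_def
proof (intro allI impI)
  fix e :: levi_civita assume e: "e > 0"
  obtain d where d: "d > 0" "\<And>y. y \<in> A \<Longrightarrow> \<bar>y - x\<bar> < d \<Longrightarrow> \<bar>f y - f x - D * (y - x)\<bar> \<le> e / 2 * \<bar>y - x\<bar>"
    using assms(1) e unfolding lc_has_deriv_def by (meson half_gt_zero)
  obtain d' where d': "d' > 0" "\<And>y. y \<in> A \<Longrightarrow> \<bar>y - x\<bar> < d' \<Longrightarrow> \<bar>g y - g x - D' * (y - x)\<bar> \<le> e / 2 * \<bar>y - x\<bar>"
    using assms(2) e unfolding lc_has_deriv_def by (meson half_gt_zero)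
  have "\<bar>(f y + g y) - (f x + g x) - (D + D') * (y - x)\<bar> \<le> e * \<bar>y - x\<bar>"
    if "y \<in> A" "\<bar>y - x\<bar> < min d d'" for y
  proof -
    have "(f y + g y) - (f x + g x) - (D + D') * (y - x)
      = (f y - f x - D * (y - x)) + (g y - g x - D' * (y - x))" by (simp add: algebra_simps)
    also have "\<bar>\<dots>\<bar> \<le> e / 2 * \<bar>y - x\<bar> + e / 2 * \<bar>y - x\<bar>"
      using d(2)[OF that(1)] d'(2)[OF that(1)] that(2) by (intro order.trans[OF abs_triangle_ineq] add_mono) auto
    finally show ?thesis by (simp add: field_simps)
  qed
  then show "\<exists>d>0. \<forall>y\<in>A. \<bar>y - x\<bar> < d \<longrightarrow> \<bar>(f y + g y) - (f x + g x) - (D + D') * (y - x)\<bar> \<le> e * \<bar>y - x\<bar>"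
    using d(1) d'(1) by (intro exI[of _ "min d d'"]) auto
qed

lemma lc_has_deriv_const: "lc_has_deriv (\<lambda>_. c) 0 x A"
  unfolding lc_has_deriv_def by (auto intro!: exI[of _ 1])

lemma lc_has_deriv_ident: "lc_has_deriv (\<lambda>x. x) 1 x A"
  unfolding lc_has_deriv_def by (auto intro!: exI[of _ 1])

lemma lc_has_deriv_mult:
  assumes "lc_has_deriv f D x A" "lc_has_deriv g D' x A"
  shows "lc_has_deriv (\<lambda>x. f x * g x) (D * g x + f x * D') x A"
  unfolding lc_has_deriv_def
proof (intro allI impI)
  fix e :: levi_civita assume e: "e > 0"
  define C where "C = \<bar>g x\<bar> + \<bar>f x\<bar> + \<bar>D'\<bar> + 1"
  have C: "0 < C" by (simp add: C_def add_nonneg_pos)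
  have eC: "0 < e / C" using e C by simp
  obtain d1 where d1: "d1 > 0" "\<And>y. y \<in> A \<Longrightarrow> \<bar>y - x\<bar> < d1 \<Longrightarrow> \<bar>f y - f x - D * (y - x)\<bar> \<le> e / C * \<bar>y - x\<bar>"
    using assms(1) eC unfolding lc_has_deriv_def by meson
  obtain d2 where d2: "d2 > 0" "\<And>y. y \<in> A \<Longrightarrow> \<bar>y - x\<bar> < d2 \<Longrightarrow> \<bar>g y - g x - D' * (y - x)\<bar> \<le> e / C * \<bar>y - x\<bar>"
    using assms(2) eC unfolding lc_has_deriv_def by meson
  obtain d3 where d3: "d3 > 0" "\<And>y. y \<in> A \<Longrightarrow> \<bar>y - x\<bar> < d3 \<Longrightarrow> \<bar>f y - f x\<bar> < e / C"
    using lc_has_deriv_continuous[OF assms(1) eC] by blast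
  obtain d4 where d4: "d4 > 0" "\<And>y. y \<in> A \<Longrightarrow> \<bar>y - x\<bar> < d4 \<Longrightarrow> \<bar>g y - g x\<bar> \<le> (\<bar>D'\<bar> + 1) * \<bar>y - x\<bar>"
    using lc_has_deriv_lipschitz[OF assms(2)] by blast
  define d where "d = min (min d1 d2) (min d3 d4)"
  have "\<bar>f y * g y - f x * g x - (D * g x + f x * D') * (y - x)\<bar> \<le> e * \<bar>y - x\<bar>"
    if y: "y \<in> A" "\<bar>y - x\<bar> < d" for y
  proof -
    have yd: "\<bar>y - x\<bar> < d1" "\<bar>y - x\<bar> < d2" "\<bar>y - x\<bar> < d3" "\<bar>y - x\<bar> < d4" using y(2) by (auto simp: d_def)
    let ?n = "\<bar>y - x\<bar>"
    have "f y * g y - f x * g x - (D * g x + f x * D') * (y - x)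
      = g x * (f y - f x - D * (y - x)) + f x * (g y - g x - D' * (y - x)) + (f y - f x) * (g y - g x)"
      by (simp add: algebra_simps)
    also have "\<bar>\<dots>\<bar> \<le> \<bar>g x\<bar> * \<bar>f y - f x - D * (y - x)\<bar> + \<bar>f x\<bar> * \<bar>g y - g x - D' * (y - x)\<bar> + \<bar>f y - f x\<bar> * \<bar>g y - g x\<bar>"
      unfolding abs_mult[symmetric] by linarith
    also have "\<dots> \<le> \<bar>g x\<bar> * (e / C * ?n) + \<bar>f x\<bar> * (e / C * ?n) + e / C * ((\<bar>D'\<bar> + 1) * ?n)"
      using d1(2)[OF y(1) yd(1)] d2(2)[OF y(1) yd(2)] d3(2)[OF y(1) yd(3)] d4(2)[OF y(1) yd(4)] eC
      by (intro add_mono mult_left_mono mult_mono) auto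
    also have "\<dots> = (e / C) * (C * ?n)" by (simp add: C_def algebra_simps add_divide_distrib)
    also have "\<dots> = e * ?n" using C by simp
    finally show ?thesis .
  qed
  moreover have "d > 0" using d1 d2 d3 d4 by (simp add: d_def)
  ultimately show "\<exists>d>0. \<forall>y\<in>A. \<bar>y - x\<bar> < d \<longrightarrow>
      \<bar>f y * g y - f x * g x - (D * g x + f x * D') * (y - x)\<bar> \<le> e * \<bar>y - x\<bar>" by blast
qed

lemma lc_has_deriv_cmult:
  assumes "lc_has_deriv f D x A" shows "lc_has_deriv (\<lambda>x. c * f x) (c * D) x A"
  using lc_has_deriv_mult[OF lc_has_deriv_const assms, of c] by simp

lemma lc_has_deriv_poly: "lc_has_deriv (poly p) (poly (pderiv p) x) x A"
proof (induction p)
  case 0 then show ?case by (simp add: lc_has_deriv_const)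
next
  case (pCons a p)
  have "lc_has_deriv (\<lambda>x. a + x * poly p x) (0 + (1 * poly p x + x * poly (pderiv p) x)) x A"
    by (intro lc_has_deriv_add lc_has_deriv_const lc_has_deriv_mult lc_has_deriv_ident pCons)
  then show ?case by (simp add: pderiv_pCons)
qed

section \<open>Analytic functions in a frame\<close>

text \<open>The frame is a parameter because functions can be added coefficientwise only in a common
  frame; a function, its derivative and its products with polynomials all share one.\<close>

definition lc_ana :: "levi_civita set \<Rightarrow> levi_civita \<Rightarrow> levi_civita \<Rightarrow> (levi_civita \<Rightarrow> levi_civita) \<Rightarrow> bool" where
  "lc_ana I y \<tau> f \<longleftrightarrow> (\<exists>e. lc_rapid e \<and> (\<forall>x\<in>I. f x = lc_phi e ((x - y) / \<tau>)))"

lemma lc_ana_subset: "lc_ana J y \<tau> f \<Longrightarrow> I \<subseteq> J \<Longrightarrow> lc_ana I y \<tau> f"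
  unfolding lc_ana_def by blast

lemma lc_ana_cong: "lc_ana I y \<tau> f \<Longrightarrow> (\<And>x. x \<in> I \<Longrightarrow> g x = f x) \<Longrightarrow> lc_ana I y \<tau> g"
  unfolding lc_ana_def by (metis (no_types, lifting))

lemma lc_ana_const:
  assumes "lc_frame u v y \<tau>" "I \<subseteq> {u..v}" shows "lc_ana I y \<tau> (\<lambda>_. c)"
  unfolding lc_ana_def
  using lc_frame_disc[OF assms(1)] assms(2)
  by (intro exI[of _ "\<lambda>k. if k = 0 then c else 0"] conjI lc_rapid_const ballI) (auto simp: lc_phi_const)

lemma lc_ana_add:
  assumes "lc_frame u v y \<tau>" "I \<subseteq> {u..v}" "lc_ana I y \<tau> f" "lc_ana I y \<tau> g"
  shows "lc_ana I y \<tau> (\<lambda>x. f x + g x)"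
proof -
  obtain e e' where e: "lc_rapid e" "\<forall>x\<in>I. f x = lc_phi e ((x - y) / \<tau>)"
    and e': "lc_rapid e'" "\<forall>x\<in>I. g x = lc_phi e' ((x - y) / \<tau>)" using assms unfolding lc_ana_def by blast
  have "\<forall>x\<in>I. f x + g x = lc_phi (\<lambda>k. e k + e' k) ((x - y) / \<tau>)"
    using e e' lc_phi_add[OF e(1) e'(1)] lc_frame_disc[OF assms(1)] assms(2) by (metis subsetD)
  then show ?thesis using lc_rapid_add[OF e(1) e'(1)] unfolding lc_ana_def by blast
qed

lemma lc_ana_cmult:
  assumes "lc_frame u v y \<tau>" "I \<subseteq> {u..v}" "lc_ana I y \<tau> f"
  shows "lc_ana I y \<tau> (\<lambda>x. c * f x)"
proof -
  obtain e where e: "lc_rapid e" "\<forall>x\<in>I. f x = lc_phi e ((x - y) / \<tau>)" using assms unfolding lc_ana_def by blast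
  have "\<forall>x\<in>I. c * f x = lc_phi (\<lambda>k. c * e k) ((x - y) / \<tau>)"
    using e lc_phi_cmult[OF e(1)] lc_frame_disc[OF assms(1)] assms(2) by (metis subsetD)
  then show ?thesis using lc_rapid_cmult[OF e(1)] unfolding lc_ana_def by blast
qed

text \<open>x = y + \<tau> t with t = (x - y) / \<tau>, and multiplication by t only shifts the
  coefficients. By Horner's scheme this leads to products with polynomials and spares a Cauchy
  product of two series.\<close>

lemma lc_ana_mult_ident:
  assumes fr: "lc_frame u v y \<tau>" and I: "I \<subseteq> {u..v}" and f: "lc_ana I y \<tau> f"
  shows "lc_ana I y \<tau> (\<lambda>x. x * f x)"
proof -
  obtain e where e: "lc_rapid e" "\<forall>x\<in>I. f x = lc_phi e ((x - y) / \<tau>)" using f unfolding lc_ana_def by blast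
  let ?e = "\<lambda>k. if k = 0 then 0 else e (k - 1)"
  have re: "lc_rapid ?e" using lc_rapid_shift[OF e(1), of "\<lambda>_. 1"] by (simp cong: if_cong)
  have "\<forall>x\<in>I. ((x - y) / \<tau>) * f x = lc_phi ?e ((x - y) / \<tau>)"
    using e lc_phi_shift[OF e(1)] lc_frame_disc[OF fr] I by (metis subsetD)
  then have "lc_ana I y \<tau> (\<lambda>x. ((x - y) / \<tau>) * f x)" using re unfolding lc_ana_def by blast
  then have "lc_ana I y \<tau> (\<lambda>x. y * f x + \<tau> * (((x - y) / \<tau>) * f x))"
    by (intro lc_ana_add[OF fr I] lc_ana_cmult[OF fr I] f)
  moreover have "0 < \<tau>" using fr by (simp add: lc_frame_def)
  then have "y * f x + \<tau> * (((x - y) / \<tau>) * f x) = x * f x" for x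
  proof -
    have "\<tau> * (((x - y) / \<tau>) * f x) = (x - y) * f x" using \<open>0 < \<tau>\<close> by (simp add: mult.assoc[symmetric])
    then show ?thesis by (simp only:) (simp add: algebra_simps)
  qed
  ultimately show ?thesis by simp
qed

lemma lc_ana_mult_poly:
  assumes "lc_frame u v y \<tau>" "I \<subseteq> {u..v}" "lc_ana I y \<tau> f"
  shows "lc_ana I y \<tau> (\<lambda>x. f x * poly p x)"
proof (induction p)
  case 0 then show ?case using lc_ana_const[OF assms(1,2), of 0] by simp
next
  case (pCons a p)
  have "lc_ana I y \<tau> (\<lambda>x. a * f x + x * (f x * poly p x))"
    by (intro lc_ana_add[OF assms(1,2)] lc_ana_cmult[OF assms] lc_ana_mult_ident[OF assms(1,2)] pCons)
  then show ?case by (simp add: algebra_simps)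
qed

lemma lc_ana_bounded:
  assumes fr: "lc_frame u v y \<tau>" and I: "I \<subseteq> {u..v}" and f: "lc_ana I y \<tau> f"
  shows "\<exists>M. \<forall>x\<in>I. \<bar>f x\<bar> \<le> M"
proof -
  obtain e where e: "lc_rapid e" "\<forall>x\<in>I. f x = lc_phi e ((x - y) / \<tau>)" using f unfolding lc_ana_def by blast
  obtain m where m: "\<And>k. lc_ge m (e k)" using lc_rapid_ge[OF e(1)] by blast
  have "\<bar>f x\<bar> \<le> lc_d (m - 1)" if "x \<in> I" for x
  proof -
    have "lc_ge m (f x)" using e(2) that lc_phi_ge[OF e(1) _ m] lc_frame_disc[OF fr, of x] I by auto
    then show ?thesis using lc_ge_abs_less_d[of m "f x" "m - 1"] by simp
  qed
  then show ?thesis by blast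
qed

lemma lc_ana_simple:
  assumes fr: "lc_frame u v y \<tau>" and I: "I \<subseteq> {u..v}" and e: "lc_rapid e" "\<And>x. x \<in> I \<Longrightarrow> f x = lc_phi e ((x - y) / \<tau>)"
  shows "lc_power_series_on I (\<lambda>k. e k / \<tau> ^ k) y f"
  unfolding lc_power_series_on_def
proof
  fix x assume x: "x \<in> I"
  have "lc_disc ((x - y) / \<tau>)" using lc_frame_disc[OF fr] I x by blast
  from lc_phi_weak[OF e(1) this]
  show "weakly_converges (\<lambda>K. \<Sum>k\<le>K. e k / \<tau> ^ k * (x - y) ^ k) (f x)"
    using e(2)[OF x] by (simp add: power_divide)
qed

lemma lc_ana_imp_simple:
  "lc_frame u v y \<tau> \<Longrightarrow> I \<subseteq> {u..v} \<Longrightarrow> lc_ana I y \<tau> f \<Longrightarrow> lc_simple_on I f"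
  unfolding lc_ana_def lc_simple_on_def using lc_ana_simple by blast

lemma lc_simple_imp_ana:
  assumes "lc_interval u v I" "u < v" "lc_simple_on I f"
  obtains y \<tau> where "lc_frame u v y \<tau>" "lc_ana I y \<tau> f"
proof -
  obtain x0 a where "lc_power_series_on I a x0 f" using assms(3) by (auto simp: lc_simple_on_def)
  from lc_normal_form[OF assms(1,2) this] show ?thesis using that unfolding lc_ana_def by metis
qed

lemma lc_rep_deriv:
  assumes fr: "lc_frame u v y \<tau>" and e: "lc_rapid e" and x: "x \<in> {u..v}"
  shows "lc_has_deriv (\<lambda>x. lc_phi e ((x - y) / \<tau>)) (lc_phi (lc_dcoeffs e) ((x - y) / \<tau>) / \<tau>) x {u..v}"
  unfolding lc_has_deriv_def
proof (intro allI impI)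
  fix \<epsilon> :: levi_civita assume "\<epsilon> > 0"
  have \<tau>: "0 < \<tau>" using fr by (simp add: lc_frame_def)
  obtain K where K: "0 < K" "\<And>t h. lc_disc t \<Longrightarrow> lc_disc (t + h) \<Longrightarrow>
    \<bar>lc_phi e (t + h) - lc_phi e t - h * lc_phi (lc_dcoeffs e) t\<bar> \<le> K * h ^ 2"
    using lc_phi_deriv[OF e] by blast
  let ?D = "lc_phi (lc_dcoeffs e) ((x - y) / \<tau>)"
  have "\<bar>lc_phi e ((z - y) / \<tau>) - lc_phi e ((x - y) / \<tau>) - ?D / \<tau> * (z - x)\<bar> \<le> \<epsilon> * \<bar>z - x\<bar>"
    if z: "z \<in> {u..v}" "\<bar>z - x\<bar> < \<epsilon> * \<tau> ^ 2 / K" for z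
  proof -
    define h where "h = (z - x) / \<tau>"
    have th: "(x - y) / \<tau> + h = (z - y) / \<tau>" by (simp add: h_def add_divide_distrib[symmetric])
    have "\<bar>lc_phi e ((z - y) / \<tau>) - lc_phi e ((x - y) / \<tau>) - h * ?D\<bar> \<le> K * h ^ 2"
      using K(2)[OF lc_frame_disc[OF fr x], of h] lc_frame_disc[OF fr z(1)] unfolding th by blast
    moreover have "h * ?D = ?D / \<tau> * (z - x)" by (simp add: h_def)
    moreover have "K * h ^ 2 \<le> \<epsilon> * \<bar>z - x\<bar>"
    proof -
      have "K * \<bar>z - x\<bar> \<le> \<epsilon> * \<tau> ^ 2" using z(2) K(1) by (simp add: less_divide_eq mult.commute)
      then have "K * \<bar>z - x\<bar> * \<bar>z - x\<bar> \<le> \<epsilon> * \<tau> ^ 2 * \<bar>z - x\<bar>" by (rule mult_right_mono) simp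
      moreover have "\<bar>z - x\<bar> * \<bar>z - x\<bar> = (z - x) ^ 2" by (simp add: power2_eq_square abs_mult[symmetric])
      ultimately have "K * (z - x) ^ 2 \<le> (\<epsilon> * \<bar>z - x\<bar>) * \<tau> ^ 2" by (simp add: mult.assoc mult.commute mult.left_commute)
      then show ?thesis using \<tau> by (simp add: h_def power_divide divide_le_eq)
    qed
    ultimately show ?thesis by simp
  qed
  moreover have "0 < \<epsilon> * \<tau> ^ 2 / K" using \<open>\<epsilon> > 0\<close> \<tau> K(1) by simp
  ultimately show "\<exists>d>0. \<forall>z\<in>{u..v}. \<bar>z - x\<bar> < d \<longrightarrow>
      \<bar>lc_phi e ((z - y) / \<tau>) - lc_phi e ((x - y) / \<tau>) - ?D / \<tau> * (z - x)\<bar> \<le> \<epsilon> * \<bar>z - x\<bar>" by blast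
qed

text \<open>\<open>f'\<close> is given only through difference quotients. Uniqueness of the
  derivative identifies it with the termwise derived series, whose coefficients are again
  rapid.\<close>

lemma lc_ana_deriv_on:
  assumes I: "lc_interval u v I" and fr: "lc_frame u v y \<tau>" and f: "lc_ana I y \<tau> f"
    and D: "\<And>x. x \<in> I \<Longrightarrow> lc_has_deriv f (f' x) x I"
  shows "lc_ana I y \<tau> f'"
proof -
  obtain e where e: "lc_rapid e" "\<And>x. x \<in> I \<Longrightarrow> f x = lc_phi e ((x - y) / \<tau>)" using f unfolding lc_ana_def by blast
  have uv: "u < v" using fr by (simp add: lc_frame_def)
  have "f' x = lc_phi (\<lambda>k. (1 / \<tau>) * lc_dcoeffs e k) ((x - y) / \<tau>)" if x: "x \<in> I" for x
  proof -
    have xu: "x \<in> {u..v}" using lc_interval_mem(1)[OF I] x by blast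
    have "lc_has_deriv f (lc_phi (lc_dcoeffs e) ((x - y) / \<tau>) / \<tau>) x I"
      by (rule lc_has_deriv_cong[OF lc_has_deriv_subset[OF lc_rep_deriv[OF fr e(1) xu] lc_interval_mem(1)[OF I]] x])
        (simp add: e(2))
    from lc_has_deriv_unique[OF D[OF x] this I uv x]
    show ?thesis using lc_phi_cmult[OF lc_rapid_comp_Suc[OF e(1)] lc_frame_disc[OF fr xu], of "1 / \<tau>"] by simp
  qed
  moreover have "lc_rapid (\<lambda>k. (1 / \<tau>) * lc_dcoeffs e k)" by (intro lc_rapid_cmult lc_rapid_comp_Suc e)
  ultimately show ?thesis unfolding lc_ana_def by blast
qed

lemma lc_simple_deriv_poly:
  assumes I: "lc_interval u v I" and f: "lc_simple_on I f"
    and D: "\<And>x. x \<in> I \<Longrightarrow> lc_has_deriv f (f' x) x I"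
  shows "lc_simple_on I (\<lambda>x. f' x * poly p x)"
proof (cases "u < v")
  case True
  obtain y \<tau> where fr: "lc_frame u v y \<tau>" and a: "lc_ana I y \<tau> f"
    by (rule lc_simple_imp_ana[OF I True f])
  have "lc_ana I y \<tau> (\<lambda>x. f' x * poly p x)"
    by (intro lc_ana_mult_poly[OF fr lc_interval_mem(1)[OF I]] lc_ana_deriv_on[OF I fr a D])
  then show ?thesis by (rule lc_ana_imp_simple[OF fr lc_interval_mem(1)[OF I]])
next
  case False
  \<comment> \<open>A degenerate interval has at most one point, where a constant series
    suffices.\<close>
  then have "I \<subseteq> {u}" using I by (auto simp: lc_interval_def)
  moreover have "weakly_converges (\<lambda>K. \<Sum>k\<le>K. (if k = 0 then c else 0) * (u - u) ^ k) c" for c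
    by (rule weakI) (auto simp: lc_regular_def cw_conv_def if_distrib[of "\<lambda>x. x * _"] sum.delta cong: if_cong
        intro: exI[of _ "lc_supp c"] left_finite_supp)
  ultimately show ?thesis unfolding lc_simple_on_def lc_power_series_on_def
    by (intro exI[of _ u] exI[of _ "\<lambda>k. if k = 0 then f' u * poly p u else 0"]) fastforce
qed

section \<open>Primitives\<close>

text \<open>Analyticity belongs to the notion: it is what makes increments comparable in
  \<open>lc_prim_mono\<close>, where the derivative alone would not suffice.\<close>

definition lc_prim ::
    "(levi_civita \<Rightarrow> levi_civita) \<Rightarrow> (levi_civita \<Rightarrow> levi_civita) \<Rightarrow> levi_civita \<Rightarrow> levi_civita \<Rightarrow> bool" where
  "lc_prim g F u v \<longleftrightarrow> (\<exists>y \<tau>. lc_frame u v y \<tau> \<and> lc_ana {u..v} y \<tau> F)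
    \<and> (\<forall>x\<in>{u..v}. lc_has_deriv F (g x) x {u..v})"

lemma lc_prim_less: "lc_prim g F u v \<Longrightarrow> u < v"
  by (auto simp: lc_prim_def lc_frame_def)

lemma lc_prim_subset:
  assumes "lc_prim g F u v" "u \<le> x" "x < z" "z \<le> v" shows "lc_prim g F x z"
proof -
  have s: "{x..z} \<subseteq> {u..v}" using assms by auto
  obtain y \<tau> where "lc_frame u v y \<tau>" "lc_ana {u..v} y \<tau> F" using assms(1) unfolding lc_prim_def by blast
  then have "lc_frame x z y \<tau>" "lc_ana {x..z} y \<tau> F"
    using lc_frame_subset assms lc_ana_subset[OF _ s] by blast+
  then show ?thesis using assms(1) s lc_has_deriv_subset unfolding lc_prim_def by blast
qed

lemma lc_closed_interval: "u \<le> v \<Longrightarrow> lc_interval u v {u..v}"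
  by (simp add: lc_interval_def)

lemma lc_prim_linear: assumes "u < v" shows "lc_prim (\<lambda>_. c) (\<lambda>x. c * x) u v"
proof -
  have "lc_disc 0" "lc_disc 1" by (auto simp: lc_disc_def lc_ge_1 lc_coeff_zero lc_coeff_one)
  then have fr: "lc_frame u v u (v - u)" using assms by (simp add: lc_frame_def)
  have "lc_ana {u..v} u (v - u) (\<lambda>x. c * (x * 1))"
    by (intro lc_ana_cmult[OF fr] lc_ana_mult_ident[OF fr] lc_ana_const[OF fr]) auto
  moreover have "lc_has_deriv (\<lambda>x. c * x) (c * 1) x {u..v}" for x by (intro lc_has_deriv_cmult lc_has_deriv_ident)
  ultimately show ?thesis using fr unfolding lc_prim_def by fastforce
qed

lemma lc_of_real_nonneg: assumes "0 \<le> c" shows "0 \<le> (of_real c :: levi_civita)"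
proof (cases "c = 0")
  case False
  then have "0 < (of_real c :: levi_civita)" unfolding lc_gt_0_iff
    using assms by (intro exI[of _ 0]) (simp add: lc_coeff_of_real lc_ge_of_real)
  then show ?thesis by simp
qed simp

lemma lc_of_real_le: "c \<le> d \<Longrightarrow> (of_real c :: levi_civita) \<le> of_real d"
  using lc_of_real_nonneg[of "d - c"] by simp

lemma lc_segment_mem:
  assumes "u < v" "s \<in> {0..1}" shows "u + of_real s * (v - u) \<in> {u..v :: levi_civita}"
proof -
  have s: "0 \<le> (of_real s :: levi_civita)" "(of_real s :: levi_civita) \<le> 1"
    using assms(2) lc_of_real_nonneg lc_of_real_le[of s 1] by auto
  have "0 \<le> of_real s * (v - u)" using assms(1) s(1) by simp
  moreover have "of_real s * (v - u) \<le> 1 * (v - u)" using assms(1) s(2) by (intro mult_right_mono) auto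
  ultimately show ?thesis by simp
qed

lemma lc_prim_line:
  assumes "lc_prim g F u v"
  shows "s \<in> {0..1} \<Longrightarrow> cw_deriv (\<lambda>s. F (u + of_real s * (v - u))) ((v - u) * g (u + of_real s * (v - u))) s {0..1}"
    and "\<exists>E. left_finite E \<and> (\<forall>s\<in>{0..1}. lc_supp ((v - u) * g (u + of_real s * (v - u))) \<subseteq> E)"
proof -
  obtain y \<tau> e where fr: "lc_frame u v y \<tau>" and e: "lc_rapid e"
    and F: "\<And>x. x \<in> {u..v} \<Longrightarrow> F x = lc_phi e ((x - y) / \<tau>)"
    using assms unfolding lc_prim_def lc_ana_def by blast
  have uv: "u < v" using fr by (simp add: lc_frame_def)
  have \<tau>: "0 < \<tau>" using fr by (simp add: lc_frame_def)
  define k where "k = (v - u) / \<tau>"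
  define t where "t = (u - y) / \<tau>"
  have d: "lc_disc t" "lc_disc (t + k)" using fr by (auto simp: lc_frame_def t_def k_def add_divide_distrib[symmetric])
  have ts: "(u + of_real s * (v - u) - y) / \<tau> = t + of_real s * k" for s
    by (simp add: t_def k_def diff_divide_distrib add_divide_distrib algebra_simps)
  have mem: "u + of_real s * (v - u) \<in> {u..v}" if "s \<in> {0..1}" for s
    using uv that by (intro lc_segment_mem) simp_all
  have g: "(v - u) * g (u + of_real s * (v - u)) = k * lc_phi (lc_dcoeffs e) (t + of_real s * k)" if "s \<in> {0..1}" for s
  proof -
    let ?x = "u + of_real s * (v - u)"
    have "lc_has_deriv F (lc_phi (lc_dcoeffs e) ((?x - y) / \<tau>) / \<tau>) ?x {u..v}"
      using lc_rep_deriv[OF fr e mem[OF that]] mem[OF that] by (rule lc_has_deriv_cong) (simp add: F)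
    moreover have "lc_has_deriv F (g ?x) ?x {u..v}" using assms mem[OF that] unfolding lc_prim_def by blast
    ultimately have "g ?x = lc_phi (lc_dcoeffs e) ((?x - y) / \<tau>) / \<tau>"
      using lc_has_deriv_unique lc_closed_interval uv mem[OF that] less_imp_le by metis
    then show ?thesis unfolding ts by (simp add: k_def)
  qed
  show "cw_deriv (\<lambda>s. F (u + of_real s * (v - u))) ((v - u) * g (u + of_real s * (v - u))) s {0..1}" if s: "s \<in> {0..1}" for s
    unfolding g[OF s] cw_deriv_def
  proof
    fix q
    have "((\<lambda>s. lc_coeff (lc_phi e (t + of_real s * k)) q) has_real_derivative
        lc_coeff (k * lc_phi (lc_dcoeffs e) (t + of_real s * k)) q) (at s within {0..1})"
      using lc_phi_line[OF e d s] by (simp add: cw_deriv_def)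
    from has_field_derivative_transform_within[OF this zero_less_one s]
    show "((\<lambda>s. lc_coeff (F (u + of_real s * (v - u))) q) has_real_derivative
        lc_coeff (k * lc_phi (lc_dcoeffs e) (t + of_real s * k)) q) (at s within {0..1})"
      using F[OF mem] by (simp add: ts)
  qed
  obtain E where E: "left_finite E" "\<And>s. s \<in> {0..1} \<Longrightarrow> lc_supp (lc_phi (lc_dcoeffs e) (t + of_real s * k)) \<subseteq> E"
    using lc_phi_line_supp[OF lc_rapid_comp_Suc[OF e] d] by blast
  show "\<exists>E. left_finite E \<and> (\<forall>s\<in>{0..1}. lc_supp ((v - u) * g (u + of_real s * (v - u))) \<subseteq> E)"
    using left_finite_conv[OF left_finite_supp E(1)] lc_supp_mult[OF subset_refl E(2)] g by (metis (no_types, lifting))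
qed

text \<open>This replaces the mean value theorem. If the increment of H = G - F were negative, let q
  be its leading exponent. The real mean value theorem at exponent q gives a point where the
  derivative h has a negative coefficient at q; since h \<ge> 0, some coefficient below q is nonzero
  there. At the least exponent p of h along the whole segment all coefficients are nonnegative and
  one is positive, so H strictly increases at exponent p < q, where its increment should be
  0.\<close>

lemma lc_prim_mono:
  assumes F: "lc_prim f F u v" and G: "lc_prim g G u v" and fg: "\<And>x. x \<in> {u..v} \<Longrightarrow> f x \<le> g x"
  shows "F v - F u \<le> G v - G u"
proof (rule ccontr)
  have uv: "u < v" by (rule lc_prim_less[OF F])
  let ?x = "\<lambda>s::real. u + of_real s * (v - u)"
  define H where "H s = G (?x s) - F (?x s)" for s
  define h where "h s = (v - u) * g (?x s) - (v - u) * f (?x s)" for s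
  define \<phi> where "\<phi> q s = lc_coeff (H s) q" for q s
  have mem: "?x s \<in> {u..v}" if "s \<in> {0..1}" for s
    using uv that by (intro lc_segment_mem) simp_all
  have D: "(\<phi> q has_real_derivative lc_coeff (h s) q) (at s within {0..1})" if "s \<in> {0..1}" for q s
    using lc_prim_line(1)[OF F that] lc_prim_line(1)[OF G that]
    by (auto simp: \<phi>_def[abs_def] H_def h_def cw_deriv_def lc_coeff_diff intro!: derivative_intros)
  have mvt: "\<exists>s\<in>{a..b}. \<phi> q b - \<phi> q a = lc_coeff (h s) q * (b - a)" if ab: "0 \<le> a" "a \<le> b" "b \<le> 1" for a b q
  proof (rule mvt_very_simple[OF ab(2)])
    fix s assume "a \<le> s" "s \<le> b"
    then have "(\<phi> q has_real_derivative lc_coeff (h s) q) (at s within {a..b})"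
      using D[of s q] ab DERIV_subset[of "\<phi> q" _ s "{0..1}" "{a..b}"] by auto
    then show "(\<phi> q has_derivative (\<lambda>x. lc_coeff (h s) q * x)) (at s within {a..b})"
      by (simp add: has_field_derivative_def)
  qed
  have h0: "0 \<le> h s" if "s \<in> {0..1}" for s
    using mult_left_mono[OF fg[OF mem[OF that]], of "v - u"] uv by (simp add: h_def)
  obtain E1 E2 where E: "left_finite E1" "\<And>s. s \<in> {0..1} \<Longrightarrow> lc_supp ((v - u) * f (?x s)) \<subseteq> E1"
    "left_finite E2" "\<And>s. s \<in> {0..1} \<Longrightarrow> lc_supp ((v - u) * g (?x s)) \<subseteq> E2"
    using lc_prim_line(2)[OF F] lc_prim_line(2)[OF G] by blast
  have hE: "q \<in> E1 \<union> E2" if "lc_coeff (h s) q \<noteq> 0" "s \<in> {0..1}" for s q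
  proof -
    have "q \<in> lc_supp ((v - u) * f (?x s)) \<or> q \<in> lc_supp ((v - u) * g (?x s))"
      using that(1) by (auto simp: h_def lc_coeff_diff lc_supp_def)
    then show ?thesis using E(2,4)[OF that(2)] by blast
  qed
  assume "\<not> F v - F u \<le> G v - G u"
  then have "0 < H 0 - H 1" by (simp add: H_def algebra_simps)
  then obtain q where q: "0 < lc_coeff (H 0 - H 1) q" "lc_ge q (H 0 - H 1)" unfolding lc_gt_0_iff by blast
  have eq: "\<phi> p 1 = \<phi> p 0" if "p < q" for p using lc_geD[OF q(2) that] by (simp add: \<phi>_def lc_coeff_diff)
  have "\<phi> q 1 - \<phi> q 0 < 0" using q(1) by (simp add: \<phi>_def lc_coeff_diff)
  then obtain s where s: "s \<in> {0..1}" "lc_coeff (h s) q < 0" using mvt[of 0 1 q] by force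
  have "\<not> lc_ge q (h s)" using lc_nonneg_coeff[OF h0[OF s(1)], of q] s(2) by auto
  then obtain q1 where q1: "q1 < q" "lc_coeff (h s) q1 \<noteq> 0" by (auto simp: lc_ge_def)
  \<comment> \<open>The common supports make this set finite although it ranges over all points of
    the segment; exponents up to \<open>q1\<close> suffice because the least one is sought.\<close>
  define B where "B = {p. p \<le> q1 \<and> (\<exists>s\<in>{0..1}. lc_coeff (h s) p \<noteq> 0)}"
  have "finite B"
  proof (rule finite_subset)
    show "B \<subseteq> {x \<in> E1 \<union> E2. x \<le> q1}" unfolding B_def using hE by blast
    show "finite {x \<in> E1 \<union> E2. x \<le> q1}" using left_finite_Un[OF E(1,3)] by (simp add: left_finite_def)
  qed
  moreover have "q1 \<in> B" using q1 s(1) by (auto simp: B_def)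
  ultimately have m: "Min B \<in> B" "\<And>p. p \<in> B \<Longrightarrow> Min B \<le> p" by (auto intro: Min_in)
  define p where "p = Min B"
  have pq: "p \<le> q1" using m(2)[OF \<open>q1 \<in> B\<close>] by (simp add: p_def)
  have ge: "lc_ge p (h s)" if "s \<in> {0..1}" for s
    unfolding lc_ge_def
  proof (intro allI impI)
    fix r assume "r < p"
    then have "r \<notin> B" using m(2)[of r] by (auto simp: p_def)
    then show "lc_coeff (h s) r = 0" using that \<open>r < p\<close> pq by (auto simp: B_def)
  qed
  have nn: "0 \<le> lc_coeff (h s) p" if "s \<in> {0..1}" for s by (rule lc_nonneg_coeff[OF h0[OF that] ge[OF that]])
  have mono: "\<phi> p a \<le> \<phi> p b" if ab: "0 \<le> a" "a \<le> b" "b \<le> 1" for a b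
  proof -
    obtain s where s: "s \<in> {a..b}" "\<phi> p b - \<phi> p a = lc_coeff (h s) p * (b - a)" using mvt[OF ab] by blast
    then have "0 \<le> lc_coeff (h s) p * (b - a)" using nn[of s] ab by auto
    then show ?thesis using s(2) by linarith
  qed
  obtain s' where s': "s' \<in> {0..1}" "lc_coeff (h s') p \<noteq> 0" using m(1) by (auto simp: B_def p_def)
  have pos: "0 < lc_coeff (h s') p" using nn[OF s'(1)] s'(2) by simp
  have "\<phi> p 0 < \<phi> p 1"
  proof (cases "s' < 1")
    case True
    obtain d where d: "d > 0" "\<And>x. 0 < x \<Longrightarrow> s' + x \<in> {0..1} \<Longrightarrow> x < d \<Longrightarrow> \<phi> p s' < \<phi> p (s' + x)"
      using has_real_derivative_pos_inc_right[OF D[OF s'(1)] pos] by blast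
    define x where "x = min (d / 2) (1 - s')"
    have "0 < x" "x < d" "s' + x \<in> {0..1}" using True d(1) s'(1) by (auto simp: x_def)
    then have "\<phi> p s' < \<phi> p (s' + x)" using d(2) by blast
    moreover have "\<phi> p 0 \<le> \<phi> p s'" "\<phi> p (s' + x) \<le> \<phi> p 1"
      using s'(1) \<open>s' + x \<in> {0..1}\<close> by (auto intro!: mono)
    ultimately show ?thesis by linarith
  next
    case False
    then have "s' = 1" using s'(1) by simp
    obtain d where d: "d > 0" "\<And>x. 0 < x \<Longrightarrow> s' - x \<in> {0..1} \<Longrightarrow> x < d \<Longrightarrow> \<phi> p (s' - x) < \<phi> p s'"
      using has_real_derivative_pos_inc_left[OF D[OF s'(1)] pos] by blast
    define x where "x = min (d / 2) 1"
    have "0 < x" "x < d" "s' - x \<in> {0..1}" using d(1) \<open>s' = 1\<close> by (auto simp: x_def)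
    then have "\<phi> p (s' - x) < \<phi> p 1" using d(2) \<open>s' = 1\<close> by blast
    moreover have "\<phi> p 0 \<le> \<phi> p (s' - x)" using \<open>s' - x \<in> {0..1}\<close> by (auto intro!: mono)
    ultimately show ?thesis by linarith
  qed
  then show False using eq[of p] pq q1(1) by simp
qed

lemma lc_prim_unique:
  "lc_prim g F u v \<Longrightarrow> lc_prim g G u v \<Longrightarrow> F v - F u = G v - G u"
  using lc_prim_mono[of g F u v g G] lc_prim_mono[of g G u v g F] by (intro order.antisym) auto

lemma lc_prim_bound:
  assumes "lc_prim g F u v" "\<And>x. x \<in> {u..v} \<Longrightarrow> \<bar>g x\<bar> \<le> M"
  shows "\<bar>F v - F u\<bar> \<le> M * (v - u)"
proof -
  note uv = lc_prim_less[OF assms(1)]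
  have "F v - F u \<le> M * v - M * u"
    by (rule lc_prim_mono[OF assms(1) lc_prim_linear[OF uv]]) (use assms(2) in \<open>auto simp: abs_le_iff\<close>)
  moreover have "- M * v - - M * u \<le> F v - F u"
    by (rule lc_prim_mono[OF lc_prim_linear[OF uv] assms(1)]) (use assms(2) in \<open>auto simp: abs_le_iff minus_le_iff\<close>)
  ultimately show ?thesis by (simp add: abs_le_iff algebra_simps)
qed

section \<open>Integrals of simple functions\<close>

text \<open>The normal form is taken of the termwise primitive \<open>F\<close>, whose convergence
  the definition supplies, and not of \<open>g\<close>. Its derived series has the coefficients
  \<open>a k\<close> again, hence the sum \<open>g\<close>.\<close>

lemma lc_simple_integral_prim:
  assumes j: "lc_has_simple_integral g u v I j" and I: "lc_interval u v I" and uv: "u < v"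
  obtains F L M where "(F \<longlongrightarrow> L) (at u within I)" "(F \<longlongrightarrow> M) (at v within I)" "j = M - L"
    "\<And>x z. x < z \<Longrightarrow> {x..z} \<subseteq> I \<Longrightarrow> lc_prim g F x z"
proof -
  obtain x0 a F L M where g: "lc_power_series_on I a x0 g"
    and F: "lc_power_series_on I (\<lambda>k. if k = 0 then 0 else a (k - 1) / of_nat k) x0 F"
    and lim: "(F \<longlongrightarrow> L) (at u within I)" "(F \<longlongrightarrow> M) (at v within I)" "j = M - L"
    using j uv unfolding lc_has_simple_integral_def by (auto split: if_splits)
  obtain y \<tau> e where fr: "lc_frame u v y \<tau>" and e: "lc_rapid e"
    and Fx: "\<And>x. x \<in> I \<Longrightarrow> F x = lc_phi e ((x - y) / \<tau>)"
    and dF: "\<And>x. x \<in> I \<Longrightarrow> cw_conv (\<lambda>K. \<Sum>k\<le>K. of_nat (Suc k) * (if Suc k = 0 then 0 else a (Suc k - 1) / of_nat (Suc k)) * (x - x0) ^ k)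
      (lc_phi (lc_dcoeffs e) ((x - y) / \<tau>) / \<tau>)"
    using lc_normal_form[OF I uv F] by blast
  have gx: "g x = lc_phi (lc_dcoeffs e) ((x - y) / \<tau>) / \<tau>" if "x \<in> I" for x
  proof -
    have "cw_conv (\<lambda>K. \<Sum>k\<le>K. a k * (x - x0) ^ k) (g x)"
      using g that by (auto simp: lc_power_series_on_def intro: weak_imp_cw)
    moreover have "of_nat (Suc k) * (if Suc k = 0 then 0 else a (Suc k - 1) / of_nat (Suc k)) = a k" for k
      by (simp del: of_nat_Suc)
    ultimately show ?thesis using cw_conv_unique[OF _ dF[OF that], of "g x"] by (simp only:)
  qed
  have "lc_prim g F x z" if xz: "x < z" "{x..z} \<subseteq> I" for x z
  proof -
    have sub: "{x..z} \<subseteq> {u..v}" using xz lc_interval_mem(1)[OF I] by blast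
    then have fr': "lc_frame x z y \<tau>" using xz(1) by (intro lc_frame_subset[OF fr]) auto
    have "lc_ana {x..z} y \<tau> F" unfolding lc_ana_def using e Fx xz(2) by blast
    moreover have "lc_has_deriv F (g t) t {x..z}" if t: "t \<in> {x..z}" for t
    proof -
      have "lc_has_deriv (\<lambda>x. lc_phi e ((x - y) / \<tau>)) (g t) t {x..z}"
        using lc_rep_deriv[OF fr' e t] gx[of t] t xz(2) by auto
      then show ?thesis using t Fx xz(2) by (elim lc_has_deriv_cong) auto
    qed
    ultimately show ?thesis unfolding lc_prim_def using fr' by blast
  qed
  then show ?thesis using that lim by blast
qed

text \<open>The factor \<open>\<tau>\<close> cancels the factor 1 / \<tau> produced by
  differentiating in the rescaled variable.\<close>

lemma lc_primitive_coeffs: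
  assumes fr: "lc_frame u v y \<tau>" and e: "lc_rapid e"
  defines "E \<equiv> \<lambda>k. \<tau> * (if k = 0 then 0 else of_real (1 / real k) * e (k - 1))"
  shows "lc_rapid E" "\<And>x. x \<in> {u..v} \<Longrightarrow>
    lc_has_deriv (\<lambda>x. lc_phi E ((x - y) / \<tau>)) (lc_phi e ((x - y) / \<tau>)) x {u..v}"
proof -
  have \<tau>: "0 < \<tau>" using fr by (simp add: lc_frame_def)
  have "\<bar>1 / real k\<bar> \<le> 1" for k by (cases k) auto
  then show E: "lc_rapid E" unfolding E_def by (intro lc_rapid_cmult lc_rapid_shift e)
  have "lc_dcoeffs E = (\<lambda>k. \<tau> * e k)"
  proof
    fix k
    have "of_nat (Suc k) * (of_real (1 / real (Suc k)) :: levi_civita) = 1"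
      by (metis nonzero_eq_divide_eq of_nat_Suc of_nat_eq_0_iff of_nat_neq_0 of_real_1 of_real_divide of_real_of_nat_eq mult.commute)
    then show "lc_dcoeffs E k = \<tau> * e k" unfolding E_def
      by (simp add: mult.left_commute mult.assoc[symmetric] del: of_nat_Suc of_real_divide)
  qed
  then have "lc_phi (lc_dcoeffs E) t / \<tau> = lc_phi e t" if "lc_disc t" for t
    using lc_phi_cmult[OF e that, of \<tau>] \<tau> by simp
  then show "lc_has_deriv (\<lambda>x. lc_phi E ((x - y) / \<tau>)) (lc_phi e ((x - y) / \<tau>)) x {u..v}" if "x \<in> {u..v}" for x
    using lc_rep_deriv[OF fr E that] lc_frame_disc[OF fr that] by simp
qed

lemma lc_ana_prim:
  assumes fr: "lc_frame u v y \<tau>" and g: "lc_ana {u..v} y \<tau> g"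
  obtains F where "lc_ana {u..v} y \<tau> F" "lc_prim g F u v"
proof -
  obtain e where e: "lc_rapid e" "\<And>x. x \<in> {u..v} \<Longrightarrow> g x = lc_phi e ((x - y) / \<tau>)"
    using g unfolding lc_ana_def by blast
  let ?E = "\<lambda>k. \<tau> * (if k = 0 then 0 else of_real (1 / real k) * e (k - 1))"
  have "lc_ana {u..v} y \<tau> (\<lambda>x. lc_phi ?E ((x - y) / \<tau>))"
    unfolding lc_ana_def using lc_primitive_coeffs(1)[OF fr e(1)] by blast
  moreover have "lc_prim g (\<lambda>x. lc_phi ?E ((x - y) / \<tau>)) u v" unfolding lc_prim_def
    using lc_primitive_coeffs(2)[OF fr e(1)] e(2) calculation fr by (auto simp del: of_real_divide)
  ultimately show ?thesis using that by blast
qed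

lemma lc_simple_prim_ex:
  assumes "lc_simple_on {u..v} g" "u < v" obtains F where "lc_prim g F u v"
proof -
  obtain y \<tau> where "lc_frame u v y \<tau>" "lc_ana {u..v} y \<tau> g"
    using lc_simple_imp_ana[OF lc_closed_interval assms(2,1)] assms(2) by auto
  then show ?thesis using lc_ana_prim that by metis
qed

text \<open>The series that witnesses simplicity may have no convergent primitive, so the integral
  is taken from the normal form. Its primitive is differentiable on all of [u, v], which provides
  the limits at ends outside \<open>I\<close>.\<close>

lemma lc_simple_integral_ex:
  assumes I: "lc_interval u v I" and g: "lc_simple_on I g"
  shows "\<exists>j. lc_has_simple_integral g u v I j"
proof (cases "u = v")
  case False
  then have uv: "u < v" using I by (auto simp: lc_interval_def)
  obtain y \<tau> where fr: "lc_frame u v y \<tau>" and a: "lc_ana I y \<tau> g" by (rule lc_simple_imp_ana[OF I uv g])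
  obtain e where e: "lc_rapid e" "\<And>x. x \<in> I \<Longrightarrow> g x = lc_phi e ((x - y) / \<tau>)"
    using a unfolding lc_ana_def by blast
  have \<tau>: "0 < \<tau>" using fr by (simp add: lc_frame_def)
  let ?E = "\<lambda>k. \<tau> * (if k = 0 then 0 else of_real (1 / real k) * e (k - 1))"
  let ?F = "\<lambda>x. lc_phi ?E ((x - y) / \<tau>)"
  have sub: "I \<subseteq> {u..v}" by (rule lc_interval_mem(1)[OF I])
  have 1: "lc_power_series_on I (\<lambda>k. e k / \<tau> ^ k) y g" by (rule lc_ana_simple[OF fr sub e])
  have "lc_power_series_on I (\<lambda>k. ?E k / \<tau> ^ k) y ?F"
    by (rule lc_ana_simple[OF fr sub lc_primitive_coeffs(1)[OF fr e(1)] refl])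
  moreover have "?E k / \<tau> ^ k = (if k = 0 then 0 else (e (k - 1) / \<tau> ^ (k - 1)) / of_nat k)" for k
    using \<tau> by (cases k) (auto simp del: of_nat_Suc)
  ultimately have 2: "lc_power_series_on I (\<lambda>k. if k = 0 then 0 else (e (k - 1) / \<tau> ^ (k - 1)) / of_nat k) y ?F"
    by (simp only:)
  have 3: "(?F \<longlongrightarrow> ?F x) (at x within I)" if "x \<in> {u..v}" for x
    by (rule lc_has_deriv_tendsto[OF lc_has_deriv_subset[OF lc_primitive_coeffs(2)[OF fr e(1) that] sub]])
  have "(?F \<longlongrightarrow> ?F u) (at u within I)" "(?F \<longlongrightarrow> ?F v) (at v within I)" using uv by (auto intro!: 3)
  then have "lc_has_simple_integral g u v I (?F v - ?F u)"
    unfolding lc_has_simple_integral_def if_not_P[OF False]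
    by (intro exI[of _ y] exI[of _ "\<lambda>k. e k / \<tau> ^ k"] exI[of _ ?F] exI[of _ "?F u"] exI[of _ "?F v"] conjI 1 2 refl)
  then show ?thesis by blast
qed (simp add: lc_has_simple_integral_def)

section \<open>Coverings, primitives of measurable functions and the integral\<close>

section \<open>Families of disjoint intervals\<close>

lemma lc_strong_le:
  assumes "strongly_converges X l" "\<And>n. X n \<le> c" shows "l \<le> c"
proof (rule ccontr)
  assume "\<not> l \<le> c"
  then have "\<forall>\<^sub>F n in sequentially. \<bar>X n - l\<bar> < l - c" using assms(1) by (simp add: strongly_converges_def)
  then obtain n where "\<bar>X n - l\<bar> < l - c" using eventually_happens'[OF sequentially_bot] by blast
  then show False using assms(2)[of n] by linarith
qed

lemma lc_strong_unique:
  "strongly_converges X l \<Longrightarrow> strongly_converges X k \<Longrightarrow> l = k"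
  unfolding strongly_converges_iff_LIMSEQ by (rule LIMSEQ_unique)

lemma lc_strong_diff:
  assumes "strongly_converges X l" "strongly_converges Y k" shows "strongly_converges (\<lambda>n. X n - Y n) (l - k)"
  unfolding strongly_converges_def
proof (intro allI impI)
  fix e :: levi_civita assume "e > 0"
  then have "e / 2 > 0" by simp
  then have "\<forall>\<^sub>F n in sequentially. \<bar>X n - l\<bar> < e / 2" "\<forall>\<^sub>F n in sequentially. \<bar>Y n - k\<bar> < e / 2"
    using assms unfolding strongly_converges_def by blast+
  then show "\<forall>\<^sub>F n in sequentially. \<bar>X n - Y n - (l - k)\<bar> < e"
    by eventually_elim linarith
qed

lemma lc_strong_const: "strongly_converges (\<lambda>_. c) c"
  by (simp add: strongly_converges_def)

lemma lc_strong_cmult: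
  assumes "strongly_converges X l" shows "strongly_converges (\<lambda>n. c * X n) (c * l)"
proof (cases "c = 0")
  case False
  show ?thesis unfolding strongly_converges_def
  proof (intro allI impI)
    fix e :: levi_civita assume "e > 0"
    then have "\<forall>\<^sub>F n in sequentially. \<bar>X n - l\<bar> < e / \<bar>c\<bar>" using assms False by (simp add: strongly_converges_def)
    then show "\<forall>\<^sub>F n in sequentially. \<bar>c * X n - c * l\<bar> < e"
      by eventually_elim (use False in \<open>simp add: right_diff_distrib[symmetric] abs_mult less_divide_eq mult.commute\<close>)
  qed
qed (simp add: lc_strong_const)

lemma lc_interval_bounds:
  assumes "lc_interval u v I" "u < v" "I \<subseteq> {a..b}" shows "a \<le> u" "v \<le> b"
proof -
  have sub: "{u<..<v} \<subseteq> {a..b}" using lc_interval_mem(2)[OF assms(1)] assms(3) by blast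
  show "a \<le> u"
  proof (rule ccontr)
    assume "\<not> a \<le> u"
    then obtain x where "u < x" "x < min a v" using dense[of u "min a v"] assms(2) by auto
    then show False using sub by (force simp: subset_iff)
  qed
  show "v \<le> b"
  proof (rule ccontr)
    assume "\<not> v \<le> b"
    then obtain x where "max u b < x" "x < v" using dense[of "max u b" v] assms(2) by auto
    then show False using sub by (force simp: subset_iff)
  qed
qed

lemma lc_disjoint_sep:
  assumes "lc_interval u v I" "lc_interval u' v' I'" "u < v" "u' < v'" "I \<inter> I' = {}"
  shows "v \<le> u' \<or> v' \<le> u"
proof (rule ccontr)
  assume "\<not> (v \<le> u' \<or> v' \<le> u)"
  then obtain x where "max u u' < x" "x < min v v'" using dense[of "max u u'" "min v v'"] assms by auto
  then have "x \<in> I \<inter> I'" using lc_interval_mem(2)[OF assms(1)] lc_interval_mem(2)[OF assms(2)] by auto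
  then show False using assms(5) by blast
qed

text \<open>The indices say nothing about the position of the intervals. Removing any one of them
  and splitting the rest into those on its left and those on its right gives an induction without
  sorting.\<close>

lemma lc_family_induct [consumes 4, case_names empty step]:
  fixes u v :: "'i \<Rightarrow> levi_civita"
  assumes "finite S" "a \<le> b" "\<And>i. i \<in> S \<Longrightarrow> a \<le> u i \<and> u i < v i \<and> v i \<le> b"
    and "\<And>i j. i \<in> S \<Longrightarrow> j \<in> S \<Longrightarrow> i \<noteq> j \<Longrightarrow> v i \<le> u j \<or> v j \<le> u i"
    and empty: "\<And>x y. a \<le> x \<Longrightarrow> x \<le> y \<Longrightarrow> y \<le> b \<Longrightarrow> P x y {}"
    and step: "\<And>x y i L R. a \<le> x \<Longrightarrow> x \<le> u i \<Longrightarrow> v i \<le> y \<Longrightarrow> y \<le> b \<Longrightarrow> i \<in> S \<Longrightarrow> finite L \<Longrightarrow> finite R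
      \<Longrightarrow> i \<notin> L \<Longrightarrow> i \<notin> R \<Longrightarrow> L \<inter> R = {} \<Longrightarrow> P x (u i) L \<Longrightarrow> P (v i) y R \<Longrightarrow> P x y (insert i (L \<union> R))"
  shows "P a b S"
proof -
  have "P x y T" if "T \<subseteq> S" "a \<le> x" "x \<le> y" "y \<le> b" "\<And>i. i \<in> T \<Longrightarrow> x \<le> u i \<and> v i \<le> y" for x y T
    using that
  proof (induction "card T" arbitrary: x y T rule: less_induct)
    case less
    have fT: "finite T" using less.prems(1) assms(1) finite_subset by blast
    show ?case
    proof (cases "T = {}")
      case True then show ?thesis using less.prems empty by simp
    next
      case False
      then obtain i where i: "i \<in> T" by blast
      define L R where "L = {j \<in> T - {i}. v j \<le> u i}" and "R = {j \<in> T - {i}. v i \<le> u j}"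
      have iS: "i \<in> S" "a \<le> u i" "u i < v i" "v i \<le> b" using i less.prems(1) assms(3) by auto
      have T: "T = insert i (L \<union> R)"
      proof
        show "T \<subseteq> insert i (L \<union> R)"
        proof
          fix j assume "j \<in> T"
          then show "j \<in> insert i (L \<union> R)"
            using assms(4)[of i j] i less.prems(1) by (cases "j = i") (auto simp: L_def R_def)
        qed
      qed (use i in \<open>auto simp: L_def R_def\<close>)
      have LR: "L \<inter> R = {}"
      proof -
        have False if "j \<in> L" "j \<in> R" for j
        proof -
          have "u j < v j" using that less.prems(1) assms(3)[of j] by (auto simp: L_def)
          then show False using that iS by (auto simp: L_def R_def)
        qed
        then show ?thesis by blast
      qed
      have sub: "L \<subset> T" "R \<subset> T" using i by (auto simp: L_def R_def)
      have xy: "x \<le> u i" "v i \<le> y" using less.prems(5)[OF i] by auto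
      have "P x (u i) L"
        by (rule less.hyps) (use psubset_card_mono[OF fT sub(1)] sub less.prems xy iS in \<open>auto simp: L_def\<close>)
      moreover have "P (v i) y R"
        by (rule less.hyps) (use psubset_card_mono[OF fT sub(2)] sub less.prems xy iS in \<open>auto simp: R_def\<close>)
      ultimately show ?thesis unfolding T using sub fT less.prems xy iS LR
        by (intro step) (auto simp: L_def R_def)
    qed
  qed
  then show ?thesis using assms(2,3) by auto
qed

lemma lc_family_sum_mono:
  fixes u v :: "'i \<Rightarrow> levi_civita" and Y :: "levi_civita \<Rightarrow> levi_civita"
  assumes "finite S" "a \<le> b" "\<And>i. i \<in> S \<Longrightarrow> a \<le> u i \<and> u i < v i \<and> v i \<le> b"
    and "\<And>i j. i \<in> S \<Longrightarrow> j \<in> S \<Longrightarrow> i \<noteq> j \<Longrightarrow> v i \<le> u j \<or> v j \<le> u i"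
    and Y: "\<And>s t. a \<le> s \<Longrightarrow> s \<le> t \<Longrightarrow> t \<le> b \<Longrightarrow> Y s \<le> Y t"
  shows "(\<Sum>i\<in>S. Y (v i) - Y (u i)) \<le> Y b - Y a"
proof (rule lc_family_induct[where u = u and v = v and P = "\<lambda>x y S. (\<Sum>i\<in>S. Y (v i) - Y (u i)) \<le> Y y - Y x"])
  fix x y i and L R :: "'i set"
  assume h: "finite L" "finite R" "i \<notin> L" "i \<notin> R" "L \<inter> R = {}"
    "(\<Sum>i\<in>L. Y (v i) - Y (u i)) \<le> Y (u i) - Y x" "(\<Sum>i\<in>R. Y (v i) - Y (u i)) \<le> Y y - Y (v i)"
  then have "(\<Sum>i\<in>insert i (L \<union> R). Y (v i) - Y (u i))
      = (Y (v i) - Y (u i)) + ((\<Sum>i\<in>L. Y (v i) - Y (u i)) + (\<Sum>i\<in>R. Y (v i) - Y (u i)))"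
    by (simp add: sum.union_disjoint)
  then show "(\<Sum>i\<in>insert i (L \<union> R). Y (v i) - Y (u i)) \<le> Y y - Y x" using h(6,7) by linarith
qed (use assms in auto)

lemma lc_intervals_sum_mono:
  assumes d: "disjoint_intervals u v I" "(\<Union>n. I n) \<subseteq> {a..b}" "a \<le> b"
    and Y: "\<And>s t. a \<le> s \<Longrightarrow> s \<le> t \<Longrightarrow> t \<le> b \<Longrightarrow> Y s \<le> Y t"
  shows "(\<Sum>n<N. Y (v n) - Y (u n)) \<le> Y b - (Y a :: levi_civita)"
proof -
  have I: "lc_interval (u n) (v n) (I n)" for n using d(1) by (simp add: disjoint_intervals_def)
  \<comment> \<open>Degenerate intervals contribute 0 and are dropped, since separation is available
    only for \<open>u n < v n\<close>.\<close>
  let ?S = "{n \<in> {..<N}. u n < v n}"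
  have "(\<Sum>n<N. Y (v n) - Y (u n)) = (\<Sum>n\<in>?S. Y (v n) - Y (u n))"
  proof (rule sum.mono_neutral_right)
    show "\<forall>i\<in>{..<N} - ?S. Y (v i) - Y (u i) = 0"
    proof
      fix i assume "i \<in> {..<N} - ?S"
      then have "u i = v i" using I[of i] by (auto simp: lc_interval_def)
      then show "Y (v i) - Y (u i) = 0" by simp
    qed
  qed auto
  also have "\<dots> \<le> Y b - Y a"
  proof (rule lc_family_sum_mono[OF _ d(3) _ _ Y])
    fix i assume "i \<in> ?S"
    moreover have "I i \<subseteq> {a..b}" using d(2) by blast
    ultimately show "a \<le> u i \<and> u i < v i \<and> v i \<le> b" using lc_interval_bounds[OF I[of i]] by auto
  next
    fix i j assume "i \<in> ?S" "j \<in> ?S" "i \<noteq> j"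
    then show "v i \<le> u j \<or> v j \<le> u i"
      using d(1) by (intro lc_disjoint_sep[OF I I]) (auto simp: disjoint_intervals_def disjoint_family_on_def)
  qed auto
  finally show ?thesis .
qed

section \<open>The measure of an interval\<close>

lemma lc_inner_sum_Icc: "a \<le> b \<Longrightarrow> b - a \<in> lc_inner_sums {a..b}"
proof -
  assume ab: "a \<le> b"
  define v where "v n = (if n = 0 then b else a)" for n :: nat
  \<comment> \<open>The sequence is filled up with the empty open interval from \<open>a\<close> to
    \<open>a\<close>.\<close>
  define I where "I n = (if n = 0 then {a..b} else {})" for n :: nat
  have 1: "disjoint_intervals (\<lambda>_. a) v I"
    using ab by (auto simp: disjoint_intervals_def v_def I_def lc_interval_def disjoint_family_on_def)
  have 2: "(\<Union>n. I n) = {a..b}" by (auto simp: I_def)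
  have "(\<Sum>n<N. v n - a) = b - a" if "N \<ge> 1" for N
    using that by (induction N rule: dec_induct) (auto simp: v_def)
  then have 3: "strong_sums (\<lambda>n. v n - a) (b - a)" unfolding strong_sums_def strongly_converges_def
    by (intro allI impI eventually_mono[OF eventually_ge_at_top[of "1::nat"]]) simp
  show ?thesis unfolding lc_inner_sums_def using 1 2 3 by blast
qed

lemma lc_inner_sum_le: "a \<le> b \<Longrightarrow> s \<in> lc_inner_sums {a..b} \<Longrightarrow> s \<le> b - a"
proof -
  assume ab: "a \<le> b" and s: "s \<in> lc_inner_sums {a..b}"
  then obtain u v I where d: "disjoint_intervals u v I" "(\<Union>n. I n) \<subseteq> {a..b}"
    "strongly_converges (\<lambda>N. \<Sum>n<N. v n - u n) s" unfolding lc_inner_sums_def strong_sums_def by blast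
  show ?thesis
    by (rule lc_strong_le[OF d(3)]) (use lc_intervals_sum_mono[OF d(1,2) ab, of "\<lambda>x. x"] in auto)
qed

lemma lc_measure_Icc: assumes "a \<le> b" shows "lc_measure {a..b} = b - a"
proof -
  have "isLub UNIV (lc_inner_sums {a..b}) (b - a)"
    using lc_inner_sum_Icc[OF assms] lc_inner_sum_le[OF assms]
    by (auto simp: isLub_def leastP_def isUb_def setle_def setge_def)
  then show ?thesis unfolding lc_measure_def using isLub_unique by (intro the_equality) auto
qed

section \<open>Coverings up to small gaps\<close>

text \<open>The last argument is the total length of the gaps.\<close>

inductive lc_cov :: "(levi_civita \<Rightarrow> levi_civita \<Rightarrow> bool) \<Rightarrow> levi_civita \<Rightarrow> levi_civita \<Rightarrow> levi_civita \<Rightarrow> bool"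
  for Q where
  piece: "Q x y \<Longrightarrow> x < y \<Longrightarrow> lc_cov Q x y 0"
| gap: "x \<le> y \<Longrightarrow> lc_cov Q x y (y - x)"
| join: "lc_cov Q x y d \<Longrightarrow> lc_cov Q y z e \<Longrightarrow> lc_cov Q x z (d + e)"

lemma lc_cov_nonneg: "lc_cov Q x y d \<Longrightarrow> 0 \<le> d \<and> x \<le> y"
  by (induction rule: lc_cov.induct) auto

lemma lc_cov_family:
  fixes u v :: "'i \<Rightarrow> levi_civita"
  assumes "finite S" "a \<le> b" "\<And>i. i \<in> S \<Longrightarrow> a \<le> u i \<and> u i < v i \<and> v i \<le> b"
    and "\<And>i j. i \<in> S \<Longrightarrow> j \<in> S \<Longrightarrow> i \<noteq> j \<Longrightarrow> v i \<le> u j \<or> v j \<le> u i"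
    and Q: "\<And>i. i \<in> S \<Longrightarrow> Q (u i) (v i)"
  shows "lc_cov Q a b (b - a - (\<Sum>i\<in>S. v i - u i))"
proof (rule lc_family_induct[where u = u and v = v and P = "\<lambda>x y S. lc_cov Q x y (y - x - (\<Sum>i\<in>S. v i - u i))"])
  fix x y i and L R :: "'i set"
  assume h: "i \<in> S" "finite L" "finite R" "i \<notin> L" "i \<notin> R" "L \<inter> R = {}"
    "lc_cov Q x (u i) (u i - x - (\<Sum>i\<in>L. v i - u i))" "lc_cov Q (v i) y (y - v i - (\<Sum>i\<in>R. v i - u i))"
  have "lc_cov Q (u i) (v i) 0" using assms(3)[OF h(1)] Q[OF h(1)] by (intro lc_cov.piece) auto
  then have "lc_cov Q x y ((u i - x - (\<Sum>i\<in>L. v i - u i)) + 0 + (y - v i - (\<Sum>i\<in>R. v i - u i)))"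
    by (rule lc_cov.join[OF lc_cov.join[OF h(7)] h(8)])
  moreover have "(\<Sum>i\<in>insert i (L \<union> R). v i - u i) = (v i - u i) + ((\<Sum>i\<in>L. v i - u i) + (\<Sum>i\<in>R. v i - u i))"
    using h by (simp add: sum.union_disjoint)
  moreover have "(u i - x - (\<Sum>i\<in>L. v i - u i)) + 0 + (y - v i - (\<Sum>i\<in>R. v i - u i))
      = y - x - ((v i - u i) + ((\<Sum>i\<in>L. v i - u i) + (\<Sum>i\<in>R. v i - u i)))" by linarith
  ultimately show "lc_cov Q x y (y - x - (\<Sum>i\<in>insert i (L \<union> R). v i - u i))" by metis
qed (use assms in \<open>auto simp: lc_cov.gap\<close>)

lemma lc_simple_on_subset: "lc_simple_on J f \<Longrightarrow> I \<subseteq> J \<Longrightarrow> lc_simple_on I f"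
  unfolding lc_simple_on_def lc_power_series_on_def by blast

abbreviation lc_simple_cov :: "(levi_civita \<Rightarrow> levi_civita) \<Rightarrow> levi_civita \<Rightarrow> levi_civita \<Rightarrow> levi_civita \<Rightarrow> bool" where
  "lc_simple_cov f \<equiv> lc_cov (\<lambda>x y. lc_simple_on {x..y} f)"

text \<open>Cutting the sequence off and trimming each remaining interval at both ends leaves
  finitely many closed intervals inside the given ones. The deficit in measure and the tail cost e /
  4 each, the trimming e / 2.\<close>

lemma lc_measurable_cov:
  assumes f: "lc_measurable_on {a..b} f" and ab: "a < b" and e: "0 < e"
  shows "\<exists>d\<le>e. lc_simple_cov f a b d"
proof -
  obtain u v I s where d: "disjoint_intervals u v I" "(\<Union>n. I n) \<subseteq> {a..b}"
    and s: "strongly_converges (\<lambda>N. \<Sum>n<N. v n - u n) s" "b - a - s < e / 4" and simp: "\<And>n. lc_simple_on (I n) f"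
  proof -
    have "0 < e / 4" "lc_measure {a..b} = b - a" using e lc_measure_Icc[of a b] ab by simp_all
    then have "\<exists>u v I s. disjoint_intervals u v I \<and> (\<Union>n. I n) \<subseteq> {a..b}
      \<and> strong_sums (\<lambda>n. v n - u n) s \<and> b - a - s < e / 4 \<and> (\<forall>n. lc_simple_on (I n) f)"
      using f unfolding lc_measurable_on_def by (simp only:)
    then show ?thesis using that unfolding strong_sums_def by blast
  qed
  have I: "lc_interval (u n) (v n) (I n)" for n using d(1) by (simp add: disjoint_intervals_def)
  have "0 < e / 4" using e by simp
  then have "\<forall>\<^sub>F N in sequentially. \<bar>(\<Sum>n<N. v n - u n) - s\<bar> < e / 4"
    using s(1) unfolding strongly_converges_def by blast
  then obtain N where N: "\<bar>(\<Sum>n<N. v n - u n) - s\<bar> < e / 4"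
    using eventually_happens'[OF sequentially_bot] by blast
  define S where "S = {n \<in> {..<N}. u n < v n}"
  have S: "(\<Sum>n<N. v n - u n) = (\<Sum>n\<in>S. v n - u n)"
  proof (rule sum.mono_neutral_right)
    have "u i \<le> v i" for i using I[of i] by (simp add: lc_interval_def)
    then show "\<forall>i\<in>{..<N} - S. v i - u i = 0" by (auto simp: S_def less_le)
  qed (auto simp: S_def)
  \<comment> \<open>The bound 1 / 4 keeps the trimmed intervals nondegenerate; the other bound
    limits the total length trimmed to e / 2.\<close>
  define \<theta> where "\<theta> = min (1 / 4) (e / (4 * (b - a)))"
  have \<theta>: "0 < \<theta>" "\<theta> \<le> 1 / 4" "\<theta> * (b - a) \<le> e / 4"
  proof -
    show "0 < \<theta>" using e ab by (simp add: \<theta>_def)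
    show "\<theta> \<le> 1 / 4" unfolding \<theta>_def by (rule min.cobounded1)
    have "\<theta> \<le> e / (4 * (b - a))" unfolding \<theta>_def by (rule min.cobounded2)
    moreover have "0 < 4 * (b - a)" using ab by simp
    ultimately have "\<theta> * (4 * (b - a)) \<le> e" using pos_le_divide_eq by blast
    then have "4 * (\<theta> * (b - a)) \<le> e" by (simp only: ac_simps)
    then show "\<theta> * (b - a) \<le> e / 4" by linarith
  qed
  define u' v' where "u' n = u n + \<theta> * (v n - u n)" and "v' n = v n - \<theta> * (v n - u n)" for n
  have uv': "u n < u' n \<and> u' n < v' n \<and> v' n < v n" if "n \<in> S" for n
  proof -
    have p: "0 < v n - u n" using that by (simp add: S_def)
    define w where "w = \<theta> * (v n - u n)"
    have "4 * \<theta> \<le> 1" using \<theta>(2) by linarith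
    then have "(4 * \<theta>) * (v n - u n) \<le> 1 * (v n - u n)" using p by (intro mult_right_mono) auto
    then have "4 * w \<le> v n - u n" by (simp only: w_def mult.assoc mult_1)
    moreover have "0 < w" using p \<theta>(1) by (simp add: w_def)
    ultimately show ?thesis unfolding u'_def v'_def w_def[symmetric] by (intro conjI) linarith+
  qed
  have "lc_simple_cov f a b (b - a - (\<Sum>i\<in>S. v' i - u' i))"
  proof (rule lc_cov_family)
    fix i assume i: "i \<in> S"
    have "I i \<subseteq> {a..b}" "u i < v i" using d(2) i by (auto simp: S_def)
    then have "a \<le> u i" "v i \<le> b" using lc_interval_bounds[OF I[of i]] by blast+
    then show "a \<le> u' i \<and> u' i < v' i \<and> v' i \<le> b" using uv'[OF i] by auto
    have "{u' i..v' i} \<subseteq> I i" using lc_interval_mem(2)[OF I[of i]] uv'[OF i] by force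
    then show "lc_simple_on {u' i..v' i} f" by (rule lc_simple_on_subset[OF simp])
  next
    fix i j assume ij: "i \<in> S" "j \<in> S" "i \<noteq> j"
    have "v i \<le> u j \<or> v j \<le> u i"
      using d(1) ij by (intro lc_disjoint_sep[OF I I]) (auto simp: S_def disjoint_intervals_def disjoint_family_on_def)
    then show "v' i \<le> u' j \<or> v' j \<le> u' i" using uv'[OF ij(1)] uv'[OF ij(2)] by auto
  qed (use ab in \<open>auto simp: S_def\<close>)
  moreover have "b - a - (\<Sum>i\<in>S. v' i - u' i) \<le> e"
  proof -
    have "(\<Sum>i\<in>S. v' i - u' i) = (1 - 2 * \<theta>) * (\<Sum>i\<in>S. v i - u i)"
      unfolding sum_distrib_left by (rule sum.cong) (auto simp: u'_def v'_def algebra_simps)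
    moreover have "\<theta> * (\<Sum>i\<in>S. v i - u i) \<le> \<theta> * (b - a)"
      using lc_intervals_sum_mono[OF d(1,2), of "\<lambda>x. x" N] ab \<theta>(1) unfolding S by (intro mult_left_mono) auto
    ultimately have "(\<Sum>i\<in>S. v i - u i) - 2 * (e / 4) \<le> (\<Sum>i\<in>S. v' i - u' i)"
      using \<theta>(3) by (simp add: left_diff_distrib)
    then show ?thesis using N s(2) unfolding S by linarith
  qed
  ultimately show ?thesis by blast
qed

lemma lc_cov_restrict:
  assumes "lc_cov Q x y d" "x \<le> x'" "x' \<le> y'" "y' \<le> y"
    and Q: "\<And>x y x' y'. Q x y \<Longrightarrow> x \<le> x' \<Longrightarrow> x' < y' \<Longrightarrow> y' \<le> y \<Longrightarrow> Q x' y'"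
  shows "\<exists>d'\<le>d. lc_cov Q x' y' d'"
  using assms(1-4)
proof (induction arbitrary: x' y' rule: lc_cov.induct)
  case (piece x y)
  show ?case
  proof (cases "x' < y'")
    case True then show ?thesis using Q[OF piece(1)] piece lc_cov.piece[of Q x' y'] by blast
  next
    case False then show ?thesis using piece lc_cov.gap[of x' y' Q] by auto
  qed
next
  case (gap x y)
  then show ?case using lc_cov.gap[of x' y' Q] by (intro exI[of _ "y' - x'"]) auto
next
  case (join x y d z e)
  note nn = lc_cov_nonneg[OF join.hyps(1)] lc_cov_nonneg[OF join.hyps(2)]
  consider "y' \<le> y" | "y \<le> x'" | "x' < y" "y < y'" by linarith
  then show ?case
  proof cases
    case 1
    then obtain d' where "d' \<le> d" "lc_cov Q x' y' d'" using join.IH(1)[of x' y'] join.prems by blast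
    then show ?thesis using nn by (intro exI[of _ d']) auto
  next
    case 2
    then obtain d' where "d' \<le> e" "lc_cov Q x' y' d'" using join.IH(2)[of x' y'] join.prems by blast
    then show ?thesis using nn by (intro exI[of _ d']) auto
  next
    case 3
    obtain d' where "d' \<le> d" "lc_cov Q x' y d'" using join.IH(1)[of x' y] join.prems 3 by auto
    moreover obtain e' where "e' \<le> e" "lc_cov Q y y' e'" using join.IH(2)[of y y'] join.prems 3 by auto
    ultimately show ?thesis using lc_cov.join[of Q x' y d' y' e'] by (intro exI[of _ "d' + e'"]) auto
  qed
qed

text \<open>\<open>P\<close> holds on pieces and passes to concatenations, so a failure on the whole
  can only come from one of the gaps.\<close>

lemma lc_cov_bad_gap:
  assumes "lc_cov Q x y d" "\<not> P x y"
    and "\<And>x y z. x \<le> y \<Longrightarrow> y \<le> z \<Longrightarrow> P x y \<Longrightarrow> P y z \<Longrightarrow> P x z"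
    and "\<And>x y. x < y \<Longrightarrow> Q x y \<Longrightarrow> P x y"
  shows "\<exists>x' y'. x \<le> x' \<and> x' \<le> y' \<and> y' \<le> y \<and> y' - x' \<le> d \<and> \<not> P x' y'"
  using assms(1,2)
proof (induction rule: lc_cov.induct)
  case (piece x y) then show ?case using assms(4) by blast
next
  case (gap x y) then show ?case by blast
next
  case (join x y d z e)
  note nn = lc_cov_nonneg[OF join.hyps(1)] lc_cov_nonneg[OF join.hyps(2)]
  have "\<not> P x y \<or> \<not> P y z" using join.prems assms(3) nn by blast
  then show ?case
  proof
    assume "\<not> P x y"
    then obtain x' y' where "x \<le> x'" "x' \<le> y'" "y' \<le> y" "y' - x' \<le> d" "\<not> P x' y'" using join.IH(1) by blast
    then show ?thesis using nn by (intro exI[of _ x'] exI[of _ y']) auto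
  next
    assume "\<not> P y z"
    then obtain x' y' where "y \<le> x'" "x' \<le> y'" "y' \<le> z" "y' - x' \<le> e" "\<not> P x' y'" using join.IH(2) by blast
    then show ?thesis using nn by (intro exI[of _ x'] exI[of _ y']) auto
  qed
qed

text \<open>A substitute for compactness: although intervals of the field are not compact, a
  failure of \<open>P\<close> can be pushed into ever smaller gaps of the coverings, which shrink to a point
  by completeness.\<close>

lemma lc_cousin:
  assumes cov: "\<And>e. 0 < e \<Longrightarrow> \<exists>d\<le>e. lc_cov Q a b d" and ab: "a \<le> b"
    and Q: "\<And>x y x' y'. Q x y \<Longrightarrow> x \<le> x' \<Longrightarrow> x' < y' \<Longrightarrow> y' \<le> y \<Longrightarrow> Q x' y'"
    and join: "\<And>x y z. x \<le> y \<Longrightarrow> y \<le> z \<Longrightarrow> P x y \<Longrightarrow> P y z \<Longrightarrow> P x z"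
    and piece: "\<And>x y. a \<le> x \<Longrightarrow> y \<le> b \<Longrightarrow> x < y \<Longrightarrow> Q x y \<Longrightarrow> P x y"
    and loc: "\<And>c. c \<in> {a..b} \<Longrightarrow> \<exists>g>0. \<forall>x y. a \<le> x \<and> x \<le> c \<and> c \<le> y \<and> y \<le> b \<and> y - x < g \<longrightarrow> P x y"
  shows "P a b"
proof (rule ccontr)
  assume nP: "\<not> P a b"
  define bad where "bad p \<longleftrightarrow> a \<le> fst p \<and> fst p \<le> snd p \<and> snd p \<le> b \<and> \<not> P (fst p) (snd p)" for p
  have next_ex: "\<exists>p'. bad p' \<and> fst p \<le> fst p' \<and> snd p' \<le> snd p \<and> snd p' - fst p' \<le> lc_d (of_nat n)"
    if bp: "bad p" for p and n :: nat
  proof -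
    obtain d0 where d0: "d0 \<le> lc_d (of_nat n)" "lc_cov Q a b d0" using cov[OF lc_d_pos] by blast
    obtain d where d: "d \<le> d0" "lc_cov Q (fst p) (snd p) d"
    proof -
      have "\<exists>d\<le>d0. lc_cov Q (fst p) (snd p) d"
      proof (rule lc_cov_restrict[OF d0(2)])
        show "a \<le> fst p" "fst p \<le> snd p" "snd p \<le> b" using bp by (auto simp: bad_def)
      qed (rule Q)
      then show thesis using that by blast
    qed
    \<comment> \<open>The restriction to subintervals of [a, b] is there because
      \<open>piece\<close> is assumed only for them.\<close>
    let ?P = "\<lambda>x y. a \<le> x \<and> y \<le> b \<longrightarrow> P x y"
    have "\<exists>x' y'. fst p \<le> x' \<and> x' \<le> y' \<and> y' \<le> snd p \<and> y' - x' \<le> d \<and> \<not> ?P x' y'"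
    proof (rule lc_cov_bad_gap[OF d(2)])
      show "\<not> ?P (fst p) (snd p)" using bp by (simp add: bad_def)
      show "?P x z" if "x \<le> y" "y \<le> z" "?P x y" "?P y z" for x y z
        using that join[of x y z] by (meson order.trans)
      show "?P x y" if "x < y" "Q x y" for x y using that piece by blast
    qed
    then obtain x' y' where "fst p \<le> x'" "x' \<le> y'" "y' \<le> snd p" "y' - x' \<le> d" "\<not> P x' y'" "a \<le> x'" "y' \<le> b" by blast
    then show ?thesis using d(1) d0(1) by (intro exI[of _ "(x', y')"]) (auto simp: bad_def)
  qed
  have "\<exists>f. \<forall>n. bad (f n) \<and> (fst (f n) \<le> fst (f (Suc n)) \<and> snd (f (Suc n)) \<le> snd (f n)
      \<and> snd (f (Suc n)) - fst (f (Suc n)) \<le> lc_d (of_nat n))"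
  proof (rule dependent_nat_choice)
    show "\<exists>x. bad x" using nP ab by (intro exI[of _ "(a, b)"]) (simp add: bad_def)
  qed (use next_ex in blast)
  then obtain f where f: "\<And>n. bad (f n)" "\<And>n. fst (f n) \<le> fst (f (Suc n))" "\<And>n. snd (f (Suc n)) \<le> snd (f n)"
    "\<And>n. snd (f (Suc n)) - fst (f (Suc n)) \<le> lc_d (of_nat n)" by blast
  have up: "fst (f m) \<le> fst (f n)" and down: "snd (f n) \<le> snd (f m)" if "m \<le> n" for m n
    using lift_Suc_mono_le[of "\<lambda>n. fst (f n)"] lift_Suc_antimono_le[of "\<lambda>n. snd (f n)"] f(2,3) that by auto
  have le: "fst (f n) \<le> snd (f n)" for n using f(1)[of n] by (simp add: bad_def)
  have cross: "fst (f m) \<le> snd (f n)" for m n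
    using up[of m "max m n"] down[of n "max m n"] le[of "max m n"] by auto
  have "\<exists>c. strongly_converges (\<lambda>n. fst (f n)) c"
  proof (rule lc_Cauchy)
    fix e :: levi_civita assume "0 < e"
    then obtain n :: nat where n: "\<And>p. of_nat n \<le> p \<Longrightarrow> lc_d p < e" using lc_d_nat_small by metis
    have "\<bar>fst (f i) - fst (f j)\<bar> < e" if "i \<ge> Suc n" "j \<ge> Suc n" for i j
      using up[OF that(1)] up[OF that(2)] cross[of i "Suc n"] cross[of j "Suc n"] f(4)[of n] n[of "of_nat n"]
      by (auto simp: abs_less_iff)
    then show "\<exists>N. \<forall>m\<ge>N. \<forall>n\<ge>N. \<bar>fst (f m) - fst (f n)\<bar> < e" by blast
  qed
  then obtain c where c: "strongly_converges (\<lambda>n. fst (f n)) c" by blast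
  have c1: "c \<le> snd (f n)" for n by (rule lc_strong_le[OF c cross])
  have c2: "fst (f n) \<le> c" for n
  proof (rule ccontr)
    assume "\<not> fst (f n) \<le> c"
    then have "\<forall>\<^sub>F m in sequentially. \<bar>fst (f m) - c\<bar> < fst (f n) - c" using c by (simp add: strongly_converges_def)
    then obtain m where "m \<ge> n" "\<bar>fst (f m) - c\<bar> < fst (f n) - c"
      using eventually_happens'[OF sequentially_bot eventually_conj[OF _ eventually_ge_at_top[of n]]] by blast
    then show False using up[of n m] by auto
  qed
  have "c \<in> {a..b}" using c1[of 0] c2[of 0] f(1)[of 0] by (auto simp: bad_def)
  from loc[OF this] obtain g where g: "g > 0"
    "\<And>x y. a \<le> x \<Longrightarrow> x \<le> c \<Longrightarrow> c \<le> y \<Longrightarrow> y \<le> b \<Longrightarrow> y - x < g \<Longrightarrow> P x y" by blast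
  obtain n :: nat where n: "\<And>p. of_nat n \<le> p \<Longrightarrow> lc_d p < g" using lc_d_nat_small[OF g(1)] by metis
  have "snd (f (Suc n)) - fst (f (Suc n)) < g" using f(4)[of n] n[of "of_nat n"] by simp
  then have "P (fst (f (Suc n))) (snd (f (Suc n)))"
    using f(1)[of "Suc n"] by (intro g(2) c1 c2) (auto simp: bad_def)
  then show False using f(1)[of "Suc n"] by (simp add: bad_def)
qed

section \<open>Primitives of bounded measurable functions\<close>

definition lc_lip :: "levi_civita \<Rightarrow> (levi_civita \<Rightarrow> levi_civita) \<Rightarrow> levi_civita \<Rightarrow> levi_civita \<Rightarrow> bool" where
  "lc_lip M W x y \<longleftrightarrow> (\<forall>s t. x \<le> s \<and> s \<le> t \<and> t \<le> y \<longrightarrow> \<bar>W t - W s\<bar> \<le> M * (t - s))"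

lemma lc_lipD: "lc_lip M W x y \<Longrightarrow> x \<le> s \<Longrightarrow> s \<le> t \<Longrightarrow> t \<le> y \<Longrightarrow> \<bar>W t - W s\<bar> \<le> M * (t - s)"
  by (simp add: lc_lip_def)

lemma lc_lip_subset: "lc_lip M W x y \<Longrightarrow> x \<le> x' \<Longrightarrow> y' \<le> y \<Longrightarrow> lc_lip M W x' y'"
  unfolding lc_lip_def by (meson order.trans)

lemma lc_lip_join:
  assumes "lc_lip M W x y" "lc_lip M W y z" shows "lc_lip M W x z"
  unfolding lc_lip_def
proof (intro allI impI, elim conjE)
  fix s t assume st: "x \<le> s" "s \<le> t" "t \<le> z"
  consider "t \<le> y" | "y \<le> s" | "s \<le> y" "y \<le> t" by linarith
  then show "\<bar>W t - W s\<bar> \<le> M * (t - s)"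
  proof cases
    case 1 then show ?thesis using lc_lipD[OF assms(1)] st by blast
  next
    case 2 then show ?thesis using lc_lipD[OF assms(2)] st by blast
  next
    case 3
    have "\<bar>W y - W s\<bar> \<le> M * (y - s)" "\<bar>W t - W y\<bar> \<le> M * (t - y)"
      using lc_lipD[OF assms(1)] lc_lipD[OF assms(2)] st 3 by auto
    moreover have "M * (y - s) + M * (t - y) = M * (t - s)" by (simp add: algebra_simps)
    ultimately show ?thesis by linarith
  qed
qed

lemma lc_prim_lip:
  assumes "lc_prim g F u v" "\<And>x. x \<in> {u..v} \<Longrightarrow> \<bar>g x\<bar> \<le> M" shows "lc_lip M F u v"
  unfolding lc_lip_def
proof (intro allI impI, elim conjE)
  fix s t assume st: "u \<le> s" "s \<le> t" "t \<le> v"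
  show "\<bar>F t - F s\<bar> \<le> M * (t - s)"
  proof (cases "s = t")
    case False
    then have "lc_prim g F s t" using st by (intro lc_prim_subset[OF assms(1)]) auto
    then show ?thesis by (rule lc_prim_bound) (use st assms(2) in auto)
  qed simp
qed

lemma lc_prim_shift:
  assumes F: "lc_prim g F u v" and G: "\<And>x. x \<in> {u..v} \<Longrightarrow> G x = F x + c"
  shows "lc_prim g G u v"
proof -
  obtain y \<tau> where fr: "lc_frame u v y \<tau>" and a: "lc_ana {u..v} y \<tau> F" using F unfolding lc_prim_def by blast
  have "lc_ana {u..v} y \<tau> (\<lambda>x. F x + c)" by (intro lc_ana_add[OF fr] lc_ana_const[OF fr] a) auto
  then have "lc_ana {u..v} y \<tau> G" by (rule lc_ana_cong) (rule G)
  moreover have "lc_has_deriv G (g x) x {u..v}" if x: "x \<in> {u..v}" for x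
  proof (rule lc_has_deriv_cong[OF _ x G[symmetric]])
    show "lc_has_deriv (\<lambda>x. F x + c) (g x) x {u..v}"
      using lc_has_deriv_add[OF _ lc_has_deriv_const, of F "g x" x "{u..v}" c] F x unfolding lc_prim_def by simp
  qed
  ultimately show ?thesis unfolding lc_prim_def using fr by blast
qed

text \<open>A primitive of \<open>g\<close> except on gaps of the total length given by the last argument.\<close>

inductive lc_appr :: "(levi_civita \<Rightarrow> levi_civita) \<Rightarrow> levi_civita \<Rightarrow> (levi_civita \<Rightarrow> levi_civita)
    \<Rightarrow> levi_civita \<Rightarrow> levi_civita \<Rightarrow> levi_civita \<Rightarrow> bool" for g M W where
  prim: "lc_prim g W x y \<Longrightarrow> lc_appr g M W x y 0"
| gap: "x \<le> y \<Longrightarrow> lc_lip M W x y \<Longrightarrow> lc_appr g M W x y (y - x)"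
| join: "lc_appr g M W x y d \<Longrightarrow> lc_appr g M W y z e \<Longrightarrow> lc_appr g M W x z (d + e)"

lemma lc_appr_nonneg: "lc_appr g M W x y d \<Longrightarrow> 0 \<le> d \<and> x \<le> y"
  by (induction rule: lc_appr.induct) (auto dest: lc_prim_less)

lemma lc_appr_shift:
  "lc_appr g M W x y d \<Longrightarrow> (\<And>t. t \<in> {x..y} \<Longrightarrow> W' t = W t + c) \<Longrightarrow> lc_appr g M W' x y d"
proof (induction rule: lc_appr.induct)
  case (prim x y)
  then show ?case by (intro lc_appr.prim lc_prim_shift[of g W x y W' c]) auto
next
  case (gap x y)
  then have "lc_lip M W' x y" unfolding lc_lip_def by auto
  then show ?case using gap by (intro lc_appr.gap) auto
next
  case (join x y d z e)
  have "x \<le> y" "y \<le> z" using lc_appr_nonneg join.hyps by blast+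
  then show ?case using join by (intro lc_appr.join join.IH) auto
qed

lemma lc_appr_ex: "lc_simple_cov g x y d \<Longrightarrow> 0 \<le> M \<Longrightarrow> \<exists>W. lc_appr g M W x y d"
proof (induction rule: lc_cov.induct)
  case (piece x y)
  then show ?case using lc_simple_prim_ex[of x y g] lc_appr.prim by metis
next
  case (gap x y)
  have "lc_lip M (\<lambda>_. 0) x y" using gap by (auto simp: lc_lip_def)
  then show ?case using gap lc_appr.gap by blast
next
  case (join x y d z e)
  then obtain W1 W2 where W: "lc_appr g M W1 x y d" "lc_appr g M W2 y z e" by blast
  let ?W = "\<lambda>t. if t \<le> y then W1 t else W2 t + (W1 y - W2 y)"
  have "lc_appr g M ?W x y d" by (rule lc_appr_shift[OF W(1), of _ 0]) auto
  moreover have "lc_appr g M ?W y z e" by (rule lc_appr_shift[OF W(2), of _ "W1 y - W2 y"]) auto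
  ultimately show ?case using lc_appr.join by blast
qed

lemma lc_appr_lip:
  "lc_appr g M W x y d \<Longrightarrow> (\<And>t. t \<in> {x..y} \<Longrightarrow> \<bar>g t\<bar> \<le> M) \<Longrightarrow> lc_lip M W x y"
proof (induction rule: lc_appr.induct)
  case (prim x y) then show ?case by (rule lc_prim_lip)
next
  case (join x y d z e)
  have "x \<le> y" "y \<le> z" using lc_appr_nonneg join.hyps by blast+
  then show ?case using join by (intro lc_lip_join[of M W x y z] join.IH) auto
qed

lemma lc_appr_split:
  "lc_appr g M W x z d \<Longrightarrow> x \<le> y \<Longrightarrow> y \<le> z \<Longrightarrow>
    \<exists>d1 d2. d1 + d2 \<le> d \<and> lc_appr g M W x y d1 \<and> lc_appr g M W y z d2"
proof (induction arbitrary: y rule: lc_appr.induct)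
  case (prim x z)
  \<comment> \<open>If the splitting point is an end point, one part is degenerate; it counts as a
    gap of length 0, since \<open>lc_prim\<close> requires a proper interval.\<close>
  have deg: "lc_appr g M W t t 0" for t
  proof -
    have "\<bar>W s' - W s\<bar> \<le> M * (s' - s)" if "t \<le> s \<and> s \<le> s' \<and> s' \<le> t" for s s'
    proof -
      have "s' = s" using that by linarith
      then show ?thesis by simp
    qed
    then have "lc_lip M W t t" unfolding lc_lip_def by blast
    then show ?thesis using lc_appr.gap[of t t M W g] by simp
  qed
  have "lc_appr g M W x y 0"
    using prim deg lc_appr.prim[OF lc_prim_subset[OF prim(1), of x y]] by (cases "x = y") auto
  moreover have "lc_appr g M W y z 0"
    using prim deg lc_appr.prim[OF lc_prim_subset[OF prim(1), of y z]] by (cases "y = z") auto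
  ultimately show ?case by (intro exI[of _ 0]) simp
next
  case (gap x z)
  have "lc_appr g M W x y (y - x)" "lc_appr g M W y z (z - y)"
    using gap by (auto intro!: lc_appr.gap elim!: lc_lip_subset)
  then show ?case by (intro exI[of _ "y - x"] exI[of _ "z - y"]) simp
next
  case (join x w d z e)
  show ?case
  proof (cases "y \<le> w")
    case True
    then obtain d1 d2 where "d1 + d2 \<le> d" "lc_appr g M W x y d1" "lc_appr g M W y w d2"
      using join.IH(1) join.prems by blast
    then show ?thesis using lc_appr.join[OF _ join.hyps(2)]
      by (intro exI[of _ d1] exI[of _ "d2 + e"]) auto
  next
    case False
    then obtain d1 d2 where "d1 + d2 \<le> e" "lc_appr g M W w y d1" "lc_appr g M W y z d2"
      using join.IH(2)[of y] join.prems by auto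
    then show ?thesis using lc_appr.join[OF join.hyps(1)]
      by (intro exI[of _ "d + d1"] exI[of _ d2]) auto
  qed
qed

lemma lc_appr_restrict:
  assumes "lc_appr g M W x y d" "x \<le> x'" "x' \<le> y'" "y' \<le> y"
  shows "\<exists>d'\<le>d. lc_appr g M W x' y' d'"
proof -
  obtain d1 d2 where d: "d1 + d2 \<le> d" "lc_appr g M W x x' d1" "lc_appr g M W x' y d2"
    using lc_appr_split[OF assms(1,2)] assms by (meson order.trans)
  obtain d3 d4 where "d3 + d4 \<le> d2" "lc_appr g M W x' y' d3" "lc_appr g M W y' y d4"
    using lc_appr_split[OF d(3) assms(3,4)] by blast
  then show ?thesis using d lc_appr_nonneg[OF d(2)] lc_appr_nonneg[of g M W y' y d4]
    by (intro exI[of _ d3]) auto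
qed

lemma lc_appr_compare_prim:
  assumes "lc_appr g M W x y d" "lc_prim g F X Y" "X \<le> x" "y \<le> Y" "\<And>t. t \<in> {X..Y} \<Longrightarrow> \<bar>g t\<bar> \<le> M"
  shows "\<bar>(W y - W x) - (F y - F x)\<bar> \<le> 2 * M * d"
  using assms(1,3,4)
proof (induction rule: lc_appr.induct)
  case (prim x y)
  then have "lc_prim g F x y" using lc_prim_less[OF prim(1)] by (intro lc_prim_subset[OF assms(2)])
  then show ?case using lc_prim_unique[OF prim(1)] by simp
next
  case (gap x y)
  have "\<bar>F y - F x\<bar> \<le> M * (y - x)" using lc_lipD[OF lc_prim_lip[OF assms(2,5)], of x y] gap by simp
  moreover have "\<bar>W y - W x\<bar> \<le> M * (y - x)" using lc_lipD[OF gap(2), of x y] gap by simp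
  moreover have "2 * M * (y - x) = M * (y - x) + M * (y - x)" by (simp add: algebra_simps)
  ultimately show ?case by linarith
next
  case (join x y d z e)
  have "x \<le> y" "y \<le> z" using lc_appr_nonneg join.hyps by blast+
  then have "\<bar>(W y - W x) - (F y - F x)\<bar> \<le> 2 * M * d" "\<bar>(W z - W y) - (F z - F y)\<bar> \<le> 2 * M * e"
    using join by auto
  moreover have "2 * M * (d + e) = 2 * M * d + 2 * M * e" by (simp add: algebra_simps)
  ultimately show ?case by linarith
qed

text \<open>The two coverings are refined against each other. Where both functions are analytic
  primitives, their increments agree by uniqueness; on a gap of either, each moves by at most
  \<open>M\<close> times the length, which explains the factor 2.\<close>

lemma lc_appr_compare:
  assumes "lc_appr g M W x y d" "lc_appr g M W' x y d'" "\<And>t. t \<in> {x..y} \<Longrightarrow> \<bar>g t\<bar> \<le> M" "0 \<le> M"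
  shows "\<bar>(W' y - W' x) - (W y - W x)\<bar> \<le> 2 * M * (d + d')"
  using assms(1-3)
proof (induction arbitrary: d' rule: lc_appr.induct)
  case (prim x y)
  show ?case using lc_appr_compare_prim[OF prim(2,1) order.refl order.refl prim(3)] by simp
next
  case (gap x y)
  have "\<bar>W' y - W' x\<bar> \<le> M * (y - x)" using lc_lipD[OF lc_appr_lip[OF gap(3,4)], of x y] gap(1) by simp
  moreover have "\<bar>W y - W x\<bar> \<le> M * (y - x)" using lc_lipD[OF gap(2), of x y] gap by simp
  moreover have "2 * M * (y - x + d') = M * (y - x) + M * (y - x) + 2 * M * d'" by (simp add: algebra_simps)
  moreover have "0 \<le> 2 * M * d'" using lc_appr_nonneg[OF gap(3)] assms(4) by simp
  ultimately show ?case by linarith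
next
  case (join x y d z e)
  have xyz: "x \<le> y" "y \<le> z" using lc_appr_nonneg join.hyps by blast+
  obtain d1 d2 where d: "d1 + d2 \<le> d'" "lc_appr g M W' x y d1" "lc_appr g M W' y z d2"
    using lc_appr_split[OF join.prems(1) xyz] by blast
  have "\<bar>(W' y - W' x) - (W y - W x)\<bar> \<le> 2 * M * (d + d1)" "\<bar>(W' z - W' y) - (W z - W y)\<bar> \<le> 2 * M * (e + d2)"
    using join.IH(1)[OF d(2)] join.IH(2)[OF d(3)] join.prems(2) xyz by auto
  moreover have "2 * M * (d + d1) + 2 * M * (e + d2) \<le> 2 * M * (d + e + d')"
  proof -
    have "2 * M * (d + d1 + (e + d2)) \<le> 2 * M * (d + e + d')"
      using assms(4) d(1) by (intro mult_left_mono) auto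
    then show ?thesis by (simp add: algebra_simps)
  qed
  ultimately show ?case by linarith
qed

text \<open>The elements \<open>lc_d (of_nat n)\<close> fall below every positive element, so their
  multiples by \<open>c\<close> tend to 0 even for infinitely large \<open>c\<close>.\<close>

lemma lc_small_le_0:
  assumes "\<And>n::nat. x \<le> c * lc_d (of_nat n)" shows "x \<le> (0 :: levi_civita)"
proof (rule ccontr)
  assume "\<not> x \<le> 0"
  then have x: "0 < x" by simp
  have c: "0 < c" using assms[of 0] x lc_d_pos[of 0]
    by (metis less_le_trans of_nat_0 zero_less_mult_pos2)
  then obtain n :: nat where "\<And>p. of_nat n \<le> p \<Longrightarrow> lc_d p < x / c" using lc_d_nat_small x by (metis divide_pos_pos)
  then have "lc_d (of_nat n) < x / c" by blast
  then have "c * lc_d (of_nat n) < x" using c by (simp add: less_divide_eq mult.commute)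
  then show False using assms[of n] by simp
qed

text \<open>Pointwise differentiability is not demanded: the increments on power series intervals
  and a Lipschitz bound across the gaps already determine the integral.\<close>

definition lc_primitive ::
    "(levi_civita \<Rightarrow> levi_civita) \<Rightarrow> levi_civita \<Rightarrow> (levi_civita \<Rightarrow> levi_civita) \<Rightarrow> levi_civita \<Rightarrow> levi_civita \<Rightarrow> bool" where
  "lc_primitive g M W a b \<longleftrightarrow> lc_lip M W a b
    \<and> (\<forall>F x y. a \<le> x \<and> y \<le> b \<and> lc_prim g F x y \<longrightarrow> W y - W x = F y - F x)"

text \<open>Approximate primitives with gaps of total length at most \<open>lc_d (of_nat n)\<close>
  have increments that form Cauchy sequences by \<open>lc_appr_compare\<close>. Normalising the
  functions to 0 at \<open>a\<close>, as \<open>V\<close> does, turns this into convergence of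
  values.\<close>

lemma lc_primitive_ex:
  assumes cov: "\<And>e. 0 < e \<Longrightarrow> \<exists>d\<le>e. lc_simple_cov g a b d"
    and M: "\<And>t. t \<in> {a..b} \<Longrightarrow> \<bar>g t\<bar> \<le> M" "0 \<le> M" and ab: "a \<le> b"
  obtains W where "lc_primitive g M W a b"
proof -
  have "\<exists>W d. d \<le> lc_d (of_nat n) \<and> lc_appr g M W a b d" for n :: nat
    using cov[OF lc_d_pos] lc_appr_ex M(2) by meson
  then obtain W d where d: "\<And>n::nat. d n \<le> lc_d (of_nat n)" and W: "\<And>n::nat. lc_appr g M (W n) a b (d n)" by metis
  define V where "V n t = W n t - W n a" for n t
  have res: "\<exists>d'\<le>lc_d (of_nat n). lc_appr g M (W n) x y d'" if "a \<le> x" "x \<le> y" "y \<le> b" for n x y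
    using lc_appr_restrict[OF W that] d order.trans by blast
  have cmp: "\<bar>(W m y - W m x) - (W n y - W n x)\<bar> \<le> 2 * M * (lc_d (of_nat n) + lc_d (of_nat m))"
    if xy: "a \<le> x" "x \<le> y" "y \<le> b" for m n x y
  proof -
    obtain dn where dn: "dn \<le> lc_d (of_nat n)" "lc_appr g M (W n) x y dn" using res[OF xy] by blast
    obtain dm where dm: "dm \<le> lc_d (of_nat m)" "lc_appr g M (W m) x y dm" using res[OF xy] by blast
    have "\<bar>(W m y - W m x) - (W n y - W n x)\<bar> \<le> 2 * M * (dn + dm)"
      by (rule lc_appr_compare[OF dn(2) dm(2) _ M(2)]) (use M(1) xy in auto)
    also have "\<dots> \<le> 2 * M * (lc_d (of_nat n) + lc_d (of_nat m))" using M(2) dn dm by (intro mult_left_mono) auto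
    finally show ?thesis .
  qed
  have dmono: "lc_d (of_nat m) \<le> lc_d (of_nat n)" if "n \<le> m" for m n :: nat
  proof (cases "n = m")
    case False
    then have "\<bar>lc_d (of_nat m)\<bar> < lc_d (of_nat n)" using that by (intro lc_ge_abs_less_d lc_ge_monom) auto
    then show ?thesis by simp
  qed simp
  have cau: "\<exists>l. strongly_converges (\<lambda>n. V n t) l" if t: "a \<le> t" "t \<le> b" for t
  proof (rule lc_Cauchy)
    fix e :: levi_civita assume e: "0 < e"
    \<comment> \<open>\<open>M + 1\<close> instead of \<open>M\<close> avoids a division by
      0.\<close>
    have M1: "0 < 4 * (M + 1)" using M(2) by simp
    obtain N :: nat where N: "\<And>p. of_nat N \<le> p \<Longrightarrow> lc_d p < e / (4 * (M + 1))"
      using lc_d_nat_small[of "e / (4 * (M + 1))"] e M1 by auto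
    have "\<bar>V m t - V n t\<bar> < e" if mn: "m \<ge> N" "n \<ge> N" for m n
    proof -
      have "\<bar>V m t - V n t\<bar> \<le> 2 * M * (lc_d (of_nat n) + lc_d (of_nat m))"
        using cmp[of a t m n] t by (simp add: V_def)
      also have "\<dots> \<le> 2 * M * (lc_d (of_nat N) + lc_d (of_nat N))"
        using M(2) dmono mn by (intro mult_left_mono add_mono) auto
      also have "\<dots> = 4 * M * lc_d (of_nat N)" by (simp add: algebra_simps)
      also have "\<dots> \<le> 4 * (M + 1) * lc_d (of_nat N)" using lc_d_pos[of "of_nat N"] by (intro mult_right_mono) auto
      also have "\<dots> < e" using N[of "of_nat N"] M1 by (simp add: less_divide_eq mult.commute)
      finally show ?thesis .
    qed
    then show "\<exists>N. \<forall>m\<ge>N. \<forall>n\<ge>N. \<bar>V m t - V n t\<bar> < e" by blast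
  qed
  then have "\<forall>t. \<exists>l. a \<le> t \<and> t \<le> b \<longrightarrow> strongly_converges (\<lambda>n. V n t) l" by blast
  then obtain U where U: "\<And>t. a \<le> t \<Longrightarrow> t \<le> b \<Longrightarrow> strongly_converges (\<lambda>n. V n t) (U t)" by metis
  have UV: "strongly_converges (\<lambda>n. W n y - W n x) (U y - U x)" if "a \<le> x" "x \<le> y" "y \<le> b" for x y
    using lc_strong_diff[OF U[of y] U[of x]] that by (simp add: V_def)
  have "lc_lip M U a b" unfolding lc_lip_def
  proof (intro allI impI, elim conjE)
    fix s t assume st: "a \<le> s" "s \<le> t" "t \<le> b"
    have l: "\<bar>W n t - W n s\<bar> \<le> M * (t - s)" for n
      using lc_lipD[OF lc_appr_lip[OF W M(1)] st] .
    have "U t - U s \<le> M * (t - s)" by (rule lc_strong_le[OF UV[OF st]]) (use l in \<open>simp add: abs_le_iff\<close>)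
    moreover have "(-1) * (U t - U s) \<le> M * (t - s)"
      by (rule lc_strong_le[OF lc_strong_cmult[OF UV[OF st]]]) (use l in \<open>simp add: abs_le_iff\<close>)
    ultimately show "\<bar>U t - U s\<bar> \<le> M * (t - s)" by (simp add: abs_le_iff)
  qed
  moreover have "U y - U x = F y - F x" if F: "a \<le> x" "y \<le> b" "lc_prim g F x y" for F x y
  proof (rule lc_strong_unique[OF UV])
    show xy: "a \<le> x" "x \<le> y" "y \<le> b" using F lc_prim_less by (auto intro: less_imp_le)
    have l: "\<bar>(W n y - W n x) - (F y - F x)\<bar> \<le> 2 * M * lc_d (of_nat n)" for n
    proof -
      obtain dn where dn: "dn \<le> lc_d (of_nat n)" "lc_appr g M (W n) x y dn" using res[OF xy] by blast
      have "\<bar>(W n y - W n x) - (F y - F x)\<bar> \<le> 2 * M * dn"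
        by (rule lc_appr_compare_prim[OF dn(2) F(3)]) (use M(1) xy in auto)
      also have "\<dots> \<le> 2 * M * lc_d (of_nat n)" using M(2) dn(1) by (intro mult_left_mono) auto
      finally show ?thesis .
    qed
    show "strongly_converges (\<lambda>n. W n y - W n x) (F y - F x)" unfolding strongly_converges_def
    proof (intro allI impI)
      fix e :: levi_civita assume e: "0 < e"
      have M1: "0 < 2 * (M + 1)" using M(2) by simp
      obtain N :: nat where N: "\<And>p. of_nat N \<le> p \<Longrightarrow> lc_d p < e / (2 * (M + 1))"
        using lc_d_nat_small[of "e / (2 * (M + 1))"] e M1 by auto
      have "\<bar>W n y - W n x - (F y - F x)\<bar> < e" if "n \<ge> N" for n
      proof -
        have "\<bar>W n y - W n x - (F y - F x)\<bar> \<le> 2 * M * lc_d (of_nat n)" by (rule l)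
        also have "\<dots> \<le> 2 * (M + 1) * lc_d (of_nat n)" using lc_d_pos[of "of_nat n"] by (intro mult_right_mono) auto
        also have "\<dots> < e" using N[of "of_nat n"] that M1 by (simp add: less_divide_eq mult.commute)
        finally show ?thesis .
      qed
      then show "\<forall>\<^sub>F n in sequentially. \<bar>W n y - W n x - (F y - F x)\<bar> < e"
        using eventually_sequentially by blast
    qed
  qed
  ultimately show ?thesis using that unfolding lc_primitive_def by blast
qed

section \<open>The integral as the increment of a primitive\<close>

text \<open>If \<open>I\<close> is not closed, the integral is a difference of limits of
  \<open>F\<close> that need not be values. On closed subintervals \<open>F\<close> and
  \<open>W\<close> have equal increments, and the Lipschitz bound of \<open>W\<close> carries the
  equality to the ends.\<close>

lemma lc_primitive_simple_integral:
  assumes W: "lc_primitive g M W a b" and I: "lc_interval u v I" "I \<subseteq> {a..b}"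
    and j: "lc_has_simple_integral g u v I j" and M: "0 \<le> M"
  shows "j = W v - W u"
proof (cases "u = v")
  case True then show ?thesis using j by (simp add: lc_has_simple_integral_def)
next
  case False
  then have uv: "u < v" using I(1) by (auto simp: lc_interval_def)
  obtain F L K where F: "(F \<longlongrightarrow> L) (at u within I)" "(F \<longlongrightarrow> K) (at v within I)" "j = K - L"
    and p: "\<And>x z. x < z \<Longrightarrow> {x..z} \<subseteq> I \<Longrightarrow> lc_prim g F x z"
    by (rule lc_simple_integral_prim[OF j I(1) uv]) blast
  have ab: "a \<le> u" "v \<le> b" by (rule lc_interval_bounds[OF I(1) uv I(2)])+
  obtain c where c: "u < c" "c < v" using dense[OF uv] by blast
  have lip: "lc_lip M W a b" using W by (simp add: lc_primitive_def)
  have inc: "F x - F c = W x - W c" if x: "u < x" "x < v" for x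
  proof -
    have sub: "{min x c..max x c} \<subseteq> I" using lc_interval_mem(2)[OF I(1)] x c by force
    show ?thesis
    proof (cases x c rule: linorder_cases)
      case less
      then have "lc_prim g F x c" using sub by (intro p) auto
      then have "W c - W x = F c - F x" using W ab x c unfolding lc_primitive_def by (meson less_imp_le order.trans)
      then show ?thesis by (simp add: algebra_simps)
    next
      case greater
      then have "lc_prim g F c x" using sub by (intro p) auto
      then show ?thesis using W ab x c unfolding lc_primitive_def by (metis less_imp_le order.trans)
    qed simp
  qed
  have lim: "(F \<longlongrightarrow> F c - W c + W w) (at w within {u<..<v})" if w: "w \<in> {u..v}" for w
    unfolding lc_tendsto_at_iff
  proof (intro allI impI)
    fix e :: levi_civita assume e: "e > 0"
    have M1: "0 < M + 1" using M by simp
    have "\<bar>F y - (F c - W c + W w)\<bar> < e" if y: "y \<in> {u<..<v}" "\<bar>y - w\<bar> < e / (M + 1)" for y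
    proof -
      have "F y - (F c - W c + W w) = W y - W w" using inc[of y] y by (simp add: algebra_simps)
      moreover have "\<bar>W y - W w\<bar> \<le> M * \<bar>y - w\<bar>"
      proof (cases "y \<le> w")
        case True then show ?thesis using lc_lipD[OF lip, of y w] ab w y by (simp add: abs_minus_commute)
      next
        case False then show ?thesis using lc_lipD[OF lip, of w y] ab w y by simp
      qed
      moreover have "M * \<bar>y - w\<bar> \<le> (M + 1) * \<bar>y - w\<bar>" by (intro mult_right_mono) auto
      moreover have "(M + 1) * \<bar>y - w\<bar> < e" using y(2) M1 by (simp add: less_divide_eq mult.commute)
      ultimately show ?thesis by simp
    qed
    then show "\<exists>d>0. \<forall>y\<in>{u<..<v}. y \<noteq> w \<and> \<bar>y - w\<bar> < d \<longrightarrow> \<bar>F y - (F c - W c + W w)\<bar> < e"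
      using e M1 by (intro exI[of _ "e / (M + 1)"]) auto
  qed
  have Io: "lc_interval u v {u<..<v}" using uv by (simp add: lc_interval_def)
  have nb: "at u within {u<..<v} \<noteq> bot" "at v within {u<..<v} \<noteq> bot"
    using lc_interval_limit_point[OF Io uv] uv by auto
  have "L = F c - W c + W u"
    using tendsto_unique[OF nb(1) tendsto_within_subset[OF F(1) lc_interval_mem(2)[OF I(1)]] lim] uv by simp
  moreover have "K = F c - W c + W v"
    using tendsto_unique[OF nb(2) tendsto_within_subset[OF F(2) lc_interval_mem(2)[OF I(1)]] lim] uv by simp
  ultimately show ?thesis using F(3) by simp
qed

text \<open>Both M t - W t and M t + W t are nondecreasing, so their increments over disjoint
  intervals sum to at most the total increment. This bounds the deviation by \<open>M\<close> times
  the uncovered length without describing the complement of an infinite family.\<close>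

lemma lc_primitive_family_sum:
  assumes lip: "lc_lip M W a b" and d: "disjoint_intervals u v I" "(\<Union>n. I n) \<subseteq> {a..b}" "a \<le> b" "0 \<le> M"
    and s: "strong_sums (\<lambda>n. v n - u n) s"
  shows "\<exists>S. strong_sums (\<lambda>n. W (v n) - W (u n)) S \<and> \<bar>S - (W b - W a)\<bar> \<le> M * (b - a - s)"
proof -
  define L where "L N = (\<Sum>n<N. v n - u n)" for N
  define T where "T N = (\<Sum>n<N. W (v n) - W (u n))" for N
  have I: "lc_interval (u n) (v n) (I n)" for n using d(1) by (simp add: disjoint_intervals_def)
  have one: "\<bar>W (v n) - W (u n)\<bar> \<le> M * (v n - u n)" for n
  proof (cases "u n = v n")
    case False
    then have uv: "u n < v n" using I[of n] by (auto simp: lc_interval_def)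
    have "I n \<subseteq> {a..b}" using d(2) by blast
    then show ?thesis using lc_interval_bounds[OF I uv] uv by (intro lc_lipD[OF lip]) auto
  qed simp
  have sL: "strongly_converges L s" using s by (simp add: strong_sums_def L_def[abs_def])
  have diff: "\<bar>T m - T n\<bar> \<le> M * (L m - L n)" if "n \<le> m" for m n
  proof -
    have "T m - T n = (\<Sum>i\<in>{n..<m}. W (v i) - W (u i))" "L m - L n = (\<Sum>i\<in>{n..<m}. v i - u i)"
      unfolding T_def L_def lessThan_atLeast0 using that by (simp_all add: sum_diff_nat_ivl)
    then show ?thesis using order.trans[OF sum_abs sum_mono[OF one]] by (simp add: sum_distrib_left)
  qed
  have "\<exists>S. strongly_converges T S"
  proof (rule lc_Cauchy)
    fix e :: levi_civita assume e: "0 < e"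
    have M1: "0 < 2 * (M + 1)" using d(4) by simp
    then have "0 < e / (2 * (M + 1))" using e by simp
    then have "\<forall>\<^sub>F N in sequentially. \<bar>L N - s\<bar> < e / (2 * (M + 1))"
      using sL unfolding strongly_converges_def by blast
    then obtain N where N: "\<And>n. n \<ge> N \<Longrightarrow> \<bar>L n - s\<bar> < e / (2 * (M + 1))" by (auto simp: eventually_sequentially)
    have *: "\<bar>T m - T n\<bar> < e" if mn: "m \<ge> n" "n \<ge> N" for m n
    proof -
      have b: "\<bar>L m - s\<bar> < e / (2 * (M + 1))" "\<bar>L n - s\<bar> < e / (2 * (M + 1))" using N mn by auto
      have nn: "0 \<le> L m - L n"
        unfolding L_def lessThan_atLeast0 using mn(1) I
        by (simp add: sum_diff_nat_ivl lc_interval_def sum_nonneg)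
      have "L m - L n < 2 * (e / (2 * (M + 1)))" using b by linarith
      also have "2 * (e / (2 * (M + 1))) = e / (M + 1)" using M1 by (simp add: field_simps)
      finally have "(M + 1) * (L m - L n) < e" using M1 by (simp add: less_divide_eq mult.commute)
      moreover have "M * (L m - L n) \<le> (M + 1) * (L m - L n)" using nn by (intro mult_right_mono) auto
      ultimately show ?thesis using diff[OF mn(1)] by linarith
    qed
    have "\<bar>T m - T n\<bar> < e" if "m \<ge> N" "n \<ge> N" for m n
      using *[of n m] *[of m n] that by (cases "n \<le> m") (auto simp: abs_minus_commute)
    then show "\<exists>N. \<forall>m\<ge>N. \<forall>n\<ge>N. \<bar>T m - T n\<bar> < e" by blast
  qed
  then obtain S where S: "strongly_converges T S" by blast
  have b1: "M * L N - T N \<le> (M * b - W b) - (M * a - W a)" for N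
  proof -
    have "M * L N - T N = (\<Sum>n<N. (M * v n - W (v n)) - (M * u n - W (u n)))"
      unfolding L_def T_def sum_distrib_left sum_subtractf[symmetric] by (rule sum.cong) (auto simp: algebra_simps)
    also have "\<dots> \<le> (M * b - W b) - (M * a - W a)"
    proof (rule lc_intervals_sum_mono[OF d(1-3), where Y = "\<lambda>t. M * t - W t"])
      fix s t assume "a \<le> s" "s \<le> t" "t \<le> b"
      then show "M * s - W s \<le> M * t - W t" using lc_lipD[OF lip, of s t] by (auto simp: abs_le_iff algebra_simps)
    qed
    finally show ?thesis .
  qed
  have b2: "M * L N + T N \<le> (M * b + W b) - (M * a + W a)" for N
  proof -
    have "M * L N + T N = (\<Sum>n<N. (M * v n + W (v n)) - (M * u n + W (u n)))"
      unfolding L_def T_def sum_distrib_left sum.distrib[symmetric] by (rule sum.cong) (auto simp: algebra_simps)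
    also have "\<dots> \<le> (M * b + W b) - (M * a + W a)"
    proof (rule lc_intervals_sum_mono[OF d(1-3), where Y = "\<lambda>t. M * t + W t"])
      fix s t assume "a \<le> s" "s \<le> t" "t \<le> b"
      then show "M * s + W s \<le> M * t + W t" using lc_lipD[OF lip, of s t] by (auto simp: abs_le_iff algebra_simps)
    qed
    finally show ?thesis .
  qed
  have "M * s - S \<le> (M * b - W b) - (M * a - W a)"
    by (rule lc_strong_le[OF lc_strong_diff[OF lc_strong_cmult[OF sL] S] b1])
  moreover have "M * s - (-1) * S \<le> (M * b + W b) - (M * a + W a)"
    by (rule lc_strong_le[OF lc_strong_diff[OF lc_strong_cmult[OF sL] lc_strong_cmult[OF S]]])
      (use b2 in simp)
  ultimately have "\<bar>S - (W b - W a)\<bar> \<le> M * (b - a - s)" by (simp add: abs_le_iff algebra_simps)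
  then show ?thesis using S by (auto simp: strong_sums_def T_def[abs_def])
qed

text \<open>The equivalence settles existence and uniqueness at once, so that the definite
  description in \<open>lc_integral\<close> denotes the increment of \<open>W\<close>.\<close>

lemma lc_has_integral_primitive:
  assumes g: "lc_measurable_on {a..b} g" and W: "lc_primitive g M W a b" and M: "0 \<le> M" and ab: "a < b"
  shows "lc_has_integral {a..b} g J \<longleftrightarrow> J = W b - W a"
proof -
  have lip: "lc_lip M W a b" using W by (simp add: lc_primitive_def)
  have meas: "lc_measure {a..b} = b - a" using lc_measure_Icc ab by simp
  have M1: "0 < M + 1" using M by simp
  have small: "M * (b - a - s) < e" if e: "0 < e" and "b - a - s < e / (M + 1)" "s \<le> b - a" for e s
  proof -
    have "M * (b - a - s) \<le> (M + 1) * (b - a - s)" using that(3) by (intro mult_right_mono) auto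
    also have "\<dots> < e" using that(2) M1 by (simp add: less_divide_eq mult.commute)
    finally show ?thesis .
  qed
  show ?thesis
  proof
    assume J: "J = W b - W a"
    show "lc_has_integral {a..b} g J" unfolding lc_has_integral_def
    proof (intro conjI g allI impI)
      fix e :: levi_civita assume e: "0 < e"
      show "\<exists>\<eta>>0. \<forall>u v I s. disjoint_intervals u v I \<and> (\<Union>n. I n) \<subseteq> {a..b}
        \<and> (\<forall>n. lc_simple_on (I n) g) \<and> strong_sums (\<lambda>n. v n - u n) s \<and> lc_measure {a..b} - s < \<eta>
        \<longrightarrow> (\<exists>j S. (\<forall>n. lc_has_simple_integral g (u n) (v n) (I n) (j n))
             \<and> strong_sums j S \<and> \<bar>S - J\<bar> < e)"
      proof (intro exI[of _ "e / (M + 1)"] conjI allI impI)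
        fix u v I s
        assume h: "disjoint_intervals u v I \<and> (\<Union>n. I n) \<subseteq> {a..b}
          \<and> (\<forall>n. lc_simple_on (I n) g) \<and> strong_sums (\<lambda>n. v n - u n) s \<and> lc_measure {a..b} - s < e / (M + 1)"
        then have d: "disjoint_intervals u v I" "(\<Union>n. I n) \<subseteq> {a..b}" "\<And>n. lc_simple_on (I n) g"
          "strong_sums (\<lambda>n. v n - u n) s" "b - a - s < e / (M + 1)" unfolding meas by auto
        have I: "lc_interval (u n) (v n) (I n)" "I n \<subseteq> {a..b}" for n
          using d by (auto simp: disjoint_intervals_def)
        have "lc_has_simple_integral g (u n) (v n) (I n) (W (v n) - W (u n))" for n
        proof -
          obtain j where j: "lc_has_simple_integral g (u n) (v n) (I n) j"
            using lc_simple_integral_ex[OF I(1) d(3)] by blast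
          then show ?thesis using lc_primitive_simple_integral[OF W I j M] by simp
        qed
        moreover obtain S where S: "strong_sums (\<lambda>n. W (v n) - W (u n)) S" "\<bar>S - (W b - W a)\<bar> \<le> M * (b - a - s)"
          using lc_primitive_family_sum[OF lip d(1,2) less_imp_le[OF ab] M d(4)] by blast
        moreover have "s \<in> lc_inner_sums {a..b}" using d unfolding lc_inner_sums_def by blast
        then have "s \<le> b - a" by (rule lc_inner_sum_le[OF less_imp_le[OF ab]])
        ultimately show "\<exists>j S. (\<forall>n. lc_has_simple_integral g (u n) (v n) (I n) (j n))
             \<and> strong_sums j S \<and> \<bar>S - J\<bar> < e"
          using small[OF e d(5)] unfolding J
          by (intro exI[of _ "\<lambda>n. W (v n) - W (u n)"] exI[of _ S]) auto
      qed (use e M1 in simp)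
    qed
  next
    assume J: "lc_has_integral {a..b} g J"
    have "\<bar>J - (W b - W a)\<bar> < e" if e: "0 < e" for e
    proof -
      have e2: "0 < e / 2" using e by simp
      then obtain \<eta> where \<eta>: "\<eta> > 0" "\<forall>u v I s. disjoint_intervals u v I \<and> (\<Union>n. I n) \<subseteq> {a..b}
        \<and> (\<forall>n. lc_simple_on (I n) g) \<and> strong_sums (\<lambda>n. v n - u n) s \<and> lc_measure {a..b} - s < \<eta>
        \<longrightarrow> (\<exists>j S. (\<forall>n. lc_has_simple_integral g (u n) (v n) (I n) (j n)) \<and> strong_sums j S \<and> \<bar>S - J\<bar> < e / 2)"
        using J unfolding lc_has_integral_def by blast
      define \<mu> where "\<mu> = min \<eta> (e / 2 / (M + 1))"
      have "0 < \<mu>" using \<eta>(1) e M1 by (simp add: \<mu>_def)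
      then obtain u v I s where h: "disjoint_intervals u v I" "(\<Union>n. I n) \<subseteq> {a..b}"
        "strong_sums (\<lambda>n. v n - u n) s" "lc_measure {a..b} - s < \<mu>" "\<forall>n. lc_simple_on (I n) g"
        using g unfolding lc_measurable_on_def by blast
      have "lc_measure {a..b} - s < \<eta>" "b - a - s < e / 2 / (M + 1)" using h(4) by (auto simp: \<mu>_def meas)
      note mu = this
      obtain j S where j: "\<And>n. lc_has_simple_integral g (u n) (v n) (I n) (j n)" "strong_sums j S" "\<bar>S - J\<bar> < e / 2"
        using \<eta>(2)[THEN spec, THEN spec, THEN spec, THEN spec, of u v I s] h mu(1) by blast
      have "lc_interval (u n) (v n) (I n)" "I n \<subseteq> {a..b}" for n
        using h by (auto simp: disjoint_intervals_def)
      then have "j n = W (v n) - W (u n)" for n using lc_primitive_simple_integral[OF W _ _ j(1) M] by blast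
      then have jW: "j = (\<lambda>n. W (v n) - W (u n))" by auto
      obtain S' where S': "strong_sums (\<lambda>n. W (v n) - W (u n)) S'" "\<bar>S' - (W b - W a)\<bar> \<le> M * (b - a - s)"
        using lc_primitive_family_sum[OF lip h(1,2) less_imp_le[OF ab] M h(3)] by blast
      have "S' = S" using S'(1) j(2) unfolding jW strong_sums_def by (rule lc_strong_unique)
      moreover have "s \<in> lc_inner_sums {a..b}" using h unfolding lc_inner_sums_def by blast
      then have "s \<le> b - a" by (rule lc_inner_sum_le[OF less_imp_le[OF ab]])
      ultimately have "\<bar>S - (W b - W a)\<bar> < e / 2" using small[OF e2 mu(2)] S'(2) by simp
      moreover have "e / 2 + e / 2 = e" by simp
      ultimately show ?thesis using j(3) by linarith
    qed
    from this[of "\<bar>J - (W b - W a)\<bar>"] show "J = W b - W a" by auto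
  qed
qed

section \<open>Approximation by real polynomials and their extension to the field\<close>

section \<open>Best uniform approximation\<close>

lemma convergent_subseq_finite:
  fixes v :: "nat \<Rightarrow> nat \<Rightarrow> real"
  assumes "\<And>j. j < N \<Longrightarrow> bounded (range (v j))"
  shows "\<exists>r. strict_mono r \<and> (\<forall>j<N. convergent (v j \<circ> r))"
  using assms
proof (induction N)
  case 0 then show ?case using strict_mono_id by auto
next
  case (Suc N)
  have "\<exists>r. strict_mono r \<and> (\<forall>j<N. convergent (v j \<circ> r))" by (rule Suc.IH) (use Suc.prems in simp)
  then obtain r where r: "strict_mono r" "\<And>j. j < N \<Longrightarrow> convergent (v j \<circ> r)" by blast
  have "bounded (range (v N \<circ> r))"
    using Suc.prems[of N] by (rule bounded_subset) auto
  then obtain l r' where r': "strict_mono r'" "((v N \<circ> r) \<circ> r') \<longlonglongrightarrow> l"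
    using bounded_imp_convergent_subsequence by blast
  have "convergent (v j \<circ> (r \<circ> r'))" if "j < Suc N" for j
  proof (cases "j = N")
    case True then show ?thesis using r'(2) by (auto simp: o_assoc intro: convergentI)
  next
    case False
    then have "convergent (v j \<circ> r)" using that r(2) by simp
    then obtain l where "(v j \<circ> r) \<longlonglongrightarrow> l" by (auto simp: convergent_def)
    then have "((v j \<circ> r) \<circ> r') \<longlonglongrightarrow> l" using r'(1) by (rule LIMSEQ_subseq_LIMSEQ)
    then show ?thesis by (auto simp: o_assoc intro: convergentI)
  qed
  then show ?case using strict_mono_o[OF r(1) r'(1)] by blast
qed

lemma sup_dist_upper:
  fixes f :: "real \<Rightarrow> real"
  assumes "continuous_on {a..b} f" "x \<in> {a..b}"
  shows "\<bar>f x - poly p x\<bar> \<le> (SUP x\<in>{a..b}. \<bar>f x - poly p x\<bar>)"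
proof (rule cSUP_upper[OF assms(2)])
  have "continuous_on {a..b} (\<lambda>x. \<bar>f x - poly p x\<bar>)"
    by (intro continuous_intros assms(1))
  then have "compact ((\<lambda>x. \<bar>f x - poly p x\<bar>) ` {a..b})" by (rule compact_continuous_image) simp
  then show "bdd_above ((\<lambda>x. \<bar>f x - poly p x\<bar>) ` {a..b})" by (intro bounded_imp_bdd_above compact_imp_bounded)
qed

text \<open>That the minimum is attained has to be shown, since otherwise \<open>arg_min\<close>
  would be an unspecified polynomial. A minimising sequence is bounded at n + 1 nodes; along a
  subsequence its values there converge, by interpolation its coefficients do too, and the limit
  attains the infimum.\<close>

lemma best_approx:
  fixes f :: "real \<Rightarrow> real"
  assumes f: "continuous_on {a..b} f" and ab: "a < b"
  shows "degree q \<le> n \<Longrightarrow> (SUP x\<in>{a..b}. \<bar>f x - poly (best_approx a b f n) x\<bar>) \<le> (SUP x\<in>{a..b}. \<bar>f x - poly q x\<bar>)"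
proof -
  define d where "d p = (SUP x\<in>{a..b}. \<bar>f x - poly p x\<bar>)" for p
  have up: "\<bar>f x - poly p x\<bar> \<le> d p" if "x \<in> {a..b}" for x p
    unfolding d_def by (rule sup_dist_upper[OF f that])
  have least: "d p \<le> c" if "\<And>x. x \<in> {a..b} \<Longrightarrow> \<bar>f x - poly p x\<bar> \<le> c" for p c
    unfolding d_def by (rule cSUP_least) (use ab that in auto)
  have d0: "0 \<le> d p" for p using up[of a p] ab by (auto intro: order.trans[OF abs_ge_zero])
  define D where "D = d ` {p. degree p \<le> n}"
  have D: "D \<noteq> {}" "bdd_below D" using d0 by (auto simp: D_def intro!: bdd_belowI exI[of _ 0])
  have "\<exists>p. degree p \<le> n \<and> d p < Inf D + inverse (real (Suc m))" for m
  proof -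
    have "Inf D < Inf D + inverse (real (Suc m))" by simp
    then show ?thesis using cInf_lessD[OF D(1)] by (force simp: D_def)
  qed
  then obtain P where P: "\<And>m. degree (P m) \<le> n" "\<And>m. d (P m) < Inf D + inverse (real (Suc m))" by metis
  \<comment> \<open>Division by \<open>Suc n\<close> keeps the nodes distinct and inside [a, b],
    also for n = 0.\<close>
  define x where "x j = a + (b - a) * (real j / real (Suc n))" for j
  have x: "x j \<in> {a..b}" if "j \<le> n" for j
  proof -
    define q where "q = real j / real (Suc n)"
    have "0 \<le> q" "q \<le> 1" using that by (auto simp: q_def)
    then have "0 \<le> (b - a) * q" "(b - a) * q \<le> (b - a) * 1" using ab by (auto intro!: mult_left_mono)
    then show ?thesis unfolding x_def q_def[symmetric] by simp
  qed
  have "inj_on x {..n}" using ab by (auto simp: inj_on_def x_def)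
  then obtain w where w: "\<And>p i. degree p \<le> n \<Longrightarrow> coeff p i = (\<Sum>j\<le>n. w i j * poly p (x j))"
    using lagrange_weights by blast
  have "bounded (range (\<lambda>m. poly (P m) (x j)))" if "j < Suc n" for j
  proof -
    have "\<bar>poly (P m) (x j)\<bar> \<le> \<bar>f (x j)\<bar> + (Inf D + 1)" for m
    proof -
      have "inverse (real (Suc m)) \<le> 1" by (simp add: inverse_le_1_iff)
      then show ?thesis using up[OF x[of j], of "P m"] P(2)[of m] that by linarith
    qed
    then show ?thesis by (auto simp: bounded_iff)
  qed
  from convergent_subseq_finite[of "Suc n" "\<lambda>j m. poly (P m) (x j)", OF this]
  obtain r where r: "strict_mono r" "\<And>j. j \<le> n \<Longrightarrow> convergent (\<lambda>m. poly (P (r m)) (x j))"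
    by (auto simp: o_def)
  have "convergent (\<lambda>m. coeff (P (r m)) i)" for i
    unfolding w[OF P(1)] by (intro convergent_sum convergent_mult convergent_const r) auto
  then obtain c where c: "\<And>i. (\<lambda>m. coeff (P (r m)) i) \<longlonglongrightarrow> c i" unfolding convergent_def by metis
  define p where "p = (\<Sum>i\<le>n. monom (c i) i)"
  have dp: "degree p \<le> n" unfolding p_def by (rule degree_sum_le) (auto intro: order.trans[OF degree_monom_le])
  have lim: "(\<lambda>m. poly (P (r m)) y) \<longlonglongrightarrow> poly p y" for y
  proof -
    have "poly (P (r m)) y = (\<Sum>i\<le>n. coeff (P (r m)) i * y ^ i)" for m
      using P(1)[of "r m"] unfolding poly_altdef
      by (intro sum.mono_neutral_left) (auto simp: coeff_eq_0)
    moreover have "poly p y = (\<Sum>i\<le>n. c i * y ^ i)" by (simp add: p_def poly_sum poly_monom)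
    ultimately show ?thesis using c by (auto intro!: tendsto_intros)
  qed
  have "d p \<le> Inf D"
  proof (rule least)
    fix y assume y: "y \<in> {a..b}"
    have "(\<lambda>m. \<bar>f y - poly (P (r m)) y\<bar>) \<longlonglongrightarrow> \<bar>f y - poly p y\<bar>" by (intro tendsto_intros lim)
    moreover have "(\<lambda>m. Inf D + inverse (real (Suc (r m)))) \<longlonglongrightarrow> Inf D + 0"
      using LIMSEQ_subseq_LIMSEQ[OF LIMSEQ_inverse_real_of_nat r(1)] by (intro tendsto_intros) (simp add: o_def)
    moreover have "\<bar>f y - poly (P (r m)) y\<bar> \<le> Inf D + inverse (real (Suc (r m)))" for m
      using up[OF y, of "P (r m)"] P(2)[of "r m"] by linarith
    ultimately have "\<bar>f y - poly p y\<bar> \<le> Inf D + 0" by (intro LIMSEQ_le exI[of _ 0]) auto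
    then show "\<bar>f y - poly p y\<bar> \<le> Inf D" by simp
  qed
  then have "is_arg_min d (\<lambda>p. degree p \<le> n) p"
    using dp D(2) by (auto simp: is_arg_min_def D_def not_less intro: order.trans cInf_lower)
  then have "is_arg_min d (\<lambda>p. degree p \<le> n) (best_approx a b f n)"
    unfolding best_approx_def arg_min_def d_def[abs_def] by (rule someI)
  then show "d (best_approx a b f n) \<le> d q" if "degree q \<le> n"
    using that by (auto simp: is_arg_min_def not_less)
qed

text \<open>As soon as \<open>n\<close> reaches the degree of a Weierstrass polynomial
  \<open>q\<close>, that polynomial competes in the minimisation, so the best approximation is at
  least as good.\<close>

lemma best_approx_tendsto:
  fixes f :: "real \<Rightarrow> real"
  assumes f: "continuous_on {a..b} f" and ab: "a < b" and r: "r \<in> {a..b}"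
  shows "(\<lambda>n. poly (best_approx a b f n) r) \<longlonglongrightarrow> f r"
proof (rule LIMSEQ_I)
  fix e :: real assume e: "0 < e"
  obtain g where g: "real_polynomial_function g" "\<And>x. x \<in> {a..b} \<Longrightarrow> \<bar>f x - g x\<bar> < e / 2"
    using Stone_Weierstrass_real_polynomial_function[of "{a..b}" f "e / 2"] f e by auto
  obtain c N where gs: "g = (\<lambda>x. \<Sum>i\<le>N. c i * x ^ i)" using g(1) unfolding real_polynomial_function_iff_sum by blast
  define q where "q = (\<Sum>i\<le>N. monom (c i) i)"
  have q: "poly q x = g x" for x by (simp add: q_def gs poly_sum poly_monom)
  have "norm (poly (best_approx a b f n) r - f r) < e" if "n \<ge> degree q" for n
  proof -
    have "\<bar>f r - poly (best_approx a b f n) r\<bar> \<le> (SUP x\<in>{a..b}. \<bar>f x - poly (best_approx a b f n) x\<bar>)"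
      by (rule sup_dist_upper[OF f r])
    also have "\<dots> \<le> (SUP x\<in>{a..b}. \<bar>f x - poly q x\<bar>)" by (rule best_approx[OF f ab that])
    also have "\<dots> \<le> e / 2" by (rule cSUP_least) (use ab g(2) in \<open>auto simp: q less_imp_le\<close>)
    finally show ?thesis using e by (simp add: abs_minus_commute)
  qed
  then show "\<exists>N. \<forall>n\<ge>N. norm (poly (best_approx a b f n) r - f r) < e" by blast
qed

lemma poly_antiderivative: "\<exists>Q. pderiv Q = p \<and> poly Q c = (0 :: real)"
proof -
  define Q where "Q = (\<Sum>i\<le>degree p. monom (coeff p i / real (Suc i)) (Suc i))"
  have "pderiv Q = p"
  proof (rule poly_eqI)
    fix n
    have "coeff Q (Suc n) = (if n \<le> degree p then coeff p n / real (Suc n) else 0)"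
      by (auto simp: Q_def coeff_sum sum.delta)
    then show "coeff (pderiv Q) n = coeff p n" by (auto simp: coeff_pderiv coeff_eq_0 simp del: of_nat_Suc)
  qed
  then have "pderiv (Q - [:poly Q c:]) = p" "poly (Q - [:poly Q c:]) c = 0"
    by (simp_all add: pderiv_diff pderiv_pCons)
  then show ?thesis by blast
qed

lemma integral_poly:
  assumes "pderiv Q = p" "poly Q a = 0" "a \<le> x" shows "integral {a..x} (poly p) = poly Q (x :: real)"
proof -
  have "(poly p has_integral (poly Q x - poly Q a)) {a..x}"
    by (rule fundamental_theorem_of_calculus[OF assms(3)])
      (use poly_DERIV[of Q] assms(1) in \<open>auto simp: has_real_derivative_iff_has_vector_derivative[symmetric] intro: DERIV_subset\<close>)
  then show ?thesis using assms(2) by (simp add: integral_unique)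
qed

section \<open>Real polynomials on the Levi-Civita field\<close>

abbreviation lc_poly :: "real poly \<Rightarrow> levi_civita poly" where "lc_poly \<equiv> map_poly of_real"

lemma lc_poly_of_real: "poly (lc_poly p) (of_real r) = of_real (poly p r)"
  by (induction p) (simp_all add: map_poly_pCons)

lemma lc_poly_pderiv: "pderiv (lc_poly p) = lc_poly (pderiv p)"
  by (rule poly_eqI) (simp add: coeff_pderiv coeff_map_poly)

lemma lc_poly_bounded:
  assumes "a \<le> b"
  shows "\<exists>C\<ge>0. \<forall>x\<in>{of_real a..of_real b}. \<bar>poly (lc_poly p) x\<bar> \<le> of_real C"
proof (induction p)
  case 0 then show ?case by (intro exI[of _ 0]) simp
next
  case (pCons c p)
  then obtain C where C: "C \<ge> 0" "\<And>x. x \<in> {of_real a..of_real b} \<Longrightarrow> \<bar>poly (lc_poly p) x\<bar> \<le> of_real C" by blast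
  define B where "B = max \<bar>a\<bar> \<bar>b\<bar>"
  have "\<bar>poly (lc_poly (pCons c p)) x\<bar> \<le> of_real (\<bar>c\<bar> + B * C)" if x: "x \<in> {of_real a..of_real b}" for x
  proof -
    have "of_real b \<le> (of_real B :: levi_civita)" "(of_real (- B) :: levi_civita) \<le> of_real a"
      by (intro lc_of_real_le; simp add: B_def; linarith)+
    then have xB: "\<bar>x\<bar> \<le> of_real B" using x by (auto simp: abs_le_iff minus_le_iff)
    have cc: "\<bar>of_real c :: levi_civita\<bar> \<le> of_real \<bar>c\<bar>"
      using lc_of_real_le[of c "\<bar>c\<bar>"] lc_of_real_le[of "- c" "\<bar>c\<bar>"] by (simp add: abs_le_iff)
    have "\<bar>poly (lc_poly (pCons c p)) x\<bar> \<le> \<bar>of_real c\<bar> + \<bar>x * poly (lc_poly p) x\<bar>"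
      by (simp add: map_poly_pCons abs_triangle_ineq)
    also have "\<dots> \<le> of_real \<bar>c\<bar> + of_real B * of_real C"
      unfolding abs_mult using C(2)[OF x] xB order.trans[OF abs_ge_zero xB] by (intro add_mono cc mult_mono) auto
    finally show ?thesis by simp
  qed
  then show ?case using C(1) by (intro exI[of _ "\<bar>c\<bar> + B * C"]) (auto simp: B_def)
qed

lemma lc_unit_frame: "u < v \<Longrightarrow> lc_frame u v u (v - u)"
  by (simp add: lc_frame_def lc_disc_def lc_ge_1 lc_coeff_zero lc_coeff_one)

lemma lc_prim_poly: assumes "u < v" shows "lc_prim (poly (pderiv p)) (poly p) u v"
proof -
  have "lc_ana {u..v} u (v - u) (\<lambda>x. 1 * poly p x)"
    by (intro lc_ana_mult_poly[OF lc_unit_frame[OF assms]] lc_ana_const[OF lc_unit_frame[OF assms]]) auto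
  then show ?thesis unfolding lc_prim_def using lc_unit_frame[OF assms] lc_has_deriv_poly by auto
qed

text \<open>That the constant is real matters: multiplied by an infinitesimal radius it stays
  infinitesimal, which gives the final error its size.\<close>

lemma lc_poly_lip:
  assumes "a < b"
  shows "\<exists>C\<ge>0. lc_lip (of_real C) (poly (lc_poly p)) (of_real a) (of_real b)"
proof -
  obtain C where C: "C \<ge> 0" "\<forall>x\<in>{of_real a..of_real b}. \<bar>poly (lc_poly (pderiv p)) x\<bar> \<le> of_real C"
    using lc_poly_bounded[of a b] assms by (meson less_imp_le)
  have ab: "(of_real a :: levi_civita) < of_real b"
    by (rule lc_less_coeff0) (use assms in \<open>auto simp: lc_ge_of_real lc_coeff_of_real\<close>)
  have "lc_lip (of_real C) (poly (lc_poly p)) (of_real a) (of_real b)"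
    using lc_prim_lip[OF lc_prim_poly[OF ab, of "lc_poly p"]] C(2) by (simp add: lc_poly_pderiv)
  then show ?thesis using C(1) by blast
qed

section \<open>Dirac-like functions of class C1 and the final estimate\<close>

section \<open>Continuously differentiable measurable functions\<close>

lemma lc_simple_on_cong: "lc_simple_on I f \<Longrightarrow> (\<And>x. x \<in> I \<Longrightarrow> f x = g x) \<Longrightarrow> lc_simple_on I g"
  unfolding lc_simple_on_def lc_power_series_on_def by metis

lemma lc_measurable_on_map:
  assumes "lc_measurable_on A f"
    and "\<And>I u v. lc_interval u v I \<Longrightarrow> I \<subseteq> A \<Longrightarrow> lc_simple_on I f \<Longrightarrow> lc_simple_on I g"
  shows "lc_measurable_on A g"
  unfolding lc_measurable_on_def
proof (intro conjI allI impI)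
  show "lc_measurable A" using assms(1) by (simp add: lc_measurable_on_def)
  fix e :: levi_civita assume "0 < e"
  then obtain u v I s where h: "disjoint_intervals u v I" "(\<Union>n. I n) \<subseteq> A" "strong_sums (\<lambda>n. v n - u n) s"
    "lc_measure A - s < e" "\<And>n. lc_simple_on (I n) f" using assms(1) unfolding lc_measurable_on_def by blast
  have "lc_simple_on (I n) g" for n
    using h(1,2) by (intro assms(2)[OF _ _ h(5)]) (auto simp: disjoint_intervals_def)
  then show "\<exists>u v I s. disjoint_intervals u v I \<and> (\<Union>n. I n) \<subseteq> A
      \<and> strong_sums (\<lambda>n. v n - u n) s \<and> lc_measure A - s < e \<and> (\<forall>n. lc_simple_on (I n) g)"
    using h by blast
qed

lemma lc_simple_subset_rule:
  "lc_simple_on {x..y} f \<Longrightarrow> x \<le> x' \<Longrightarrow> x' < y' \<Longrightarrow> y' \<le> y \<Longrightarrow> lc_simple_on {x'..y'} f"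
  by (erule lc_simple_on_subset) auto

text \<open>By \<open>lc_cousin\<close>. Power series intervals give the constant \<open>M\<close>;
  at a single point the difference quotients are known only to come within 1 of the derivative,
  hence \<open>M + 1\<close>.\<close>

lemma lc_deriv_bound_imp_lip:
  assumes cov: "\<And>e. 0 < e \<Longrightarrow> \<exists>d\<le>e. lc_simple_cov f a b d"
    and H: "\<And>x. x \<in> {a..b} \<Longrightarrow> lc_has_deriv H (H' x) x {a..b}" "\<And>x. x \<in> {a..b} \<Longrightarrow> \<bar>H' x\<bar> \<le> M"
    and prim: "\<And>x y. a \<le> x \<Longrightarrow> y \<le> b \<Longrightarrow> x < y \<Longrightarrow> lc_simple_on {x..y} f \<Longrightarrow> lc_prim H' H x y"
  shows "lc_lip (M + 1) H a b"
  unfolding lc_lip_def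
proof (intro allI impI, elim conjE)
  fix s t assume st: "a \<le> s" "s \<le> t" "t \<le> b"
  show "\<bar>H t - H s\<bar> \<le> (M + 1) * (t - s)"
  proof (rule lc_cousin[where Q = "\<lambda>x y. lc_simple_on {x..y} f" and P = "\<lambda>x y. \<bar>H y - H x\<bar> \<le> (M + 1) * (y - x)"])
    fix e :: levi_civita assume "0 < e"
    then obtain d where d: "d \<le> e" "lc_simple_cov f a b d" using cov by blast
    have "\<exists>d'\<le>d. lc_simple_cov f s t d'"
      by (rule lc_cov_restrict[OF d(2) st]) (rule lc_simple_subset_rule)
    then show "\<exists>d\<le>e. lc_simple_cov f s t d" using d(1) order.trans by blast
  next
    show "s \<le> t" by fact
  next
    fix x y x' y' assume "lc_simple_on {x..y} f" "x \<le> x'" "x' < y'" "y' \<le> y"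
    then show "lc_simple_on {x'..y'} f" by (rule lc_simple_subset_rule)
  next
    fix x y z assume "\<bar>H y - H x\<bar> \<le> (M + 1) * (y - x)" "\<bar>H z - H y\<bar> \<le> (M + 1) * (z - y)"
    moreover have "(M + 1) * (y - x) + (M + 1) * (z - y) = (M + 1) * (z - x)" by (simp add: algebra_simps)
    ultimately show "\<bar>H z - H x\<bar> \<le> (M + 1) * (z - x)" by linarith
  next
    fix x y assume xy: "s \<le> x" "y \<le> t" "x < y" "lc_simple_on {x..y} f"
    then have "\<bar>H y - H x\<bar> \<le> M * (y - x)"
      using st H(2) by (intro lc_prim_bound[OF prim]) auto
    also have "\<dots> \<le> (M + 1) * (y - x)" using xy by (intro mult_right_mono) auto
    finally show "\<bar>H y - H x\<bar> \<le> (M + 1) * (y - x)" .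
  next
    fix c assume "c \<in> {s..t}"
    then have c: "c \<in> {a..b}" using st by auto
    obtain g where g: "g > 0" "\<And>y. y \<in> {a..b} \<Longrightarrow> \<bar>y - c\<bar> < g \<Longrightarrow> \<bar>H y - H c\<bar> \<le> (\<bar>H' c\<bar> + 1) * \<bar>y - c\<bar>"
      using lc_has_deriv_lipschitz[OF H(1)[OF c]] by blast
    have l: "\<bar>H y - H c\<bar> \<le> (M + 1) * \<bar>y - c\<bar>" if "y \<in> {a..b}" "\<bar>y - c\<bar> < g" for y
    proof -
      have "(\<bar>H' c\<bar> + 1) * \<bar>y - c\<bar> \<le> (M + 1) * \<bar>y - c\<bar>" using H(2)[OF c] by (intro mult_right_mono) auto
      then show ?thesis using g(2)[OF that] by simp
    qed
    show "\<exists>g>0. \<forall>x y. s \<le> x \<and> x \<le> c \<and> c \<le> y \<and> y \<le> t \<and> y - x < g \<longrightarrow> \<bar>H y - H x\<bar> \<le> (M + 1) * (y - x)"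
    proof (intro exI[of _ g] conjI g(1) allI impI)
      fix x y assume xy: "s \<le> x \<and> x \<le> c \<and> c \<le> y \<and> y \<le> t \<and> y - x < g"
      have "\<bar>H y - H c\<bar> \<le> (M + 1) * (y - c)" using l[of y] xy st by auto
      moreover have "\<bar>H x - H c\<bar> \<le> (M + 1) * (c - x)" using l[of x] xy st by (auto simp: abs_minus_commute)
      moreover have "(M + 1) * (y - c) + (M + 1) * (c - x) = (M + 1) * (y - x)" by (simp add: algebra_simps)
      ultimately show "\<bar>H y - H x\<bar> \<le> (M + 1) * (y - x)" by linarith
    qed
  qed
qed

lemma lc_C1_deriv:
  assumes "lc_C1_on {a..b} f" "a < b" "x \<in> {a..b}"
  shows "lc_has_deriv f (lc_deriv {a..b} f x) x {a..b}"
proof -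
  obtain D where D: "((\<lambda>y. (f y - f x) / (y - x)) \<longlongrightarrow> D) (at x within {a..b})"
    using assms(1,3) unfolding lc_C1_on_def lc_differentiable_on_def by blast
  have "at x within {a..b} \<noteq> bot"
    using lc_interval_limit_point[OF lc_closed_interval assms(2,3)] assms(2) by simp
  then have "lc_deriv {a..b} f x = D" unfolding lc_deriv_def using D by (intro tendsto_Lim) auto
  then show ?thesis using D unfolding lc_has_deriv_iff_tendsto by simp
qed

lemma lc_simple_C1_ana:
  assumes "lc_simple_on {x..y} f" "x < y" "{x..y} \<subseteq> A" "\<And>t. t \<in> A \<Longrightarrow> lc_has_deriv f (f' t) t A"
  obtains c \<tau> where "lc_frame x y c \<tau>" "lc_ana {x..y} c \<tau> f" "lc_ana {x..y} c \<tau> f'"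
proof -
  have I: "lc_interval x y {x..y}" using assms(2) by (simp add: lc_interval_def)
  obtain c \<tau> where fr: "lc_frame x y c \<tau>" "lc_ana {x..y} c \<tau> f" by (rule lc_simple_imp_ana[OF I assms(2,1)])
  have "lc_ana {x..y} c \<tau> f'"
    by (rule lc_ana_deriv_on[OF I fr]) (use assms(3,4) lc_has_deriv_subset in blast)
  then show ?thesis using that fr by blast
qed

text \<open>Near each point continuity bounds \<open>f\<close> and its derivative, on power series
  intervals the normal form does, and bounds pass to unions; \<open>lc_cousin\<close> extends this
  to the noncompact [a, b]. Here the continuity of the derivative enters.\<close>

lemma lc_C1_bounded:
  assumes cov: "\<And>e. 0 < e \<Longrightarrow> \<exists>d\<le>e. lc_simple_cov f a b d" and C1: "lc_C1_on {a..b} f" and ab: "a < b"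
  shows "\<exists>M\<ge>0. \<forall>x\<in>{a..b}. \<bar>f x\<bar> \<le> M \<and> \<bar>lc_deriv {a..b} f x\<bar> \<le> M"
proof -
  let ?f' = "lc_deriv {a..b} f"
  have D: "\<And>x. x \<in> {a..b} \<Longrightarrow> lc_has_deriv f (?f' x) x {a..b}" by (rule lc_C1_deriv[OF C1 ab])
  have "\<exists>M. \<forall>x\<in>{a..b}. \<bar>f x\<bar> \<le> M \<and> \<bar>?f' x\<bar> \<le> M"
  proof (rule lc_cousin[where Q = "\<lambda>x y. lc_simple_on {x..y} f"
        and P = "\<lambda>x y. \<exists>M. \<forall>t\<in>{x..y}. \<bar>f t\<bar> \<le> M \<and> \<bar>?f' t\<bar> \<le> M"])
    fix e :: levi_civita assume "0 < e" then show "\<exists>d\<le>e. lc_simple_cov f a b d" by (rule cov)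
  next
    show "a \<le> b" using ab by simp
  next
    fix x y x' y' assume "lc_simple_on {x..y} f" "x \<le> x'" "x' < y'" "y' \<le> y"
    then show "lc_simple_on {x'..y'} f" by (rule lc_simple_subset_rule)
  next
    fix x y z
    assume "\<exists>M. \<forall>t\<in>{x..y}. \<bar>f t\<bar> \<le> M \<and> \<bar>?f' t\<bar> \<le> M" "\<exists>M. \<forall>t\<in>{y..z}. \<bar>f t\<bar> \<le> M \<and> \<bar>?f' t\<bar> \<le> M"
    then obtain M N where M: "\<And>t. t \<in> {x..y} \<Longrightarrow> \<bar>f t\<bar> \<le> M \<and> \<bar>?f' t\<bar> \<le> M"
      and N: "\<And>t. t \<in> {y..z} \<Longrightarrow> \<bar>f t\<bar> \<le> N \<and> \<bar>?f' t\<bar> \<le> N" by blast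
    have "\<bar>f t\<bar> \<le> max M N \<and> \<bar>?f' t\<bar> \<le> max M N" if "t \<in> {x..z}" for t
      using M[of t] N[of t] that by (cases "t \<le> y") (auto simp: le_max_iff_disj)
    then show "\<exists>M. \<forall>t\<in>{x..z}. \<bar>f t\<bar> \<le> M \<and> \<bar>?f' t\<bar> \<le> M" by blast
  next
    fix x y assume xy: "a \<le> x" "y \<le> b" "x < y" "lc_simple_on {x..y} f"
    have sub: "{x..y} \<subseteq> {a..b}" using xy by auto
    obtain c \<tau> where fr: "lc_frame x y c \<tau>" "lc_ana {x..y} c \<tau> f" "lc_ana {x..y} c \<tau> ?f'"
      by (rule lc_simple_C1_ana[OF xy(4,3) sub D])
    obtain M where M: "\<forall>t\<in>{x..y}. \<bar>f t\<bar> \<le> M" using lc_ana_bounded[OF fr(1) subset_refl fr(2)] by blast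
    obtain N where N: "\<forall>t\<in>{x..y}. \<bar>?f' t\<bar> \<le> N" using lc_ana_bounded[OF fr(1) subset_refl fr(3)] by blast
    show "\<exists>M. \<forall>t\<in>{x..y}. \<bar>f t\<bar> \<le> M \<and> \<bar>?f' t\<bar> \<le> M"
      using M N by (intro exI[of _ "max M N"]) (auto simp: le_max_iff_disj)
  next
    fix c assume c: "c \<in> {a..b}"
    obtain g1 where g1: "g1 > 0" "\<And>t. t \<in> {a..b} \<Longrightarrow> \<bar>t - c\<bar> < g1 \<Longrightarrow> \<bar>f t - f c\<bar> < 1"
      using lc_has_deriv_continuous[OF D[OF c] zero_less_one] by blast
    have "(?f' \<longlongrightarrow> ?f' c) (at c within {a..b})" using C1 c by (simp add: lc_C1_on_def continuous_on_def)
    then obtain g2 where g2: "g2 > 0" "\<And>t. t \<in> {a..b} \<Longrightarrow> t \<noteq> c \<Longrightarrow> \<bar>t - c\<bar> < g2 \<Longrightarrow> \<bar>?f' t - ?f' c\<bar> < 1"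
      unfolding lc_tendsto_at_iff by (meson zero_less_one)
    define M where "M = max (\<bar>f c\<bar> + 1) (\<bar>?f' c\<bar> + 1)"
    have "\<bar>f t\<bar> \<le> M \<and> \<bar>?f' t\<bar> \<le> M" if t: "t \<in> {a..b}" "\<bar>t - c\<bar> < min g1 g2" for t
    proof (cases "t = c")
      case True then show ?thesis by (auto simp: M_def le_max_iff_disj)
    next
      case False
      have "\<bar>f t\<bar> \<le> \<bar>f c\<bar> + 1" "\<bar>?f' t\<bar> \<le> \<bar>?f' c\<bar> + 1"
        using g1(2)[OF t(1)] g2(2)[OF t(1) False] t(2) by auto
      then show ?thesis by (auto simp: M_def le_max_iff_disj)
    qed
    then show "\<exists>g>0. \<forall>x y. a \<le> x \<and> x \<le> c \<and> c \<le> y \<and> y \<le> b \<and> y - x < g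
        \<longrightarrow> (\<exists>M. \<forall>t\<in>{x..y}. \<bar>f t\<bar> \<le> M \<and> \<bar>?f' t\<bar> \<le> M)"
      using g1(1) g2(1) by (intro exI[of _ "min g1 g2"] conjI allI impI exI[of _ M] ballI) (auto simp: abs_less_iff)
  qed
  then obtain M where M: "\<And>x. x \<in> {a..b} \<Longrightarrow> \<bar>f x\<bar> \<le> M \<and> \<bar>?f' x\<bar> \<le> M" by blast
  then have "0 \<le> M" using M[of a] ab abs_ge_zero order.trans by (metis atLeastAtMost_iff less_imp_le order.refl)
  then show ?thesis using M by blast
qed

section \<open>Integrating against a Dirac-like function\<close>

text \<open>\<open>K\<close> may be infinitely large; the estimate is useful because
  \<open>d\<close> can be made arbitrarily small for the same \<open>X\<close>, \<open>Z\<close> and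
  \<open>K\<close>.\<close>

lemma lc_simple_cov_increment_bound:
  assumes "lc_simple_cov f a b d"
    and "\<And>x y. a \<le> x \<Longrightarrow> y \<le> b \<Longrightarrow> x < y \<Longrightarrow> lc_simple_on {x..y} f \<Longrightarrow> \<bar>X y - X x\<bar> \<le> Z y - Z x"
    and "lc_lip K X a b" "\<And>x y. a \<le> x \<Longrightarrow> x \<le> y \<Longrightarrow> y \<le> b \<Longrightarrow> Z x \<le> Z y"
  shows "\<bar>X b - X a\<bar> \<le> Z b - Z a + K * d"
  using assms
proof (induction rule: lc_cov.induct)
  case (piece x y)
  then show ?case by simp
next
  case (gap x y)
  have "\<bar>X y - X x\<bar> \<le> K * (y - x)" using lc_lipD[OF gap(3), of x y] gap(1) by simp
  moreover have "Z x \<le> Z y" using gap by simp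
  ultimately show ?case by linarith
next
  case (join x y d z e)
  have xyz: "x \<le> y" "y \<le> z" using lc_cov_nonneg join.hyps by blast+
  have "\<bar>X y - X x\<bar> \<le> Z y - Z x + K * d"
    by (rule join.IH(1)) (use join.prems xyz lc_lip_subset[of K X x z x y] in auto)
  moreover have "\<bar>X z - X y\<bar> \<le> Z z - Z y + K * e"
    by (rule join.IH(2)) (use join.prems xyz lc_lip_subset[of K X x z y z] in auto)
  moreover have "K * (d + e) = K * d + K * e" by (simp add: algebra_simps)
  ultimately show ?case by linarith
qed

lemma lc_lip_mult:
  assumes "lc_lip K f a b" "lc_lip L g a b" "0 \<le> K" "0 \<le> L"
    and "\<And>x. x \<in> {a..b} \<Longrightarrow> \<bar>f x\<bar> \<le> M" "\<And>x. x \<in> {a..b} \<Longrightarrow> \<bar>g x\<bar> \<le> N"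
  shows "lc_lip (M * L + N * K) (\<lambda>x. f x * g x) a b"
  unfolding lc_lip_def
proof (intro allI impI, elim conjE)
  fix s t assume st: "a \<le> s" "s \<le> t" "t \<le> b"
  have "f t * g t - f s * g s = f t * (g t - g s) + g s * (f t - f s)" by (simp add: algebra_simps)
  also have "\<bar>\<dots>\<bar> \<le> \<bar>f t\<bar> * \<bar>g t - g s\<bar> + \<bar>g s\<bar> * \<bar>f t - f s\<bar>"
    by (simp add: abs_mult[symmetric] abs_triangle_ineq)
  also have "\<dots> \<le> M * (L * (t - s)) + N * (K * (t - s))"
    using assms(5)[of t] assms(6)[of s] st lc_lipD[OF assms(1) st] lc_lipD[OF assms(2) st]
      order.trans[OF abs_ge_zero assms(5)[of t]] order.trans[OF abs_ge_zero assms(6)[of s]]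
    by (intro add_mono mult_mono) auto
  finally show "\<bar>f t * g t - f s * g s\<bar> \<le> (M * L + N * K) * (t - s)" by (simp add: algebra_simps)
qed

lemma lc_lip_add: "lc_lip K f a b \<Longrightarrow> lc_lip L g a b \<Longrightarrow> lc_lip (K + L) (\<lambda>x. f x + g x) a b"
  unfolding lc_lip_def
proof (intro allI impI, elim conjE)
  fix s t assume h: "\<forall>s t. a \<le> s \<and> s \<le> t \<and> t \<le> b \<longrightarrow> \<bar>f t - f s\<bar> \<le> K * (t - s)"
    "\<forall>s t. a \<le> s \<and> s \<le> t \<and> t \<le> b \<longrightarrow> \<bar>g t - g s\<bar> \<le> L * (t - s)" "a \<le> s" "s \<le> t" "t \<le> b"
  then have "\<bar>f t - f s\<bar> \<le> K * (t - s)" "\<bar>g t - g s\<bar> \<le> L * (t - s)" by blast+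
  moreover have "(K + L) * (t - s) = K * (t - s) + L * (t - s)" by (simp add: algebra_simps)
  ultimately show "\<bar>f t + g t - (f s + g s)\<bar> \<le> (K + L) * (t - s)" by linarith
qed

lemma lc_lip_cmult: "lc_lip K f a b \<Longrightarrow> lc_lip (\<bar>c\<bar> * K) (\<lambda>x. c * f x) a b"
  unfolding lc_lip_def right_diff_distrib[symmetric] abs_mult mult.assoc by (auto intro!: mult_left_mono)

text \<open>\<open>W\<close> does not decrease on power series intervals by
  \<open>lc_prim_mono\<close>, and across gaps it drops by at most \<open>M\<close> times a length
  that can be made arbitrarily small.\<close>

lemma lc_primitive_mono:
  assumes W: "lc_primitive h M W a b" and h: "\<And>x. x \<in> {a..b} \<Longrightarrow> 0 \<le> h x" and M: "0 \<le> M"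
    and cov: "\<And>e. 0 < e \<Longrightarrow> \<exists>d\<le>e. lc_simple_cov h a b d" and st: "a \<le> s" "s \<le> t" "t \<le> b"
  shows "W s \<le> W t"
proof -
  have piece: "0 \<le> W y - W x" if xy: "a \<le> x" "y \<le> b" "x < y" "lc_simple_on {x..y} h" for x y
  proof -
    obtain F where F: "lc_prim h F x y" by (rule lc_simple_prim_ex[OF xy(4,3)])
    have "0 * y - 0 * x \<le> F y - F x"
      by (rule lc_prim_mono[OF lc_prim_linear[OF xy(3)] F]) (use h xy in auto)
    then show ?thesis using W F xy unfolding lc_primitive_def by simp
  qed
  have "W s - W t \<le> M * lc_d (of_nat n)" for n
  proof -
    obtain d where d: "d \<le> lc_d (of_nat n)" "lc_simple_cov h a b d" using cov[OF lc_d_pos] by blast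
    have "\<exists>d'\<le>d. lc_simple_cov h s t d'" by (rule lc_cov_restrict[OF d(2) st]) (rule lc_simple_subset_rule)
    then obtain d' where d': "d' \<le> d" "lc_simple_cov h s t d'" by blast
    have "- (M * d') \<le> W t - W s"
      using d'(2) st
    proof (induction rule: lc_cov.induct)
      case (piece x y)
      then show ?case using \<open>\<And>x y. a \<le> x \<Longrightarrow> y \<le> b \<Longrightarrow> x < y \<Longrightarrow> lc_simple_on {x..y} h \<Longrightarrow> 0 \<le> W y - W x\<close>[of x y] by simp
    next
      case (gap x y)
      have "\<bar>W y - W x\<bar> \<le> M * (y - x)" using W gap unfolding lc_primitive_def by (intro lc_lipD) auto
      then show ?case by linarith
    next
      case (join x y d z e)
      have "x \<le> y" "y \<le> z" using lc_cov_nonneg join.hyps by blast+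
      then have "- (M * d) \<le> W y - W x" "- (M * e) \<le> W z - W y" using join by auto
      moreover have "M * (d + e) = M * d + M * e" by (simp add: algebra_simps)
      ultimately show ?case by linarith
    qed
    moreover have "M * d' \<le> M * lc_d (of_nat n)" using M d d' by (intro mult_left_mono) auto
    ultimately show ?thesis by linarith
  qed
  then have "W s - W t \<le> 0" by (rule lc_small_le_0)
  then show ?thesis by simp
qed

text \<open>The first conclusion is an equivalence so that both integrability and the value of
  \<open>lc_integral\<close> follow from it.\<close>

lemma lc_dirac_deriv_integral:
  fixes a b r :: real and Q :: "real poly"
  defines "A \<equiv> {of_real a..of_real b}"
  assumes ab: "a < b" and r: "a < r" "r < b" and dir: "dirac_like A (of_real r) \<delta>" and C1: "lc_C1_on A \<delta>"
  shows "\<exists>J. (\<forall>J'. lc_has_integral A (\<lambda>x. lc_deriv A \<delta> x * poly (lc_poly Q) x) J' \<longleftrightarrow> J' = J)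
    \<and> lc_ge 0 J \<and> lc_coeff J 0 = - poly (pderiv Q) r"
proof -
  define al be where "al = (of_real a :: levi_civita)" and "be = (of_real b :: levi_civita)"
  have A: "A = {al..be}" by (simp add: A_def al_def be_def)
  have of_real_less: "(of_real c :: levi_civita) < of_real d" if "c < d" for c d :: real
    by (rule lc_less_coeff0) (use that in \<open>auto simp: lc_ge_of_real lc_coeff_of_real\<close>)
  have alb: "al < be" using of_real_less[OF ab] by (simp add: al_def be_def)
  define \<delta>' where "\<delta>' = lc_deriv A \<delta>"
  have D: "lc_has_deriv \<delta> (\<delta>' x) x A" if "x \<in> A" for x
    using lc_C1_deriv[OF _ alb] C1 that unfolding A \<delta>'_def by blast
  have ms: "lc_measurable_on A \<delta>" and nn: "\<And>x. x \<in> A \<Longrightarrow> 0 \<le> \<delta> x" and n1: "lc_norm1 A \<delta> = 1"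
    using dir by (auto simp: dirac_like_def lc_L1_def)
  obtain h where h: "h \<in> lc_infinitesimals" "0 < h"
    "{x \<in> A. \<delta> x \<noteq> 0} \<subseteq> {of_real r - h..of_real r + h}"
    using dir by (auto simp: dirac_like_def)
  have cov: "\<exists>d\<le>e. lc_simple_cov \<delta> al be d" if "0 < e" for e
    by (rule lc_measurable_cov[OF ms[unfolded A] alb that])
  obtain M1 where M1: "0 \<le> M1" "\<And>x. x \<in> A \<Longrightarrow> \<bar>\<delta> x\<bar> \<le> M1 \<and> \<bar>\<delta>' x\<bar> \<le> M1"
    using lc_C1_bounded[OF cov C1[unfolded A] alb] unfolding A \<delta>'_def by blast
  define P where "P = poly (lc_poly Q)"
  define p where "p = poly (lc_poly (pderiv Q))"
  define c where "c = (of_real (poly (pderiv Q) r) :: levi_civita)"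
  obtain C2 where C2: "0 \<le> C2" "\<And>x. x \<in> A \<Longrightarrow> \<bar>P x\<bar> \<le> of_real C2"
    using lc_poly_bounded[of a b Q] ab unfolding A_def P_def by auto
  obtain C3 where C3: "0 \<le> C3" "lc_lip (of_real C3) P al be"
    using lc_poly_lip[OF ab, of Q] unfolding P_def al_def be_def by blast
  obtain C4 where C4: "0 \<le> C4" "lc_lip (of_real C4) p al be"
    using lc_poly_lip[OF ab, of "pderiv Q"] unfolding p_def al_def be_def by blast
  have n2: "0 \<le> (of_real C2 :: levi_civita)" "0 \<le> (of_real C3 :: levi_civita)" "0 \<le> (of_real C4 :: levi_civita)"
    using C2 C3 C4 lc_of_real_nonneg by auto

  define g where "g x = \<delta>' x * P x" for x
  \<comment> \<open>\<open>lc_norm1\<close> integrates |\<delta>|, which agrees with \<delta> on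
    \<open>A\<close>; keeping the absolute value lets the norm be read off from the increment of
    \<open>V\<close>.\<close>
  define k where "k x = \<bar>\<delta> x\<bar>" for x
  have k: "k x = \<delta> x" if "x \<in> A" for x using nn[OF that] by (simp add: k_def)
  have mg: "lc_measurable_on A g"
  proof (rule lc_measurable_on_map[OF ms])
    fix I u v assume I: "lc_interval u v I" "I \<subseteq> A" "lc_simple_on I \<delta>"
    have "lc_has_deriv \<delta> (\<delta>' x) x I" if "x \<in> I" for x
      using that I(2) D lc_has_deriv_subset by blast
    then show "lc_simple_on I g" unfolding g_def[abs_def] P_def by (intro lc_simple_deriv_poly[OF I(1,3)])
  qed
  have mk: "lc_measurable_on A k"
  proof (rule lc_measurable_on_map[OF ms])
    fix I u v assume I: "I \<subseteq> A" "lc_simple_on I \<delta>"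
    show "lc_simple_on I k" by (rule lc_simple_on_cong[OF I(2)]) (use k I(1) in auto)
  qed
  have covg: "\<exists>d\<le>e. lc_simple_cov g al be d" if "0 < e" for e
    by (rule lc_measurable_cov[OF mg[unfolded A] alb that])
  have covk: "\<exists>d\<le>e. lc_simple_cov k al be d" if "0 < e" for e
    by (rule lc_measurable_cov[OF mk[unfolded A] alb that])
  define M where "M = M1 * of_real C2"
  have M0: "0 \<le> M" using M1(1) n2(1) by (simp add: M_def)
  have gM: "\<bar>g x\<bar> \<le> M" if "x \<in> {al..be}" for x
    unfolding g_def abs_mult M_def using M1 C2(2) that by (intro mult_mono) (auto simp: A)
  obtain W where W: "lc_primitive g M W al be"
    by (rule lc_primitive_ex[OF covg gM M0 less_imp_le[OF alb]])
  have kM: "\<bar>k x\<bar> \<le> M1" if "x \<in> {al..be}" for x using M1(2) that by (simp add: k_def A)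
  obtain V where V: "lc_primitive k M1 V al be"
    by (rule lc_primitive_ex[OF covk kM M1(1) less_imp_le[OF alb]])
  define J where "J = W be - W al"
  have hJ: "lc_has_integral A g J' \<longleftrightarrow> J' = J" for J'
    unfolding A J_def by (rule lc_has_integral_primitive[OF mg[unfolded A] W M0 alb])
  have hk: "lc_has_integral A k J' \<longleftrightarrow> J' = V be - V al" for J'
    unfolding A by (rule lc_has_integral_primitive[OF mk[unfolded A] V M1(1) alb])
  have "lc_integral A k = V be - V al" unfolding lc_integral_def hk by simp
  then have V1: "V be - V al = 1" using n1 unfolding lc_norm1_def k_def[abs_def] by simp

  define H where "H x = \<delta> x * P x" for x
  define H' where "H' x = g x + \<delta> x * p x" for x
  have PD: "lc_has_deriv P (p x) x B" for x B
    unfolding P_def p_def lc_poly_pderiv[symmetric] by (rule lc_has_deriv_poly)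
  have HD: "lc_has_deriv H (H' x) x A" if "x \<in> A" for x
    unfolding H_def[abs_def] H'_def g_def by (rule lc_has_deriv_mult[OF D[OF that] PD])
  have ana: "\<exists>y \<tau>. lc_frame u v y \<tau> \<and> lc_ana {u..v} y \<tau> g \<and> lc_ana {u..v} y \<tau> k \<and> lc_ana {u..v} y \<tau> H"
    if uv: "al \<le> u" "v \<le> be" "u < v" "lc_simple_on {u..v} \<delta>" for u v
  proof -
    have sub: "{u..v} \<subseteq> A" using uv by (auto simp: A)
    obtain y \<tau> where fr: "lc_frame u v y \<tau>" "lc_ana {u..v} y \<tau> \<delta>" "lc_ana {u..v} y \<tau> \<delta>'"
      by (rule lc_simple_C1_ana[OF uv(4,3) sub D])
    have "lc_ana {u..v} y \<tau> g" "lc_ana {u..v} y \<tau> H"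
      unfolding g_def[abs_def] H_def[abs_def] P_def by (intro lc_ana_mult_poly[OF fr(1)] fr subset_refl)+
    moreover have "lc_ana {u..v} y \<tau> k" by (rule lc_ana_cong[OF fr(2)]) (use sub k in auto)
    ultimately show ?thesis using fr(1) by blast
  qed
  have \<delta>lip: "lc_lip (M1 + 1) \<delta> al be"
  proof (rule lc_deriv_bound_imp_lip[OF cov])
    fix x y assume xy: "al \<le> x" "y \<le> be" "x < y" "lc_simple_on {x..y} \<delta>"
    have sub: "{x..y} \<subseteq> A" using xy by (auto simp: A)
    obtain z \<tau> where "lc_frame x y z \<tau>" "lc_ana {x..y} z \<tau> \<delta>" "lc_ana {x..y} z \<tau> \<delta>'"
      by (rule lc_simple_C1_ana[OF xy(4,3) sub D])
    then show "lc_prim \<delta>' \<delta> x y" unfolding lc_prim_def using D sub lc_has_deriv_subset by blast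
  qed (use D M1 in \<open>auto simp: A\<close>)
  have M11: "0 \<le> M1 + 1" using M1(1) by simp
  have Hlip: "lc_lip (M1 * of_real C3 + of_real C2 * (M1 + 1)) H al be"
    unfolding H_def[abs_def] by (rule lc_lip_mult[OF \<delta>lip C3(2) M11 n2(2)]) (use M1 C2 in \<open>auto simp: A\<close>)
  \<comment> \<open>On power series intervals the derivative of \<open>X\<close> is \<delta>' P -
    (\<delta> P)' + c \<delta> = \<delta> (c - p), which is small because \<delta> vanishes where p
    is not close to c.\<close>
  define X where "X t = W t + ((-1) * H t + c * V t)" for t
  have "lc_lip M W al be" "lc_lip M1 V al be" using W V by (auto simp: lc_primitive_def)
  then obtain K where K: "lc_lip K X al be"
    unfolding X_def[abs_def] using lc_lip_add[OF _ lc_lip_add[OF lc_lip_cmult[OF Hlip] lc_lip_cmult]] by meson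
  \<comment> \<open>\<open>E\<close> bounds |p - c| on the support of \<delta>, whose points are
    within \<open>h\<close> of r.\<close>
  define E where "E = of_real C4 * h"
  have E0: "0 \<le> E" using n2 h(2) by (simp add: E_def)
  have rA: "of_real r \<in> {al..be}" using of_real_less[OF r(1)] of_real_less[OF r(2)] by (simp add: al_def be_def)
  have \<delta>p: "\<bar>\<delta> x * (c - p x)\<bar> \<le> E * k x" if x: "x \<in> A" for x
  proof (cases "\<delta> x = 0")
    case False
    then have xh: "\<bar>x - of_real r\<bar> \<le> h" using h(3) x by (auto simp: abs_le_iff algebra_simps)
    have pr: "p (of_real r) = c" by (simp add: p_def c_def lc_poly_of_real)
    have "\<bar>p x - c\<bar> \<le> of_real C4 * \<bar>x - of_real r\<bar>"
    proof (cases "x \<le> of_real r")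
      case True
      then show ?thesis using lc_lipD[OF C4(2), of x "of_real r"] x rA pr by (simp add: A abs_minus_commute)
    next
      case False
      then show ?thesis using lc_lipD[OF C4(2), of "of_real r" x] x rA pr by (simp add: A)
    qed
    also have "\<dots> \<le> E" unfolding E_def using xh n2 by (intro mult_left_mono) auto
    finally have "\<bar>\<delta> x\<bar> * \<bar>c - p x\<bar> \<le> \<bar>\<delta> x\<bar> * E" by (intro mult_left_mono) (auto simp: abs_minus_commute)
    then show ?thesis by (simp add: abs_mult k_def mult.commute)
  qed (simp add: k_def)
  have piece: "\<bar>X v - X u\<bar> \<le> E * V v - E * V u" if uv: "al \<le> u" "v \<le> be" "u < v" "lc_simple_on {u..v} \<delta>" for u v
  proof -
    have sub: "{u..v} \<subseteq> A" using uv by (auto simp: A)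
    obtain y \<tau> where fr: "lc_frame u v y \<tau>" and an: "lc_ana {u..v} y \<tau> g" "lc_ana {u..v} y \<tau> k" "lc_ana {u..v} y \<tau> H"
      using ana[OF uv] by blast
    obtain F where F: "lc_ana {u..v} y \<tau> F" "lc_prim g F u v" by (rule lc_ana_prim[OF fr an(1)])
    obtain G where G: "lc_ana {u..v} y \<tau> G" "lc_prim k G u v" by (rule lc_ana_prim[OF fr an(2)])
    have WF: "W v - W u = F v - F u" "V v - V u = G v - G u"
      using W V F(2) G(2) uv unfolding lc_primitive_def by blast+
    define Y where "Y t = F t + ((-1) * H t + c * G t)" for t
    have XY: "X v - X u = Y v - Y u"
    proof -
      have "c * V v - c * V u = c * G v - c * G u" unfolding right_diff_distrib[symmetric] WF(2) ..
      then show ?thesis using WF(1) by (simp add: X_def Y_def algebra_simps)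
    qed
    have Yd: "lc_has_deriv Y (\<delta> x * (c - p x)) x {u..v}" if x: "x \<in> {u..v}" for x
    proof -
      have "lc_has_deriv Y (g x + ((-1) * H' x + c * k x)) x {u..v}"
        unfolding Y_def[abs_def] using F(2) G(2) x HD sub
        by (intro lc_has_deriv_add lc_has_deriv_cmult) (auto simp: lc_prim_def intro: lc_has_deriv_subset[OF HD sub])
      moreover have "g x + ((-1) * H' x + c * k x) = \<delta> x * (c - p x)"
        using k[of x] x sub by (auto simp: H'_def algebra_simps)
      ultimately show ?thesis by simp
    qed
    have Ya: "lc_ana {u..v} y \<tau> Y" unfolding Y_def[abs_def]
      by (intro lc_ana_add[OF fr] lc_ana_cmult[OF fr] F(1) G(1) an(3) subset_refl)
    have Yp: "lc_prim (\<lambda>x. \<delta> x * (c - p x)) Y u v" unfolding lc_prim_def using fr Ya Yd by blast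
    have Gp: "lc_prim (\<lambda>x. e * k x) (\<lambda>x. e * G x) u v" for e
      unfolding lc_prim_def using fr lc_ana_cmult[OF fr subset_refl G(1)] G(2) lc_has_deriv_cmult
      by (auto simp: lc_prim_def)
    have "Y v - Y u \<le> E * G v - E * G u"
      by (rule lc_prim_mono[OF Yp Gp]) (use \<delta>p sub in \<open>auto simp: abs_le_iff\<close>)
    moreover have "(- E) * G v - (- E) * G u \<le> Y v - Y u"
      by (rule lc_prim_mono[OF Gp Yp]) (use \<delta>p sub in \<open>force simp: abs_le_iff\<close>)
    moreover have "E * V v - E * V u = E * G v - E * G u" unfolding right_diff_distrib[symmetric] WF(2) ..
    ultimately show ?thesis unfolding XY by (simp add: abs_le_iff)
  qed
  have Vm: "E * V x \<le> E * V y" if "al \<le> x" "x \<le> y" "y \<le> be" for x y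
    using lc_primitive_mono[OF V _ M1(1) covk that] E0 by (intro mult_left_mono) (auto simp: k_def)
  \<comment> \<open>The gaps cost at most |K| times their length. As that length can be made
    arbitrarily small, the bound \<open>E\<close> remains without an error term.\<close>
  have "\<bar>X be - X al\<bar> - E \<le> \<bar>K\<bar> * lc_d (of_nat n)" for n
  proof -
    obtain d where d: "d \<le> lc_d (of_nat n)" "lc_simple_cov \<delta> al be d" using cov[OF lc_d_pos] by blast
    have "\<bar>X be - X al\<bar> \<le> E * V be - E * V al + K * d"
      by (rule lc_simple_cov_increment_bound[OF d(2), where Z = "\<lambda>x. E * V x"])
        (use piece K Vm in auto)
    moreover have "E * V be - E * V al = E" using V1 by (simp add: right_diff_distrib[symmetric])
    moreover have "K * d \<le> \<bar>K\<bar> * lc_d (of_nat n)"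
      using d lc_cov_nonneg[OF d(2)] by (intro mult_mono) auto
    ultimately show ?thesis by simp
  qed
  then have "\<bar>X be - X al\<bar> - E \<le> 0" by (rule lc_small_le_0)
  then have XE: "\<bar>X be - X al\<bar> \<le> E" by simp

  have h0: "h \<noteq> 0" "0 < lc_lead h"
    using h(1,2) by (auto simp: lc_infinitesimals_def lc_lambda_def split: if_splits)
  \<comment> \<open>An infinitesimal radius keeps the support away from the ends of the interval, so
    the boundary terms \<delta> P vanish.\<close>
  have hr: "h < of_real d" if "0 < d" for d
    using lc_abs_less[OF lc_ge_lead[of h], of "of_real d" 0] of_real_less[of 0 d] that h0(2) by (auto simp: lc_coeff_of_real)
  have ends: "\<delta> al = 0" "\<delta> be = 0"
  proof -
    have "al < of_real r - h" using hr[of "r - a"] r by (simp add: al_def algebra_simps)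
    then have "al \<notin> {of_real r - h..of_real r + h}" by simp
    then show "\<delta> al = 0" using h(3) alb by (auto simp: A)
    have "of_real r + h < be" using hr[of "b - r"] r by (simp add: be_def algebra_simps)
    then have "be \<notin> {of_real r - h..of_real r + h}" by simp
    moreover have "be \<in> A" using alb by (simp add: A)
    ultimately show "\<delta> be = 0" using h(3) by blast
  qed
  have "X be - X al = J + c"
  proof -
    have "c * V be - c * V al = c" using V1 by (simp add: right_diff_distrib[symmetric])
    then show ?thesis using ends by (simp add: X_def H_def J_def algebra_simps)
  qed
  then have JE: "\<bar>J + c\<bar> \<le> E" using XE by simp
  have "lc_ge (0 + lc_lead h) E" unfolding E_def by (intro lc_ge_mult lc_ge_of_real lc_ge_lead)
  then have JH: "lc_ge (lc_lead h) (J + c)" using lc_abs_le_ge[OF JE] by simp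
  have "lc_coeff (J + c) 0 = 0" by (rule lc_geD[OF JH h0(2)])
  then have J0: "lc_coeff J 0 = - poly (pderiv Q) r" by (simp add: lc_coeff_add c_def lc_coeff_of_real)
  have "lc_ge 0 ((J + c) - c)"
    by (rule lc_ge_diff[OF lc_ge_mono[OF JH]]) (use h0 in \<open>auto simp: c_def lc_ge_of_real\<close>)
  then have "lc_ge 0 J" by simp
  then show ?thesis using hJ J0 unfolding g_def[abs_def] \<delta>'_def P_def by blast
qed

lemma lc_standard_part_eq: "lc_ge 0 x \<Longrightarrow> lc_standard_part x = ereal (lc_coeff x 0)"
proof -
  assume x: "lc_ge 0 x"
  have "0 \<le> lc_lambda x"
  proof (cases "x = 0")
    case False
    then have "0 \<le> lc_lead x" using lc_lead(1)[OF False] lc_geD[OF x] by (meson not_le)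
    then show ?thesis using False by (simp add: lc_lambda_def)
  qed (simp add: lc_lambda_def)
  then show ?thesis by (simp add: lc_standard_part_def)
qed

text \<open>Integrability is part of the conclusion because \<open>lc_integral\<close> is a definite
  description, whose value carries no information unless an integral exists.\<close>

theorem proposition5p11:
  fixes a b r :: real and \<delta> :: "levi_civita \<Rightarrow> levi_civita" and f :: "real \<Rightarrow> real"
  defines "A \<equiv> {of_real a..of_real b}"
    and "P \<equiv> \<lambda>n x. integral {a..x} (poly (best_approx a b f n))"
  defines "J \<equiv> \<lambda>n. lc_integral A (\<lambda>x. lc_deriv A \<delta> x * canonical_ext a b (P n) x)"
  assumes "a < b" and "r \<in> {a..b}" and "r \<noteq> a" and "r \<noteq> b"
    and "dirac_like A (of_real r) \<delta>" and "lc_C1_on A \<delta>"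
    and "continuous_on {a..b} f"
  shows "(\<forall>n. lc_integrable A (\<lambda>x. lc_deriv A \<delta> x * canonical_ext a b (P n) x))
    \<and> (\<lambda>n. lc_standard_part (J n)) \<longlonglongrightarrow> ereal (- f r)
    \<and> (\<lambda>n. lc_coeff (J n) 0) \<longlonglongrightarrow> - f r"
proof -
  have ar: "a < r" "r < b" using assms by auto
  have main: "lc_integrable A (\<lambda>x. lc_deriv A \<delta> x * canonical_ext a b (P n) x)
      \<and> lc_ge 0 (J n) \<and> lc_coeff (J n) 0 = - poly (best_approx a b f n) r" for n
  proof -
    \<comment> \<open>The antiderivative that vanishes at \<open>a\<close> agrees with
      \<open>P n\<close> on [a, b], so the canonical extension of \<open>P n\<close> is
      \<open>Q\<close> evaluated on the field.\<close>
    obtain Q where Q: "pderiv Q = best_approx a b f n" "poly Q a = 0" using poly_antiderivative by blast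
    have "canonical_ext a b (P n) = poly (lc_poly Q)"
      by (rule ext, rule canonical_ext_eq[OF \<open>a < b\<close>]) (simp add: P_def integral_poly[OF Q])
    then have eq: "(\<lambda>x. lc_deriv A \<delta> x * canonical_ext a b (P n) x) = (\<lambda>x. lc_deriv A \<delta> x * poly (lc_poly Q) x)"
      by simp
    obtain I where I: "\<And>J'. lc_has_integral A (\<lambda>x. lc_deriv A \<delta> x * poly (lc_poly Q) x) J' \<longleftrightarrow> J' = I"
      "lc_ge 0 I" "lc_coeff I 0 = - poly (pderiv Q) r"
      using lc_dirac_deriv_integral[OF \<open>a < b\<close> ar, of \<delta> Q] assms(8,9) unfolding A_def by blast
    have "J n = I" unfolding J_def eq lc_integral_def I(1) by simp
    moreover have "lc_integrable A (\<lambda>x. lc_deriv A \<delta> x * canonical_ext a b (P n) x)"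
      unfolding eq lc_integrable_def using I(1) by blast
    ultimately show ?thesis using I(2,3) Q(1) by simp
  qed
  have lim: "(\<lambda>n. lc_coeff (J n) 0) \<longlonglongrightarrow> - f r"
    using main tendsto_minus[OF best_approx_tendsto[OF assms(10) \<open>a < b\<close> assms(5)]] by simp
  \<comment> \<open>Each \<open>J n\<close> has no negative exponents, so its standard part is its
    coefficient at 0 and the two limits coincide.\<close>
  then have "(\<lambda>n. lc_standard_part (J n)) \<longlonglongrightarrow> ereal (- f r)"
    using main by (simp add: lc_standard_part_eq del: uminus_ereal.simps)
  then show ?thesis using lim main by blast
qed

end
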